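(* Let $m\ge 1$, $1\le k\le n-m$, $\alpha\in\mathbf W_{n,m}$, and suppose $$f\in L^p(\mathfrak M_{n,m}),\qquad 1\le p<\frac{n}{\operatorname{Re}\alpha+k+m-1}.$$ Then $$(\stackrel{*}{P}{}^{\alpha}\hat f)(x)=c_{n,k,m}\,(I^{\alpha+k}f)(x),\qquad c_{n,k,m}=2^{km}\pi^{km/2}\,\Gamma_m\!\left(\tfrac n2\right)\Big/\Gamma_m\!\left(\tfrac{n-k}2\right),$$ for almost all $x\in\mathfrak M_{n,m}$. In particular (the case $\alpha=0$), $(\hat f)^\vee(x)=c_{n,k,m}(I^kf)(x)$.
   Context: $\mathfrak M_{n,m}$: real $n\times m$ matrices with Lebesgue measure; $x'$ transpose; $|x|_m=\det(x'x)^{1/2}$; $\Gamma_m(\alpha)=\pi^{m(m-1)/4}\prod_{j=0}^{m-1}\Gamma(\alpha-j/2)$. $V_{n,n-k}=\{\xi\in\mathfrak M_{n,n-k}:\xi'\xi=I_{n-k}\}$, $d_*\xi$ its $O(n)$-invariant probability measure; $d\gamma$ denotes Haar probability measure on orthogonal groups. $\mathbf W_{n,m}=\{0,1,\dots,k_0\}\cup\{\alpha\in\mathbb C:\operatorname{Re}\alpha>m-1,\ \alpha\ne n-m+1,n-m+2,\dots\}$, $k_0=\min(m-1,n-m)$. Riesz potential on $\mathfrak M_{n,m}$: for $\operatorname{Re}\alpha>m-1$, $\alpha\neq n-m+1,n-m+2,\dots$, $(I^\alpha f)(x)=\frac1{\gamma_{n,m}(\alpha)}\int_{\mathfrak M_{n,m}}f(x-y)|y|_m^{\alpha-n}dy$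 with $\gamma_{n,m}(\alpha)=2^{\alpha m}\pi^{nm/2}\Gamma_m(\alpha/2)/\Gamma_m((n-\alpha)/2)$; for a positive integer $j\le n-m$, $(I^jf)(x)=\gamma\int_{\mathfrak M_{j,m}}d\omega\int_{O(n)}f\left(x-\gamma\begin{bmatrix}\omega\\0\end{bmatrix}\right)d\gamma$ with constant factor in front equal to $2^{-jm}\pi^{-jm/2}\Gamma_m((n-j)/2)/\Gamma_m(n/2)$ (the two formulas agree when both apply); $I^0f=f$. Radon transform: $\hat f(\xi,t)=\int_{\mathfrak M_{k,m}}f\left(g_\xi\begin{bmatrix}\omega\\ t\end{bmatrix}\right)d\omega$, $\xi\in V_{n,n-k}$, $t\in\mathfrak M_{n-k,m}$, $g_\xi\in SO(n)$ any rotation sending $\begin{bmatrix}0\\ I_{n-k}\end{bmatrix}$ to $\xi$. Dual Radon transform: $\check\varphi(x)=\int_{V_{n,n-k}}\varphi(\xi,\xi'x)\,d_*\xi$, also written $(\varphi)^\vee$. The operator $\stackrel{*}{P}{}^\alpha$ (generalized Semyanistyi integral): $\stackrel{*}{P}{}^{\alpha}\varphi=(\tilde I^\alpha\varphi)^\vee$ with $\tilde I^\alpha$ the Riesz potential on $\mathfrak M_{n-k,m}$ in the $t$-variable. Explicitly, for $\operatorname{Re}\alpha>m-1$, $\alpha\ne n-k-m+1,n-k-m+2,\dots$: $(\stackrel{*}{P}{}^{\alpha}\varphi)(x)=\frac1{\gamma_{n-k,m}(\alpha)}\int_{V_{n,n-k}}d_*\xi\int_{\mathfrak M_{n-k,m}}\varphi(\xi,t)|\xi'x-t|_m^{\alpha+k-n}dt$;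 for a positive integer $\alpha=\ell\le n-k-m$: $(\stackrel{*}{P}{}^{\ell}\varphi)(x)=c_\ell\int_{V_{n,n-k}}d_*\xi\int_{\mathfrak M_{\ell,m}}dz\int_{O(n-k)}\varphi\left(\xi,\xi'x-\gamma\begin{bmatrix}z\\0\end{bmatrix}\right)d\gamma$, $c_\ell=2^{-\ell m}\pi^{-\ell m/2}\Gamma_m((n-k-\ell)/2)/\Gamma_m((n-k)/2)$; and $\stackrel{*}{P}{}^0\varphi=\check\varphi$. (The condition on $p$ with $p\ge1$ forces $\operatorname{Re}\alpha<n-k-m+1$, so $\stackrel{*}{P}{}^\alpha$ is defined.) *)

theory Defs
  imports "HOL-Probability.Probability" "Jordan_Normal_Form.Determinant"
begin

section \<open>Matrix spaces\<close>

(* The dimensions k, n - k, j, l all vary inside one statement, so the space of real n x m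
   matrices is the carrier set carrier_mat n m rather than a type; all measures on it are
   given explicitly.  Its Borel structure is that of the n * m entries. *)
definition borel_mat :: "nat \<Rightarrow> nat \<Rightarrow> real mat measure" where
  "borel_mat n m =
     vimage_algebra (carrier_mat n m) (\<lambda>A. \<lambda>ij\<in>{..<n} \<times> {..<m}. A $$ ij)
       (\<Pi>\<^sub>M ij\<in>{..<n} \<times> {..<m}. borel)"

(* Completed, so that measurability is Lebesgue (not merely Borel) measurability. *)
definition lebesgue_mat :: "nat \<Rightarrow> nat \<Rightarrow> real mat measure" where
  "lebesgue_mat n m =
     completion (distr (\<Pi>\<^sub>M ij\<in>{..<n} \<times> {..<m}. lborel) (borel_mat n m) (\<lambda>e. mat n m e))"

definition Lp_space :: "real \<Rightarrow> 'a measure \<Rightarrow> ('a \<Rightarrow> complex) set" where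
  "Lp_space p M = {f \<in> borel_measurable M. integrable M (\<lambda>x. norm (f x) powr p)}"

definition mat_abs :: "real mat \<Rightarrow> real" where
  "mat_abs x = sqrt (Determinant.det (x\<^sup>T * x))"


section \<open>Orthogonal groups and Stiefel manifolds\<close>

definition stiefel :: "nat \<Rightarrow> nat \<Rightarrow> real mat set" where
  "stiefel n r = {\<xi> \<in> carrier_mat n r. \<xi>\<^sup>T * \<xi> = 1\<^sub>m r}"

definition orth_group :: "nat \<Rightarrow> real mat set" where
  "orth_group n = {g \<in> carrier_mat n n. g\<^sup>T * g = 1\<^sub>m n}"

definition special_orth_group :: "nat \<Rightarrow> real mat set" where
  "special_orth_group n = {g \<in> orth_group n. Determinant.det g = 1}"

definition invariant_prob :: "nat \<Rightarrow> nat \<Rightarrow> real mat set \<Rightarrow> real mat measure \<Rightarrow> bool" where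
  "invariant_prob n r S \<mu> \<longleftrightarrow>
     prob_space \<mu> \<and>
     sets \<mu> = sets (restrict_space (borel_mat n r) S) \<and>
     (\<forall>g\<in>orth_group n. distr \<mu> \<mu> (\<lambda>\<xi>. g * \<xi>) = \<mu>)"

definition stiefel_measure :: "nat \<Rightarrow> nat \<Rightarrow> real mat measure" where
  "stiefel_measure n r = completion (THE \<mu>. invariant_prob n r (stiefel n r) \<mu>)"

definition haar_orth :: "nat \<Rightarrow> real mat measure" where
  "haar_orth n = completion (THE \<mu>. invariant_prob n n (orth_group n) \<mu>)"


section \<open>Riesz potentials\<close>

definition Gamma_mat :: "nat \<Rightarrow> complex \<Rightarrow> complex" where
  "Gamma_mat m \<alpha> =
     of_real (pi powr (real m * (real m - 1) / 4)) * (\<Prod>j<m. Gamma (\<alpha> - of_nat j / 2))"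

definition W_set :: "nat \<Rightarrow> nat \<Rightarrow> complex set" where
  "W_set n m =
     of_nat ` {0..min (m - 1) (n - m)} \<union>
     {\<alpha>. Re \<alpha> > real m - 1 \<and> \<alpha> \<notin> of_nat ` {n - m + 1..}}"

definition riesz_gamma :: "nat \<Rightarrow> nat \<Rightarrow> complex \<Rightarrow> complex" where
  "riesz_gamma n m \<alpha> =
     2 powr (\<alpha> * of_nat m) * of_real (pi powr (real n * real m / 2)) *
     Gamma_mat m (\<alpha> / 2) / Gamma_mat m ((of_nat n - \<alpha>) / 2)"

definition riesz_kernel ::
  "nat \<Rightarrow> nat \<Rightarrow> complex \<Rightarrow> (real mat \<Rightarrow> complex) \<Rightarrow> real mat \<Rightarrow> complex" where
  "riesz_kernel n m \<alpha> f x =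
     1 / riesz_gamma n m \<alpha> *
     (\<integral>y. f (x - y) * of_real (mat_abs y) powr (\<alpha> - of_nat n) \<partial>lebesgue_mat n m)"

definition riesz_int ::
  "nat \<Rightarrow> nat \<Rightarrow> nat \<Rightarrow> (real mat \<Rightarrow> complex) \<Rightarrow> real mat \<Rightarrow> complex" where
  "riesz_int n m j f x =
     of_real (2 powr - (real j * real m) * pi powr - (real j * real m / 2)) *
     Gamma_mat m ((of_nat n - of_nat j) / 2) / Gamma_mat m (of_nat n / 2) *
     (\<integral>\<omega>. (\<integral>\<gamma>. f (x - \<gamma> * (\<omega> @\<^sub>r 0\<^sub>m (n - j) m)) \<partial>haar_orth n) \<partial>lebesgue_mat j m)"

(* For integers j with m \<le> j \<le> n - m both formulas are available (and agree); the integral with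
   the power kernel is taken as the definition wherever it makes sense.  Outside the range of
   all three formulas the value 0 is a dummy. *)
definition riesz ::
  "nat \<Rightarrow> nat \<Rightarrow> complex \<Rightarrow> (real mat \<Rightarrow> complex) \<Rightarrow> real mat \<Rightarrow> complex" where
  "riesz n m \<alpha> f x =
     (if Re \<alpha> > real m - 1 \<and> \<alpha> \<notin> of_nat ` {n - m + 1..} then riesz_kernel n m \<alpha> f x
      else if \<alpha> \<in> of_nat ` {1..n - m} then riesz_int n m (THE j. \<alpha> = of_nat j) f x
      else if \<alpha> = 0 then f x
      else 0)"


section \<open>Radon transforms and the generalized Semyanistyi integral\<close>

(* The integral below does not depend on which rotation is selected. *)
definition rotation_to :: "nat \<Rightarrow> nat \<Rightarrow> real mat \<Rightarrow> real mat" where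
  "rotation_to n k \<xi> =
     (SOME g. g \<in> special_orth_group n \<and> g * (0\<^sub>m k (n - k) @\<^sub>r 1\<^sub>m (n - k)) = \<xi>)"

definition radon ::
  "nat \<Rightarrow> nat \<Rightarrow> nat \<Rightarrow> (real mat \<Rightarrow> complex) \<Rightarrow> real mat \<Rightarrow> real mat \<Rightarrow> complex" where
  "radon n m k f \<xi> t = (\<integral>\<omega>. f (rotation_to n k \<xi> * (\<omega> @\<^sub>r t)) \<partial>lebesgue_mat k m)"

definition dual_radon ::
  "nat \<Rightarrow> nat \<Rightarrow> (real mat \<Rightarrow> real mat \<Rightarrow> complex) \<Rightarrow> real mat \<Rightarrow> complex" where
  "dual_radon n k \<phi> x = (\<integral>\<xi>. \<phi> \<xi> (\<xi>\<^sup>T * x) \<partial>stiefel_measure n (n - k))"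

definition semyanistyi ::
  "nat \<Rightarrow> nat \<Rightarrow> nat \<Rightarrow> complex \<Rightarrow> (real mat \<Rightarrow> real mat \<Rightarrow> complex) \<Rightarrow> real mat \<Rightarrow> complex" where
  "semyanistyi n m k \<alpha> \<phi> = dual_radon n k (\<lambda>\<xi>. riesz (n - k) m \<alpha> (\<phi> \<xi>))"

definition c_const :: "nat \<Rightarrow> nat \<Rightarrow> nat \<Rightarrow> complex" where
  "c_const n k m =
     of_real (2 ^ (k * m) * pi powr (real k * real m / 2)) *
     Gamma_mat m (of_nat n / 2) / Gamma_mat m ((of_nat n - of_nat k) / 2)"

end

theory Submission
  imports Defs
begin

text \<open>Write \<open>n = k + q\<close>.  Rotating the plane integral onto \<open>O(n)\<close> turns the left-hand side into an average of
  \<open>f (x - g [\<omega>; t])\<close> over \<open>g\<close>, \<open>\<omega>\<close> and \<open>t\<close>, the latter weighted by the Riesz kernel of the smaller space.  For the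
  power kernel, \<open>O(n)\<close>-invariance of Lebesgue measure and the average of \<open>|t|^s\<close> over rotations give a multiple of
  \<open>|y|^s\<close>, and the factor is computed on a Gaussian; for the singular measures of lower rank the rotated
  measures \<open>[\<omega>; \<gamma> z]\<close> combine to the rank \<open>k + j\<close> measure.  All integrals converge for almost every \<open>x\<close>
  because \<open>a \<le> a^p g + g^(-1/(p-1))\<close> for \<open>g\<close> a power of \<open>det (I + y' y)\<close>: the second term is integrable against the kernel,
  and the Gaussian averages of \<open>g\<close> times the kernel are bounded uniformly in the centre.\<close>

section \<open>Measures on matrix spaces\<close>

text \<open>For \<alpha> = j < m the measures behind the potentials can be singular to Lebesgue
  measure, so \<open>f\<close> may not be changed on a null set for free. A Borel representative is
  fixed, and only those \<open>x\<close> are kept for which the exceptional set, reflected through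
  \<open>x\<close>, is null for the measure at hand. A second obstacle is
  \<open>rotation_to\<close>, an arbitrary choice that need not be measurable: plane integrals are
  rewritten in terms of the frame \<xi> alone, over Borel measures, and completions are taken last.
  Convergence is proved once for measures homogeneous of degree \<open>lam\<close> = Re \<alpha> + k
  under right multiplication; this covers the power kernel and the low-rank measures. The power of
  \<open>det (I + y' y)\<close> is \<open>(n - lam) / 2\<close>, chosen against the kernel
  \<open>|y|^(lam - n)\<close>; the Gaussian bound then follows by removing one diagonal unit or one
  column at a time. The hypothesis on \<open>p\<close> makes the second term of the splitting
  integrable. The measures on orthogonal groups and Stiefel manifolds are given only through
  \<open>THE\<close>. They exist as the law of Gram-Schmidt applied to a Gaussian matrix, and are
  unique by averaging over the group.\<close>

abbreviation borel_fun :: "nat => nat => (real mat => 'b :: topological_space) set" where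
 "borel_fun n m \<equiv> borel_measurable (borel_mat n m)"

text \<open>Real \<open>powr\<close> has \<open>0 powr s = 0\<close> for every \<open>s\<close>, so
  \<open>epow y s\<close> vanishes on rank-deficient \<open>y\<close> even when \<open>s\<close> is
  negative or zero. For \<open>m\<close> at most \<open>n\<close> this affects a null set only; on a
  measure carried by matrices of rank below \<open>m\<close> it makes the weight vanish
  identically.\<close>

abbreviation epow :: "real mat => real => ennreal" where
 "epow y s \<equiv> ennreal (mat_abs y powr s)"

lemmas mcomp = measurable_compose and times_ennreal = borel_measurable_times_ennreal

section \<open>Borel measurability of matrix-valued maps\<close>

lemma space_borel_mat [simp]: "space (borel_mat n m) = carrier_mat n m"
 by (simp add: borel_mat_def)

lemma measurable_borel_mat_entry:
 assumes "i < n" "j < m"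
 shows "(\<lambda>A. A $$ (i, j)) \<in> borel_fun n m"
proof -
 have "(\<lambda>A. \<lambda>ij\<in>{..<n} \<times> {..<m}. A $$ ij) \<in> borel_mat n m \<rightarrow>\<^sub>M (\<Pi>\<^sub>M ij\<in>{..<n} \<times> {..<m}. borel)"
  unfolding borel_mat_def by (rule measurable_vimage_algebra1) (auto simp: space_PiM)
 then have "(\<lambda>A. (\<lambda>ij\<in>{..<n} \<times> {..<m}. A $$ ij) (i, j)) \<in> borel_fun n m"
  by (rule mcomp[OF _ measurable_component_singleton]) (use assms in auto)
 then show ?thesis using assms by simp
qed

lemma measurable_mat_entry:
 assumes "f \<in> M \<rightarrow>\<^sub>M borel_mat n m" "i < n" "j < m"
 shows "(\<lambda>x. f x $$ (i, j)) \<in> borel_measurable M"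
 using mcomp[OF assms(1) measurable_borel_mat_entry[OF assms(2,3)]] .

lemma measurable_borel_matI:
 assumes "\<And>x. x \<in> space M ==> f x \<in> carrier_mat n m"
  and "\<And>i j. i < n ==> j < m ==> (\<lambda>x. f x $$ (i, j)) \<in> borel_measurable M"
 shows "f \<in> M \<rightarrow>\<^sub>M borel_mat n m"
 unfolding borel_mat_def
proof (rule measurable_vimage_algebra2)
 show "f \<in> space M \<rightarrow> carrier_mat n m" using assms(1) by auto
 show "(\<lambda>x. \<lambda>ij\<in>{..<n} \<times> {..<m}. f x $$ ij) \<in> M \<rightarrow>\<^sub>M (\<Pi>\<^sub>M ij\<in>{..<n} \<times> {..<m}. borel)"
  by (rule measurable_restrict) (use assms(2) in auto)
qed

lemma measurable_mat_carrier:
 "f \<in> M \<rightarrow>\<^sub>M borel_mat n m ==> x \<in> space M ==> f x \<in> carrier_mat n m"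
 using measurable_space[of f M "borel_mat n m" x] by simp

text \<open>Index formulas for matrix operations hold only inside the carrier, so the entries are
  first replaced on \<open>space M\<close> by expressions \<open>h i j\<close> of evident
  measurability.\<close>

lemma measurable_borel_matI2:
 assumes "\<And>x. x \<in> space M ==> f x \<in> carrier_mat n m"
  and "\<And>i j. i < n ==> j < m ==> h i j \<in> borel_measurable M"
  and "\<And>i j x. x \<in> space M ==> i < n ==> j < m ==> f x $$ (i, j) = h i j x"
 shows "f \<in> M \<rightarrow>\<^sub>M borel_mat n m"
proof (rule measurable_borel_matI[OF assms(1)])
 fix i j assume ij: "i < n" "j < m"
 have "(\<lambda>x. f x $$ (i, j)) \<in> borel_measurable M \<longleftrightarrow> h i j \<in> borel_measurable M"
  by (rule measurable_cong) (rule assms(3)[OF _ ij])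
 then show "(\<lambda>x. f x $$ (i, j)) \<in> borel_measurable M" using assms(2)[OF ij] by simp
qed

lemma measurable_mat_times:
 assumes f: "f \<in> M \<rightarrow>\<^sub>M borel_mat n k" and g: "g \<in> M \<rightarrow>\<^sub>M borel_mat k (m::nat)"
 shows "(\<lambda>x. f x * g x :: real mat) \<in> M \<rightarrow>\<^sub>M borel_mat n m"
proof (rule measurable_borel_matI2[where h="\<lambda>i j x. \<Sum>l<k. f x $$ (i, l) * g x $$ (l, j)"])
 note c = measurable_mat_carrier[OF f] measurable_mat_carrier[OF g]
 show "f x * g x \<in> carrier_mat n m" if "x \<in> space M" for x using c[OF that] by auto
 show "(\<lambda>x. \<Sum>l<k. f x $$ (i, l) * g x $$ (l, j)) \<in> borel_measurable M" if "i < n" "j < m" for i j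
  by (intro borel_measurable_sum borel_measurable_times measurable_mat_entry[OF f]
    measurable_mat_entry[OF g]) (use that in auto)
 show "(f x * g x) $$ (i, j) = (\<Sum>l<k. f x $$ (i, l) * g x $$ (l, j))"
  if "x \<in> space M" "i < n" "j < m" for i j x
  using c[OF that(1)] that(2,3) by (auto simp: scalar_prod_def lessThan_atLeast0 intro!: sum.cong)
qed

lemma measurable_mat_add:
 assumes f: "f \<in> M \<rightarrow>\<^sub>M borel_mat n m" and g: "g \<in> M \<rightarrow>\<^sub>M borel_mat n m"
 shows "(\<lambda>x. f x + g x :: real mat) \<in> M \<rightarrow>\<^sub>M borel_mat n m"
proof (rule measurable_borel_matI2[where h="\<lambda>i j x. f x $$ (i, j) + g x $$ (i, j)"])
 note c = measurable_mat_carrier[OF f] measurable_mat_carrier[OF g]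
 show "f x + g x \<in> carrier_mat n m" if "x \<in> space M" for x using c[OF that] by simp
 show "(f x + g x) $$ (i, j) = f x $$ (i, j) + g x $$ (i, j)"
  if "x \<in> space M" "i < n" "j < m" for i j x using c[OF that(1)] that(2,3) by simp
qed (intro borel_measurable_add measurable_mat_entry[OF f] measurable_mat_entry[OF g])

lemma measurable_mat_minus:
 assumes f: "f \<in> M \<rightarrow>\<^sub>M borel_mat n m" and g: "g \<in> M \<rightarrow>\<^sub>M borel_mat n m"
 shows "(\<lambda>x. f x - g x :: real mat) \<in> M \<rightarrow>\<^sub>M borel_mat n m"
proof (rule measurable_borel_matI2[where h="\<lambda>i j x. f x $$ (i, j) - g x $$ (i, j)"])
 note c = measurable_mat_carrier[OF f] measurable_mat_carrier[OF g]
 show "f x - g x \<in> carrier_mat n m" if "x \<in> space M" for x using c[OF that] by (simp add: minus_carrier_mat)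
 show "(f x - g x) $$ (i, j) = f x $$ (i, j) - g x $$ (i, j)"
  if "x \<in> space M" "i < n" "j < m" for i j x using c[OF that(1)] that(2,3) by simp
qed (intro borel_measurable_diff measurable_mat_entry[OF f] measurable_mat_entry[OF g])

lemma measurable_mat_smult:
 assumes a: "a \<in> borel_measurable M" and f: "f \<in> M \<rightarrow>\<^sub>M borel_mat n m"
 shows "(\<lambda>x. a x \<cdot>\<^sub>m f x :: real mat) \<in> M \<rightarrow>\<^sub>M borel_mat n m"
proof (rule measurable_borel_matI2[where h="\<lambda>i j x. a x * f x $$ (i, j)"])
 note c = measurable_mat_carrier[OF f]
 show "a x \<cdot>\<^sub>m f x \<in> carrier_mat n m" if "x \<in> space M" for x using c[OF that] by simp
 show "(a x \<cdot>\<^sub>m f x) $$ (i, j) = a x * f x $$ (i, j)"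
  if "x \<in> space M" "i < n" "j < m" for i j x using c[OF that(1)] that(2,3) by simp
qed (intro borel_measurable_times a measurable_mat_entry[OF f])

lemma measurable_mat_transpose:
 assumes f: "f \<in> M \<rightarrow>\<^sub>M borel_mat n m"
 shows "(\<lambda>x. (f x)\<^sup>T :: real mat) \<in> M \<rightarrow>\<^sub>M borel_mat m n"
proof (rule measurable_borel_matI2[where h="\<lambda>i j x. f x $$ (j, i)"])
 note c = measurable_mat_carrier[OF f]
 show "(f x)\<^sup>T \<in> carrier_mat m n" if "x \<in> space M" for x using c[OF that] by simp
 show "(f x)\<^sup>T $$ (i, j) = f x $$ (j, i)"
  if "x \<in> space M" "i < m" "j < n" for i j x using c[OF that(1)] that(2,3) by simp
qed (intro measurable_mat_entry[OF f])

section \<open>Block matrices: stacking rows and columns\<close>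

definition append_cols :: "'a :: zero mat => 'a mat => 'a mat" (infixr \<open>@\<^sub>c\<close> 65) where
 "A @\<^sub>c B = four_block_mat A B (0\<^sub>m 0 (dim_col A)) (0\<^sub>m 0 (dim_col B))"

lemma carrier_append_cols [simp, intro]:
 "A \<in> carrier_mat n m1 ==> B \<in> carrier_mat n m2 ==> A @\<^sub>c B \<in> carrier_mat n (m1 + m2)"
 unfolding append_cols_def by auto

lemma index_append_rows:
 assumes "A \<in> carrier_mat n1 m" "B \<in> carrier_mat n2 m" "i < n1 + n2" "j < m"
 shows "(A @\<^sub>r B) $$ (i, j) = (if i < n1 then A $$ (i, j) else B $$ (i - n1, j))"
 using assms unfolding append_rows_def by auto

lemma index_append_cols:
 assumes "A \<in> carrier_mat n m1" "B \<in> carrier_mat n m2" "i < n" "j < m1 + m2"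
 shows "(A @\<^sub>c B) $$ (i, j) = (if j < m1 then A $$ (i, j) else B $$ (i, j - m1))"
 using assms unfolding append_cols_def by auto

lemma transpose_append_rows:
 assumes "A \<in> carrier_mat n1 m" "B \<in> carrier_mat n2 m"
 shows "(A @\<^sub>r B)\<^sup>T = A\<^sup>T @\<^sub>c B\<^sup>T"
 unfolding append_rows_def append_cols_def
 by (subst transpose_four_block_mat[of _ n1 m _ 0 _ n2]) (use assms in auto)

lemma transpose_append_cols:
 assumes "A \<in> carrier_mat n m1" "B \<in> carrier_mat n m2"
 shows "(A @\<^sub>c B)\<^sup>T = A\<^sup>T @\<^sub>r B\<^sup>T"
 unfolding append_rows_def append_cols_def
 by (subst transpose_four_block_mat[of _ n m1 _ m2 _ 0]) (use assms in auto)

lemma mult_append_cols: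
 fixes g :: "'a :: comm_ring_1 mat"
 assumes "g \<in> carrier_mat l n" "A \<in> carrier_mat n m1" "B \<in> carrier_mat n m2"
 shows "g * (A @\<^sub>c B) = (g * A) @\<^sub>c (g * B)"
 by (rule eq_matI) (use assms in "auto simp: append_cols_def scalar_prod_def")

lemma append_rows_mult:
 fixes g :: "'a :: comm_ring_1 mat"
 assumes "g \<in> carrier_mat m l" "A \<in> carrier_mat n1 m" "B \<in> carrier_mat n2 m"
 shows "(A @\<^sub>r B) * g = (A * g) @\<^sub>r (B * g)"
 by (rule eq_matI) (use assms in "auto simp: append_rows_def scalar_prod_def")

lemma four_block_mult_append_rows:
 fixes A :: "'a :: comm_ring_1 mat"
 assumes "A \<in> carrier_mat k1 n1" "B \<in> carrier_mat k1 n2" "C \<in> carrier_mat k2 n1" "D \<in> carrier_mat k2 n2"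
  "a \<in> carrier_mat n1 m" "b \<in> carrier_mat n2 m"
 shows "four_block_mat A B C D * (a @\<^sub>r b) = (A * a + B * b) @\<^sub>r (C * a + D * b)"
 unfolding append_rows_def
 by (subst mult_four_block_mat[of _ k1 n1 _ n2 _ k2 _ _ m _ 0]) (use assms in auto)

lemma append_cols_mult_append_rows:
 fixes A :: "'a :: comm_ring_1 mat"
 assumes "A \<in> carrier_mat k n1" "B \<in> carrier_mat k n2" "a \<in> carrier_mat n1 m" "b \<in> carrier_mat n2 m"
 shows "(A @\<^sub>c B) * (a @\<^sub>r b) = A * a + B * b"
proof -
 have "(A @\<^sub>c B) * (a @\<^sub>r b) = (A * a + B * b) @\<^sub>r (0\<^sub>m 0 n1 * a + 0\<^sub>m 0 n2 * b)"
  unfolding append_cols_def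
  by (subst four_block_mult_append_rows[of _ k n1 _ n2 _ 0]) (use assms in auto)
 also have "... = A * a + B * b"
  by (rule eq_matI) (use assms in "auto simp: append_rows_def")
 finally show ?thesis .
qed

lemma append_rows_mult_append_cols:
 fixes A :: "'a :: comm_ring_1 mat"
 assumes "A \<in> carrier_mat k1 n" "B \<in> carrier_mat k2 n" "a \<in> carrier_mat n m1" "b \<in> carrier_mat n m2"
 shows "(A @\<^sub>r B) * (a @\<^sub>c b) = four_block_mat (A * a) (A * b) (B * a) (B * b)"
proof -
 note [simp] = carrier_matD[OF assms(1)] carrier_matD[OF assms(2)] carrier_matD[OF assms(3)] carrier_matD[OF assms(4)]
 show ?thesis
  by (rule eq_matI) (auto simp: append_rows_def append_cols_def scalar_prod_def)
qed

lemma append_rows_assoc: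
 assumes "a \<in> carrier_mat n1 m" "b \<in> carrier_mat n2 m" "c \<in> carrier_mat n3 m"
 shows "(a @\<^sub>r b) @\<^sub>r c = a @\<^sub>r (b @\<^sub>r c)"
 by (rule eq_matI) (use assms in "auto simp: append_rows_def")

lemma split_rows:
 assumes "y \<in> carrier_mat (n1 + n2) m"
 obtains a b where "a \<in> carrier_mat n1 m" "b \<in> carrier_mat n2 m" "y = a @\<^sub>r b"
proof (rule that)
 show "mat n1 m (\<lambda>(i,j). y $$ (i,j)) \<in> carrier_mat n1 m" by simp
 show "mat n2 m (\<lambda>(i,j). y $$ (i + n1,j)) \<in> carrier_mat n2 m" by simp
 show "y = mat n1 m (\<lambda>(i,j). y $$ (i,j)) @\<^sub>r mat n2 m (\<lambda>(i,j). y $$ (i + n1,j))"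
  by (rule eq_matI) (use assms in "auto simp: append_rows_def")
qed

lemma split_cols:
 assumes "y \<in> carrier_mat n (m1 + m2)"
 obtains a b where "a \<in> carrier_mat n m1" "b \<in> carrier_mat n m2" "y = a @\<^sub>c b"
proof (rule that)
 show "mat n m1 (\<lambda>(i,j). y $$ (i,j)) \<in> carrier_mat n m1" by simp
 show "mat n m2 (\<lambda>(i,j). y $$ (i,j + m1)) \<in> carrier_mat n m2" by simp
 show "y = mat n m1 (\<lambda>(i,j). y $$ (i,j)) @\<^sub>c mat n m2 (\<lambda>(i,j). y $$ (i,j + m1))"
  by (rule eq_matI) (use assms in "auto simp: append_cols_def")
qed

lemma measurable_append_rows:
 assumes f: "f \<in> M \<rightarrow>\<^sub>M borel_mat n1 m" and g: "g \<in> M \<rightarrow>\<^sub>M borel_mat n2 m"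
 shows "(\<lambda>x. f x @\<^sub>r g x :: real mat) \<in> M \<rightarrow>\<^sub>M borel_mat (n1 + n2) m"
proof (rule measurable_borel_matI2[where h="\<lambda>i j x. if i < n1 then f x $$ (i, j) else g x $$ (i - n1, j)"])
 note c = measurable_mat_carrier[OF f] measurable_mat_carrier[OF g]
 show "f x @\<^sub>r g x \<in> carrier_mat (n1 + n2) m" if "x \<in> space M" for x using c[OF that] by simp
 show "(\<lambda>x. if i < n1 then f x $$ (i, j) else g x $$ (i - n1, j)) \<in> borel_measurable M"
  if "i < n1 + n2" "j < m" for i j
  using measurable_mat_entry[OF f, of i j] measurable_mat_entry[OF g, of "i - n1" j] that by (cases "i < n1") auto
 show "(f x @\<^sub>r g x) $$ (i, j) = (if i < n1 then f x $$ (i, j) else g x $$ (i - n1, j))"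
  if "x \<in> space M" "i < n1 + n2" "j < m" for i j x
  by (rule index_append_rows[OF c(1)[OF that(1)] c(2)[OF that(1)] that(2,3)])
qed

lemma measurable_append_cols:
 assumes f: "f \<in> M \<rightarrow>\<^sub>M borel_mat n m1" and g: "g \<in> M \<rightarrow>\<^sub>M borel_mat n m2"
 shows "(\<lambda>x. f x @\<^sub>c g x :: real mat) \<in> M \<rightarrow>\<^sub>M borel_mat n (m1 + m2)"
proof -
 have "(\<lambda>x. ((f x)\<^sup>T @\<^sub>r (g x)\<^sup>T)\<^sup>T) \<in> M \<rightarrow>\<^sub>M borel_mat n (m1 + m2)"
  by (intro measurable_mat_transpose measurable_append_rows f g)
 moreover have "((f x)\<^sup>T @\<^sub>r (g x)\<^sup>T)\<^sup>T = f x @\<^sub>c g x" if "x \<in> space M" for x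
  using measurable_mat_carrier[OF f that] measurable_mat_carrier[OF g that]
  by (subst transpose_append_rows) auto
 ultimately show ?thesis by (subst measurable_cong) auto
qed

lemma measurable_mat_det:
 assumes f: "f \<in> M \<rightarrow>\<^sub>M borel_mat n n"
 shows "(\<lambda>x. det (f x :: real mat)) \<in> borel_measurable M"
proof -
 note c = measurable_mat_carrier[OF f]
 have "(\<lambda>x. \<Sum>p\<in>{p. p permutes {0..<n}}. signof p * (\<Prod>i = 0..<n. f x $$ (i, p i))) \<in> borel_measurable M"
  by (intro borel_measurable_sum borel_measurable_times borel_measurable_prod measurable_mat_entry[OF f])
   (auto simp: permutes_in_image)
 moreover have "det (f x) = (\<Sum>p\<in>{p. p permutes {0..<n}}. signof p * (\<Prod>i = 0..<n. f x $$ (i, p i)))"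
  if "x \<in> space M" for x
  using c[OF that] by (rule det_def')
 ultimately show ?thesis by (subst measurable_cong) auto
qed

lemma measurable_mat_abs:
 assumes f: "f \<in> M \<rightarrow>\<^sub>M borel_mat n m"
 shows "(\<lambda>x. mat_abs (f x)) \<in> borel_measurable M"
 unfolding mat_abs_def
 by (intro mcomp[OF _ borel_measurable_sqrt] measurable_mat_det[where n=m] measurable_mat_times[where k=n]
   measurable_mat_transpose f)

section \<open>Lebesgue measure on matrices: boxes, Fubini and translations\<close>

definition lmat :: "nat => nat => real mat measure" where
 "lmat n m = distr (\<Pi>\<^sub>M ij\<in>{..<n} \<times> {..<m}. lborel) (borel_mat n m) (mat n m)"

text \<open>Fubini and image measures are used for the Borel measure \<open>lmat\<close>; the
  completion enters only when the integrals of the statement are identified.\<close>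

lemma lebesgue_mat_eq: "lebesgue_mat n m = completion (lmat n m)"
 unfolding lebesgue_mat_def lmat_def ..

lemma sets_lmat [simp, measurable_cong]: "sets (lmat n m) = sets (borel_mat n m)"
 by (simp add: lmat_def)

lemma space_lmat [simp]: "space (lmat n m) = carrier_mat n m"
 by (simp add: lmat_def)

lemma lmat_cong:
 "(\<And>y. y \<in> carrier_mat n m ==> F y = G y) ==> (\<integral>\<^sup>+y. F y \<partial>lmat n m) = (\<integral>\<^sup>+y. G y \<partial>lmat n m)"
 by (rule nn_integral_cong) simp

lemma lmat_mono:
 "(\<And>y. y \<in> carrier_mat n m ==> F y \<le> G y) ==> (\<integral>\<^sup>+y. F y \<partial>lmat n m) \<le> (\<integral>\<^sup>+y. G y \<partial>lmat n m)"
 by (rule nn_integral_mono) simp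

lemma measurable_lmat [simp]: "measurable (lmat n m) N = measurable (borel_mat n m) N"
 by (rule measurable_cong_sets) auto

lemma measurable_lmat_pair [simp]:
 "measurable (lmat n m \<Otimes>\<^sub>M lmat k l) N = measurable (borel_mat n m \<Otimes>\<^sub>M borel_mat k l) N"
 by (rule measurable_cong_sets) (auto intro!: sets_pair_measure_cong)

lemma measurable_mat_PiM: "mat n m \<in> (\<Pi>\<^sub>M ij\<in>{..<n} \<times> {..<m}. (lborel :: real measure)) \<rightarrow>\<^sub>M borel_mat n m"
 by (rule measurable_borel_matI) auto

lemma measurable_entries_PiM:
 "(\<lambda>A. \<lambda>ij\<in>{..<n} \<times> {..<m}. A $$ ij) \<in> borel_mat n m \<rightarrow>\<^sub>M (\<Pi>\<^sub>M ij\<in>{..<n} \<times> {..<m}. (lborel :: real measure))"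
 by (rule measurable_restrict) (auto intro!: measurable_borel_mat_entry)

lemma mat_entries: "A \<in> carrier_mat n m ==> mat n m (\<lambda>ij\<in>{..<n} \<times> {..<m}. A $$ ij) = A"
 by (rule eq_matI) auto

lemma finite_product_lborel: "finite_product_sigma_finite (\<lambda>_. lborel :: real measure) ({..<n::nat} \<times> {..<m::nat})"
 by standard auto

text \<open>The entry map carries \<open>M\<close> to a measure on a finite product of lines, which
  is determined by its values on boxes; \<open>mat n m\<close> inverts the entry map on the carrier
  and brings the equality back.\<close>

lemma lmat_eqI:
 assumes M: "sets M = sets (borel_mat n m)"
  and box: "\<And>E. (\<And>i j. E i j \<in> sets borel) ==>
   emeasure M {y \<in> carrier_mat n m. \<forall>i<n. \<forall>j<m. y $$ (i, j) \<in> E i j} =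
    (\<Prod>i<n. \<Prod>j<m. emeasure lborel (E i j))"
 shows "M = lmat n m"
proof -
 let ?I = "{..<n} \<times> {..<m}" and ?e = "\<lambda>A. \<lambda>ij\<in>{..<n} \<times> {..<m}. A $$ ij"
 interpret finite_product_sigma_finite "\<lambda>_. lborel :: real measure" ?I
  by (rule finite_product_lborel)
 have sp: "space M = carrier_mat n m" using sets_eq_imp_space_eq[OF M] by simp
 have e: "?e \<in> M \<rightarrow>\<^sub>M (\<Pi>\<^sub>M ij\<in>?I. lborel)"
  using measurable_entries_PiM M measurable_cong_sets by blast
 have "distr M (\<Pi>\<^sub>M ij\<in>?I. lborel) ?e = (\<Pi>\<^sub>M ij\<in>?I. lborel)"
 proof (rule PiM_eqI)
  fix A :: "nat \<times> nat => real set" assume A: "\<And>i. i \<in> ?I ==> A i \<in> sets lborel"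
  define E where "E i j = (if (i, j) \<in> ?I then A (i, j) else {})" for i j
  have E: "E i j \<in> sets borel" for i j using A by (auto simp: E_def)
  have "emeasure (distr M (\<Pi>\<^sub>M ij\<in>?I. lborel) ?e) (Pi\<^sub>E ?I A) = emeasure M (?e -` Pi\<^sub>E ?I A \<inter> space M)"
   by (rule emeasure_distr[OF e]) (use A in "auto intro!: sets_PiM_I_finite")
  also have "?e -` Pi\<^sub>E ?I A \<inter> space M = {y \<in> carrier_mat n m. \<forall>i<n. \<forall>j<m. y $$ (i, j) \<in> E i j}"
   by (auto simp: sp E_def PiE_iff)
  also have "emeasure M ... = (\<Prod>i<n. \<Prod>j<m. emeasure lborel (E i j))" by (rule box[OF E])
  also have "... = (\<Prod>ij\<in>?I. emeasure lborel (A ij))"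
   by (subst prod.cartesian_product, rule prod.cong) (auto simp: E_def)
  finally show "emeasure (distr M (\<Pi>\<^sub>M ij\<in>?I. lborel) ?e) (Pi\<^sub>E ?I A) = (\<Prod>ij\<in>?I. emeasure lborel (A ij))" .
 qed simp_all
 then have "lmat n m = distr (distr M (\<Pi>\<^sub>M ij\<in>?I. lborel) ?e) (borel_mat n m) (mat n m)"
  by (simp add: lmat_def)
 also have "... = distr M (borel_mat n m) (mat n m \<circ> ?e)"
  by (rule distr_distr[OF measurable_mat_PiM e])
 also have "... = distr M M (\<lambda>x. x)"
  by (rule distr_cong) (auto simp: M sp mat_entries)
 finally show ?thesis by simp
qed

lemma sets_mat_box:
 assumes "\<And>i j. E i j \<in> sets borel"
 shows "{y \<in> carrier_mat n m. \<forall>i<n. \<forall>j<m. y $$ (i, j) \<in> E i j} \<in> sets (borel_mat n m)"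
proof -
 have "{y \<in> space (borel_mat n m). \<forall>i\<in>{..<n}. \<forall>j\<in>{..<m}. y $$ (i, j) \<in> E i j} \<in> sets (borel_mat n m)"
 proof (intro sets.sets_Collect_finite_All)
  fix i j assume ij: "i \<in> {..<n}" "j \<in> {..<m}"
  have eq: "{y \<in> space (borel_mat n m). y $$ (i, j) \<in> E i j} =
   (\<lambda>y. y $$ (i, j)) -` E i j \<inter> space (borel_mat n m)" by auto
  show "{y \<in> space (borel_mat n m). y $$ (i, j) \<in> E i j} \<in> sets (borel_mat n m)"
   unfolding eq by (rule measurable_sets[OF measurable_borel_mat_entry assms]) (use ij in auto)
 qed auto
 moreover have "{y \<in> space (borel_mat n m). \<forall>i\<in>{..<n}. \<forall>j\<in>{..<m}. y $$ (i, j) \<in> E i j} =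
  {y \<in> carrier_mat n m. \<forall>i<n. \<forall>j<m. y $$ (i, j) \<in> E i j}" by auto
 ultimately show ?thesis by (simp only:)
qed

lemma emeasure_lmat_box:
 assumes E: "\<And>i j. E i j \<in> sets borel"
 shows "emeasure (lmat n m) {y \<in> carrier_mat n m. \<forall>i<n. \<forall>j<m. y $$ (i, j) \<in> E i j} =
  (\<Prod>i<n. \<Prod>j<m. emeasure lborel (E i j))"
proof -
 let ?I = "{..<n} \<times> {..<m}"
 interpret finite_product_sigma_finite "\<lambda>_. lborel :: real measure" ?I
  by (rule finite_product_lborel)
 have "emeasure (lmat n m) {y \<in> carrier_mat n m. \<forall>i<n. \<forall>j<m. y $$ (i, j) \<in> E i j} =
  emeasure (\<Pi>\<^sub>M ij\<in>?I. lborel) (mat n m -` {y \<in> carrier_mat n m. \<forall>i<n. \<forall>j<m. y $$ (i, j) \<in> E i j} \<inter> space (\<Pi>\<^sub>M ij\<in>?I. lborel))"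
  unfolding lmat_def by (rule emeasure_distr[OF measurable_mat_PiM sets_mat_box[OF E]])
 also have "mat n m -` {y \<in> carrier_mat n m. \<forall>i<n. \<forall>j<m. y $$ (i, j) \<in> E i j} \<inter> space (\<Pi>\<^sub>M ij\<in>?I. lborel)
   = Pi\<^sub>E ?I (\<lambda>(i,j). E i j)"
  by (auto simp: space_PiM PiE_iff)
 also have "emeasure (\<Pi>\<^sub>M ij\<in>?I. lborel) ... = (\<Prod>ij\<in>?I. emeasure lborel ((\<lambda>(i,j). E i j) ij))"
  by (rule measure_times) (use E in auto)
 also have "... = (\<Prod>i<n. \<Prod>j<m. emeasure lborel (E i j))"
  by (subst prod.cartesian_product) (simp add: case_prod_beta)
 finally show ?thesis .
qed

text \<open>The image under the entry map is the product of lines, and a measure with a sigma-finite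
  image is itself sigma-finite.\<close>

lemma sigma_finite_lmat: "sigma_finite_measure (lmat n m)"
proof -
 let ?I = "{..<n} \<times> {..<m}" and ?e = "\<lambda>A. \<lambda>ij\<in>{..<n} \<times> {..<m}. A $$ ij"
 interpret finite_product_sigma_finite "\<lambda>_. lborel :: real measure" ?I
  by (rule finite_product_lborel)
 have "distr (lmat n m) (\<Pi>\<^sub>M ij\<in>?I. lborel) ?e = distr (\<Pi>\<^sub>M ij\<in>?I. lborel) (\<Pi>\<^sub>M ij\<in>?I. lborel) (?e \<circ> mat n m)"
  unfolding lmat_def by (rule distr_distr[OF measurable_entries_PiM measurable_mat_PiM])
 also have "... = distr (\<Pi>\<^sub>M ij\<in>?I. lborel) (\<Pi>\<^sub>M ij\<in>?I. lborel) (\<lambda>x. x)"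
  by (rule distr_cong) (auto simp: space_PiM PiE_iff extensional_def fun_eq_iff)
 finally have "distr (lmat n m) (\<Pi>\<^sub>M ij\<in>?I. lborel) ?e = (\<Pi>\<^sub>M ij\<in>?I. lborel)" by simp
 then have "sigma_finite_measure (distr (lmat n m) (\<Pi>\<^sub>M ij\<in>?I. lborel) ?e)"
  using sigma_finite_measure_axioms by simp
 then show ?thesis
  by (rule sigma_finite_measure_distr) (simp add: measurable_entries_PiM)
qed

interpretation lmat: sigma_finite_measure "lmat n m" for n m by (rule sigma_finite_lmat)
interpretation lmat_pair: pair_sigma_finite "lmat n m" "lmat k l" for n m k l ..

lemma measurable_append_rows_pair:
 "(\<lambda>(a, b). a @\<^sub>r b) \<in> borel_mat k m \<Otimes>\<^sub>M borel_mat l m \<rightarrow>\<^sub>M borel_mat (k + l) m"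
 unfolding case_prod_unfold by (rule measurable_append_rows[OF measurable_fst measurable_snd])

lemma prod_lessThan_add:
 fixes f :: "nat => 'a :: comm_monoid_mult"
 shows "(\<Prod>i<k + l. f i) = (\<Prod>i<k. f i) * (\<Prod>i<l. f (k + i))"
 by (induction l) (auto simp: ac_simps)

lemma append_rows_box:
 assumes ab: "a \<in> carrier_mat k m" "b \<in> carrier_mat l m"
 shows "(\<forall>i<k + l. \<forall>j<m. (a @\<^sub>r b) $$ (i, j) \<in> E i j) \<longleftrightarrow>
  (\<forall>i<k. \<forall>j<m. a $$ (i, j) \<in> E i j) \<and> (\<forall>i<l. \<forall>j<m. b $$ (i, j) \<in> E (k + i) j)"
  (is "?L \<longleftrightarrow> ?A \<and> ?B")
proof
 assume H: ?L
 have "a $$ (i, j) \<in> E i j" if "i < k" "j < m" for i j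
  using H[rule_format, of i j] that index_append_rows[OF ab, of i j] by auto
 moreover have "b $$ (i, j) \<in> E (k + i) j" if "i < l" "j < m" for i j
  using H[rule_format, of "k + i" j] that index_append_rows[OF ab, of "k + i" j] by auto
 ultimately show "?A \<and> ?B" by blast
next
 assume H: "?A \<and> ?B"
 have "(a @\<^sub>r b) $$ (i, j) \<in> E i j" if "i < k + l" "j < m" for i j
  using conjunct1[OF H, rule_format, of i j] conjunct2[OF H, rule_format, of "i - k" j] that
   index_append_rows[OF ab, of i j]
  by (cases "i < k") auto
 then show ?L by blast
qed

text \<open>A box of stacked matrices is the product of a box for the upper and a box for the lower
  block. This is the source of the iterated integrals over rows and, after transposition, over
  columns.\<close>

lemma lmat_rows:
 "distr (lmat k m \<Otimes>\<^sub>M lmat l m) (borel_mat (k + l) m) (\<lambda>(a, b). a @\<^sub>r b) = lmat (k + l) m"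
proof (rule lmat_eqI)
 fix E :: "nat => nat => real set" assume E: "\<And>i j. E i j \<in> sets borel"
 let ?A = "\<lambda>n E. {y \<in> carrier_mat n m. \<forall>i<n. \<forall>j<m. y $$ (i, j) \<in> E i j}"
 have ap: "(\<lambda>(a, b). a @\<^sub>r b) \<in> lmat k m \<Otimes>\<^sub>M lmat l m \<rightarrow>\<^sub>M borel_mat (k + l) m"
  using measurable_append_rows_pair by simp
 have "emeasure (distr (lmat k m \<Otimes>\<^sub>M lmat l m) (borel_mat (k + l) m) (\<lambda>(a, b). a @\<^sub>r b)) (?A (k + l) E)
  = emeasure (lmat k m \<Otimes>\<^sub>M lmat l m) ((\<lambda>(a, b). a @\<^sub>r b) -` ?A (k + l) E \<inter> space (lmat k m \<Otimes>\<^sub>M lmat l m))"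
  by (rule emeasure_distr[OF ap sets_mat_box[OF E]])
 also have "(\<lambda>(a, b). a @\<^sub>r b) -` ?A (k + l) E \<inter> space (lmat k m \<Otimes>\<^sub>M lmat l m) =
   ?A k E \<times> ?A l (\<lambda>i. E (k + i))"
 proof (rule Set.set_eqI)
  fix z :: "real mat \<times> real mat"
  obtain a b where z: "z = (a, b)" by (cases z)
  show "z \<in> (\<lambda>(a, b). a @\<^sub>r b) -` ?A (k + l) E \<inter> space (lmat k m \<Otimes>\<^sub>M lmat l m) \<longleftrightarrow>
    z \<in> ?A k E \<times> ?A l (\<lambda>i. E (k + i))"
  proof (cases "a \<in> carrier_mat k m \<and> b \<in> carrier_mat l m")
   case True
   then have "a @\<^sub>r b \<in> carrier_mat (k + l) m" by auto
   with True show ?thesis using append_rows_box[of a k m b l E]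
    by (simp only: z space_pair_measure space_lmat vimage_eq Int_iff mem_Collect_eq mem_Sigma_iff
      case_prod_conv simp_thms)
  next
   case False
   then show ?thesis
    by (simp only: z space_pair_measure space_lmat vimage_eq Int_iff mem_Collect_eq mem_Sigma_iff
      case_prod_conv simp_thms) blast
  qed
 qed
 also have "emeasure (lmat k m \<Otimes>\<^sub>M lmat l m) ... = emeasure (lmat k m) (?A k E) * emeasure (lmat l m) (?A l (\<lambda>i. E (k + i)))"
  by (rule lmat.emeasure_pair_measure_Times) (simp_all only: sets_lmat, (rule sets_mat_box E)+)
 also have "... = (\<Prod>i<k + l. \<Prod>j<m. emeasure lborel (E i j))"
  by (simp add: emeasure_lmat_box E prod_lessThan_add)
 finally show "emeasure (distr (lmat k m \<Otimes>\<^sub>M lmat l m) (borel_mat (k + l) m) (\<lambda>(a, b). a @\<^sub>r b)) (?A (k + l) E) =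
  (\<Prod>i<k + l. \<Prod>j<m. emeasure lborel (E i j))" .
qed simp

lemma lmat_transpose: "distr (lmat n m) (borel_mat m n) transpose_mat = lmat m n"
proof (rule lmat_eqI)
 fix E :: "nat => nat => real set" assume E: "\<And>i j. E i j \<in> sets borel"
 have t: "transpose_mat \<in> lmat n m \<rightarrow>\<^sub>M borel_mat m n"
  by (rule measurable_mat_transpose) (simp add: measurable_ident_sets)
 have "emeasure (distr (lmat n m) (borel_mat m n) transpose_mat)
   {y \<in> carrier_mat m n. \<forall>i<m. \<forall>j<n. y $$ (i, j) \<in> E i j} =
  emeasure (lmat n m) (transpose_mat -` {y \<in> carrier_mat m n. \<forall>i<m. \<forall>j<n. y $$ (i, j) \<in> E i j} \<inter> space (lmat n m))"
  by (rule emeasure_distr[OF t sets_mat_box[OF E]])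
 also have "transpose_mat -` {y \<in> carrier_mat m n. \<forall>i<m. \<forall>j<n. y $$ (i, j) \<in> E i j} \<inter> space (lmat n m) =
  {y \<in> carrier_mat n m. \<forall>i<n. \<forall>j<m. y $$ (i, j) \<in> E j i}" by auto
 also have "emeasure (lmat n m) ... = (\<Prod>i<n. \<Prod>j<m. emeasure lborel (E j i))"
  by (rule emeasure_lmat_box) (rule E)
 also have "... = (\<Prod>i<m. \<Prod>j<n. emeasure lborel (E i j))" by (rule prod.swap)
 finally show "emeasure (distr (lmat n m) (borel_mat m n) transpose_mat)
   {y \<in> carrier_mat m n. \<forall>i<m. \<forall>j<n. y $$ (i, j) \<in> E i j} = (\<Prod>i<m. \<Prod>j<n. emeasure lborel (E i j))" .
qed simp

text \<open>Each of the \<open>n * m\<close> entries contributes one factor \<open>c\<close> to the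
  volume of a box. Translation, reflection and scaling are the instances in which
  \<open>h i j\<close> is affine.\<close>

lemma lmat_coordinatewise:
 assumes T: "T \<in> borel_mat n m \<rightarrow>\<^sub>M borel_mat n m"
  and entry: "\<And>y i j. y \<in> carrier_mat n m ==> i < n ==> j < m ==> T y $$ (i, j) = h i j (y $$ (i, j))"
  and h: "\<And>i j. h i j \<in> borel_measurable borel"
  and inv: "\<And>i j E. E \<in> sets borel ==> emeasure lborel E = c * emeasure lborel (h i j -` E :: real set)"
 shows "scale_measure ((c ^ m) ^ n) (distr (lmat n m) (borel_mat n m) T) = lmat n m"
proof (rule lmat_eqI)
 fix E :: "nat => nat => real set" assume E: "\<And>i j. E i j \<in> sets borel"
 have hE: "h i j -` E i j \<in> sets borel" for i j
  using measurable_sets[OF h E, of i j i j] by simp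
 have T': "T \<in> lmat n m \<rightarrow>\<^sub>M borel_mat n m" using T by simp
 have "emeasure (distr (lmat n m) (borel_mat n m) T) {y \<in> carrier_mat n m. \<forall>i<n. \<forall>j<m. y $$ (i, j) \<in> E i j} =
  emeasure (lmat n m) (T -` {y \<in> carrier_mat n m. \<forall>i<n. \<forall>j<m. y $$ (i, j) \<in> E i j} \<inter> space (lmat n m))"
  by (rule emeasure_distr[OF T' sets_mat_box[OF E]])
 also have "T -` {y \<in> carrier_mat n m. \<forall>i<n. \<forall>j<m. y $$ (i, j) \<in> E i j} \<inter> space (lmat n m) =
  {y \<in> carrier_mat n m. \<forall>i<n. \<forall>j<m. y $$ (i, j) \<in> h i j -` E i j}"
  using measurable_space[OF T] by (auto simp: entry)
 also have "emeasure (lmat n m) ... = (\<Prod>i<n. \<Prod>j<m. emeasure lborel (h i j -` E i j))"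
  by (rule emeasure_lmat_box) (rule hE)
 finally have "emeasure (scale_measure ((c ^ m) ^ n) (distr (lmat n m) (borel_mat n m) T))
   {y \<in> carrier_mat n m. \<forall>i<n. \<forall>j<m. y $$ (i, j) \<in> E i j} =
   (c ^ m) ^ n * (\<Prod>i<n. \<Prod>j<m. emeasure lborel (h i j -` E i j))" by simp
 also have "... = (\<Prod>i<n. \<Prod>j<m. c * emeasure lborel (h i j -` E i j))"
  by (simp add: prod.distrib)
 also have "... = (\<Prod>i<n. \<Prod>j<m. emeasure lborel (E i j))" by (simp add: inv[OF E, symmetric])
 finally show "emeasure (scale_measure ((c ^ m) ^ n) (distr (lmat n m) (borel_mat n m) T))
   {y \<in> carrier_mat n m. \<forall>i<n. \<forall>j<m. y $$ (i, j) \<in> E i j} = (\<Prod>i<n. \<Prod>j<m. emeasure lborel (E i j))" .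
qed simp

lemma emeasure_lborel_affine:
 fixes c :: real
 assumes "c \<noteq> 0" "E \<in> sets borel"
 shows "emeasure lborel E = ennreal \<bar>c\<bar> * emeasure lborel ((\<lambda>x. t + c * x) -` E)"
proof -
 have m: "(\<lambda>x. t + c * x) \<in> lborel \<rightarrow>\<^sub>M borel" by simp
 have "emeasure lborel E = emeasure (density (distr lborel borel (\<lambda>x. t + c * x)) (\<lambda>_. ennreal \<bar>c\<bar>)) E"
  using lborel_real_affine[OF assms(1), of t] by simp
 also have "... = ennreal \<bar>c\<bar> * emeasure (distr lborel borel (\<lambda>x. t + c * x)) E"
  using assms(2) by (simp add: emeasure_density_const)
 also have "emeasure (distr lborel borel (\<lambda>x. t + c * x)) E = emeasure lborel ((\<lambda>x. t + c * x) -` E)"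
  using emeasure_distr[OF m assms(2)] by simp
 finally show ?thesis .
qed

lemma lmat_translate:
 assumes c: "c \<in> carrier_mat n m"
 shows "distr (lmat n m) (borel_mat n m) (\<lambda>y. c + y) = lmat n m"
proof -
 have "scale_measure ((1 ^ m) ^ n) (distr (lmat n m) (borel_mat n m) (\<lambda>y. c + y)) = lmat n m"
 proof (rule lmat_coordinatewise[where h="\<lambda>i j x. c $$ (i, j) + 1 * x"])
  show "(\<lambda>y. c + y) \<in> borel_mat n m \<rightarrow>\<^sub>M borel_mat n m"
   by (rule measurable_mat_add) (use c in auto)
  show "emeasure lborel E = 1 * emeasure lborel ((\<lambda>x. c $$ (i, j) + 1 * x) -` E)"
   if "E \<in> sets borel" for E i j
   using emeasure_lborel_affine[of 1 E "c $$ (i,j)"] that by simp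
 qed (use c in auto)
 then show ?thesis by simp
qed

lemma lmat_reflect:
 assumes c: "c \<in> carrier_mat n m"
 shows "distr (lmat n m) (borel_mat n m) (\<lambda>y. c - y) = lmat n m"
proof -
 have "scale_measure ((1 ^ m) ^ n) (distr (lmat n m) (borel_mat n m) (\<lambda>y. c - y)) = lmat n m"
 proof (rule lmat_coordinatewise[where h="\<lambda>i j x. c $$ (i, j) + (-1) * x"])
  show "(\<lambda>y. c - y) \<in> borel_mat n m \<rightarrow>\<^sub>M borel_mat n m"
   by (rule measurable_mat_minus) (use c in auto)
  show "emeasure lborel E = 1 * emeasure lborel ((\<lambda>x. c $$ (i, j) + (-1) * x) -` E)"
   if "E \<in> sets borel" for E i j
   using emeasure_lborel_affine[of "-1" E "c $$ (i,j)"] that by simp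
 qed (use c in auto)
 then show ?thesis by simp
qed

lemma lmat_smult:
 assumes c: "c \<noteq> 0"
 shows "scale_measure ((ennreal \<bar>c\<bar> ^ m) ^ n) (distr (lmat n m) (borel_mat n m) (\<lambda>y. c \<cdot>\<^sub>m y)) = lmat n m"
proof (rule lmat_coordinatewise[where h="\<lambda>i j x. 0 + c * x"])
 show "(\<lambda>y. c \<cdot>\<^sub>m y) \<in> borel_mat n m \<rightarrow>\<^sub>M borel_mat n m"
  by (rule measurable_mat_smult) auto
 show "emeasure lborel E = ennreal \<bar>c\<bar> * emeasure lborel ((\<lambda>x. 0 + c * x) -` E)"
  if "E \<in> sets borel" for E i j
  using emeasure_lborel_affine[of c E 0] that c by simp
qed auto

lemma measurable_id_borel_mat [simp]: "(\<lambda>x. x) \<in> lmat n m \<rightarrow>\<^sub>M borel_mat n m"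
 "(\<lambda>x. x) \<in> borel_mat n m \<rightarrow>\<^sub>M borel_mat n m"
 by auto

lemma measurable_mat_mult_left:
 assumes "F \<in> borel_mat n m \<rightarrow>\<^sub>M N" "g \<in> carrier_mat n k"
 shows "(\<lambda>y. F (g * y)) \<in> borel_mat k m \<rightarrow>\<^sub>M N"
 by (rule mcomp[OF measurable_mat_times[where k=k] assms(1)]) (use assms(2) in auto)

lemma measurable_mat_mult_right:
 assumes "F \<in> borel_mat n m \<rightarrow>\<^sub>M N" "T \<in> carrier_mat k m"
 shows "(\<lambda>y. F (y * T)) \<in> borel_mat n k \<rightarrow>\<^sub>M N"
 by (rule mcomp[OF measurable_mat_times[where k=k] assms(1)]) (use assms(2) in auto)

lemma nn_integral_lmat_translate:
 assumes F: "F \<in> borel_fun n m" and c: "c \<in> carrier_mat n m"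
 shows "(\<integral>\<^sup>+y. F (c + y) \<partial>lmat n m) = (\<integral>\<^sup>+y. F y \<partial>lmat n m)"
proof -
 have "(\<integral>\<^sup>+y. F y \<partial>lmat n m) = (\<integral>\<^sup>+y. F y \<partial>distr (lmat n m) (borel_mat n m) (\<lambda>y. c + y))"
  by (simp add: lmat_translate[OF c])
 also have "... = (\<integral>\<^sup>+y. F (c + y) \<partial>lmat n m)"
  by (rule nn_integral_distr) (use F c in "auto intro!: measurable_mat_add")
 finally show ?thesis ..
qed

lemma nn_integral_lmat_transpose:
 assumes F: "F \<in> borel_fun m n"
 shows "(\<integral>\<^sup>+y. F y\<^sup>T \<partial>lmat n m) = (\<integral>\<^sup>+y. F y \<partial>lmat m n)"
proof -
 have "(\<integral>\<^sup>+y. F y \<partial>lmat m n) = (\<integral>\<^sup>+y. F y \<partial>distr (lmat n m) (borel_mat m n) transpose_mat)"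
  by (simp add: lmat_transpose)
 also have "... = (\<integral>\<^sup>+y. F y\<^sup>T \<partial>lmat n m)"
  by (rule nn_integral_distr) (use F in "auto intro!: measurable_mat_transpose")
 finally show ?thesis ..
qed

lemma nn_integral_lmat_rows:
 assumes F: "F \<in> borel_fun (k + l) m"
 shows "(\<integral>\<^sup>+y. F y \<partial>lmat (k + l) m) = (\<integral>\<^sup>+a. \<integral>\<^sup>+b. F (a @\<^sub>r b) \<partial>lmat l m \<partial>lmat k m)"
  and "(\<integral>\<^sup>+y. F y \<partial>lmat (k + l) m) = (\<integral>\<^sup>+b. \<integral>\<^sup>+a. F (a @\<^sub>r b) \<partial>lmat k m \<partial>lmat l m)"
proof -
 have ap: "(\<lambda>(a, b). a @\<^sub>r b) \<in> lmat k m \<Otimes>\<^sub>M lmat l m \<rightarrow>\<^sub>M borel_mat (k + l) m"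
  using measurable_append_rows_pair by simp
 have F': "(\<lambda>(a, b). F (a @\<^sub>r b)) \<in> borel_measurable (lmat k m \<Otimes>\<^sub>M lmat l m)"
  using mcomp[OF ap F] by (simp add: case_prod_beta)
 have "(\<integral>\<^sup>+y. F y \<partial>lmat (k + l) m) = (\<integral>\<^sup>+z. (\<lambda>(a, b). F (a @\<^sub>r b)) z \<partial>(lmat k m \<Otimes>\<^sub>M lmat l m))"
  unfolding lmat_rows[symmetric] by (subst nn_integral_distr[OF ap]) (simp_all add: case_prod_unfold F)
 then show "(\<integral>\<^sup>+y. F y \<partial>lmat (k + l) m) = (\<integral>\<^sup>+a. \<integral>\<^sup>+b. F (a @\<^sub>r b) \<partial>lmat l m \<partial>lmat k m)"
  "(\<integral>\<^sup>+y. F y \<partial>lmat (k + l) m) = (\<integral>\<^sup>+b. \<integral>\<^sup>+a. F (a @\<^sub>r b) \<partial>lmat k m \<partial>lmat l m)"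
  using lmat.nn_integral_fst[OF F'] lmat_pair.nn_integral_snd[OF F'] by simp_all
qed

lemma nn_integral_lmat_cols:
 assumes F: "F \<in> borel_fun n (k + l)"
 shows "(\<integral>\<^sup>+y. F y \<partial>lmat n (k + l)) = (\<integral>\<^sup>+a. \<integral>\<^sup>+b. F (a @\<^sub>c b) \<partial>lmat n l \<partial>lmat n k)"
  and "(\<integral>\<^sup>+y. F y \<partial>lmat n (k + l)) = (\<integral>\<^sup>+b. \<integral>\<^sup>+a. F (a @\<^sub>c b) \<partial>lmat n k \<partial>lmat n l)"
proof -
 have F': "(\<lambda>(a, b). F (a @\<^sub>c b)) \<in> borel_measurable (lmat n k \<Otimes>\<^sub>M lmat n l)"
  unfolding case_prod_beta
  by (rule mcomp[OF measurable_append_cols F]) auto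
 have FT: "(\<lambda>y. F y\<^sup>T) \<in> borel_fun (k + l) n"
  by (rule mcomp[OF measurable_mat_transpose F]) auto
 have "(\<integral>\<^sup>+y. F y \<partial>lmat n (k + l)) = (\<integral>\<^sup>+y. F y\<^sup>T \<partial>lmat (k + l) n)"
  by (rule nn_integral_lmat_transpose[OF F, symmetric])
 also have "... = (\<integral>\<^sup>+a. \<integral>\<^sup>+b. F (a @\<^sub>r b)\<^sup>T \<partial>lmat l n \<partial>lmat k n)"
  by (rule nn_integral_lmat_rows(1)[OF FT])
 also have "... = (\<integral>\<^sup>+a. \<integral>\<^sup>+b. F (a\<^sup>T @\<^sub>c b\<^sup>T) \<partial>lmat l n \<partial>lmat k n)"
  by (intro nn_integral_cong) (simp add: transpose_append_rows)
 also have "... = (\<integral>\<^sup>+a. \<integral>\<^sup>+b. F (a\<^sup>T @\<^sub>c b) \<partial>lmat n l \<partial>lmat k n)"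
  by (intro nn_integral_cong nn_integral_lmat_transpose mcomp[OF measurable_append_cols F]) auto
 also have "... = (\<integral>\<^sup>+a. \<integral>\<^sup>+b. F (a @\<^sub>c b) \<partial>lmat n l \<partial>lmat n k)"
  using lmat.borel_measurable_nn_integral_fst[OF F']
  by (intro nn_integral_lmat_transpose[where F="\<lambda>a. \<integral>\<^sup>+b. F (a @\<^sub>c b) \<partial>lmat n l"]) simp
 finally show 1: "(\<integral>\<^sup>+y. F y \<partial>lmat n (k + l)) = (\<integral>\<^sup>+a. \<integral>\<^sup>+b. F (a @\<^sub>c b) \<partial>lmat n l \<partial>lmat n k)" .
 then show "(\<integral>\<^sup>+y. F y \<partial>lmat n (k + l)) = (\<integral>\<^sup>+b. \<integral>\<^sup>+a. F (a @\<^sub>c b) \<partial>lmat n k \<partial>lmat n l)"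
  using lmat_pair.Fubini'[OF F'] by simp
qed

text \<open>An empty index set leaves a single matrix, whose mass is the empty product 1. These
  degenerate sizes start the inductions over rows and columns.\<close>

lemma nn_integral_lmat_0:
 assumes F: "F \<in> borel_fun n m" and "n = 0 \<or> m = 0"
 shows "(\<integral>\<^sup>+y. F y \<partial>lmat n m) = F (0\<^sub>m n m)"
proof -
 have c: "carrier_mat n m = {0\<^sub>m n m :: real mat}"
  using assms(2) by (auto intro!: eq_matI)
 have "emeasure (lmat n m) {0\<^sub>m n m} = 1"
  using emeasure_lmat_box[of "\<lambda>_ _. UNIV" n m] assms(2) c by auto
 moreover have "(\<integral>\<^sup>+y. F y \<partial>lmat n m) = (\<integral>\<^sup>+y. F (0\<^sub>m n m) \<partial>lmat n m)"
  by (rule nn_integral_cong) (simp add: c)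
 ultimately show ?thesis by (simp add: c)
qed

section \<open>Linear change of variables for left and right multiplication\<close>

definition lin_scales :: "nat => real mat => bool" where
 "lin_scales n g \<longleftrightarrow> (\<forall>m. \<forall>F \<in> borel_fun n m.
   ennreal (\<bar>det g\<bar> ^ m) * (\<integral>\<^sup>+y. F (g * y) \<partial>lmat n m) = (\<integral>\<^sup>+y. F y \<partial>lmat n m))"

lemma lin_scalesD:
 "lin_scales n g ==> F \<in> borel_fun n m ==>
   ennreal (\<bar>det g\<bar> ^ m) * (\<integral>\<^sup>+y. F (g * y) \<partial>lmat n m) = (\<integral>\<^sup>+y. F y \<partial>lmat n m)"
 unfolding lin_scales_def by blast

lemma lin_scales_mult:
 assumes g: "g \<in> carrier_mat n n" "lin_scales n g" and h: "h \<in> carrier_mat n n" "lin_scales n h"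
 shows "lin_scales n (g * h)"
 unfolding lin_scales_def
proof (intro allI ballI)
 fix m and F :: "real mat => ennreal" assume F: "F \<in> borel_fun n m"
 have Fg: "(\<lambda>y. F (g * y)) \<in> borel_fun n m"
  by (rule measurable_mat_mult_left[OF F]) (use g in auto)
 have "(\<integral>\<^sup>+y. F (g * h * y) \<partial>lmat n m) = (\<integral>\<^sup>+y. F (g * (h * y)) \<partial>lmat n m)"
  by (rule nn_integral_cong) (use g h in "simp add: assoc_mult_mat[of _ n n _ n _ m]")
 then have "ennreal (\<bar>det (g * h)\<bar> ^ m) * (\<integral>\<^sup>+y. F (g * h * y) \<partial>lmat n m) =
   ennreal (\<bar>det g\<bar> ^ m) * (ennreal (\<bar>det h\<bar> ^ m) * (\<integral>\<^sup>+y. F (g * (h * y)) \<partial>lmat n m))"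
  using det_mult[OF g(1) h(1)] by (simp add: abs_mult power_mult_distrib ennreal_mult mult.assoc)
 also have "ennreal (\<bar>det h\<bar> ^ m) * (\<integral>\<^sup>+y. F (g * (h * y)) \<partial>lmat n m) = (\<integral>\<^sup>+y. F (g * y) \<partial>lmat n m)"
  by (rule lin_scalesD[OF h(2) Fg])
 also have "ennreal (\<bar>det g\<bar> ^ m) * ... = (\<integral>\<^sup>+y. F y \<partial>lmat n m)"
  by (rule lin_scalesD[OF g(2) F])
 finally show "ennreal (\<bar>det (g * h)\<bar> ^ m) * (\<integral>\<^sup>+y. F (g * h * y) \<partial>lmat n m) = (\<integral>\<^sup>+y. F y \<partial>lmat n m)" .
qed

text \<open>For a fixed lower block \<open>b\<close> the shear translates the upper block by
  \<open>C * b\<close>, so integrating the upper block first reduces the claim to translation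
  invariance; the determinant is 1.\<close>

lemma lin_scales_upper_shear:
 assumes C: "C \<in> carrier_mat k l"
 shows "lin_scales (k + l) (four_block_mat (1\<^sub>m k) C (0\<^sub>m l k) (1\<^sub>m l))"
 unfolding lin_scales_def
proof (intro allI ballI)
 fix m and F :: "real mat => ennreal" assume F: "F \<in> borel_fun (k + l) m"
 let ?g = "four_block_mat (1\<^sub>m k) C (0\<^sub>m l k) (1\<^sub>m l)"
 have g: "?g \<in> carrier_mat (k + l) (k + l)" using C by auto
 have Fg: "(\<lambda>y. F (?g * y)) \<in> borel_fun (k + l) m"
  by (rule measurable_mat_mult_left[OF F]) (use g in auto)
 have "(\<integral>\<^sup>+y. F (?g * y) \<partial>lmat (k + l) m) = (\<integral>\<^sup>+b. \<integral>\<^sup>+a. F (?g * (a @\<^sub>r b)) \<partial>lmat k m \<partial>lmat l m)"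
  by (rule nn_integral_lmat_rows(2)[OF Fg])
 also have "... = (\<integral>\<^sup>+b. \<integral>\<^sup>+a. F ((C * b + a) @\<^sub>r b) \<partial>lmat k m \<partial>lmat l m)"
  by (intro nn_integral_cong, subst four_block_mult_append_rows[of _ k k _ l _ l _ _ m])
   (use C in \<open>auto simp: comm_add_mat[of "C * _" k m]\<close>)
 also have "... = (\<integral>\<^sup>+b. \<integral>\<^sup>+a. F (a @\<^sub>r b) \<partial>lmat k m \<partial>lmat l m)"
  by (intro nn_integral_cong nn_integral_lmat_translate mcomp[OF measurable_append_rows F])
   (use C in auto)
 also have "... = (\<integral>\<^sup>+y. F y \<partial>lmat (k + l) m)"
  by (rule nn_integral_lmat_rows(2)[OF F, symmetric])
 finally show "ennreal (\<bar>det ?g\<bar> ^ m) * (\<integral>\<^sup>+y. F (?g * y) \<partial>lmat (k + l) m) = (\<integral>\<^sup>+y. F y \<partial>lmat (k + l) m)"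
  using det_four_block_mat_lower_left_zero[of "1\<^sub>m k" k C l "0\<^sub>m l k" "1\<^sub>m l"] C by simp
qed

lemma lin_scales_lower_shear:
 assumes C: "C \<in> carrier_mat l k"
 shows "lin_scales (k + l) (four_block_mat (1\<^sub>m k) (0\<^sub>m k l) C (1\<^sub>m l))"
 unfolding lin_scales_def
proof (intro allI ballI)
 fix m and F :: "real mat => ennreal" assume F: "F \<in> borel_fun (k + l) m"
 let ?g = "four_block_mat (1\<^sub>m k) (0\<^sub>m k l) C (1\<^sub>m l)"
 have g: "?g \<in> carrier_mat (k + l) (k + l)" using C by auto
 have Fg: "(\<lambda>y. F (?g * y)) \<in> borel_fun (k + l) m"
  by (rule measurable_mat_mult_left[OF F]) (use g in auto)
 have "(\<integral>\<^sup>+y. F (?g * y) \<partial>lmat (k + l) m) = (\<integral>\<^sup>+a. \<integral>\<^sup>+b. F (?g * (a @\<^sub>r b)) \<partial>lmat l m \<partial>lmat k m)"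
  by (rule nn_integral_lmat_rows(1)[OF Fg])
 also have "... = (\<integral>\<^sup>+a. \<integral>\<^sup>+b. F (a @\<^sub>r (C * a + b)) \<partial>lmat l m \<partial>lmat k m)"
  by (intro nn_integral_cong, subst four_block_mult_append_rows[of _ k k _ l _ l _ _ m])
   (use C in auto)
 also have "... = (\<integral>\<^sup>+a. \<integral>\<^sup>+b. F (a @\<^sub>r b) \<partial>lmat l m \<partial>lmat k m)"
  by (intro nn_integral_cong nn_integral_lmat_translate mcomp[OF measurable_append_rows F])
   (use C in auto)
 also have "... = (\<integral>\<^sup>+y. F y \<partial>lmat (k + l) m)"
  by (rule nn_integral_lmat_rows(1)[OF F, symmetric])
 finally show "ennreal (\<bar>det ?g\<bar> ^ m) * (\<integral>\<^sup>+y. F (?g * y) \<partial>lmat (k + l) m) = (\<integral>\<^sup>+y. F y \<partial>lmat (k + l) m)"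
  using det_four_block_mat_upper_right_zero[of "1\<^sub>m k" k "0\<^sub>m k l" l C "1\<^sub>m l"] C by simp
qed

lemma lin_scales_diag:
 assumes A: "A \<in> carrier_mat k k" "lin_scales k A" and D: "D \<in> carrier_mat l l" "lin_scales l D"
 shows "lin_scales (k + l) (four_block_mat A (0\<^sub>m k l) (0\<^sub>m l k) D)"
 unfolding lin_scales_def
proof (intro allI ballI)
 fix m and F :: "real mat => ennreal" assume F: "F \<in> borel_fun (k + l) m"
 let ?g = "four_block_mat A (0\<^sub>m k l) (0\<^sub>m l k) D"
 have g: "?g \<in> carrier_mat (k + l) (k + l)" using A D by auto
 have Fg: "(\<lambda>y. F (?g * y)) \<in> borel_fun (k + l) m"
  by (rule measurable_mat_mult_left[OF F]) (use g in auto)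
 have F': "(\<lambda>(a, b). F (a @\<^sub>r b)) \<in> borel_measurable (lmat k m \<Otimes>\<^sub>M lmat l m)"
  unfolding case_prod_beta
  by (rule mcomp[OF measurable_append_rows F]) auto
 have FD: "(\<lambda>a. \<integral>\<^sup>+b. F (a @\<^sub>r b) \<partial>lmat l m) \<in> borel_fun k m"
  using lmat.borel_measurable_nn_integral_fst[OF F'] by simp
 have FA: "(\<lambda>a. \<integral>\<^sup>+b. F (A * a @\<^sub>r b) \<partial>lmat l m) \<in> borel_fun k m"
  by (rule measurable_mat_mult_left[OF FD]) (use A in auto)
 have d: "det ?g = det A * det D"
  by (rule det_four_block_mat_lower_left_zero) (use A D in auto)
 have Dint: "ennreal (\<bar>det D\<bar> ^ m) * (\<integral>\<^sup>+b. F (a @\<^sub>r (D * b)) \<partial>lmat l m) = (\<integral>\<^sup>+b. F (a @\<^sub>r b) \<partial>lmat l m)"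
  if "a \<in> carrier_mat k m" for a
  using D(2)[unfolded lin_scales_def, rule_format, of "\<lambda>b. F (a @\<^sub>r b)" m]
   mcomp[OF measurable_append_rows F, of "\<lambda>_. a" _ "\<lambda>b. b"] that by auto
 have AD: "A * a @\<^sub>r D * b = ?g * (a @\<^sub>r b)" if "a \<in> carrier_mat k m" "b \<in> carrier_mat l m" for a b
  by (subst four_block_mult_append_rows[of _ k k _ l _ l _ _ m]) (use that A D in auto)
 have m2: "(\<lambda>a. \<integral>\<^sup>+b. F (?g * (a @\<^sub>r b)) \<partial>lmat l m) \<in> borel_measurable (lmat k m)"
 proof -
  have "(\<lambda>(a, b). F (?g * (a @\<^sub>r b))) \<in> borel_measurable (lmat k m \<Otimes>\<^sub>M lmat l m)"
   unfolding case_prod_beta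
   by (rule mcomp[OF measurable_append_rows Fg]) auto
  from lmat.borel_measurable_nn_integral_fst[OF this] show ?thesis by simp
 qed
 have "ennreal (\<bar>det ?g\<bar> ^ m) * (\<integral>\<^sup>+y. F (?g * y) \<partial>lmat (k + l) m) =
   ennreal (\<bar>det A\<bar> ^ m) * (ennreal (\<bar>det D\<bar> ^ m) * (\<integral>\<^sup>+a. \<integral>\<^sup>+b. F (?g * (a @\<^sub>r b)) \<partial>lmat l m \<partial>lmat k m))"
  by (simp add: nn_integral_lmat_rows(1)[OF Fg] d abs_mult power_mult_distrib ennreal_mult mult.assoc)
 also have "ennreal (\<bar>det D\<bar> ^ m) * (\<integral>\<^sup>+a. \<integral>\<^sup>+b. F (?g * (a @\<^sub>r b)) \<partial>lmat l m \<partial>lmat k m) =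
   (\<integral>\<^sup>+a. ennreal (\<bar>det D\<bar> ^ m) * (\<integral>\<^sup>+b. F (?g * (a @\<^sub>r b)) \<partial>lmat l m) \<partial>lmat k m)"
  by (rule nn_integral_cmult[symmetric, OF m2])
 also have "... = (\<integral>\<^sup>+a. ennreal (\<bar>det D\<bar> ^ m) * (\<integral>\<^sup>+b. F (A * a @\<^sub>r D * b) \<partial>lmat l m) \<partial>lmat k m)"
  by (intro nn_integral_cong arg_cong2[where f="(*)"] refl) (simp add: AD)
 also have "... = (\<integral>\<^sup>+a. \<integral>\<^sup>+b. F (A * a @\<^sub>r b) \<partial>lmat l m \<partial>lmat k m)"
  by (intro nn_integral_cong Dint) (use A in auto)
 also have "ennreal (\<bar>det A\<bar> ^ m) * ... = (\<integral>\<^sup>+a. \<integral>\<^sup>+b. F (a @\<^sub>r b) \<partial>lmat l m \<partial>lmat k m)"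
  by (rule lin_scalesD[OF A(2) FD])
 also have "... = (\<integral>\<^sup>+y. F y \<partial>lmat (k + l) m)"
  by (rule nn_integral_lmat_rows(1)[OF F, symmetric])
 finally show "ennreal (\<bar>det ?g\<bar> ^ m) * (\<integral>\<^sup>+y. F (?g * y) \<partial>lmat (k + l) m) = (\<integral>\<^sup>+y. F y \<partial>lmat (k + l) m)" .
qed

lemma mat1_mult:
 assumes "p \<in> carrier_mat 1 1" "y \<in> carrier_mat 1 m"
 shows "p * y = p $$ (0, 0) \<cdot>\<^sub>m (y :: real mat)"
 by (rule eq_matI) (use assms in "auto simp: scalar_prod_def")

lemma lin_scales_1:
 assumes p: "p \<in> carrier_mat 1 1" "p $$ (0, 0) \<noteq> 0"
 shows "lin_scales 1 p"
 unfolding lin_scales_def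
proof (intro allI ballI)
 fix m and F :: "real mat => ennreal" assume F: "F \<in> borel_fun 1 m"
 let ?c = "p $$ (0, 0)"
 have "(\<integral>\<^sup>+y. F y \<partial>lmat 1 m) =
  (\<integral>\<^sup>+y. F y \<partial>scale_measure ((ennreal \<bar>?c\<bar> ^ m) ^ 1) (distr (lmat 1 m) (borel_mat 1 m) (\<lambda>y. ?c \<cdot>\<^sub>m y)))"
  by (simp only: lmat_smult[OF p(2)])
 also have "... = ennreal \<bar>?c\<bar> ^ m * (\<integral>\<^sup>+y. F y \<partial>distr (lmat 1 m) (borel_mat 1 m) (\<lambda>y. ?c \<cdot>\<^sub>m y))"
  using F by (simp add: nn_integral_scale_measure)
 also have "(\<integral>\<^sup>+y. F y \<partial>distr (lmat 1 m) (borel_mat 1 m) (\<lambda>y. ?c \<cdot>\<^sub>m y)) = (\<integral>\<^sup>+y. F (?c \<cdot>\<^sub>m y) \<partial>lmat 1 m)"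
  by (rule nn_integral_distr) (use F in "auto intro!: measurable_mat_smult")
 also have "... = (\<integral>\<^sup>+y. F (p * y) \<partial>lmat 1 m)"
  by (rule nn_integral_cong) (use p mat1_mult in auto)
 finally show "ennreal (\<bar>det p\<bar> ^ m) * (\<integral>\<^sup>+y. F (p * y) \<partial>lmat 1 m) = (\<integral>\<^sup>+y. F y \<partial>lmat 1 m)"
  using det_single[OF p(1)] by (simp add: ennreal_power)
qed

text \<open>Elimination with a scalar pivot \<open>p\<close>: the lower right block of the middle
  factor is the Schur complement \<open>D - c * b / p\<close>.\<close>

lemma four_block_LU:
 fixes p :: "real mat"
 assumes p: "p \<in> carrier_mat 1 1" "p $$ (0,0) \<noteq> 0" and b: "b \<in> carrier_mat 1 n"
  and c: "c \<in> carrier_mat n 1" and D: "D \<in> carrier_mat n n"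
 defines "q \<equiv> 1 / p $$ (0,0)"
 shows "four_block_mat p b c D = four_block_mat (1\<^sub>m 1) (0\<^sub>m 1 n) (q \<cdot>\<^sub>m c) (1\<^sub>m n)
   * (four_block_mat p (0\<^sub>m 1 n) (0\<^sub>m n 1) (D - q \<cdot>\<^sub>m (c * b))
   * four_block_mat (1\<^sub>m 1) (q \<cdot>\<^sub>m b) (0\<^sub>m n 1) (1\<^sub>m n))"
proof -
 have pq: "p * (q \<cdot>\<^sub>m b) = b" "q \<cdot>\<^sub>m c * p = c"
  using p b c by (auto intro!: eq_matI simp: q_def scalar_prod_def)
 have S: "D - q \<cdot>\<^sub>m (c * b) \<in> carrier_mat n n" using b c D by (intro minus_carrier_mat) auto
 have "four_block_mat p (0\<^sub>m 1 n) (0\<^sub>m n 1) (D - q \<cdot>\<^sub>m (c * b)) * four_block_mat (1\<^sub>m 1) (q \<cdot>\<^sub>m b) (0\<^sub>m n 1) (1\<^sub>m n)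
   = four_block_mat p b (0\<^sub>m n 1) (D - q \<cdot>\<^sub>m (c * b))"
  by (subst mult_four_block_mat[of _ 1 1 _ n _ n _ _ 1 _ n]) (use p b c D S pq in auto)
 moreover have "q \<cdot>\<^sub>m c * b + (D - q \<cdot>\<^sub>m (c * b)) = D"
  using b c D by (intro eq_matI) (auto simp: mult_smult_assoc_mat[of c n 1 b n])
 ultimately show ?thesis
  by (simp, subst mult_four_block_mat[of _ 1 1 _ n _ n _ _ 1 _ n]) (use p b c D S pq in auto)
qed

text \<open>Induction on \<open>n\<close> by block elimination: the property is closed under
  products and holds for shears and block-diagonal matrices, and the Schur complement of a nonzero
  pivot is an invertible matrix of the next smaller size.\<close>

lemma lin_scales_invertible:
 assumes "g \<in> carrier_mat n n" "det g \<noteq> 0"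
 shows "lin_scales n g"
 using assms
proof (induction n arbitrary: g)
 case 0
 show ?case
  unfolding lin_scales_def
 proof (intro allI ballI)
  fix m and F :: "real mat => ennreal" assume F: "F \<in> borel_fun 0 m"
  have Fg: "(\<lambda>y. F (g * y)) \<in> borel_fun 0 m"
   by (rule measurable_mat_mult_left[OF F 0(1)])
  have "g * 0\<^sub>m 0 m = 0\<^sub>m 0 m" by (rule right_mult_zero_mat[OF 0(1)])
  then show "ennreal (\<bar>det g\<bar> ^ m) * (\<integral>\<^sup>+y. F (g * y) \<partial>lmat 0 m) = (\<integral>\<^sup>+y. F y \<partial>lmat 0 m)"
   using nn_integral_lmat_0[OF F] nn_integral_lmat_0[OF Fg] det_dim_zero[OF 0(1)] by simp
 qed
next
 case (Suc n)
 have pivot: "lin_scales (1 + n) (four_block_mat p b c D)"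
  if p: "p \<in> carrier_mat 1 1" "p $$ (0,0) \<noteq> 0" and b: "b \<in> carrier_mat 1 n"
  and c: "c \<in> carrier_mat n 1" and D: "D \<in> carrier_mat n n"
  and nz: "det (four_block_mat p b c D) \<noteq> 0" for p b c D
 proof -
  define q where "q = 1 / p $$ (0,0)"
  let ?L = "four_block_mat (1\<^sub>m 1) (0\<^sub>m 1 n) (q \<cdot>\<^sub>m c) (1\<^sub>m n)"
  let ?U = "four_block_mat (1\<^sub>m 1) (q \<cdot>\<^sub>m b) (0\<^sub>m n 1) (1\<^sub>m n)"
  let ?S = "D - q \<cdot>\<^sub>m (c * b)"
  let ?M = "four_block_mat p (0\<^sub>m 1 n) (0\<^sub>m n 1) ?S"
  have S: "?S \<in> carrier_mat n n" using b c D by (intro minus_carrier_mat) auto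
  have car: "?L \<in> carrier_mat (1 + n) (1 + n)" "?M \<in> carrier_mat (1 + n) (1 + n)" "?U \<in> carrier_mat (1 + n) (1 + n)"
   using four_block_carrier_mat[OF one_carrier_mat[of 1] one_carrier_mat[of n]]
    four_block_carrier_mat[OF p(1) S] by blast+
  have eq: "four_block_mat p b c D = ?L * (?M * ?U)"
   unfolding q_def by (rule four_block_LU[OF p b c D])
  have "det ?M = det p * det ?S"
   by (rule det_four_block_mat_lower_left_zero) (use p S in auto)
  moreover have "det ?M \<noteq> 0"
   using nz det_mult[OF car(1) mult_carrier_mat[OF car(2,3)]] det_mult[OF car(2,3)] unfolding eq by force
  ultimately have "det ?S \<noteq> 0" by auto
  then have "lin_scales n ?S" using S by (rule Suc.IH[rotated])
  then have M: "lin_scales (1 + n) ?M"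
   by (intro lin_scales_diag lin_scales_1) (use p S in auto)
  show ?thesis unfolding eq
   by (intro lin_scales_mult lin_scales_lower_shear lin_scales_upper_shear M mult_carrier_mat[OF car(2,3)] car)
    (use b c in auto)
 qed
 obtain p b c D where sp: "split_block g 1 1 = (p, b, c, D)" by (metis surj_pair)
 note sb = split_block[OF sp, of n n]
 have g: "g = four_block_mat p b c D" and p: "p \<in> carrier_mat 1 1" and b: "b \<in> carrier_mat 1 n"
  and c: "c \<in> carrier_mat n 1" and D: "D \<in> carrier_mat n n"
  using sb Suc.prems by auto
 show ?case
 proof (cases "p $$ (0,0) = 0")
  case False
  then show ?thesis using pivot[OF p False b c D] Suc.prems g by simp
 next
  case True
  \<comment> \<open>With a vanishing pivot the rest of the first column cannot vanish as well, since
    then \<open>det g\<close> would be \<open>det p * det D = 0\<close>.\<close>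
  have "\<exists>i<n. c $$ (i, 0) \<noteq> 0"
  proof (rule ccontr)
   assume "\<not> ?thesis"
   then have "c = 0\<^sub>m n 1" using c by (intro eq_matI) auto
   then have "det g = det p * det D"
    unfolding g by (intro det_four_block_mat_lower_left_zero) (use p b D in auto)
   then show False using True p Suc.prems det_single[OF p] by simp
  qed
  then obtain i where i: "i < n" "c $$ (i, 0) \<noteq> 0" by blast
  \<comment> \<open>The shear by \<open>e\<close> adds row \<open>i\<close> of the lower block to
    the first row, which makes the pivot equal to \<open>c $$ (i, 0)\<close>; the shear by
    \<open>- e\<close> undoes it.\<close>
  define e where "e = mat 1 n (\<lambda>(_, j). if j = i then 1 else 0 :: real)"
  have e: "e \<in> carrier_mat 1 n" by (simp add: e_def)
  have ee: "e + - e = 0\<^sub>m 1 n" using e by (intro eq_matI) auto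
  let ?E = "four_block_mat (1\<^sub>m 1) e (0\<^sub>m n 1) (1\<^sub>m n)"
  let ?E' = "four_block_mat (1\<^sub>m 1) (- e) (0\<^sub>m n 1) (1\<^sub>m n)"
  have Eg: "?E * g = four_block_mat (p + e * c) (b + e * D) c D"
   unfolding g by (subst mult_four_block_mat[of _ 1 1 _ n _ n _ _ 1 _ n]) (use p b c D e in auto)
  have EE: "?E' * ?E = 1\<^sub>m (1 + n)"
   by (subst mult_four_block_mat[of _ 1 1 _ n _ n _ _ 1 _ n])
    (use e ee four_block_one_mat[of 1 n] in auto)
  have car: "?E \<in> carrier_mat (1 + n) (1 + n)" "?E' \<in> carrier_mat (1 + n) (1 + n)" "g \<in> carrier_mat (1 + n) (1 + n)"
   using four_block_carrier_mat[OF one_carrier_mat[of 1] one_carrier_mat[of n]] Suc.prems(1)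
   by (blast, blast, simp)
  have dE: "det ?E = 1"
   by (subst det_four_block_mat_lower_left_zero[of _ 1 _ n]) (use e in auto)
  have "(e * c) $$ (0, 0) = c $$ (i, 0)"
   using i c e by (simp add: e_def scalar_prod_def if_distrib[where f="\<lambda>x. x * _"] cong: if_cong)
  then have pv: "(p + e * c) $$ (0, 0) \<noteq> 0" using True i p e c by simp
  have "det (?E * g) \<noteq> 0" using det_mult[OF car(1,3)] dE Suc.prems by simp
  then have "lin_scales (1 + n) (?E * g)"
   unfolding Eg by (intro pivot) (use p b c D e pv in auto)
  then have "lin_scales (1 + n) (?E' * (?E * g))"
   by (intro lin_scales_mult[OF car(2) lin_scales_upper_shear mult_carrier_mat[OF car(1,3)]]) (use e in auto)
  also have "?E' * (?E * g) = g"
   using assoc_mult_mat[OF car(2,1,3)] EE car by simp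
  finally show ?thesis by simp
 qed
qed

lemma nn_integral_lmat_mult_left:
 assumes g: "g \<in> carrier_mat n n" "det g \<noteq> 0" and F: "F \<in> borel_fun n m"
 shows "ennreal (\<bar>det g\<bar> ^ m) * (\<integral>\<^sup>+y. F (g * y) \<partial>lmat n m) = (\<integral>\<^sup>+y. F y \<partial>lmat n m)"
 by (rule lin_scalesD[OF lin_scales_invertible[OF g] F])

lemma nn_integral_lmat_mult_right:
 assumes T: "T \<in> carrier_mat m m" "det T \<noteq> 0" and F: "F \<in> borel_fun n m"
 shows "ennreal (\<bar>det T\<bar> ^ n) * (\<integral>\<^sup>+y. F (y * T) \<partial>lmat n m) = (\<integral>\<^sup>+y. F y \<partial>lmat n m)"
proof -
 have FT: "(\<lambda>y. F y\<^sup>T) \<in> borel_fun m n"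
  by (rule mcomp[OF measurable_mat_transpose F]) auto
 have FT': "(\<lambda>y. F (y * T)) \<in> borel_fun n m"
  by (rule measurable_mat_mult_right[OF F]) (use T in auto)
 have "(\<integral>\<^sup>+y. F y \<partial>lmat n m) = (\<integral>\<^sup>+y. F y\<^sup>T \<partial>lmat m n)"
  by (rule nn_integral_lmat_transpose[OF F, symmetric])
 also have "... = ennreal (\<bar>det T\<bar> ^ n) * (\<integral>\<^sup>+y. F (T\<^sup>T * y)\<^sup>T \<partial>lmat m n)"
  using nn_integral_lmat_mult_left[of "T\<^sup>T" m, OF _ _ FT] T by (simp add: det_transpose)
 also have "(\<integral>\<^sup>+y. F (T\<^sup>T * y)\<^sup>T \<partial>lmat m n) = (\<integral>\<^sup>+y. F (y\<^sup>T * T) \<partial>lmat m n)"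
  by (intro nn_integral_cong arg_cong[where f=F]) (use T in "simp add: transpose_mult[of _ m m _ n]")
 also have "... = (\<integral>\<^sup>+y. F (y * T) \<partial>lmat n m)"
  by (rule nn_integral_lmat_transpose[OF FT'])
 finally show ?thesis ..
qed

section \<open>Orthogonal matrices and the Gram--Schmidt map\<close>

declare One_nat_def [simp del]

lemma orth_groupD:
 assumes "g \<in> orth_group n"
 shows "g \<in> carrier_mat n n" "g\<^sup>T * g = 1\<^sub>m n" "g * g\<^sup>T = 1\<^sub>m n" "\<bar>det g\<bar> = 1" "det g \<noteq> 0" "g\<^sup>T \<in> orth_group n"
proof -
 show g: "g \<in> carrier_mat n n" and gg: "g\<^sup>T * g = 1\<^sub>m n" using assms by (auto simp: orth_group_def)
 show gg': "g * g\<^sup>T = 1\<^sub>m n" by (rule mat_mult_left_right_inverse[OF _ g gg]) (use g in auto)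
 have "det g * det g = 1"
  using det_mult[of "g\<^sup>T" n g] g gg by (simp add: det_transpose)
 then have "det g ^ 2 = 1" by (simp add: power2_eq_square)
 then show "\<bar>det g\<bar> = 1" by (simp add: abs_square_eq_1)
 then show "det g \<noteq> 0" by auto
 show "g\<^sup>T \<in> orth_group n" using g gg' by (simp add: orth_group_def)
qed

lemma stiefel_square: "stiefel n n = orth_group n"
 by (simp add: stiefel_def orth_group_def)

lemma orth_mult_stiefel:
 assumes "g \<in> orth_group n" "u \<in> stiefel n r"
 shows "g * u \<in> stiefel n r"
proof -
 have u: "u \<in> carrier_mat n r" "u\<^sup>T * u = 1\<^sub>m r" using assms by (auto simp: stiefel_def)
 note g = orth_groupD[OF assms(1)]
 have "(g * u)\<^sup>T * (g * u) = u\<^sup>T * (g\<^sup>T * g) * u"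
  using g(1) u(1) by (simp add: transpose_mult[of _ n n _ r] assoc_mult_mat[of _ r n _ n _ r] assoc_mult_mat[of _ n n _ n _ r] assoc_mult_mat[of _ r n _ n _ n])
 then show ?thesis using g u by (simp add: stiefel_def)
qed

lemma orth_group_mult: "g \<in> orth_group n ==> h \<in> orth_group n ==> g * h \<in> orth_group n"
 using orth_mult_stiefel[of g n h n] by (simp add: stiefel_square)

lemma one_orth_group [simp]: "1\<^sub>m n \<in> orth_group n"
 by (simp add: orth_group_def)

lemma orth_cancel [simp]:
 assumes "g \<in> orth_group n" "y \<in> carrier_mat n m"
 shows "g\<^sup>T * (g * y) = y" "g * (g\<^sup>T * y) = y"
 using assms orth_groupD[OF assms(1)] assoc_mult_mat[of "g\<^sup>T" n n g n y m] assoc_mult_mat[of g n n "g\<^sup>T" n y m]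
 by auto

section \<open>Gram determinants under rotation, stacking and right multiplication\<close>

lemma gram_orth:
 assumes "g \<in> orth_group n" "y \<in> carrier_mat n m"
 shows "(g * y)\<^sup>T * (g * y) = y\<^sup>T * y"
 using assms orth_groupD[OF assms(1)]
 by (simp add: transpose_mult[of _ n n _ m] assoc_mult_mat[of _ m n _ n _ m])

lemma gram_append_rows:
 fixes a :: "real mat"
 assumes "a \<in> carrier_mat k m" "b \<in> carrier_mat l m"
 shows "(a @\<^sub>r b)\<^sup>T * (a @\<^sub>r b) = a\<^sup>T * a + b\<^sup>T * b"
 by (subst transpose_append_rows[OF assms], subst append_cols_mult_append_rows[of _ m k _ l _ m]) (use assms in auto)

lemma gram_append_cols:
 fixes a :: "real mat"
 assumes "a \<in> carrier_mat n k" "b \<in> carrier_mat n l"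
 shows "(a @\<^sub>c b)\<^sup>T * (a @\<^sub>c b) = four_block_mat (a\<^sup>T * a) (a\<^sup>T * b) (b\<^sup>T * a) (b\<^sup>T * b)"
 by (subst transpose_append_cols[OF assms], subst append_rows_mult_append_cols[of _ k n _ l _ k _ l]) (use assms in auto)

lemma mat_abs_mult_right:
 assumes "y \<in> carrier_mat n m" "T \<in> carrier_mat m m"
 shows "mat_abs (y * T) = mat_abs y * \<bar>det T\<bar>"
proof -
 have "(y * T)\<^sup>T * (y * T) = T\<^sup>T * ((y\<^sup>T * y) * T)"
  using assms by (simp add: transpose_mult[of _ n m _ m] assoc_mult_mat[of _ m m _ n _ m] assoc_mult_mat[of _ m n _ m _ m])
 moreover have "det (T\<^sup>T * ((y\<^sup>T * y) * T)) = det (y\<^sup>T * y) * (det T)\<^sup>2"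
  using assms det_mult[of "T\<^sup>T" m "(y\<^sup>T * y) * T"] det_mult[of "y\<^sup>T * y" m T] det_transpose[of T m]
  by (simp add: power2_eq_square)
 ultimately show ?thesis by (simp add: mat_abs_def real_sqrt_mult)
qed

lemma mat_abs_orth: "g \<in> orth_group n ==> y \<in> carrier_mat n m ==> mat_abs (g * y) = mat_abs y"
 by (simp add: mat_abs_def gram_orth)

lemma mat_abs_one [simp]: "mat_abs (1\<^sub>m m) = 1"
 by (simp add: mat_abs_def)

lemma mat_abs_square: "T \<in> carrier_mat m m ==> mat_abs T = \<bar>det T\<bar>"
 using mat_abs_mult_right[of "1\<^sub>m m" m m T] by simp

lemma mat_abs_append_zero:
 assumes "T \<in> carrier_mat k m"
 shows "mat_abs (T @\<^sub>r 0\<^sub>m l m) = mat_abs T"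
 using gram_append_rows[OF assms, of "0\<^sub>m l m" l] assms by (simp add: mat_abs_def)

lemma gram_zero_imp_zero:
 fixes y :: "real mat"
 assumes y: "y \<in> carrier_mat n m" and "y\<^sup>T * y = 0\<^sub>m m m"
 shows "y = 0\<^sub>m n m"
proof (rule eq_matI)
 fix i j assume "i < dim_row (0\<^sub>m n m :: real mat)" "j < dim_col (0\<^sub>m n m :: real mat)"
 then have ij: "i < n" "j < m" by auto
 have "(\<Sum>i = 0..<n. y $$ (i, j) * y $$ (i, j)) = (y\<^sup>T * y) $$ (j, j)"
  using y ij by (simp add: scalar_prod_def)
 also have "... = 0" using assms ij by simp
 finally have "\<forall>i\<in>{0..<n}. y $$ (i, j) * y $$ (i, j) = 0"
  by (subst (asm) sum_nonneg_eq_0_iff) auto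
 then show "y $$ (i, j) = 0\<^sub>m n m $$ (i, j)" using ij by simp
qed (use y in auto)

text \<open>Kernel vectors are taken as one-column matrices so that the block identities apply to
  them.\<close>

lemma det_0_iff_kernel:
 fixes A :: "real mat"
 assumes A: "A \<in> carrier_mat m m"
 shows "det A = 0 \<longleftrightarrow> (\<exists>c \<in> carrier_mat m 1. c \<noteq> 0\<^sub>m m 1 \<and> A * c = 0\<^sub>m m 1)"
proof
 assume "det A = 0"
 then obtain v where v: "v \<in> carrier_vec m" "v \<noteq> 0\<^sub>v m" "A *\<^sub>v v = 0\<^sub>v m"
  using det_0_iff_vec_prod_zero_field[OF A] by auto
 let ?c = "mat_of_cols m [v]"
 have "A * ?c = 0\<^sub>m m 1"
 proof (rule eq_matI)
  fix i j assume "i < dim_row (0\<^sub>m m 1 :: real mat)" "j < dim_col (0\<^sub>m m 1 :: real mat)"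
  then have ij: "i < m" "j = 0" by auto
  have "Matrix.row A i \<bullet> v = (A *\<^sub>v v) $ i" using A ij by simp
  also have "... = 0" using v(3) ij by simp
  finally show "(A * ?c) $$ (i, j) = 0\<^sub>m m 1 $$ (i, j)" using A v(1) ij by simp
 qed (use A in auto)
 moreover have "?c \<noteq> 0\<^sub>m m 1"
 proof
  assume 0: "?c = 0\<^sub>m m 1"
  have "v = col ?c 0" using v by simp
  also have "... = 0\<^sub>v m" unfolding 0 by auto
  finally show False using v by simp
 qed
 ultimately show "\<exists>c \<in> carrier_mat m 1. c \<noteq> 0\<^sub>m m 1 \<and> A * c = 0\<^sub>m m 1"
  by (intro bexI[of _ ?c]) auto
next
 assume "\<exists>c \<in> carrier_mat m 1. c \<noteq> 0\<^sub>m m 1 \<and> A * c = 0\<^sub>m m 1"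
 then obtain c where c: "c \<in> carrier_mat m 1" "c \<noteq> 0\<^sub>m m 1" "A * c = 0\<^sub>m m 1" by auto
 have "A *\<^sub>v col c 0 = col (A * c) 0" using A c(1) by simp
 then have "A *\<^sub>v col c 0 = 0\<^sub>v m" using c(3) by auto
 moreover have "col c 0 \<noteq> 0\<^sub>v m"
 proof
  assume 0: "col c 0 = 0\<^sub>v m"
  have "c $$ (i, 0) = 0" if "i < m" for i
   using arg_cong[OF 0, of "\<lambda>v. v $ i"] c(1) that by simp
  then have "c = 0\<^sub>m m 1" using c(1) by (intro eq_matI) auto
  then show False using c(2) by simp
 qed
 ultimately show "det A = 0" using det_0_iff_vec_prod_zero_field[OF A] c(1) by force
qed

text \<open>By \<open>c' y' y c = (y c)' (y c)\<close> the matrices \<open>y\<close> and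
  \<open>y' y\<close> have the same kernel.\<close>

lemma det_gram_0_iff:
 fixes y :: "real mat"
 assumes y: "y \<in> carrier_mat n m"
 shows "det (y\<^sup>T * y) = 0 \<longleftrightarrow> (\<exists>c \<in> carrier_mat m 1. c \<noteq> 0\<^sub>m m 1 \<and> y * c = 0\<^sub>m n 1)"
proof -
 have "y\<^sup>T * y * c = 0\<^sub>m m 1 \<longleftrightarrow> y * c = 0\<^sub>m n 1" if c: "c \<in> carrier_mat m 1" for c
 proof
  assume 0: "y\<^sup>T * y * c = 0\<^sub>m m 1"
  have "(y * c)\<^sup>T * (y * c) = c\<^sup>T * (y\<^sup>T * y * c)"
   using y c by (simp add: transpose_mult[of _ n m _ 1] assoc_mult_mat[of _ 1 m _ n _ 1] assoc_mult_mat[of _ m n _ m _ 1])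
  also have "... = 0\<^sub>m 1 1" unfolding 0 using c by auto
  finally show "y * c = 0\<^sub>m n 1"
   by (rule gram_zero_imp_zero[rotated]) (use y c in auto)
 next
  assume "y * c = 0\<^sub>m n 1"
  then show "y\<^sup>T * y * c = 0\<^sub>m m 1"
   using y c by (simp add: assoc_mult_mat[of _ m n _ m _ 1])
 qed
 moreover have "det (y\<^sup>T * y) = 0 \<longleftrightarrow> (\<exists>c \<in> carrier_mat m 1. c \<noteq> 0\<^sub>m m 1 \<and> y\<^sup>T * y * c = 0\<^sub>m m 1)"
  by (rule det_0_iff_kernel) (use y in auto)
 ultimately show ?thesis by blast
qed

text \<open>Padding \<open>u\<close> with zero rows gives a square matrix \<open>A\<close>; its
  determinant is the \<open>(r, r)\<close> entry of \<open>A * adj_mat A\<close>, which vanishes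
  because row \<open>r\<close> of \<open>A\<close> is zero.\<close>

lemma wide_kernel:
 fixes u :: "real mat"
 assumes u: "u \<in> carrier_mat r n" and "r < n"
 shows "\<exists>v \<in> carrier_mat n 1. v \<noteq> 0\<^sub>m n 1 \<and> u * v = 0\<^sub>m r 1"
proof -
 define l where "l = n - r"
 have n: "n = r + l" and l: "0 < l" using assms by (auto simp: l_def)
 let ?A = "u @\<^sub>r 0\<^sub>m l n"
 have A: "?A \<in> carrier_mat n n" using u unfolding n by auto
 note adj = adj_mat[OF A]
 have "det ?A = (?A * adj_mat ?A) $$ (r, r)" using adj(2) n l by simp
 also have "... = (\<Sum>i = 0..<n. ?A $$ (r, i) * adj_mat ?A $$ (i, r))"
  using A adj(1) n l by (simp add: scalar_prod_def)
 also have "... = 0"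
 proof (rule sum.neutral, rule ballI)
  fix i assume "i \<in> {0..<n}"
  then have "?A $$ (r, i) = 0" using index_append_rows[OF u zero_carrier_mat[of l n], of r i] n l by simp
  then show "?A $$ (r, i) * adj_mat ?A $$ (i, r) = 0" by simp
 qed
 finally obtain v where v: "v \<in> carrier_mat n 1" "v \<noteq> 0\<^sub>m n 1" "?A * v = 0\<^sub>m n 1"
  using det_0_iff_kernel[OF A] by auto
 have "?A * v = (u * v) @\<^sub>r (0\<^sub>m l n * v)" by (rule append_rows_mult) (use u v in auto)
 then have 0: "(u * v) @\<^sub>r (0\<^sub>m l n * v) = 0\<^sub>m n 1" using v by simp
 have "(u * v) $$ (i, 0) = 0" if "i < r" for i
  using arg_cong[OF 0, of "\<lambda>M. M $$ (i, 0)"] that n v u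
   index_append_rows[of "u * v" r 1 "0\<^sub>m l n * v" l i 0] by simp
 then have "u * v = 0\<^sub>m r 1" using u v by (intro eq_matI) auto
 then show ?thesis using v by blast
qed

lemma det_gram_nonzero_dim:
 assumes "y \<in> carrier_mat n m" "det (y\<^sup>T * y) \<noteq> (0::real)"
 shows "m \<le> n"
 using wide_kernel[OF assms(1)] det_gram_0_iff[OF assms(1)] assms(2) by force

section \<open>Gram-Schmidt and the QR decomposition\<close>

definition nrm :: "real mat => real mat" where
 "nrm v = (1 / mat_abs v) \<cdot>\<^sub>m v"

text \<open>Since division by zero yields 0, a vanishing residual gives a zero column. The map is
  therefore measurable and rotation-equivariant on matrices of every rank.\<close>

primrec gs :: "nat => nat => real mat => real mat" where
 "gs n 0 y = 0\<^sub>m n 0"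
| "gs n (Suc m) y =
  (let u = gs n m (mat n m (\<lambda>ij. y $$ ij)); v = mat n 1 (\<lambda>(i, j). y $$ (i, m))
   in u @\<^sub>c nrm (v - u * (u\<^sup>T * v)))"

lemma gs_append_cols:
 assumes "a \<in> carrier_mat n m" "v \<in> carrier_mat n 1"
 shows "gs n (Suc m) (a @\<^sub>c v) = gs n m a @\<^sub>c nrm (v - gs n m a * ((gs n m a)\<^sup>T * v))"
proof -
 have "mat n m (\<lambda>ij. (a @\<^sub>c v) $$ ij) = a"
  by (rule eq_matI) (use assms in "auto simp: index_append_cols[of _ n m _ 1]")
 moreover have "mat n 1 (\<lambda>(i, j). (a @\<^sub>c v) $$ (i, m)) = v"
  by (rule eq_matI) (use assms in "auto simp: index_append_cols[of _ n m _ 1]")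
 ultimately show ?thesis by (simp add: Let_def)
qed

lemma nrm_carrier [simp]: "v \<in> carrier_mat n 1 ==> nrm v \<in> carrier_mat n 1"
 by (simp add: nrm_def)

lemma residual_carrier:
 fixes u :: "real mat"
 assumes "u \<in> carrier_mat n m" "v \<in> carrier_mat n l"
 shows "v - u * (u\<^sup>T * v) \<in> carrier_mat n l"
 using assms by (intro minus_carrier_mat mult_carrier_mat[of _ n m]) auto

lemma gs_carrier [simp]: "gs n m y \<in> carrier_mat n m"
proof (induction m arbitrary: y)
 case (Suc m)
 have "gs n (Suc m) y \<in> carrier_mat n (m + 1)"
  using carrier_append_cols[OF Suc nrm_carrier[OF residual_carrier[OF Suc, of _ 1]]] by (simp add: Let_def)
 then show ?case by (simp only: Suc_eq_plus1)
qed simp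

lemma split_cols_Suc:
 assumes "y \<in> carrier_mat n (Suc m)"
 obtains a v where "a \<in> carrier_mat n m" "v \<in> carrier_mat n 1" "y = a @\<^sub>c v"
 using split_cols[of y n m 1] assms unfolding Suc_eq_plus1 by blast

lemma mult_nrm:
 assumes "g \<in> orth_group n" "v \<in> carrier_mat n 1"
 shows "nrm (g * v) = g * nrm v"
 using assms orth_groupD(1)[OF assms(1)] by (simp add: nrm_def mat_abs_orth[OF assms] mult_smult_distrib[of g n n v 1])

text \<open>The coefficients \<open>u' v\<close> and the length of the residual are unchanged by
  \<open>g\<close>. This equivariance transfers the rotation invariance of a Gaussian matrix to its
  orthonormalization.\<close>

lemma gs_orth_mult:
 assumes "g \<in> orth_group n" "y \<in> carrier_mat n m"
 shows "gs n m (g * y) = g * gs n m y"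
 using assms(2)
proof (induction m arbitrary: y)
 case 0
 then show ?case using orth_groupD(1)[OF assms(1)] by auto
next
 case (Suc m)
 then obtain a v where av: "a \<in> carrier_mat n m" "v \<in> carrier_mat n 1" "y = a @\<^sub>c v"
  by (elim split_cols_Suc)
 note g = orth_groupD[OF assms(1)]
 let ?u = "gs n m a"
 have "gs n (Suc m) (g * y) = gs n (Suc m) ((g * a) @\<^sub>c (g * v))"
  unfolding av(3) using mult_append_cols[OF g(1) av(1,2)] by simp
 also have "... = (g * ?u) @\<^sub>c nrm (g * v - g * ?u * ((g * ?u)\<^sup>T * (g * v)))"
  using Suc.IH[OF av(1)] gs_append_cols[of "g * a" n m "g * v"] av g(1) by simp
 also have "(g * ?u)\<^sup>T * (g * v) = ?u\<^sup>T * v"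
  using orth_cancel(1)[OF assms(1) av(2)] g(1) av(2)
  by (simp add: transpose_mult[of _ n n _ m] assoc_mult_mat[of _ m n _ n _ 1])
 also have "g * v - g * ?u * (?u\<^sup>T * v) = g * (v - ?u * (?u\<^sup>T * v))"
 proof -
  have c: "?u\<^sup>T * v \<in> carrier_mat m 1" using av(2) by (intro mult_carrier_mat[of _ m n]) auto
  show ?thesis
   using mult_minus_distrib_mat[OF g(1) av(2) mult_carrier_mat[OF gs_carrier c]]
    assoc_mult_mat[OF g(1) gs_carrier c] by simp
 qed
 also have "nrm ... = g * nrm (v - ?u * (?u\<^sup>T * v))"
  by (rule mult_nrm[OF assms(1)]) (rule residual_carrier[OF gs_carrier av(2)])
 also have "(g * ?u) @\<^sub>c ... = g * gs n (Suc m) y"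
  unfolding av(3) gs_append_cols[OF av(1,2)]
  by (rule mult_append_cols[symmetric, OF g(1) gs_carrier nrm_carrier[OF residual_carrier[OF gs_carrier av(2)]]])
 finally show ?case .
qed

lemma measurable_gs: "gs n m \<in> borel_mat n m \<rightarrow>\<^sub>M borel_mat n m"
proof (induction m)
 case 0
 show ?case by simp
next
 case (Suc m)
 let ?a = "\<lambda>y. mat n m (\<lambda>ij. y $$ ij) :: real mat" and ?v = "\<lambda>y. mat n 1 (\<lambda>(i, j). y $$ (i, m)) :: real mat"
 have a: "?a \<in> borel_mat n (Suc m) \<rightarrow>\<^sub>M borel_mat n m"
  by (rule measurable_borel_matI2[where h="\<lambda>i j y. y $$ (i, j)"]) (auto intro!: measurable_borel_mat_entry)
 have v: "?v \<in> borel_mat n (Suc m) \<rightarrow>\<^sub>M borel_mat n 1"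
  by (rule measurable_borel_matI2[where h="\<lambda>i j y. y $$ (i, m)"]) (auto intro!: measurable_borel_mat_entry)
 have u: "(\<lambda>y. gs n m (?a y)) \<in> borel_mat n (Suc m) \<rightarrow>\<^sub>M borel_mat n m"
  by (rule mcomp[OF a Suc.IH])
 have w: "(\<lambda>y. ?v y - gs n m (?a y) * ((gs n m (?a y))\<^sup>T * ?v y)) \<in> borel_mat n (Suc m) \<rightarrow>\<^sub>M borel_mat n 1"
  by (intro measurable_mat_minus v measurable_mat_times[where k=m] measurable_mat_times[where k=n] u measurable_mat_transpose)
 have "(\<lambda>y. gs n m (?a y) @\<^sub>c nrm (?v y - gs n m (?a y) * ((gs n m (?a y))\<^sup>T * ?v y))) \<in> borel_mat n (Suc m) \<rightarrow>\<^sub>M borel_mat n (m + 1)"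
  unfolding nrm_def
  by (intro measurable_append_cols u measurable_mat_smult borel_measurable_divide borel_measurable_const measurable_mat_abs[where n=n and m=1] w)
 moreover have "gs n (Suc m) = (\<lambda>y. gs n m (?a y) @\<^sub>c nrm (?v y - gs n m (?a y) * ((gs n m (?a y))\<^sup>T * ?v y)))"
  by (rule ext) (simp add: Let_def)
 ultimately have "gs n (Suc m) \<in> borel_mat n (Suc m) \<rightarrow>\<^sub>M borel_mat n (m + 1)" by simp
 then show ?case by (simp only: Suc_eq_plus1)
qed

lemma mat_abs_col:
 assumes "v \<in> carrier_mat n 1"
 shows "v\<^sup>T * v = (mat_abs v)\<^sup>2 \<cdot>\<^sub>m 1\<^sub>m 1"
proof -
 have c: "v\<^sup>T * v \<in> carrier_mat 1 1" using assms by auto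
 have "(v\<^sup>T * v) $$ (0, 0) = (\<Sum>i = 0..<n. v $$ (i, 0) * v $$ (i, 0))"
  using assms by (simp add: scalar_prod_def)
 also have "... \<ge> 0" by (intro sum_nonneg) auto
 finally have "0 \<le> det (v\<^sup>T * v)" using det_single[OF c] by simp
 then have "(mat_abs v)\<^sup>2 = (v\<^sup>T * v) $$ (0, 0)" using det_single[OF c] by (simp add: mat_abs_def)
 then show ?thesis using c by (intro eq_matI) auto
qed

lemma nrm_unit:
 assumes v: "v \<in> carrier_mat n 1" "v \<noteq> 0\<^sub>m n 1"
 shows "(nrm v)\<^sup>T * nrm v = 1\<^sub>m 1" "mat_abs v \<cdot>\<^sub>m nrm v = v" "mat_abs v \<noteq> 0"
proof -
 show nz: "mat_abs v \<noteq> 0"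
 proof
  assume "mat_abs v = 0"
  then have "v\<^sup>T * v = 0\<^sub>m 1 1" using mat_abs_col[OF v(1)] by auto
  then show False using gram_zero_imp_zero[OF v(1)] v(2) by simp
 qed
 have "(nrm v)\<^sup>T * nrm v = ((1 / mat_abs v) * (1 / mat_abs v)) \<cdot>\<^sub>m (v\<^sup>T * v)"
  using v by (intro eq_matI) (auto simp: nrm_def scalar_prod_def sum_distrib_left ac_simps)
 then show "(nrm v)\<^sup>T * nrm v = 1\<^sub>m 1"
  unfolding mat_abs_col[OF v(1)] using nz by (intro eq_matI) (auto simp: power2_eq_square)
 show "mat_abs v \<cdot>\<^sub>m nrm v = v" using v nz by (intro eq_matI) (auto simp: nrm_def)
qed

lemma stiefel_append_col:
 assumes u: "u \<in> stiefel n r" and e: "e \<in> carrier_mat n 1" "e\<^sup>T * e = 1\<^sub>m 1" "u\<^sup>T * e = 0\<^sub>m r 1"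
 shows "u @\<^sub>c e \<in> stiefel n (Suc r)"
proof -
 have u': "u \<in> carrier_mat n r" "u\<^sup>T * u = 1\<^sub>m r" using u by (auto simp: stiefel_def)
 have "(u\<^sup>T * e)\<^sup>T = e\<^sup>T * u" using transpose_mult[of "u\<^sup>T" r n e 1] u' e by simp
 then have "e\<^sup>T * u = 0\<^sub>m 1 r" using e(3) by simp
 then have "(u @\<^sub>c e)\<^sup>T * (u @\<^sub>c e) = 1\<^sub>m (r + 1)"
  using gram_append_cols[OF u'(1) e(1)] u' e by simp
 then show ?thesis using carrier_append_cols[OF u'(1) e(1)] by (simp add: stiefel_def Suc_eq_plus1)
qed

lemma invertible_inverse:
 fixes R :: "real mat"
 assumes R: "R \<in> carrier_mat m m" "det R \<noteq> 0"
 obtains Q where "Q \<in> carrier_mat m m" "R * Q = 1\<^sub>m m" "Q * R = 1\<^sub>m m"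
proof (rule that)
 note adj = adj_mat[OF R(1)]
 let ?Q = "(1 / det R) \<cdot>\<^sub>m adj_mat R"
 show "?Q \<in> carrier_mat m m" using adj by simp
 show "R * ?Q = 1\<^sub>m m" "?Q * R = 1\<^sub>m m"
  using adj R by (auto simp: mult_smult_distrib[of _ m m _ m] mult_smult_assoc_mat[of _ m m _ m] intro!: eq_matI)
qed

text \<open>The second conjunct says \<open>y = u R\<close> with \<open>R = u' y\<close>.
  Independence of the columns keeps every residual nonzero, and each residual is orthogonal to the
  earlier columns, so the new frame is orthonormal.\<close>

lemma gs_nonsingular:
 assumes "y \<in> carrier_mat n m" "det (y\<^sup>T * y) \<noteq> 0"
 shows "gs n m y \<in> stiefel n m \<and> gs n m y * ((gs n m y)\<^sup>T * y) = y"
 using assms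
proof (induction m arbitrary: y)
 case 0
 then show ?case by (auto simp: stiefel_def intro!: eq_matI)
next
 case (Suc m)
 then obtain a v where av: "a \<in> carrier_mat n m" "v \<in> carrier_mat n 1" "y = a @\<^sub>c v"
  by (elim split_cols_Suc)
 have ker: "c = 0\<^sub>m (m + 1) 1" if "c \<in> carrier_mat (m + 1) 1" "y * c = 0\<^sub>m n 1" for c
  using Suc.prems det_gram_0_iff[OF Suc.prems(1)] that by (auto simp: Suc_eq_plus1)
 have anz: "det (a\<^sup>T * a) \<noteq> 0"
 proof
  assume "det (a\<^sup>T * a) = 0"
  then obtain c where c: "c \<in> carrier_mat m 1" "c \<noteq> 0\<^sub>m m 1" "a * c = 0\<^sub>m n 1"
   using det_gram_0_iff[OF av(1)] by auto
  have "y * (c @\<^sub>r 0\<^sub>m 1 1) = a * c + v * 0\<^sub>m 1 1"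
   unfolding av(3) by (rule append_cols_mult_append_rows) (use av c in auto)
  also have "... = 0\<^sub>m n 1" using c av by simp
  finally have 0: "c @\<^sub>r 0\<^sub>m 1 1 = 0\<^sub>m (m + 1) 1"
   by (intro ker carrier_append_rows c zero_carrier_mat)
  have "c $$ (i, 0) = 0" if "i < m" for i
   using arg_cong[OF 0, of "\<lambda>M. M $$ (i, 0)"] that c index_append_rows[OF c(1), of "0\<^sub>m 1 1" 1 i 0] by simp
  then have "c = 0\<^sub>m m 1" using c(1) by (intro eq_matI) auto
  then show False using c(2) by simp
 qed
 define u where "u = gs n m a"
 define w where "w = v - u * (u\<^sup>T * v)"
 have IH: "u \<in> stiefel n m" "u * (u\<^sup>T * a) = a" using Suc.IH[OF av(1) anz] by (auto simp: u_def)
 have u: "u \<in> carrier_mat n m" "u\<^sup>T * u = 1\<^sub>m m" using IH(1) by (auto simp: stiefel_def)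
 have wc: "w \<in> carrier_mat n 1" unfolding w_def by (rule residual_carrier[OF u(1) av(2)])
 let ?R = "u\<^sup>T * a"
 have R: "?R \<in> carrier_mat m m" using u av by auto
 have uw: "u\<^sup>T * w = 0\<^sub>m m 1"
 proof -
  have "u\<^sup>T * w = u\<^sup>T * v - u\<^sup>T * (u * (u\<^sup>T * v))"
   unfolding w_def by (rule mult_minus_distrib_mat) (use u av in auto)
  also have "u\<^sup>T * (u * (u\<^sup>T * v)) = u\<^sup>T * u * (u\<^sup>T * v)"
   using u(1) av by (intro assoc_mult_mat[symmetric]) auto
  also have "... = u\<^sup>T * v" using u av by simp
  also have "u\<^sup>T * v - u\<^sup>T * v = 0\<^sub>m m 1" using u av by auto
  finally show ?thesis .
 qed
 have vw: "v = u * (u\<^sup>T * v) + w"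
  unfolding w_def using u av by (intro eq_matI) auto
 \<comment> \<open>If the residual vanished, the last column would be \<open>v = a * c\<close> with
   \<open>c = R^(-1) u' v\<close>, and \<open>(c; -1)\<close> would be a nonzero kernel vector of
   \<open>y\<close>.\<close>
 have wnz: "w \<noteq> 0\<^sub>m n 1"
 proof
  assume w0: "w = 0\<^sub>m n 1"
  have vv: "v = u * (u\<^sup>T * v)" using vw u av unfolding w0 by simp
  have "det ?R \<noteq> 0"
  proof
   assume "det ?R = 0"
   then obtain c where c: "c \<in> carrier_mat m 1" "c \<noteq> 0\<^sub>m m 1" "?R * c = 0\<^sub>m m 1"
    using det_0_iff_kernel[OF R] by auto
   have "a * c = u * ?R * c" using IH(2) by simp
   also have "... = u * (?R * c)" by (rule assoc_mult_mat) (use u R c in auto)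
   also have "... = 0\<^sub>m n 1" using c u by simp
   finally show False using anz det_gram_0_iff[OF av(1)] c by auto
  qed
  then obtain Q where Q: "Q \<in> carrier_mat m m" "?R * Q = 1\<^sub>m m"
   using invertible_inverse[OF R] by auto
  let ?c = "Q * (u\<^sup>T * v)"
  have "a * ?c = u * ?R * ?c" using IH(2) by simp
  also have "... = u * (?R * ?c)"
   by (rule assoc_mult_mat[of _ n m _ m _ 1]) (use u R Q(1) av in auto)
  also have "?R * ?c = ?R * Q * (u\<^sup>T * v)"
   by (rule assoc_mult_mat[symmetric, of _ m m _ m _ 1]) (use u R Q(1) av in auto)
  also have "... = u\<^sup>T * v" unfolding Q(2) using u av by simp
  also have "u * (u\<^sup>T * v) = v" using vv by simp
  finally have ac: "a * ?c = v" .
  have cc: "?c \<in> carrier_mat m 1" using Q u av by auto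
  have "y * (?c @\<^sub>r (- 1\<^sub>m 1)) = a * ?c + v * (- 1\<^sub>m 1)"
   unfolding av(3) by (rule append_cols_mult_append_rows) (use av cc in auto)
  also have "... = v - v" unfolding ac using av by (intro eq_matI) (auto simp: scalar_prod_def)
  also have "... = 0\<^sub>m n 1" using av by auto
  finally have 0: "?c @\<^sub>r (- 1\<^sub>m 1) = 0\<^sub>m (m + 1) 1"
   by (intro ker carrier_append_rows) (use cc in auto)
  show False
   using arg_cong[OF 0, of "\<lambda>M. M $$ (m, 0)"] index_append_rows[OF cc, of "- 1\<^sub>m 1" 1 m 0] by simp
 qed
 let ?e = "nrm w"
 note e = nrm_unit[OF wc wnz]
 have ec: "?e \<in> carrier_mat n 1" using wc by simp
 have ue: "u\<^sup>T * ?e = 0\<^sub>m m 1"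
  unfolding nrm_def using uw u wc by (simp add: mult_smult_distrib[of _ m n _ 1])
 have gsy: "gs n (Suc m) y = u @\<^sub>c ?e"
  unfolding av(3) gs_append_cols[OF av(1,2)] w_def u_def ..
 have eu: "?e\<^sup>T * u = 0\<^sub>m 1 m"
  using arg_cong[OF ue, of transpose_mat] u ec by (simp add: transpose_mult[of _ m n _ 1])
 have ea: "?e\<^sup>T * a = 0\<^sub>m 1 m"
 proof -
  have "?e\<^sup>T * a = ?e\<^sup>T * (u * ?R)" using IH(2) by simp
  also have "... = ?e\<^sup>T * u * ?R" by (rule assoc_mult_mat[symmetric]) (use ec u R in auto)
  finally show ?thesis using eu left_mult_zero_mat[OF R, of 1] by simp
 qed
 \<comment> \<open>The unit vector \<open>nrm w\<close> is orthogonal to \<open>u\<close>, so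
   projecting \<open>v = u u' v + w\<close> on it returns exactly \<open>w\<close>.\<close>
 have ev: "?e * (?e\<^sup>T * v) = w"
 proof -
  have "?e\<^sup>T * v = ?e\<^sup>T * (u * (u\<^sup>T * v)) + ?e\<^sup>T * w"
   by (subst vw, rule mult_add_distrib_mat[of _ 1 n _ 1]) (use ec u av wc in auto)
  also have "?e\<^sup>T * (u * (u\<^sup>T * v)) = ?e\<^sup>T * u * (u\<^sup>T * v)"
   by (rule assoc_mult_mat[symmetric, of _ 1 n _ m _ 1]) (use ec u av in auto)
  also have "... = 0\<^sub>m 1 1" unfolding eu using u av by simp
  also have "?e\<^sup>T * w = mat_abs w \<cdot>\<^sub>m 1\<^sub>m 1"
   by (subst e(2)[symmetric], subst mult_smult_distrib[of _ 1 n _ 1]) (use ec e(1) in auto)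
  finally have "?e\<^sup>T * v = mat_abs w \<cdot>\<^sub>m 1\<^sub>m 1" by simp
  then have "?e * (?e\<^sup>T * v) = mat_abs w \<cdot>\<^sub>m ?e"
   using ec by (simp add: mult_smult_distrib[of _ n 1 _ 1])
  then show ?thesis using e(2) by simp
 qed
 have "(u @\<^sub>c ?e) * ((u @\<^sub>c ?e)\<^sup>T * y) = a @\<^sub>c v"
 proof -
  have "(u @\<^sub>c ?e)\<^sup>T * y = four_block_mat ?R (u\<^sup>T * v) (0\<^sub>m 1 m) (?e\<^sup>T * v)"
   unfolding av(3) transpose_append_cols[OF u(1) ec]
   by (subst append_rows_mult_append_cols[of _ m n _ 1 _ m _ 1]) (use u ec av ea in auto)
  also have "... = (?R @\<^sub>r 0\<^sub>m 1 m) @\<^sub>c ((u\<^sup>T * v) @\<^sub>r (?e\<^sup>T * v))"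
   using u ec av R by (intro eq_matI) (auto simp: append_cols_def append_rows_def)
  finally have "(u @\<^sub>c ?e) * ((u @\<^sub>c ?e)\<^sup>T * y) =
    ((u @\<^sub>c ?e) * (?R @\<^sub>r 0\<^sub>m 1 m)) @\<^sub>c ((u @\<^sub>c ?e) * ((u\<^sup>T * v) @\<^sub>r (?e\<^sup>T * v)))"
   using mult_append_cols[of "u @\<^sub>c ?e" n "m + 1" "?R @\<^sub>r 0\<^sub>m 1 m" m "(u\<^sup>T * v) @\<^sub>r (?e\<^sup>T * v)" 1]
    carrier_append_cols[OF u(1) ec] carrier_append_rows[OF R, of "0\<^sub>m 1 m" 1]
    carrier_append_rows[of "u\<^sup>T * v" m 1 "?e\<^sup>T * v" 1] u ec av by auto
  also have "(u @\<^sub>c ?e) * (?R @\<^sub>r 0\<^sub>m 1 m) = u * ?R + ?e * 0\<^sub>m 1 m"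
   by (rule append_cols_mult_append_rows) (use u ec R in auto)
  also have "... = a" using IH(2) ec av by simp
  also have "(u @\<^sub>c ?e) * ((u\<^sup>T * v) @\<^sub>r (?e\<^sup>T * v)) = u * (u\<^sup>T * v) + ?e * (?e\<^sup>T * v)"
   by (rule append_cols_mult_append_rows) (use u ec av in auto)
  also have "... = v" using vw ev by simp
  finally show ?thesis .
 qed
 then show ?case unfolding gsy using stiefel_append_col[OF IH(1) ec e(1) ue] av(3) by simp
qed

text \<open>While columns are missing, \<open>u'\<close> has more columns than rows, hence a nonzero
  kernel vector; normalized, it extends the frame.\<close>

lemma orth_completion:
 assumes "u \<in> stiefel (r + l) r"
 shows "\<exists>b \<in> carrier_mat (r + l) l. u @\<^sub>c b \<in> orth_group (r + l)"
 using assms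
proof (induction l arbitrary: r u)
 case 0
 then have "u @\<^sub>c 0\<^sub>m (r + 0) 0 = u"
  by (intro eq_matI) (auto simp: append_cols_def stiefel_def)
 then show ?case using 0 by (intro bexI[of _ "0\<^sub>m (r + 0) 0"]) (auto simp: stiefel_square)
next
 case (Suc l)
 let ?n = "r + Suc l"
 have u: "u \<in> carrier_mat ?n r" using Suc.prems by (auto simp: stiefel_def)
 obtain v where v: "v \<in> carrier_mat ?n 1" "v \<noteq> 0\<^sub>m ?n 1" "u\<^sup>T * v = 0\<^sub>m r 1"
  using wide_kernel[of "u\<^sup>T" r ?n] u by auto
 note e = nrm_unit[OF v(1,2)]
 have ec: "nrm v \<in> carrier_mat ?n 1" using v(1) by (rule nrm_carrier)
 have "u\<^sup>T * nrm v = 0\<^sub>m r 1"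
  unfolding nrm_def using u v by (simp add: mult_smult_distrib[of _ r ?n _ 1])
 then have "u @\<^sub>c nrm v \<in> stiefel ?n (Suc r)"
  using stiefel_append_col[OF Suc.prems ec e(1)] by blast
 then have "\<exists>b \<in> carrier_mat (Suc r + l) l. (u @\<^sub>c nrm v) @\<^sub>c b \<in> orth_group (Suc r + l)"
  by (intro Suc.IH) simp
 then obtain b where b: "b \<in> carrier_mat ?n l" "(u @\<^sub>c nrm v) @\<^sub>c b \<in> orth_group ?n" by auto
 have "(u @\<^sub>c nrm v) @\<^sub>c b = u @\<^sub>c (nrm v @\<^sub>c b)"
  using u ec b by (intro eq_matI) (auto simp: append_cols_def)
 moreover have "nrm v @\<^sub>c b \<in> carrier_mat ?n (Suc l)" using carrier_append_cols[OF ec b(1)] by (simp add: Suc_eq_plus1_left)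
 ultimately show ?case using b by (intro bexI[of _ "nrm v @\<^sub>c b"]) auto
qed

text \<open>The Gram-Schmidt frame \<open>u\<close>, completed to an orthogonal \<open>g\<close>,
  consists of the first \<open>m\<close> columns of \<open>g\<close>, and \<open>T = u' y\<close>.
  This reduces questions about tall matrices of full rank to square ones.\<close>

lemma QR_decomposition:
 assumes y: "y \<in> carrier_mat (m + l) m" and nz: "det (y\<^sup>T * y) \<noteq> 0"
 obtains g T where "g \<in> orth_group (m + l)" "T \<in> carrier_mat m m" "det T \<noteq> 0"
  "y = g * (T @\<^sub>r 0\<^sub>m l m)" "mat_abs y = \<bar>det T\<bar>"
proof -
 define u where "u = gs (m + l) m y"
 have u: "u \<in> stiefel (m + l) m" "u * (u\<^sup>T * y) = y"
  using gs_nonsingular[OF y nz] by (auto simp: u_def)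
 have uc: "u \<in> carrier_mat (m + l) m" using u by (simp add: stiefel_def)
 obtain b where b: "b \<in> carrier_mat (m + l) l" "u @\<^sub>c b \<in> orth_group (m + l)"
  using orth_completion[OF u(1)] by auto
 let ?T = "u\<^sup>T * y"
 have T: "?T \<in> carrier_mat m m" using uc y by auto
 have eq: "y = (u @\<^sub>c b) * (?T @\<^sub>r 0\<^sub>m l m)"
  using append_cols_mult_append_rows[OF uc b(1) T, of "0\<^sub>m l m"] u(2) b(1) y by simp
 have "mat_abs y = mat_abs ((u @\<^sub>c b) * (?T @\<^sub>r 0\<^sub>m l m))" using eq by simp
 also have "... = mat_abs (?T @\<^sub>r 0\<^sub>m l m)"
  by (rule mat_abs_orth[OF b(2), of _ m]) (use T in auto)
 also have "... = \<bar>det ?T\<bar>" using mat_abs_append_zero[OF T] mat_abs_square[OF T] by simp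
 finally have ab: "mat_abs y = \<bar>det ?T\<bar>" .
 moreover have "det ?T \<noteq> 0"
  using nz ab by (simp add: mat_abs_def) (metis abs_0_eq real_sqrt_eq_zero_cancel_iff)
 ultimately show ?thesis using that[OF b(2) T _ eq] by blast
qed

text \<open>Real \<open>sqrt\<close> preserves signs, also of negative arguments, so
  \<open>mat_abs y = \<bar>det T\<bar> > 0\<close> already forces a positive Gram
  determinant.\<close>

lemma det_gram_nonneg:
 assumes y: "y \<in> carrier_mat n m"
 shows "0 \<le> det (y\<^sup>T * y :: real mat)"
proof (cases "det (y\<^sup>T * y) = 0")
 case False
 define l where "l = n - m"
 have n: "n = m + l" using det_gram_nonzero_dim[OF y False] by (simp add: l_def)
 obtain g T where "mat_abs y = \<bar>det T\<bar>" "det T \<noteq> (0::real)"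
  using QR_decomposition[OF y[unfolded n] False] by metis
 then have "0 < mat_abs y" by simp
 then show ?thesis by (simp add: mat_abs_def)
qed simp

lemma mat_abs_nonneg: "y \<in> carrier_mat n m ==> 0 \<le> mat_abs y"
 using det_gram_nonneg by (simp add: mat_abs_def)

lemma mat_abs_0_iff: "mat_abs y = 0 \<longleftrightarrow> det (y\<^sup>T * y) = 0"
 by (simp add: mat_abs_def)

lemma mat_abs_four_block:
 assumes T: "T \<in> carrier_mat r r" and a: "a \<in> carrier_mat r q" and b: "b \<in> carrier_mat p q"
 shows "mat_abs (four_block_mat T a (0\<^sub>m p r) b) = \<bar>det T\<bar> * mat_abs b"
proof -
 let ?B = "four_block_mat (1\<^sub>m r) (0\<^sub>m r q) (0\<^sub>m p r) b" and ?T = "four_block_mat T a (0\<^sub>m q r) (1\<^sub>m q)"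
 have B: "?B \<in> carrier_mat (r + p) (r + q)" and T': "?T \<in> carrier_mat (r + q) (r + q)"
  using T b by auto
 have "four_block_mat T a (0\<^sub>m p r) b = ?B * ?T"
  by (subst mult_four_block_mat[of _ r r _ q _ p _ _ r _ q]) (use T a b in auto)
 then have "mat_abs (four_block_mat T a (0\<^sub>m p r) b) = mat_abs ?B * \<bar>det ?T\<bar>"
  using mat_abs_mult_right[OF B T'] by simp
 moreover have "det ?T = det T"
  using det_four_block_mat_lower_left_zero[OF T a refl one_carrier_mat] by simp
 moreover have "?B\<^sup>T * ?B = four_block_mat (1\<^sub>m r) (0\<^sub>m r q) (0\<^sub>m q r) (b\<^sup>T * b)"
  by (subst transpose_four_block_mat[of _ r r _ q _ p], use b in auto,
    subst mult_four_block_mat[of _ r r _ p _ q _ _ r _ q], use b in auto)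
 then have "det (?B\<^sup>T * ?B) = det (b\<^sup>T * b)"
  using det_four_block_mat_lower_left_zero[of "1\<^sub>m r" r "0\<^sub>m r q" q "0\<^sub>m q r" "b\<^sup>T * b"] b by simp
 then have "mat_abs ?B = mat_abs b" by (simp add: mat_abs_def)
 ultimately show ?thesis by simp
qed

text \<open>Removing \<open>g\<close> leaves a block-triangular matrix: new columns multiply the
  volume by that of their component orthogonal to the columns of the first block. Integrating powers
  of \<open>mat_abs\<close> column by column rests on this.\<close>

lemma mat_abs_append_cols:
 assumes g: "g \<in> orth_group (r + p)" and T: "T \<in> carrier_mat r r"
  and a: "a \<in> carrier_mat r q" and b: "b \<in> carrier_mat p q"
 shows "mat_abs ((g * (T @\<^sub>r 0\<^sub>m p r)) @\<^sub>c (g * (a @\<^sub>r b))) = \<bar>det T\<bar> * mat_abs b"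
proof -
 have "(g * (T @\<^sub>r 0\<^sub>m p r)) @\<^sub>c (g * (a @\<^sub>r b)) = g * ((T @\<^sub>r 0\<^sub>m p r) @\<^sub>c (a @\<^sub>r b))"
  by (rule mult_append_cols[symmetric, OF orth_groupD(1)[OF g]]) (use T a b in auto)
 also have "mat_abs ... = mat_abs ((T @\<^sub>r 0\<^sub>m p r) @\<^sub>c (a @\<^sub>r b))"
  by (rule mat_abs_orth[OF g, of _ "r + q"]) (use T a b in auto)
 also have "(T @\<^sub>r 0\<^sub>m p r) @\<^sub>c (a @\<^sub>r b) = four_block_mat T a (0\<^sub>m p r) b"
  using T a b by (intro eq_matI) (auto simp: append_cols_def append_rows_def)
 finally show ?thesis using mat_abs_four_block[OF T a b] by simp
qed

section \<open>The squared Frobenius norm and the Gaussian weight\<close>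

definition sqn :: "real mat => real" where
 "sqn y = (\<Sum>j<dim_col y. \<Sum>i<dim_row y. (y $$ (i, j))\<^sup>2)"

abbreviation egauss :: "real mat => ennreal" where
 "egauss y \<equiv> ennreal (exp (- sqn y))"

lemma sqn_eq: "y \<in> carrier_mat n m ==> sqn y = (\<Sum>j<m. \<Sum>i<n. (y $$ (i, j))\<^sup>2)"
 by (simp add: sqn_def)

text \<open>As the trace of \<open>y' y\<close>, the squared norm inherits invariance and additivity
  from the Gram matrix.\<close>

lemma sqn_gram: "y \<in> carrier_mat n m ==> sqn y = (\<Sum>j<m. (y\<^sup>T * y) $$ (j, j))"
 by (auto simp: sqn_def scalar_prod_def power2_eq_square lessThan_atLeast0 intro!: sum.cong)

lemma sqn_nonneg [simp]: "0 \<le> sqn y"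
 by (simp add: sqn_def sum_nonneg)

lemma sqn_orth: "g \<in> orth_group n ==> y \<in> carrier_mat n m ==> sqn (g * y) = sqn y"
 using gram_orth[of g n y m] orth_groupD(1)[of g n] by (simp add: sqn_gram[of _ n m])

lemma sqn_transpose: "sqn (y\<^sup>T) = sqn y"
 unfolding sqn_def by (subst sum.swap) (auto intro!: sum.cong)

lemma sqn_append_rows:
 assumes "a \<in> carrier_mat k m" "b \<in> carrier_mat l m"
 shows "sqn (a @\<^sub>r b) = sqn a + sqn b"
proof -
 have ab: "a @\<^sub>r b \<in> carrier_mat (k + l) m" using assms by auto
 have "sqn (a @\<^sub>r b) = (\<Sum>j<m. (a\<^sup>T * a + b\<^sup>T * b) $$ (j, j))"
  using sqn_gram[OF ab] gram_append_rows[OF assms] by simp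
 also have "... = (\<Sum>j<m. (a\<^sup>T * a) $$ (j, j) + (b\<^sup>T * b) $$ (j, j))"
  using assms by (intro sum.cong) auto
 finally show ?thesis using assms by (simp add: sum.distrib sqn_gram[of a k m] sqn_gram[of b l m])
qed

lemma sqn_append_cols:
 assumes "a \<in> carrier_mat n k" "b \<in> carrier_mat n l"
 shows "sqn (a @\<^sub>c b) = sqn a + sqn b"
 using sqn_append_rows[of "a\<^sup>T" k n "b\<^sup>T" l] transpose_append_cols[OF assms] assms sqn_transpose
 by (metis transpose_carrier_mat)

lemma sqn_zero [simp]: "sqn (0\<^sub>m n m) = 0"
 by (simp add: sqn_def)

lemma measurable_sqn:
 assumes f: "f \<in> M \<rightarrow>\<^sub>M borel_mat n m"
 shows "(\<lambda>x. sqn (f x)) \<in> borel_measurable M"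
proof -
 have "(\<lambda>x. \<Sum>j<m. \<Sum>i<n. (f x $$ (i, j))\<^sup>2) \<in> borel_measurable M"
  by (intro borel_measurable_sum borel_measurable_power measurable_mat_entry[OF f]) auto
 moreover have "sqn (f x) = (\<Sum>j<m. \<Sum>i<n. (f x $$ (i, j))\<^sup>2)" if "x \<in> space M" for x
  by (rule sqn_eq[OF measurable_mat_carrier[OF f that]])
 ultimately show ?thesis by (subst measurable_cong) auto
qed

section \<open>Gaussian measures and invariant measures\<close>

lemma carrier_mat_sets [simp]: "carrier_mat n m \<in> sets (borel_mat n m)"
 using sets.top[of "borel_mat n m"] by simp

lemma measurable_mat_abs_id: "mat_abs \<in> borel_fun n m"
 using measurable_mat_abs[of "\<lambda>x. x" "borel_mat n m" n m] by simp

lemma sets_singular: "{y \<in> carrier_mat n m. mat_abs y = 0} \<in> sets (borel_mat n m)"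
proof -
 have "mat_abs -` {0} \<inter> space (borel_mat n m) \<in> sets (borel_mat n m)"
  by (rule measurable_sets[OF measurable_mat_abs_id]) simp
 moreover have "mat_abs -` {0} \<inter> space (borel_mat n m) = {y \<in> carrier_mat n m. mat_abs y = 0}" by auto
 ultimately show ?thesis by simp
qed

lemma QR_nonsingular:
 assumes "y \<in> carrier_mat (m + p) m" "mat_abs y \<noteq> 0"
 shows "\<exists>g T. g \<in> orth_group (m + p) \<and> T \<in> carrier_mat m m \<and> det T \<noteq> 0 \<and>
  y = g * (T @\<^sub>r 0\<^sub>m p m) \<and> mat_abs y = \<bar>det T\<bar>"
proof -
 have "det (y\<^sup>T * y) \<noteq> 0" using assms(2) by (simp add: mat_abs_0_iff)
 from QR_decomposition[OF assms(1) this] show ?thesis by metis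
qed

lemma nn_integral_lmat_orth:
 assumes g: "g \<in> orth_group n" and F: "F \<in> borel_fun n m"
 shows "(\<integral>\<^sup>+y. F (g * y) \<partial>lmat n m) = (\<integral>\<^sup>+y. F y \<partial>lmat n m)"
 using nn_integral_lmat_mult_left[OF orth_groupD(1,5)[OF g] F] orth_groupD(4)[OF g] by simp

lemma distr_lmat_orth:
 assumes g: "g \<in> orth_group n"
 shows "distr (lmat n m) (borel_mat n m) (\<lambda>y. g * y) = lmat n m"
proof (rule measure_eqI)
 fix A assume "A \<in> sets (distr (lmat n m) (borel_mat n m) (\<lambda>y. g * y))"
 then have A: "A \<in> sets (borel_mat n m)" by simp
 have gm: "(\<lambda>y. g * y) \<in> lmat n m \<rightarrow>\<^sub>M borel_mat n m"
  using measurable_mat_mult_left[OF measurable_id_borel_mat(2) orth_groupD(1)[OF g]] by simp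
 have "emeasure (distr (lmat n m) (borel_mat n m) (\<lambda>y. g * y)) A = (\<integral>\<^sup>+y. indicator A y \<partial>distr (lmat n m) (borel_mat n m) (\<lambda>y. g * y))"
  using A by simp
 also have "... = (\<integral>\<^sup>+y. indicator A (g * y) \<partial>lmat n m)"
  by (rule nn_integral_distr[OF gm]) (use A in simp)
 also have "... = (\<integral>\<^sup>+y. indicator A y \<partial>lmat n m)"
  by (rule nn_integral_lmat_orth[OF g]) (use A in simp)
 finally show "emeasure (distr (lmat n m) (borel_mat n m) (\<lambda>y. g * y)) A = emeasure (lmat n m) A"
  using A by simp
qed simp

text \<open>Applied with \<open>g\<close> from a QR decomposition of \<open>a\<close>, the
  coordinates \<open>b1\<close> and \<open>b2\<close> separate the directions along the column span
  of \<open>a\<close> from the orthogonal ones.\<close>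

lemma nn_integral_lmat_fibre:
 assumes g: "g \<in> orth_group (r + p)" and a: "a \<in> carrier_mat (r + p) k" and F: "F \<in> borel_fun (r + p) (k + q)"
 shows "(\<integral>\<^sup>+b. F (a @\<^sub>c b) \<partial>lmat (r + p) q) =
  (\<integral>\<^sup>+b1. \<integral>\<^sup>+b2. F (a @\<^sub>c (g * (b1 @\<^sub>r b2))) \<partial>lmat p q \<partial>lmat r q)"
proof -
 have F1: "(\<lambda>b. F (a @\<^sub>c b)) \<in> borel_fun (r + p) q"
  by (rule mcomp[OF measurable_append_cols F]) (use a in auto)
 have F2: "(\<lambda>b. F (a @\<^sub>c (g * b))) \<in> borel_fun (r + p) q"
  by (rule measurable_mat_mult_left[OF F1 orth_groupD(1)[OF g]])
 show ?thesis
  using nn_integral_lmat_orth[OF g F1] nn_integral_lmat_rows(1)[OF F2] by simp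
qed

lemma distr_lmat_11: "distr (lmat 1 1) borel (\<lambda>y. y $$ (0, 0)) = lborel"
proof (rule measure_eqI)
 fix A assume "A \<in> sets (distr (lmat 1 1) borel (\<lambda>y. y $$ (0, 0)))"
 then have A: "A \<in> sets borel" by simp
 have m: "(\<lambda>y. y $$ (0, 0)) \<in> lmat 1 1 \<rightarrow>\<^sub>M borel" by (simp add: measurable_borel_mat_entry)
 have "emeasure (distr (lmat 1 1) borel (\<lambda>y. y $$ (0, 0))) A = emeasure (lmat 1 1) ((\<lambda>y. y $$ (0, 0)) -` A \<inter> space (lmat 1 1))"
  by (rule emeasure_distr[OF m A])
 also have "(\<lambda>y. y $$ (0, 0)) -` A \<inter> space (lmat 1 1) = {y \<in> carrier_mat 1 1. \<forall>i<1. \<forall>j<1. y $$ (i, j) \<in> A}"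
  by auto
 also have "emeasure (lmat 1 1) ... = emeasure lborel A"
  by (subst emeasure_lmat_box[where E="\<lambda>_ _. A"]) (use A in "auto simp: One_nat_def")
 finally show "emeasure (distr (lmat 1 1) borel (\<lambda>y. y $$ (0, 0))) A = emeasure lborel A" .
qed simp

lemma nn_integral_lmat_11:
 assumes F: "F \<in> borel_measurable borel"
 shows "(\<integral>\<^sup>+y. F (y $$ (0, 0)) \<partial>lmat 1 1) = (\<integral>\<^sup>+x. F x \<partial>lborel)"
 unfolding distr_lmat_11[symmetric]
 by (rule nn_integral_distr[symmetric]) (use F in "auto simp: measurable_borel_mat_entry")

lemma sqn_11: "y \<in> carrier_mat 1 1 ==> sqn y = (y $$ (0, 0))\<^sup>2"
 by (simp add: sqn_def One_nat_def)

lemma nn_integral_gauss_real: "(\<integral>\<^sup>+x. ennreal (exp (- x\<^sup>2)) \<partial>lborel) = ennreal (sqrt pi)"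
proof -
 \<comment> \<open>The normal density of variance 1/2 has exponent \<open>- x^2\<close> and
   normalizing factor \<open>1 / sqrt pi\<close>.\<close>
 have eq: "ennreal (exp (- x\<^sup>2)) = ennreal (sqrt pi) * ennreal (normal_density 0 (1 / sqrt 2) x)" for x :: real
  by (subst ennreal_mult[symmetric])
   (auto simp: normal_density_def power_divide real_sqrt_mult[symmetric] intro!: arg_cong[where f=ennreal])
 have "(\<integral>\<^sup>+x. ennreal (normal_density 0 (1 / sqrt 2) x) \<partial>lborel) = 1"
  using prob_space.emeasure_space_1[OF prob_space_normal_density[of "1 / sqrt 2" 0]]
  by (simp add: emeasure_density)
 then show ?thesis unfolding eq by (subst nn_integral_cmult) auto
qed

lemma measurable_exp_sqn_real [measurable, simp]: "(\<lambda>y. exp (- sqn y)) \<in> borel_fun n m"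
 by (intro mcomp[OF _ borel_measurable_exp] borel_measurable_uminus measurable_sqn[where n=n and m=m]) simp

lemma measurable_exp_sqn: "(\<lambda>y. egauss y) \<in> borel_fun n m"
 by (intro mcomp[OF _ measurable_ennreal] mcomp[OF _ borel_measurable_exp]
   borel_measurable_uminus measurable_sqn[where n=n and m=m]) simp

lemma nn_integral_gauss:
 "(\<integral>\<^sup>+y. egauss y \<partial>lmat n m) = ennreal (sqrt pi ^ (n * m))"
proof -
 have one: "(\<integral>\<^sup>+y. egauss y \<partial>lmat 1 m) = ennreal (sqrt pi ^ m)" for m
 proof (induction m)
  case 0
  show ?case by (subst nn_integral_lmat_0) auto
 next
  case (Suc m)
  have "(\<integral>\<^sup>+y. egauss y \<partial>lmat 1 (m + 1)) =
   (\<integral>\<^sup>+a. \<integral>\<^sup>+b. egauss a * egauss b \<partial>lmat 1 1 \<partial>lmat 1 m)"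
   by (subst nn_integral_lmat_cols(1)[OF measurable_exp_sqn], intro nn_integral_cong)
    (simp add: sqn_append_cols[of _ 1 m _ 1] exp_diff exp_minus ennreal_mult[symmetric] field_simps)
  also have "... = (\<integral>\<^sup>+a. egauss a * ennreal (sqrt pi) \<partial>lmat 1 m)"
  proof (intro nn_integral_cong)
   fix a
   have "(\<integral>\<^sup>+b. egauss b \<partial>lmat 1 1) = (\<integral>\<^sup>+b. (\<lambda>x. ennreal (exp (- x\<^sup>2))) (b $$ (0, 0)) \<partial>lmat 1 1)"
    by (rule nn_integral_cong) (simp add: sqn_11)
   also have "... = ennreal (sqrt pi)"
    by (subst nn_integral_lmat_11) (auto simp: nn_integral_gauss_real)
   finally show "(\<integral>\<^sup>+b. egauss a * egauss b \<partial>lmat 1 1) =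
     egauss a * ennreal (sqrt pi)"
    by (subst nn_integral_cmult) auto
  qed
  also have "... = ennreal (sqrt pi ^ Suc m)"
   by (subst nn_integral_multc) (auto simp: Suc ennreal_mult[symmetric] mult.commute)
  finally show ?case by (simp add: Suc_eq_plus1)
 qed
 show ?thesis
 proof (induction n)
  case 0
  show ?case by (subst nn_integral_lmat_0) auto
 next
  case (Suc n)
  have "(\<integral>\<^sup>+y. egauss y \<partial>lmat (n + 1) m) =
   (\<integral>\<^sup>+a. \<integral>\<^sup>+b. egauss a * egauss b \<partial>lmat 1 m \<partial>lmat n m)"
   by (subst nn_integral_lmat_rows(1)[OF measurable_exp_sqn], intro nn_integral_cong)
    (simp add: sqn_append_rows[of _ n m _ 1] exp_diff exp_minus ennreal_mult[symmetric] field_simps)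
  also have "... = (\<integral>\<^sup>+a. egauss a * ennreal (sqrt pi ^ m) \<partial>lmat n m)"
   by (intro nn_integral_cong) (simp add: nn_integral_cmult one)
  also have "... = ennreal (sqrt pi ^ (Suc n * m))"
   by (subst nn_integral_multc) (auto simp: Suc ennreal_mult[symmetric] power_add mult.commute)
  finally show ?case by (simp add: Suc_eq_plus1)
 qed
qed

text \<open>Given \<open>m\<close> independent columns, one more column makes the matrix singular
  only if its component in the orthogonal complement, of dimension \<open>n - m > 0\<close>, is
  zero; in each fibre that is a null set.\<close>

lemma AE_nonsingular:
 assumes "m \<le> n"
 shows "AE y in lmat n m. mat_abs y \<noteq> 0"
 using assms
proof (induction m)
 case 0
 have "mat_abs y \<noteq> 0" if "y \<in> carrier_mat n 0" for y :: "real mat"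
 proof -
  have "y\<^sup>T * y \<in> carrier_mat 0 0" using that by auto
  then show ?thesis by (simp add: mat_abs_def)
 qed
 then show ?case by (intro AE_I2) simp
next
 case (Suc m)
 define p where "p = n - m"
 have n: "n = m + p" and p: "0 < p" using Suc.prems by (auto simp: p_def)
 let ?Z = "\<lambda>n m. {y \<in> carrier_mat n m. mat_abs y = 0}"
 note Z = sets_singular
 let ?F = "indicator (?Z n (m + 1)) :: real mat => ennreal"
 have F: "?F \<in> borel_fun n (m + 1)" using Z by simp
 have zero1: "emeasure (lmat p 1) (?Z p 1) = 0"
 proof -
  have "emeasure (lmat p 1) (?Z p 1) \<le> emeasure (lmat p 1) {y \<in> carrier_mat p 1. \<forall>i<p. \<forall>j<1. y $$ (i, j) \<in> {0}}"
  proof (rule emeasure_mono)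
   show "?Z p 1 \<subseteq> {y \<in> carrier_mat p 1. \<forall>i<p. \<forall>j<1. y $$ (i, j) \<in> {0}}"
   proof
    fix y assume "y \<in> ?Z p 1"
    then have "y = 0\<^sub>m p 1" using nrm_unit(3)[of y p] by blast
    then show "y \<in> {y \<in> carrier_mat p 1. \<forall>i<p. \<forall>j<1. y $$ (i, j) \<in> {0}}" by simp
   qed
   show "{y \<in> carrier_mat p 1. \<forall>i<p. \<forall>j<1. y $$ (i, j) \<in> {0}} \<in> sets (lmat p 1)"
    unfolding sets_lmat by (rule sets_mat_box) (rule borel_closed, rule closed_singleton)
  qed
  also have "... = (\<Prod>i<p. \<Prod>j<(1::nat). emeasure lborel {0::real})"
   by (rule emeasure_lmat_box[where E="\<lambda>_ _. {0}"]) (rule borel_closed, rule closed_singleton)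
  also have "... = 0" using p by (simp add: One_nat_def)
  finally show ?thesis by simp
 qed
 have "emeasure (lmat n (m + 1)) (?Z n (m + 1)) = (\<integral>\<^sup>+y. ?F y \<partial>lmat n (m + 1))"
  using Z by simp
 also have "... = (\<integral>\<^sup>+a. \<integral>\<^sup>+b. ?F (a @\<^sub>c b) \<partial>lmat n 1 \<partial>lmat n m)"
  by (rule nn_integral_lmat_cols(1)[OF F])
 also have "... = (\<integral>\<^sup>+a. 0 \<partial>lmat n m)"
 proof (rule nn_integral_cong_AE)
  have ae: "AE a in lmat n m. mat_abs a \<noteq> 0" using Suc by simp
  have zz: "(\<integral>\<^sup>+b. ?F (a @\<^sub>c b) \<partial>lmat n 1) = 0" if a: "a \<in> carrier_mat n m" "mat_abs a \<noteq> 0" for a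
  proof -
   obtain g T where gT: "g \<in> orth_group (m + p)" "T \<in> carrier_mat m m" "det T \<noteq> 0" "a = g * (T @\<^sub>r 0\<^sub>m p m)"
    using QR_nonsingular[of a m p] a unfolding n by blast
   have "(\<integral>\<^sup>+b. ?F (a @\<^sub>c b) \<partial>lmat n 1) = (\<integral>\<^sup>+b1. \<integral>\<^sup>+b2. ?F (a @\<^sub>c (g * (b1 @\<^sub>r b2))) \<partial>lmat p 1 \<partial>lmat m 1)"
    using nn_integral_lmat_fibre[OF gT(1), of a m ?F 1] F a n by simp
   also have "... = (\<integral>\<^sup>+b1. \<integral>\<^sup>+b2. indicator (?Z p 1) b2 \<partial>lmat p 1 \<partial>lmat m 1)"
   proof (intro nn_integral_cong)
    fix b1 b2 assume "b1 \<in> space (lmat m 1)" "b2 \<in> space (lmat p 1)"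
    then have b: "b1 \<in> carrier_mat m 1" "b2 \<in> carrier_mat p 1" by auto
    have "mat_abs (a @\<^sub>c (g * (b1 @\<^sub>r b2))) = \<bar>det T\<bar> * mat_abs b2"
     unfolding gT(4) by (rule mat_abs_append_cols[OF gT(1,2) b])
    moreover have "a @\<^sub>c (g * (b1 @\<^sub>r b2)) \<in> carrier_mat n (m + 1)"
     using a(1) b orth_groupD(1)[OF gT(1)] n by auto
    ultimately show "?F (a @\<^sub>c (g * (b1 @\<^sub>r b2))) = indicator (?Z p 1) b2"
     using b gT(3) by (auto simp: indicator_def)
   qed
   also have "... = 0" using Z[of p 1] zero1 by simp
   finally show ?thesis .
  qed
  show "AE a in lmat n m. (\<integral>\<^sup>+b. ?F (a @\<^sub>c b) \<partial>lmat n 1) = 0"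
   by (rule AE_mp[OF ae], rule AE_I2) (simp add: zz)
 qed
 finally have "emeasure (lmat n (Suc m)) (?Z n (Suc m)) = 0" by (simp add: Suc_eq_plus1)
 then show ?case using Z[of n "Suc m"] by (intro AE_I[of _ _ "?Z n (Suc m)"]) auto
qed

definition gauss :: "nat => nat => real mat measure" where
 "gauss n m = density (lmat n m) (\<lambda>y. egauss y / ennreal (sqrt pi ^ (n * m)))"

lemma sets_gauss [simp, measurable_cong]: "sets (gauss n m) = sets (borel_mat n m)"
 by (simp add: gauss_def)

lemma space_gauss [simp]: "space (gauss n m) = carrier_mat n m"
 by (simp add: gauss_def)

lemma measurable_gauss_density: "(\<lambda>y. egauss y / ennreal (sqrt pi ^ (n * m))) \<in> borel_fun n m"
 by (intro borel_measurable_divide_ennreal measurable_exp_sqn) simp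

lemma measurable_gauss [simp]: "measurable (gauss n m) N = measurable (borel_mat n m) N"
 by (rule measurable_cong_sets) auto

lemma prob_space_gauss: "prob_space (gauss n m)"
proof (rule prob_spaceI)
 have "emeasure (gauss n m) (space (gauss n m)) =
  (\<integral>\<^sup>+y. egauss y / ennreal (sqrt pi ^ (n * m)) \<partial>lmat n m)"
  unfolding gauss_def using measurable_gauss_density
  by (subst emeasure_density) (auto intro!: nn_integral_cong simp: sets_eq_imp_space_eq[OF sets_lmat, symmetric])
 also have "... = 1"
  by (subst nn_integral_divide) (auto simp: nn_integral_gauss divide_self_if ennreal_divide_self)
 finally show "emeasure (gauss n m) (space (gauss n m)) = 1" .
qed

lemma AE_gauss: "(AE y in lmat n m. P y) ==> (AE y in gauss n m. P y)"
 unfolding gauss_def using measurable_gauss_density by (subst AE_density) auto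

lemma distr_gauss_orth:
 assumes g: "g \<in> orth_group n"
 shows "distr (gauss n m) (borel_mat n m) (\<lambda>y. g * y) = gauss n m"
proof -
 let ?d = "\<lambda>y. egauss y / ennreal (sqrt pi ^ (n * m))"
 have gm: "(\<lambda>y. g * y) \<in> lmat n m \<rightarrow>\<^sub>M borel_mat n m"
  using measurable_mat_mult_left[OF measurable_id_borel_mat(2) orth_groupD(1)[OF g]] by simp
 have "gauss n m = density (distr (lmat n m) (borel_mat n m) (\<lambda>y. g * y)) ?d"
  unfolding gauss_def distr_lmat_orth[OF g] ..
 also have "... = distr (density (lmat n m) (\<lambda>y. ?d (g * y))) (borel_mat n m) (\<lambda>y. g * y)"
  by (rule density_distr[OF measurable_gauss_density gm])
 also have "density (lmat n m) (\<lambda>y. ?d (g * y)) = gauss n m"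
  unfolding gauss_def
  by (rule density_cong) (use measurable_gauss_density[of n m] measurable_mat_mult_left[OF measurable_gauss_density orth_groupD(1)[OF g]] sqn_orth[OF g] in "auto intro!: AE_I2")
 finally show ?thesis ..
qed

section \<open>Existence and uniqueness of invariant measures on Stiefel manifolds\<close>

abbreviation borel_stiefel :: "nat => nat => real mat measure" where
 "borel_stiefel n r \<equiv> restrict_space (borel_mat n r) (stiefel n r)"

lemma sets_stiefel: "stiefel n r \<in> sets (borel_mat n r)"
proof -
 have "{y \<in> space (borel_mat n r). \<forall>i\<in>{..<r}. \<forall>j\<in>{..<r}. (y\<^sup>T * y) $$ (i, j) = 1\<^sub>m r $$ (i, j)} \<in> sets (borel_mat n r)"
 proof (intro sets.sets_Collect_finite_All)
  fix i j assume ij: "i \<in> {..<r}" "j \<in> {..<r}"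
  have m: "(\<lambda>y. (y\<^sup>T * y) $$ (i, j)) \<in> borel_fun n r"
   by (rule measurable_mat_entry[OF measurable_mat_times[OF measurable_mat_transpose[where n=n], where m=r]]) (use ij in auto)
  have eq: "{y \<in> space (borel_mat n r). (y\<^sup>T * y) $$ (i, j) = 1\<^sub>m r $$ (i, j)} =
   (\<lambda>y. (y\<^sup>T * y) $$ (i, j)) -` {1\<^sub>m r $$ (i, j)} \<inter> space (borel_mat n r)" by auto
  show "{y \<in> space (borel_mat n r). (y\<^sup>T * y) $$ (i, j) = 1\<^sub>m r $$ (i, j)} \<in> sets (borel_mat n r)"
   unfolding eq by (rule measurable_sets[OF m]) simp
 qed auto
 moreover have "{y \<in> space (borel_mat n r). \<forall>i\<in>{..<r}. \<forall>j\<in>{..<r}. (y\<^sup>T * y) $$ (i, j) = 1\<^sub>m r $$ (i, j)} = stiefel n r"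
 proof (rule Set.set_eqI)
  fix y :: "real mat"
  have "y\<^sup>T * y = 1\<^sub>m r"
   if "y \<in> carrier_mat n r" "\<forall>i\<in>{..<r}. \<forall>j\<in>{..<r}. (y\<^sup>T * y) $$ (i, j) = 1\<^sub>m r $$ (i, j)"
   by (rule eq_matI) (use that in simp_all)
  then show "y \<in> {y \<in> space (borel_mat n r). \<forall>i\<in>{..<r}. \<forall>j\<in>{..<r}. (y\<^sup>T * y) $$ (i, j) = 1\<^sub>m r $$ (i, j)}
    \<longleftrightarrow> y \<in> stiefel n r"
   unfolding stiefel_def mem_Collect_eq space_borel_mat by metis
 qed
 ultimately show ?thesis by (simp only:)
qed

lemma space_borel_stiefel: "space (borel_stiefel n r) = stiefel n r"
 using sets.sets_into_space[OF sets_stiefel[of n r]] by (auto simp: space_restrict_space)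

definition base_frame :: "nat => nat => real mat" where
 "base_frame n r = 1\<^sub>m r @\<^sub>r 0\<^sub>m (n - r) r"

lemma base_frame_stiefel: "r \<le> n ==> base_frame n r \<in> stiefel n r"
 unfolding stiefel_def base_frame_def
 using gram_append_rows[of "1\<^sub>m r" r r "0\<^sub>m (n - r) r" "n - r"] carrier_append_rows[of "1\<^sub>m r" r r "0\<^sub>m (n - r) r" "n - r"]
 by auto

text \<open>A frame completed to an orthogonal matrix is the image of \<open>base_frame\<close>
  under that matrix; two such matrices are then compared.\<close>

lemma stiefel_transitive:
 assumes "u \<in> stiefel n r" "v \<in> stiefel n r" "r \<le> n"
 obtains g where "g \<in> orth_group n" "v = g * u"
proof -
 have *: "\<exists>g \<in> orth_group n. w = g * base_frame n r" if w: "w \<in> stiefel n r" for w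
 proof -
  define l where "l = n - r"
  have n: "n = r + l" using assms by (simp add: l_def)
  obtain b where b: "b \<in> carrier_mat (r + l) l" "w @\<^sub>c b \<in> orth_group (r + l)"
   using orth_completion[of w r l] w n by auto
  have wc: "w \<in> carrier_mat (r + l) r" using w n by (simp add: stiefel_def)
  have "(w @\<^sub>c b) * (1\<^sub>m r @\<^sub>r 0\<^sub>m l r) = w * 1\<^sub>m r + b * 0\<^sub>m l r"
   by (rule append_cols_mult_append_rows[OF wc b(1)]) auto
  also have "... = w" using wc b(1) by simp
  finally show ?thesis using b(2) n by (intro bexI[of _ "w @\<^sub>c b"]) (auto simp: base_frame_def)
 qed
 obtain g h where g: "g \<in> orth_group n" "u = g * base_frame n r" and h: "h \<in> orth_group n" "v = h * base_frame n r"
  using *[OF assms(1)] *[OF assms(2)] by auto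
 have bc: "base_frame n r \<in> carrier_mat n r" using base_frame_stiefel[OF assms(3)] by (simp add: stiefel_def)
 have "h * g\<^sup>T * u = h * (g\<^sup>T * (g * base_frame n r))"
  unfolding g(2) by (rule assoc_mult_mat[of _ n n _ n _ r]) (use orth_groupD(1)[OF g(1)] orth_groupD(1)[OF h(1)] bc in auto)
 also have "... = v" using orth_cancel(1)[OF g(1) bc] h(2) by simp
 finally show ?thesis using that[of "h * g\<^sup>T"] orth_group_mult[OF h(1) orth_groupD(6)[OF g(1)]] by simp
qed

lemma invariant_probD:
 assumes "invariant_prob n r (stiefel n r) \<mu>"
 shows "prob_space \<mu>" "sets \<mu> = sets (borel_stiefel n r)" "space \<mu> = stiefel n r"
  "g \<in> orth_group n ==> distr \<mu> \<mu> (\<lambda>\<xi>. g * \<xi>) = \<mu>"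
 using assms sets_eq_imp_space_eq[of \<mu> "borel_stiefel n r"] unfolding invariant_prob_def
 by (auto simp: space_borel_stiefel)

lemma measurable_from_stiefel:
 assumes "sets \<mu> = sets (borel_stiefel n r)" "f \<in> borel_mat n r \<rightarrow>\<^sub>M N"
 shows "f \<in> \<mu> \<rightarrow>\<^sub>M N"
 using measurable_restrict_space1[OF assms(2)] measurable_cong_sets[OF assms(1) refl] by blast

lemma measurable_to_stiefel:
 assumes "sets \<mu> = sets (borel_stiefel n r)" "f \<in> N \<rightarrow>\<^sub>M borel_mat n r" "\<And>x. x \<in> space N ==> f x \<in> stiefel n r"
 shows "f \<in> N \<rightarrow>\<^sub>M \<mu>"
proof -
 have "f \<in> N \<rightarrow>\<^sub>M borel_stiefel n r"
  by (rule measurable_restrict_space2) (use assms in auto)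
 then show ?thesis using measurable_cong_sets[OF refl assms(1)] by blast
qed

lemma measurable_orth_action:
 assumes \<mu>: "sets \<mu> = sets (borel_stiefel n r)" and g: "g \<in> orth_group n"
 shows "(\<lambda>\<xi>. g * \<xi>) \<in> \<mu> \<rightarrow>\<^sub>M \<mu>"
proof (rule measurable_to_stiefel[OF \<mu>])
 have sp: "space \<mu> = stiefel n r" using sets_eq_imp_space_eq[OF \<mu>] by (simp add: space_borel_stiefel)
 show "g * x \<in> stiefel n r" if "x \<in> space \<mu>" for x using orth_mult_stiefel[OF g] that sp by simp
 show "(\<lambda>\<xi>. g * \<xi>) \<in> \<mu> \<rightarrow>\<^sub>M borel_mat n r"
  by (rule measurable_from_stiefel[OF \<mu> measurable_mat_mult_left[OF measurable_id_borel_mat(2) orth_groupD(1)[OF g]]])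
qed

lemma nn_integral_invariant:
 assumes \<mu>: "invariant_prob n r (stiefel n r) \<mu>" and g: "g \<in> orth_group n" and F: "F \<in> borel_measurable \<mu>"
 shows "(\<integral>\<^sup>+\<xi>. F (g * \<xi>) \<partial>\<mu>) = (\<integral>\<^sup>+\<xi>. F \<xi> \<partial>\<mu>)"
proof -
 note m = measurable_orth_action[OF invariant_probD(2)[OF \<mu>] g]
 have "(\<integral>\<^sup>+\<xi>. F \<xi> \<partial>\<mu>) = (\<integral>\<^sup>+\<xi>. F \<xi> \<partial>distr \<mu> \<mu> (\<lambda>\<xi>. g * \<xi>))"
  by (simp add: invariant_probD(4)[OF \<mu> g])
 also have "... = (\<integral>\<^sup>+\<xi>. F (g * \<xi>) \<partial>\<mu>)" by (rule nn_integral_distr[OF m]) (use F in simp)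
 finally show ?thesis ..
qed

text \<open>The law of a Gaussian matrix is rotation invariant and Gram-Schmidt commutes with
  rotations, so the law of the orthonormalized matrix is invariant.\<close>

lemma invariant_prob_exists:
 assumes "r \<le> n"
 shows "\<exists>\<mu>. invariant_prob n r (stiefel n r) \<mu>"
proof
 \<comment> \<open>Rank-deficient matrices are sent to a fixed frame so that \<open>q\<close> takes
   values in the manifold everywhere. Equivariance may fail there, which is a null set.\<close>
 define q where "q y = (if mat_abs y = 0 then base_frame n r else gs n r y)" for y
 let ?G = "gauss n r" and ?V = "borel_stiefel n r"
 let ?\<mu> = "distr ?G ?V q"
 have qm: "q \<in> borel_mat n r \<rightarrow>\<^sub>M borel_mat n r"
  unfolding q_def
  by (intro measurable_If measurable_gs measurable_const) (use sets_singular[of n r] base_frame_stiefel[OF assms] in "auto simp: stiefel_def")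
 have qs: "q y \<in> stiefel n r" if "y \<in> carrier_mat n r" for y
  using gs_nonsingular[OF that] base_frame_stiefel[OF assms] by (simp add: q_def mat_abs_0_iff)
 have qV: "q \<in> ?G \<rightarrow>\<^sub>M ?V"
  by (rule measurable_restrict_space2) (use qm qs in auto)
 have qV': "q \<in> borel_mat n r \<rightarrow>\<^sub>M ?V" using qV by simp
 interpret G: prob_space ?G by (rule prob_space_gauss)
 show "invariant_prob n r (stiefel n r) ?\<mu>"
  unfolding invariant_prob_def
 proof (intro conjI ballI)
  show "prob_space ?\<mu>" by (rule G.prob_space_distr[OF qV])
  fix g assume g: "g \<in> orth_group n"
  have gm: "(\<lambda>y. g * y) \<in> borel_mat n r \<rightarrow>\<^sub>M borel_mat n r"
   by (rule measurable_mat_mult_left[OF measurable_id_borel_mat(2) orth_groupD(1)[OF g]])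
  have gV: "(\<lambda>\<xi>. g * \<xi>) \<in> ?V \<rightarrow>\<^sub>M ?V" by (rule measurable_orth_action[OF refl g])
  have "distr ?\<mu> ?\<mu> (\<lambda>\<xi>. g * \<xi>) = distr ?\<mu> ?V (\<lambda>\<xi>. g * \<xi>)" by (rule distr_cong) auto
  also have "... = distr ?G ?V ((\<lambda>\<xi>. g * \<xi>) \<circ> q)" by (rule distr_distr[OF gV qV])
  also have "... = distr ?G ?V (q \<circ> (\<lambda>y. g * y))"
  proof (rule distr_cong_AE)
   have "AE y in ?G. mat_abs y \<noteq> 0" by (rule AE_gauss[OF AE_nonsingular[OF assms]])
   then show "AE y in ?G. ((\<lambda>\<xi>. g * \<xi>) \<circ> q) y = (q \<circ> (\<lambda>y. g * y)) y"
   proof (rule AE_mp, intro AE_I2 impI)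
    fix y assume "y \<in> space ?G" "mat_abs y \<noteq> 0"
    then show "((\<lambda>\<xi>. g * \<xi>) \<circ> q) y = (q \<circ> (\<lambda>y. g * y)) y"
     using gs_orth_mult[OF g, of y r] mat_abs_orth[OF g, of y r] by (simp add: q_def)
   qed
   show "(\<lambda>\<xi>. g * \<xi>) \<circ> q \<in> ?G \<rightarrow>\<^sub>M ?V" by (rule measurable_comp[OF qV gV])
   show "q \<circ> (\<lambda>y. g * y) \<in> ?G \<rightarrow>\<^sub>M ?V" using measurable_comp[OF gm qV'] by simp
  qed simp_all
  also have "... = distr (distr ?G (borel_mat n r) (\<lambda>y. g * y)) ?V q"
   by (rule distr_distr[symmetric]) (use qV' gm in auto)
  also have "... = ?\<mu>" unfolding distr_gauss_orth[OF g] ..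
  finally show "distr ?\<mu> ?\<mu> (\<lambda>\<xi>. g * \<xi>) = ?\<mu>" .
 qed simp
qed

text \<open>Every invariant measure is expressed through one fixed measure \<open>h\<close> on the
  group: average over \<open>g\<close>, exchange the integrals, and use transitivity to replace
  \<xi> by \<open>base_frame\<close>.\<close>

lemma invariant_prob_unique:
 assumes "r \<le> n" and \<mu>: "invariant_prob n r (stiefel n r) \<mu>" and \<nu>: "invariant_prob n r (stiefel n r) \<nu>"
 shows "\<mu> = \<nu>"
proof -
 obtain h where h: "invariant_prob n n (stiefel n n) h" using invariant_prob_exists[of n n] by auto
 interpret h: prob_space h by (rule invariant_probD[OF h])
 let ?E = "base_frame n r"
 have E: "?E \<in> stiefel n r" by (rule base_frame_stiefel[OF assms(1)])
 then have Ec: "?E \<in> carrier_mat n r" by (simp add: stiefel_def)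
 \<comment> \<open>The group acts through \<open>g'\<close> because \<open>h\<close> is known to be
   invariant under left translation: for \<open>\<xi> = g0 E\<close>, replacing \<open>g\<close> by
   \<open>g0 g\<close> turns \<open>(g0 g)' \<xi>\<close> into \<open>g' E\<close>.\<close>
 have key: "emeasure \<kappa> A = (\<integral>\<^sup>+g. indicator A (g\<^sup>T * ?E) \<partial>h)"
  if \<kappa>: "invariant_prob n r (stiefel n r) \<kappa>" and A: "A \<in> sets (borel_stiefel n r)" for \<kappa> A
 proof -
  interpret \<kappa>: prob_space \<kappa> by (rule invariant_probD[OF \<kappa>])
  interpret P: pair_sigma_finite h \<kappa> ..
  note sk = invariant_probD(2)[OF \<kappa>] and spk = invariant_probD(3)[OF \<kappa>]
   and sh = invariant_probD(2)[OF h] and sph = invariant_probD(3)[OF h]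
  have Ak: "A \<in> sets \<kappa>" using A sk by simp
  have act: "(\<lambda>(g, \<xi>). g\<^sup>T * \<xi>) \<in> h \<Otimes>\<^sub>M \<kappa> \<rightarrow>\<^sub>M \<kappa>"
  proof (rule measurable_to_stiefel[OF sk])
   show "(\<lambda>(g, \<xi>). g\<^sup>T * \<xi>) \<in> h \<Otimes>\<^sub>M \<kappa> \<rightarrow>\<^sub>M borel_mat n r"
    unfolding case_prod_beta
    by (intro measurable_mat_times[where k=n] measurable_mat_transpose
      mcomp[OF measurable_fst measurable_from_stiefel[OF sh measurable_id_borel_mat(2)]]
      mcomp[OF measurable_snd measurable_from_stiefel[OF sk measurable_id_borel_mat(2)]])
   show "(case x of (g, \<xi>) => g\<^sup>T * \<xi>) \<in> stiefel n r" if "x \<in> space (h \<Otimes>\<^sub>M \<kappa>)" for x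
    using that orth_mult_stiefel[OF orth_groupD(6)] by (auto simp: space_pair_measure spk sph stiefel_square)
  qed
  have mI: "(\<lambda>(g, \<xi>). indicator A (g\<^sup>T * \<xi>) :: ennreal) \<in> borel_measurable (h \<Otimes>\<^sub>M \<kappa>)"
   using mcomp[OF act borel_measurable_indicator[OF Ak]] by (simp add: case_prod_unfold)
  have "emeasure \<kappa> A = (\<integral>\<^sup>+g. emeasure \<kappa> A \<partial>h)" by (simp add: h.emeasure_space_1)
  also have "... = (\<integral>\<^sup>+g. \<integral>\<^sup>+\<xi>. indicator A (g\<^sup>T * \<xi>) \<partial>\<kappa> \<partial>h)"
  proof (rule nn_integral_cong)
   fix g assume "g \<in> space h"
   then have "g\<^sup>T \<in> orth_group n" using orth_groupD(6) by (simp add: sph stiefel_square)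
   from nn_integral_invariant[OF \<kappa> this, of "indicator A"] Ak
   show "emeasure \<kappa> A = (\<integral>\<^sup>+\<xi>. indicator A (g\<^sup>T * \<xi>) \<partial>\<kappa>)" by simp
  qed
  also have "... = (\<integral>\<^sup>+\<xi>. \<integral>\<^sup>+g. indicator A (g\<^sup>T * \<xi>) \<partial>h \<partial>\<kappa>)"
   by (rule P.Fubini'[OF mI, symmetric])
  also have "... = (\<integral>\<^sup>+\<xi>. \<integral>\<^sup>+g. indicator A (g\<^sup>T * ?E) \<partial>h \<partial>\<kappa>)"
  proof (rule nn_integral_cong)
   fix \<xi> assume "\<xi> \<in> space \<kappa>"
   then have \<xi>: "\<xi> \<in> stiefel n r" by (simp add: spk)
   obtain g0 where g0: "g0 \<in> orth_group n" "\<xi> = g0 * ?E" using stiefel_transitive[OF E \<xi> assms(1)] .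
   have mg: "(\<lambda>g. indicator A (g\<^sup>T * \<xi>) :: ennreal) \<in> borel_measurable h"
    using mcomp[OF measurable_Pair2'[of \<xi> \<kappa> h] mI] \<xi> spk by simp
   have "(\<integral>\<^sup>+g. indicator A (g\<^sup>T * \<xi>) \<partial>h) = (\<integral>\<^sup>+g. indicator A ((g0 * g)\<^sup>T * \<xi>) \<partial>h)"
    by (rule nn_integral_invariant[OF h g0(1) mg, symmetric])
   also have "... = (\<integral>\<^sup>+g. indicator A (g\<^sup>T * ?E) \<partial>h)"
   proof (rule nn_integral_cong)
    fix g assume "g \<in> space h"
    then have g: "g \<in> carrier_mat n n" using orth_groupD(1) by (simp add: sph stiefel_square)
    have "(g0 * g)\<^sup>T * \<xi> = g\<^sup>T * (g0\<^sup>T * (g0 * ?E))"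
     unfolding g0(2) using orth_groupD(1)[OF g0(1)] g Ec
     by (simp add: transpose_mult[of _ n n _ n], intro assoc_mult_mat) auto
    then show "indicator A ((g0 * g)\<^sup>T * \<xi>) = indicator A (g\<^sup>T * ?E)"
     using orth_cancel(1)[OF g0(1) Ec] by simp
   qed
   finally show "(\<integral>\<^sup>+g. indicator A (g\<^sup>T * \<xi>) \<partial>h) = (\<integral>\<^sup>+g. indicator A (g\<^sup>T * ?E) \<partial>h)" .
  qed
  also have "... = (\<integral>\<^sup>+g. indicator A (g\<^sup>T * ?E) \<partial>h)" by (simp add: \<kappa>.emeasure_space_1)
  finally show ?thesis .
 qed
 show ?thesis
 proof (rule measure_eqI)
  show "sets \<mu> = sets \<nu>" using invariant_probD(2)[OF \<mu>] invariant_probD(2)[OF \<nu>] by simp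
  show "emeasure \<mu> A = emeasure \<nu> A" if "A \<in> sets \<mu>" for A
   using key[OF \<mu>] key[OF \<nu>] that invariant_probD(2)[OF \<mu>] by simp
 qed
qed

text \<open>The invariant measure before completion; \<open>stf n n\<close> is Haar measure on the
  orthogonal group.\<close>

definition stf :: "nat => nat => real mat measure" where
 "stf n r = (THE \<mu>. invariant_prob n r (stiefel n r) \<mu>)"

lemma stf_eqI: "r \<le> n ==> invariant_prob n r (stiefel n r) \<mu> ==> stf n r = \<mu>"
 unfolding stf_def using invariant_prob_unique by (intro the_equality) auto

lemma invariant_prob_stf: "r \<le> n ==> invariant_prob n r (stiefel n r) (stf n r)"
 using invariant_prob_exists stf_eqI by metis

lemma stiefel_measure_eq: "stiefel_measure n r = completion (stf n r)"
 by (simp add: stiefel_measure_def stf_def)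

lemma haar_orth_eq: "haar_orth n = completion (stf n n)"
 by (simp add: haar_orth_def stf_def stiefel_square)

lemma stfD:
 assumes "r \<le> n"
 shows "prob_space (stf n r)" "sets (stf n r) = sets (borel_stiefel n r)" "space (stf n r) = stiefel n r"
 using invariant_probD[OF invariant_prob_stf[OF assms]] by auto

lemma measurable_stf: "r \<le> n ==> f \<in> borel_mat n r \<rightarrow>\<^sub>M N ==> f \<in> stf n r \<rightarrow>\<^sub>M N"
 by (rule measurable_from_stiefel[OF stfD(2)])

lemma measurable_id_stf [simp]: "r \<le> n ==> (\<lambda>x. x) \<in> stf n r \<rightarrow>\<^sub>M borel_mat n r"
 by (rule measurable_stf) auto

lemma haarD:
 shows "prob_space (stf n n)" "space (stf n n) = orth_group n"
 using stfD[of n n] by (auto simp: stiefel_square)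

text \<open>The image measure is invariant, hence equal to \<open>stf n r\<close> by uniqueness. For
  \<open>r = n\<close> this yields right invariance of Haar measure.\<close>

lemma distr_haar_frame:
 assumes "r \<le> n" and E: "E \<in> stiefel n r"
 shows "distr (stf n n) (stf n r) (\<lambda>g. g * E) = stf n r"
proof (rule stf_eqI[OF assms(1), symmetric])
 have Ec: "E \<in> carrier_mat n r" using E by (simp add: stiefel_def)
 interpret H: prob_space "stf n n" by (rule haarD)
 have m: "(\<lambda>g. g * E) \<in> stf n n \<rightarrow>\<^sub>M stf n r"
 proof (rule measurable_to_stiefel[OF stfD(2)[OF assms(1)]])
  show "(\<lambda>g. g * E) \<in> stf n n \<rightarrow>\<^sub>M borel_mat n r"
   by (rule measurable_stf[OF order_refl measurable_mat_mult_right[OF measurable_id_borel_mat(2) Ec]])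
  show "g * E \<in> stiefel n r" if "g \<in> space (stf n n)" for g
   using orth_mult_stiefel[OF _ E] that haarD by simp
 qed
 let ?\<mu> = "distr (stf n n) (stf n r) (\<lambda>g. g * E)"
 show "invariant_prob n r (stiefel n r) ?\<mu>"
  unfolding invariant_prob_def
 proof (intro conjI ballI)
  show "prob_space ?\<mu>" by (rule H.prob_space_distr[OF m])
  show "sets ?\<mu> = sets (borel_stiefel n r)" using stfD(2)[OF assms(1)] by simp
  fix h assume h: "h \<in> orth_group n"
  have hr: "(\<lambda>\<xi>. h * \<xi>) \<in> stf n r \<rightarrow>\<^sub>M stf n r" by (rule measurable_orth_action[OF stfD(2)[OF assms(1)] h])
  have hn: "(\<lambda>\<xi>. h * \<xi>) \<in> stf n n \<rightarrow>\<^sub>M stf n n" by (rule measurable_orth_action[OF stfD(2) h]) simp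
  have "distr ?\<mu> ?\<mu> (\<lambda>\<xi>. h * \<xi>) = distr ?\<mu> (stf n r) (\<lambda>\<xi>. h * \<xi>)" by (rule distr_cong) auto
  also have "... = distr (stf n n) (stf n r) ((\<lambda>\<xi>. h * \<xi>) \<circ> (\<lambda>g. g * E))"
   by (rule distr_distr[OF hr m])
  also have "... = distr (stf n n) (stf n r) ((\<lambda>g. g * E) \<circ> (\<lambda>\<xi>. h * \<xi>))"
   by (rule distr_cong) (use orth_groupD(1) h Ec in "auto simp: haarD assoc_mult_mat[of _ n n _ n _ r]")
  also have "... = distr (distr (stf n n) (stf n n) (\<lambda>\<xi>. h * \<xi>)) (stf n r) (\<lambda>g. g * E)"
   by (rule distr_distr[OF m hn, symmetric])
  also have "... = ?\<mu>" using invariant_probD(4)[OF invariant_prob_stf h, of n] by simp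
  finally show "distr ?\<mu> ?\<mu> (\<lambda>\<xi>. h * \<xi>) = ?\<mu>" .
 qed
qed

lemma nn_integral_haar_left:
 assumes g: "g \<in> orth_group n" and F: "F \<in> borel_fun n n"
 shows "(\<integral>\<^sup>+h. F (g * h) \<partial>stf n n) = (\<integral>\<^sup>+h. F h \<partial>stf n n)"
 by (rule nn_integral_invariant[OF invariant_prob_stf g measurable_stf]) (use F in auto)

lemma distr_haar_right:
 assumes g: "g \<in> orth_group n"
 shows "distr (stf n n) (stf n n) (\<lambda>h. h * g) = stf n n"
 by (rule distr_haar_frame) (use g in "auto simp: stiefel_square")

lemma nn_integral_haar_right:
 assumes g: "g \<in> orth_group n" and F: "F \<in> borel_fun n n"
 shows "(\<integral>\<^sup>+h. F (h * g) \<partial>stf n n) = (\<integral>\<^sup>+h. F h \<partial>stf n n)"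
proof -
 have m: "(\<lambda>h. h * g) \<in> stf n n \<rightarrow>\<^sub>M stf n n"
 proof (rule measurable_to_stiefel[OF stfD(2)[OF order_refl]])
  show "(\<lambda>h. h * g) \<in> stf n n \<rightarrow>\<^sub>M borel_mat n n"
   by (rule measurable_stf[OF order_refl measurable_mat_mult_right[OF measurable_id_borel_mat(2) orth_groupD(1)[OF g]]])
  show "h * g \<in> stiefel n n" if "h \<in> space (stf n n)" for h
   using orth_group_mult[OF _ g] that haarD by (simp add: stiefel_square)
 qed
 have "(\<integral>\<^sup>+h. F h \<partial>stf n n) = (\<integral>\<^sup>+h. F h \<partial>distr (stf n n) (stf n n) (\<lambda>h. h * g))"
  by (simp add: distr_haar_right[OF g])
 also have "... = (\<integral>\<^sup>+h. F (h * g) \<partial>stf n n)"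
  by (rule nn_integral_distr[OF m]) (use measurable_stf[OF order_refl F] in simp)
 finally show ?thesis ..
qed

section \<open>Polar decomposition and Gaussian integrals\<close>

text \<open>Cramer's formula gives a total function of \<open>T\<close> that is visibly measurable
  in the entries.\<close>

definition minv :: "real mat => real mat" where
 "minv T = (1 / det T) \<cdot>\<^sub>m adj_mat T"

lemma minv:
 assumes "T \<in> carrier_mat m m"
 shows "minv T \<in> carrier_mat m m"
  "det T \<noteq> 0 ==> T * minv T = 1\<^sub>m m" "det T \<noteq> 0 ==> minv T * T = 1\<^sub>m m"
proof -
 note adj = adj_mat[OF assms]
 show "minv T \<in> carrier_mat m m" using adj by (simp add: minv_def)
 show "T * minv T = 1\<^sub>m m" if "det T \<noteq> 0"
  using adj assms that mult_smult_distrib[OF assms adj(1)] by (auto simp: minv_def intro!: eq_matI)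
 show "minv T * T = 1\<^sub>m m" if "det T \<noteq> 0"
  using adj assms that mult_smult_assoc_mat[OF adj(1) assms] by (auto simp: minv_def intro!: eq_matI)
qed

lemma minv_mult:
 assumes T: "T \<in> carrier_mat m m" "det T \<noteq> 0" and R: "R \<in> carrier_mat m m" "det R \<noteq> 0"
 shows "minv (T * R) = minv R * minv T"
proof -
 note iT = minv[OF T(1)] and iR = minv[OF R(1)]
 have TR: "T * R \<in> carrier_mat m m" "det (T * R) \<noteq> 0" using T R det_mult[OF T(1) R(1)] by auto
 note iTR = minv[OF TR(1)]
 have "(T * R) * (minv R * minv T) = T * (R * (minv R * minv T))"
  using T R iT(1) iR(1) by (intro assoc_mult_mat) auto
 also have "R * (minv R * minv T) = R * minv R * minv T"
  using T R iT(1) iR(1) by (intro assoc_mult_mat[symmetric]) auto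
 also have "... = minv T" using iR(2) R iT(1) by simp
 also have "T * minv T = 1\<^sub>m m" using iT(2) T by simp
 finally have eq: "(T * R) * (minv R * minv T) = 1\<^sub>m m" .
 have iRT: "minv R * minv T \<in> carrier_mat m m" using iR(1) iT(1) by auto
 have "minv (T * R) = minv (T * R) * ((T * R) * (minv R * minv T))"
  unfolding eq using iTR(1) by simp
 also have "... = minv (T * R) * (T * R) * (minv R * minv T)"
  by (rule assoc_mult_mat[symmetric, OF iTR(1) TR(1) iRT])
 also have "... = minv R * minv T" unfolding iTR(3)[OF TR(2)] by (rule left_mult_one_mat[OF iRT])
 finally show ?thesis .
qed

lemma measurable_minv: "minv \<in> borel_mat m m \<rightarrow>\<^sub>M borel_mat m m"
 unfolding minv_def
proof (intro measurable_mat_smult borel_measurable_divide borel_measurable_const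
  measurable_mat_det[where n=m] measurable_id_borel_mat)
 show "adj_mat \<in> borel_mat m m \<rightarrow>\<^sub>M borel_mat m m"
 proof (rule measurable_borel_matI2[where h="\<lambda>i j T. (-1) ^ (j + i) * det (mat_delete T j i)"])
  show "adj_mat T \<in> carrier_mat m m" if "T \<in> space (borel_mat m m)" for T :: "real mat"
   using adj_mat(1)[of T m] that by simp
  show "adj_mat T $$ (i, j) = (-1) ^ (j + i) * det (mat_delete T j i)"
   if "T \<in> space (borel_mat m m)" "i < m" "j < m" for i j and T :: "real mat"
   using that by (simp add: adj_mat_def cofactor_def)
  fix i j assume ij: "i < m" "j < m"
  have "(\<lambda>T :: real mat. mat_delete T j i) \<in> borel_mat m m \<rightarrow>\<^sub>M borel_mat (m - 1) (m - 1)"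
  proof (rule measurable_borel_matI2[where h="\<lambda>i' j' T. T $$ (if i' < j then i' else Suc i', if j' < i then j' else Suc j')"])
   show "mat_delete T j i \<in> carrier_mat (m - 1) (m - 1)" if "T \<in> space (borel_mat m m)" for T :: "real mat"
    using that by (intro mat_delete_carrier) simp
   show "(\<lambda>T. T $$ (if i' < j then i' else Suc i', if j' < i then j' else Suc j')) \<in> borel_fun m m"
    if "i' < m - 1" "j' < m - 1" for i' j'
    by (rule measurable_borel_mat_entry) (use that in auto)
   show "mat_delete T j i $$ (i', j') = T $$ (if i' < j then i' else Suc i', if j' < i then j' else Suc j')"
    if "T \<in> space (borel_mat m m)" "i' < m - 1" "j' < m - 1" for i' j' and T :: "real mat"
    using that by (simp add: mat_delete_def)
  qed
  then show "(\<lambda>T. (-1) ^ (j + i) * det (mat_delete T j i) :: real) \<in> borel_fun m m"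
   by (intro borel_measurable_times borel_measurable_const measurable_mat_det)
 qed
qed

lemma measurable_mat_abs_powr: "(\<lambda>y. epow y s) \<in> borel_fun n m"
 by (rule mcomp[OF measurable_mat_abs_id, of "\<lambda>x. ennreal (x powr s)"]) measurable

lemma measurable_pad:
 assumes "F \<in> borel_mat (m + l) m' \<rightarrow>\<^sub>M N"
 shows "(\<lambda>T. F (T @\<^sub>r 0\<^sub>m l m')) \<in> borel_mat m m' \<rightarrow>\<^sub>M N"
 by (rule mcomp[OF measurable_append_rows assms]) auto

lemma AE_det_nonzero: "AE T in lmat m m. det T \<noteq> 0"
 by (rule AE_mp[OF AE_nonsingular[of m m]], simp, rule AE_I2) (simp add: mat_abs_square)

lemma nn_integral_eq_imp_inverse:
 assumes "ennreal a * x = y" "0 < a"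
 shows "x = ennreal (1 / a) * y"
proof -
 have "ennreal (1 / a) * y = ennreal (1 / a) * ennreal a * x" using assms by (simp add: mult.assoc)
 also have "ennreal (1 / a) * ennreal a = 1" using assms by (simp add: ennreal_mult[symmetric])
 finally show ?thesis by simp
qed

text \<open>Both sides come from the double integral of \<open>\<psi>(y) F(y T) |det T|^l\<close> over \<open>y\<close> and \<open>T\<close>,
 which by invariance factorises in either order of integration.\<close>

lemma polar_raw:
 assumes F: "F \<in> borel_fun (m + l) m"
  and inv: "\<And>g y. g \<in> orth_group (m + l) ==> y \<in> carrier_mat (m + l) m ==> F (g * y) = F y"
 shows "(\<integral>\<^sup>+T. egauss T * ennreal (\<bar>det T\<bar> ^ l) \<partial>lmat m m) * (\<integral>\<^sup>+y. F y \<partial>lmat (m + l) m) =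
  ennreal (sqrt pi ^ ((m + l) * m)) * (\<integral>\<^sup>+T. F (T @\<^sub>r 0\<^sub>m l m) * ennreal (\<bar>det T\<bar> ^ l) \<partial>lmat m m)"
proof -
 let ?n = "m + l"
 \<comment> \<open>The power \<open>mat_abs y ^ (m + l)\<close> compensates the substitution
   \<open>T -> R T\<close> made below, which costs \<open>m\<close> powers of the determinant from
   Lebesgue measure and \<open>l\<close> from the weight; a pure Gaussian in \<open>y\<close> is
   left.\<close>
 define \<psi> where "\<psi> y = egauss y * ennreal (mat_abs y ^ ?n)" for y
 define Lam where "Lam F = (\<integral>\<^sup>+T. F (T @\<^sub>r 0\<^sub>m l m) * ennreal (\<bar>det T\<bar> ^ l) \<partial>lmat m m)"
  for F :: "real mat => ennreal"
 define c0 where "c0 = (\<integral>\<^sup>+T. \<psi> (minv T @\<^sub>r 0\<^sub>m l m) * ennreal (1 / \<bar>det T\<bar> ^ m) \<partial>lmat m m)"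
 have mdet: "(\<lambda>T. ennreal (\<bar>det T\<bar> ^ l)) \<in> borel_fun m m" for l
  by (intro mcomp[OF _ measurable_ennreal] borel_measurable_power borel_measurable_abs measurable_mat_det[where n=m]) simp
 have mdet': "(\<lambda>T. ennreal (1 / \<bar>det T\<bar> ^ m)) \<in> borel_fun m m"
  by (intro mcomp[OF _ measurable_ennreal] borel_measurable_divide borel_measurable_const
    borel_measurable_power borel_measurable_abs measurable_mat_det[where n=m]) simp
 have m\<psi>: "\<psi> \<in> borel_fun ?n m"
  unfolding \<psi>_def
  by (intro times_ennreal measurable_exp_sqn mcomp[OF _ measurable_ennreal]
    borel_measurable_power measurable_mat_abs_id)
 have key: "c0 * (\<integral>\<^sup>+y. F y \<partial>lmat ?n m) = ennreal (sqrt pi ^ (?n * m)) * Lam F"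
  if F: "F \<in> borel_fun ?n m"
  and inv: "\<And>g y. g \<in> orth_group ?n ==> y \<in> carrier_mat ?n m ==> F (g * y) = F y" for F
 proof -
  let ?I = "\<integral>\<^sup>+y. \<integral>\<^sup>+T. \<psi> y * (F (y * T) * ennreal (\<bar>det T\<bar> ^ l)) \<partial>lmat m m \<partial>lmat ?n m"
  have mFT: "(\<lambda>T. F (y * T) * ennreal (\<bar>det T\<bar> ^ l)) \<in> borel_fun m m"
   if "y \<in> carrier_mat ?n m" for y
   by (intro times_ennreal measurable_mat_mult_left[OF F that] mdet)
  have mpair: "(\<lambda>(y, T). \<psi> y * (F (y * T) * ennreal (\<bar>det T\<bar> ^ l))) \<in> borel_measurable (lmat ?n m \<Otimes>\<^sub>M lmat m m)"
   unfolding case_prod_unfold measurable_lmat_pair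
   by (intro times_ennreal mcomp[OF measurable_fst m\<psi>]
     mcomp[OF measurable_mat_times[OF measurable_fst measurable_snd] F]
     mcomp[OF measurable_snd mdet])
  have decomp: "\<exists>g R. g \<in> orth_group ?n \<and> R \<in> carrier_mat m m \<and> det R \<noteq> 0 \<and> y = g * (R @\<^sub>r 0\<^sub>m l m) \<and> mat_abs y = \<bar>det R\<bar>"
   if "y \<in> carrier_mat ?n m" "mat_abs y \<noteq> 0" for y
   using QR_nonsingular[OF that] .
  have gRT: "g * (R @\<^sub>r 0\<^sub>m l m) * T = g * ((R * T) @\<^sub>r 0\<^sub>m l m)"
   if "g \<in> orth_group ?n" "R \<in> carrier_mat m m" "T \<in> carrier_mat m m" for g R T
  proof -
   have "g * (R @\<^sub>r 0\<^sub>m l m) * T = g * ((R @\<^sub>r 0\<^sub>m l m) * T)"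
    by (rule assoc_mult_mat[of _ ?n ?n _ m _ m]) (use orth_groupD(1)[OF that(1)] that in auto)
   also have "(R @\<^sub>r 0\<^sub>m l m) * T = (R * T) @\<^sub>r (0\<^sub>m l m * T)"
    by (rule append_rows_mult) (use that in auto)
   also have "0\<^sub>m l m * T = 0\<^sub>m l m" using that by simp
   finally show ?thesis .
  qed
  \<comment> \<open>With \<open>y = g (R; 0)\<close> invariance gives
    \<open>F (y T) = F (R T; 0)\<close>, and the substitution in \<open>T\<close> then removes
    \<open>R\<close>.\<close>
  have inner1: "(\<integral>\<^sup>+T. \<psi> y * (F (y * T) * ennreal (\<bar>det T\<bar> ^ l)) \<partial>lmat m m) = egauss y * Lam F"
   if y: "y \<in> carrier_mat ?n m" "mat_abs y \<noteq> 0" for y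
  proof -
   obtain g R where gR: "g \<in> orth_group ?n" "R \<in> carrier_mat m m" "det R \<noteq> 0" "y = g * (R @\<^sub>r 0\<^sub>m l m)" "mat_abs y = \<bar>det R\<bar>"
    using decomp[OF y] by blast
   let ?H = "\<lambda>T. F (T @\<^sub>r 0\<^sub>m l m) * ennreal (\<bar>det T\<bar> ^ l)"
   have mH: "?H \<in> borel_fun m m"
    by (intro times_ennreal measurable_pad[OF F] mdet)
   have "Lam F = ennreal (\<bar>det R\<bar> ^ m) * (\<integral>\<^sup>+T. ?H (R * T) \<partial>lmat m m)"
    unfolding Lam_def by (rule nn_integral_lmat_mult_left[OF gR(2,3) mH, symmetric])
   also have "(\<integral>\<^sup>+T. ?H (R * T) \<partial>lmat m m) = (\<integral>\<^sup>+T. ennreal (\<bar>det R\<bar> ^ l) * (F (y * T) * ennreal (\<bar>det T\<bar> ^ l)) \<partial>lmat m m)"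
   proof (rule lmat_cong)
    fix T :: "real mat" assume T: "T \<in> carrier_mat m m"
    have "F (y * T) = F ((R * T) @\<^sub>r 0\<^sub>m l m)"
     unfolding gR(4) gRT[OF gR(1,2) T] by (rule inv[OF gR(1)]) (use gR(2) T in auto)
    then show "?H (R * T) = ennreal (\<bar>det R\<bar> ^ l) * (F (y * T) * ennreal (\<bar>det T\<bar> ^ l))"
     using det_mult[OF gR(2) T] by (simp add: abs_mult power_mult_distrib ennreal_mult ac_simps)
   qed
   also have "... = ennreal (\<bar>det R\<bar> ^ l) * (\<integral>\<^sup>+T. F (y * T) * ennreal (\<bar>det T\<bar> ^ l) \<partial>lmat m m)"
    by (rule nn_integral_cmult) (use mFT[OF y(1)] in simp)
   finally have "Lam F = ennreal (mat_abs y ^ ?n) * (\<integral>\<^sup>+T. F (y * T) * ennreal (\<bar>det T\<bar> ^ l) \<partial>lmat m m)"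
    by (simp add: gR(5) power_add ennreal_mult ac_simps)
   moreover have "(\<integral>\<^sup>+T. \<psi> y * (F (y * T) * ennreal (\<bar>det T\<bar> ^ l)) \<partial>lmat m m) =
     \<psi> y * (\<integral>\<^sup>+T. F (y * T) * ennreal (\<bar>det T\<bar> ^ l) \<partial>lmat m m)"
    by (rule nn_integral_cmult) (use mFT[OF y(1)] in simp)
   ultimately show ?thesis by (simp add: \<psi>_def mult.assoc)
  qed
  have I1: "?I = ennreal (sqrt pi ^ (?n * m)) * Lam F"
  proof -
   have "?I = (\<integral>\<^sup>+y. egauss y * Lam F \<partial>lmat ?n m)"
    by (rule nn_integral_cong_AE, rule AE_mp[OF AE_nonsingular[of m ?n]], simp, rule AE_I2) (simp add: inner1)
   also have "... = (\<integral>\<^sup>+y. egauss y \<partial>lmat ?n m) * Lam F"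
    by (rule nn_integral_multc) simp
   finally show ?thesis by (simp add: nn_integral_gauss)
  qed
  have mpair2: "(\<lambda>(y, T). F y * (\<psi> (y * minv T) * ennreal (1 / \<bar>det T\<bar> ^ m))) \<in> borel_measurable (lmat ?n m \<Otimes>\<^sub>M lmat m m)"
   unfolding case_prod_unfold measurable_lmat_pair
   by (intro times_ennreal mcomp[OF measurable_fst F]
     mcomp[OF measurable_mat_times[OF measurable_fst mcomp[OF measurable_snd measurable_minv]] m\<psi>]
     mcomp[OF measurable_snd mdet'])
  \<comment> \<open>The substitution \<open>y -> y T^(-1)\<close> moves the dependence on
    \<open>T\<close> from \<open>F\<close> to \<psi>.\<close>
  have inner2: "(\<integral>\<^sup>+y. \<psi> y * (F (y * T) * ennreal (\<bar>det T\<bar> ^ l)) \<partial>lmat ?n m) =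
    (\<integral>\<^sup>+y. F y * (\<psi> (y * minv T) * ennreal (1 / \<bar>det T\<bar> ^ m)) \<partial>lmat ?n m)"
   if T: "T \<in> carrier_mat m m" "det T \<noteq> 0" for T
  proof -
   note iT = minv[OF T(1)]
   let ?H = "\<lambda>y. F y * (\<psi> (y * minv T) * ennreal (1 / \<bar>det T\<bar> ^ m))"
   have mH: "?H \<in> borel_fun ?n m"
    by (intro times_ennreal F measurable_mat_mult_right[OF m\<psi> iT(1)] borel_measurable_const)
   have mH': "(\<lambda>y. ?H (y * T)) \<in> borel_fun ?n m"
    by (rule measurable_mat_mult_right[OF mH T(1)])
   have "(\<integral>\<^sup>+y. ?H y \<partial>lmat ?n m) = ennreal (\<bar>det T\<bar> ^ ?n) * (\<integral>\<^sup>+y. ?H (y * T) \<partial>lmat ?n m)"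
    by (rule nn_integral_lmat_mult_right[OF T mH, symmetric])
   also have "... = (\<integral>\<^sup>+y. ennreal (\<bar>det T\<bar> ^ ?n) * ?H (y * T) \<partial>lmat ?n m)"
    by (rule nn_integral_cmult[symmetric]) (use mH' in simp)
   also have "... = (\<integral>\<^sup>+y. \<psi> y * (F (y * T) * ennreal (\<bar>det T\<bar> ^ l)) \<partial>lmat ?n m)"
   proof (rule lmat_cong)
    fix y :: "real mat" assume y: "y \<in> carrier_mat ?n m"
    have "y * T * minv T = y" using assoc_mult_mat[OF y T(1) iT(1)] iT(2)[OF T(2)] y by simp
    moreover have "ennreal (\<bar>det T\<bar> ^ ?n) * ennreal (1 / \<bar>det T\<bar> ^ m) = ennreal (\<bar>det T\<bar> ^ l)"
     using T(2) by (subst ennreal_mult[symmetric]) (auto simp: power_add)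
    ultimately show "ennreal (\<bar>det T\<bar> ^ ?n) * ?H (y * T) = \<psi> y * (F (y * T) * ennreal (\<bar>det T\<bar> ^ l))"
     by (simp only: mult.assoc mult.left_commute[of "ennreal (\<bar>det T\<bar> ^ ?n)"]) (simp add: ac_simps)
   qed
   finally show ?thesis ..
  qed
  \<comment> \<open>The substitution \<open>T -> T R\<close> cancels \<open>R\<close> in
    \<open>y T^(-1)\<close>, so the integral over \<open>T\<close> is the same constant
    \<open>c0\<close> for every \<open>y\<close> of full rank.\<close>
  have inner3: "(\<integral>\<^sup>+T. F y * (\<psi> (y * minv T) * ennreal (1 / \<bar>det T\<bar> ^ m)) \<partial>lmat m m) = F y * c0"
   if y: "y \<in> carrier_mat ?n m" "mat_abs y \<noteq> 0" for y
  proof -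
   obtain g R where gR: "g \<in> orth_group ?n" "R \<in> carrier_mat m m" "det R \<noteq> 0" "y = g * (R @\<^sub>r 0\<^sub>m l m)" "mat_abs y = \<bar>det R\<bar>"
    using decomp[OF y] by blast
   note iR = minv[OF gR(2)]
   have \<psi>inv: "\<psi> (g * z) = \<psi> z" if "z \<in> carrier_mat ?n m" for z
    using sqn_orth[OF gR(1) that] mat_abs_orth[OF gR(1) that] by (simp add: \<psi>_def)
   let ?Q = "\<lambda>T. \<psi> (y * minv T) * ennreal (1 / \<bar>det T\<bar> ^ m)"
   have mQ: "?Q \<in> borel_fun m m"
    by (intro times_ennreal mdet' mcomp[OF measurable_minv measurable_mat_mult_left[OF m\<psi> y(1)]])
   have mQR: "(\<lambda>T. ?Q (T * R)) \<in> borel_fun m m"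
    by (rule measurable_mat_mult_right[OF mQ gR(2)])
   have "(\<integral>\<^sup>+T. ?Q T \<partial>lmat m m) = ennreal (\<bar>det R\<bar> ^ m) * (\<integral>\<^sup>+T. ?Q (T * R) \<partial>lmat m m)"
    by (rule nn_integral_lmat_mult_right[OF gR(2,3) mQ, symmetric])
   also have "... = (\<integral>\<^sup>+T. ennreal (\<bar>det R\<bar> ^ m) * ?Q (T * R) \<partial>lmat m m)"
    by (rule nn_integral_cmult[symmetric]) (use mQR in simp)
   also have "... = c0"
    unfolding c0_def
   proof (rule nn_integral_cong_AE, rule AE_mp[OF AE_det_nonzero], rule AE_I2, rule impI)
    fix T assume "T \<in> space (lmat m m)" and T0: "det T \<noteq> 0"
    then have T: "T \<in> carrier_mat m m" by simp
    note iT = minv[OF T]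
    have "R * minv (T * R) = R * (minv R * minv T)"
     using minv_mult[OF T T0 gR(2,3)] by simp
    also have "... = R * minv R * minv T"
     by (rule assoc_mult_mat[symmetric]) (use gR(2) iR(1) iT(1) in auto)
    also have "... = minv T" using iR(2)[OF gR(3)] iT(1) by simp
    finally have e: "R * minv (T * R) = minv T" .
    have TR: "T * R \<in> carrier_mat m m" using T gR(2) by auto
    have "\<psi> (y * minv (T * R)) = \<psi> (g * ((R * minv (T * R)) @\<^sub>r 0\<^sub>m l m))"
     unfolding gR(4) gRT[OF gR(1,2) minv(1)[OF TR]] ..
    also have "... = \<psi> (minv T @\<^sub>r 0\<^sub>m l m)"
     unfolding e by (rule \<psi>inv) (use iT(1) in auto)
    finally have "\<psi> (y * minv (T * R)) = \<psi> (minv T @\<^sub>r 0\<^sub>m l m)" .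
    moreover have "ennreal (\<bar>det R\<bar> ^ m) * ennreal (1 / \<bar>det (T * R)\<bar> ^ m) = ennreal (1 / \<bar>det T\<bar> ^ m)"
     using gR(3) T0 det_mult[OF T gR(2)] by (subst ennreal_mult[symmetric]) (auto simp: abs_mult power_mult_distrib)
    ultimately show "ennreal (\<bar>det R\<bar> ^ m) * ?Q (T * R) = \<psi> (minv T @\<^sub>r 0\<^sub>m l m) * ennreal (1 / \<bar>det T\<bar> ^ m)"
     by (simp only: mult.left_commute[of "ennreal (\<bar>det R\<bar> ^ m)"])
   qed
   finally have "(\<integral>\<^sup>+T. ?Q T \<partial>lmat m m) = c0" .
   moreover have "(\<integral>\<^sup>+T. F y * ?Q T \<partial>lmat m m) = F y * (\<integral>\<^sup>+T. ?Q T \<partial>lmat m m)"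
    by (rule nn_integral_cmult) (use mQ in simp)
   ultimately show ?thesis by simp
  qed
  have "?I = (\<integral>\<^sup>+T. \<integral>\<^sup>+y. \<psi> y * (F (y * T) * ennreal (\<bar>det T\<bar> ^ l)) \<partial>lmat ?n m \<partial>lmat m m)"
   by (rule lmat_pair.Fubini'[OF mpair, symmetric])
  also have "... = (\<integral>\<^sup>+T. \<integral>\<^sup>+y. F y * (\<psi> (y * minv T) * ennreal (1 / \<bar>det T\<bar> ^ m)) \<partial>lmat ?n m \<partial>lmat m m)"
   by (rule nn_integral_cong_AE, rule AE_mp[OF AE_det_nonzero], rule AE_I2, rule impI, rule inner2) simp_all
  also have "... = (\<integral>\<^sup>+y. \<integral>\<^sup>+T. F y * (\<psi> (y * minv T) * ennreal (1 / \<bar>det T\<bar> ^ m)) \<partial>lmat m m \<partial>lmat ?n m)"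
   by (rule lmat_pair.Fubini'[OF mpair2])
  also have "... = (\<integral>\<^sup>+y. F y * c0 \<partial>lmat ?n m)"
   by (rule nn_integral_cong_AE, rule AE_mp[OF AE_nonsingular[of m ?n]], simp, rule AE_I2) (simp add: inner3)
  also have "... = (\<integral>\<^sup>+y. F y \<partial>lmat ?n m) * c0"
   by (rule nn_integral_multc) (use F in simp)
  finally show ?thesis unfolding I1 by (simp add: mult.commute)
 qed
 \<comment> \<open>The constant \<open>c0\<close> is found by taking \<open>F\<close> Gaussian,
   where the integral on the left is known.\<close>
 let ?G = "\<lambda>y. egauss y"
 have "c0 * ennreal (sqrt pi ^ (?n * m)) = ennreal (sqrt pi ^ (?n * m)) * Lam ?G"
  using key[OF measurable_exp_sqn] by (simp add: sqn_orth nn_integral_gauss)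
 then have "ennreal (1 / sqrt pi ^ (?n * m)) * (ennreal (sqrt pi ^ (?n * m)) * c0) = ennreal (1 / sqrt pi ^ (?n * m)) * (ennreal (sqrt pi ^ (?n * m)) * Lam ?G)"
  by (simp only: mult.commute)
 then have "c0 = Lam ?G"
  by (simp add: mult.assoc[symmetric] ennreal_mult[symmetric])
 also have "Lam ?G = (\<integral>\<^sup>+T. egauss T * ennreal (\<bar>det T\<bar> ^ l) \<partial>lmat m m)"
  unfolding Lam_def by (rule nn_integral_cong) (simp add: sqn_append_rows[of _ m m _ l])
 finally show ?thesis using key[OF F inv] unfolding Lam_def by simp
qed

section \<open>Radial integration and Gamma integrals\<close>

lemma nn_integral_square_pos:
 fixes h :: "real => ennreal"
 assumes h: "h \<in> borel_measurable borel"
 shows "(\<integral>\<^sup>+t. h (t\<^sup>2) * ennreal (2 * t) * indicator {0..} t \<partial>lborel) = (\<integral>\<^sup>+u. h u * indicator {0..} u \<partial>lborel)"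
proof -
 have h2: "(\<lambda>t. h (t\<^sup>2)) \<in> borel_measurable borel"
  by (rule mcomp[OF _ h]) measurable
 have step: "(\<integral>\<^sup>+t. h (t\<^sup>2) * ennreal (2 * t) * indicator {0..real (Suc i)} t \<partial>lborel) =
   (\<integral>\<^sup>+u. h u * indicator {0..(real (Suc i))\<^sup>2} u \<partial>lborel)" for i
 proof -
  have "(\<integral>\<^sup>+u. h u * indicator {0\<^sup>2..(real (Suc i))\<^sup>2} u \<partial>lborel) =
    (\<integral>\<^sup>+t. h (t\<^sup>2) * ennreal (2 * t) * indicator {0..real (Suc i)} t \<partial>lborel)"
   by (rule nn_integral_substitution_aux[where g'="\<lambda>t. 2 * t"])
    (use h in "auto intro!: derivative_eq_intros continuous_intros")
  then show ?thesis by simp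
 qed
 have "(\<integral>\<^sup>+t. h (t\<^sup>2) * ennreal (2 * t) * indicator {0..} t \<partial>lborel) =
  (\<integral>\<^sup>+t. (SUP i. h (t\<^sup>2) * ennreal (2 * t) * indicator {0..real (Suc i)} t) \<partial>lborel)"
 proof (rule nn_integral_cong)
  fix t :: real
  have "(SUP i. indicator {0..real (Suc i)} t :: ennreal) = indicator {0..} t"
  proof (rule antisym)
   show "(SUP i. indicator {0..real (Suc i)} t :: ennreal) \<le> indicator {0..} t"
    by (rule SUP_least) (auto simp: indicator_def)
   obtain i where "t \<le> real i" using real_arch_simple by blast
   then have "(indicator {0..} t :: ennreal) \<le> indicator {0..real (Suc i)} t" by (auto simp: indicator_def)
   then show "(indicator {0..} t :: ennreal) \<le> (SUP i. indicator {0..real (Suc i)} t)"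
    by (rule order_trans) (rule SUP_upper, simp)
  qed
  then show "h (t\<^sup>2) * ennreal (2 * t) * indicator {0..} t = (SUP i. h (t\<^sup>2) * ennreal (2 * t) * indicator {0..real (Suc i)} t)"
   by (simp add: SUP_mult_left_ennreal[symmetric])
 qed
 also have "... = (SUP i. \<integral>\<^sup>+t. h (t\<^sup>2) * ennreal (2 * t) * indicator {0..real (Suc i)} t \<partial>lborel)"
 proof (rule nn_integral_monotone_convergence_SUP)
  show "incseq (\<lambda>i t. h (t\<^sup>2) * ennreal (2 * t) * indicator {0..real (Suc i)} t)"
   by (auto simp: incseq_def le_fun_def indicator_def)
 qed (use h2 in measurable)
 also have "... = (SUP i. \<integral>\<^sup>+u. h u * indicator {0..(real (Suc i))\<^sup>2} u \<partial>lborel)"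
  by (simp only: step)
 also have "... = (\<integral>\<^sup>+u. (SUP i. h u * indicator {0..(real (Suc i))\<^sup>2} u) \<partial>lborel)"
 proof (rule nn_integral_monotone_convergence_SUP[symmetric])
  show "incseq (\<lambda>i u. h u * indicator {0..(real (Suc i))\<^sup>2} u)"
   by (auto simp: incseq_def le_fun_def indicator_def intro: order_trans[OF _ power_mono])
 qed (use h in measurable)
 also have "... = (\<integral>\<^sup>+u. h u * indicator {0..} u \<partial>lborel)"
 proof (rule nn_integral_cong)
  fix t :: real
  have "(SUP i. indicator {0..(real (Suc i))\<^sup>2} t :: ennreal) = indicator {0..} t"
  proof (rule antisym)
   show "(SUP i. indicator {0..(real (Suc i))\<^sup>2} t :: ennreal) \<le> indicator {0..} t"
    by (rule SUP_least) (auto simp: indicator_def)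
   obtain i where i: "t \<le> real i" using real_arch_simple by blast
   have "real i \<le> (real (Suc i))\<^sup>2" by (simp add: power2_eq_square algebra_simps)
   then have "(indicator {0..} t :: ennreal) \<le> indicator {0..(real (Suc i))\<^sup>2} t" using i by (auto simp: indicator_def)
   then show "(indicator {0..} t :: ennreal) \<le> (SUP i. indicator {0..(real (Suc i))\<^sup>2} t)"
    by (rule order_trans) (rule SUP_upper, simp)
  qed
  then show "(SUP i. h t * indicator {0..(real (Suc i))\<^sup>2} t) = h t * indicator {0..} t"
   by (simp add: SUP_mult_left_ennreal[symmetric])
 qed
 finally show ?thesis .
qed

text \<open>Both \<open>t\<close> and \<open>- t\<close> map to \<open>u = t^2\<close>, so folding
  the line supplies the factor 2 of the Jacobian \<open>2 t\<close>.\<close>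

lemma nn_integral_square:
 fixes h :: "real => ennreal"
 assumes h: "h \<in> borel_measurable borel"
 shows "(\<integral>\<^sup>+t. h (t\<^sup>2) * ennreal \<bar>t\<bar> \<partial>lborel) = (\<integral>\<^sup>+u. h u * indicator {0..} u \<partial>lborel)"
proof -
 have h2: "(\<lambda>t. h (t\<^sup>2)) \<in> borel_measurable borel"
  by (rule mcomp[OF _ h]) measurable
 let ?f = "\<lambda>t. h (t\<^sup>2) * ennreal \<bar>t\<bar> * indicator {0..} t"
 have mf: "?f \<in> borel_measurable borel" using h2 by measurable
 have "(\<integral>\<^sup>+t. h (t\<^sup>2) * ennreal \<bar>t\<bar> \<partial>lborel) = (\<integral>\<^sup>+t. ?f t + ?f (- t) \<partial>lborel)"
  by (rule nn_integral_cong_AE, rule AE_mp[OF AE_lborel_singleton[of 0]], rule AE_I2) (auto simp: indicator_def)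
 also have "... = (\<integral>\<^sup>+t. ?f t \<partial>lborel) + (\<integral>\<^sup>+t. ?f (- t) \<partial>lborel)"
  by (rule nn_integral_add) (use h2 in measurable)
 also have "(\<integral>\<^sup>+t. ?f (- t) \<partial>lborel) = (\<integral>\<^sup>+t. ?f t \<partial>lborel)"
  using nn_integral_real_affine[OF mf, of "-1" 0] by simp
 also have "(\<integral>\<^sup>+t. ?f t \<partial>lborel) + (\<integral>\<^sup>+t. ?f t \<partial>lborel) = (\<integral>\<^sup>+t. ?f t + ?f t \<partial>lborel)"
  by (rule nn_integral_add[symmetric]) (use mf in auto)
 also have "... = (\<integral>\<^sup>+t. h (t\<^sup>2) * ennreal (2 * t) * indicator {0..} t \<partial>lborel)"
 proof (rule nn_integral_cong)
  fix t :: real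
  have "ennreal (2 * t) = ennreal t + ennreal t" if "0 \<le> t"
   using that by (subst ennreal_plus[symmetric]) auto
  then show "?f t + ?f t = h (t\<^sup>2) * ennreal (2 * t) * indicator {0..} t"
   by (cases "0 \<le> t") (simp_all add: distrib_left)
 qed
 finally show ?thesis by (simp add: nn_integral_square_pos[OF h])
qed

lemma nn_integral_Gamma:
 assumes "0 < a"
 shows "(\<integral>\<^sup>+u. ennreal (exp (- u) * u powr (a - 1)) * indicator {0..} u \<partial>lborel) = ennreal (Gamma a)"
 using nn_integral_has_integral_lebesgue'[OF _ Gamma_integral_real[OF assms]]
 by (simp add: exp_minus field_simps)

text \<open>For one column the square matrix of the polar formula is a real number \<open>t\<close>
  with weight \<open>\<bar>t\<bar>^l\<close>; after \<open>u = t^2\<close> the weight is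
  \<open>u^((1 + l)/2 - 1)\<close>.\<close>

lemma radial_raw:
 assumes h: "h \<in> borel_measurable borel"
 shows "(\<integral>\<^sup>+T. h (sqn (T @\<^sub>r 0\<^sub>m l 1)) * ennreal (\<bar>det T\<bar> ^ l) \<partial>lmat 1 1) =
  (\<integral>\<^sup>+u. h u * ennreal (u powr (real (1 + l) / 2 - 1)) * indicator {0..} u \<partial>lborel)"
proof -
 let ?k = "\<lambda>u. h u * ennreal (u powr (real (1 + l) / 2 - 1))"
 have h2: "(\<lambda>t. h (t\<^sup>2)) \<in> borel_measurable borel"
  by (rule mcomp[OF _ h]) measurable
 have "(\<integral>\<^sup>+T. h (sqn (T @\<^sub>r 0\<^sub>m l 1)) * ennreal (\<bar>det T\<bar> ^ l) \<partial>lmat 1 1) =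
   (\<integral>\<^sup>+T. (\<lambda>t. h (t\<^sup>2) * ennreal (\<bar>t\<bar> ^ l)) (T $$ (0, 0)) \<partial>lmat 1 1)"
  by (rule nn_integral_cong) (simp add: sqn_append_rows[of _ 1 1 _ l] sqn_11 det_single)
 also have "... = (\<integral>\<^sup>+t. h (t\<^sup>2) * ennreal (\<bar>t\<bar> ^ l) \<partial>lborel)"
  by (rule nn_integral_lmat_11) (use h2 in measurable)
 also have "... = (\<integral>\<^sup>+t. ?k (t\<^sup>2) * ennreal \<bar>t\<bar> \<partial>lborel)"
 proof (rule nn_integral_cong_AE, rule AE_mp[OF AE_lborel_singleton[of 0]], rule AE_I2, rule impI)
  fix t :: real assume t: "t \<noteq> 0"
  have "t\<^sup>2 = \<bar>t\<bar> powr 2" using t by (simp add: powr_numeral)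
  then have "(t\<^sup>2) powr (real (1 + l) / 2 - 1) = \<bar>t\<bar> powr (2 * (real (1 + l) / 2 - 1))"
   by (simp only: powr_powr)
  also have "2 * (real (1 + l) / 2 - 1) = real l - 1" by (simp add: field_simps)
  finally have "(t\<^sup>2) powr (real (1 + l) / 2 - 1) * \<bar>t\<bar> = \<bar>t\<bar> powr (real l - 1) * \<bar>t\<bar> powr 1"
   using t by simp
  also have "... = \<bar>t\<bar> ^ l" using t by (simp only: powr_add[symmetric]) (simp add: powr_realpow)
  finally show "h (t\<^sup>2) * ennreal (\<bar>t\<bar> ^ l) = ?k (t\<^sup>2) * ennreal \<bar>t\<bar>"
   by (simp add: mult.assoc ennreal_mult[symmetric])
 qed
 also have "... = (\<integral>\<^sup>+u. ?k u * indicator {0..} u \<partial>lborel)"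
  by (rule nn_integral_square) (use h in measurable)
 finally show ?thesis .
qed

lemma ennreal_weight:
 assumes "0 \<le> C" "0 \<le> P"
 shows "ennreal C * (x * ennreal P * indicator A u) = x * ennreal (indicator A u * C * P)"
 using assms by (cases "u \<in> A") (simp_all add: ennreal_mult ac_simps)

text \<open>The polar formula with one column; its Gaussian constant is now
  \<open>Gamma (N / 2)\<close>. The resulting density of the squared radius encodes the sphere area
  \<open>2 pi^(N/2) / Gamma (N/2)\<close>.\<close>

lemma radial_nn:
 assumes h: "h \<in> borel_measurable borel" and N: "0 < N"
 shows "(\<integral>\<^sup>+y. h (sqn y) \<partial>lmat N 1) =
  (\<integral>\<^sup>+u. h u * ennreal (indicator {0..} u * (sqrt pi ^ N / Gamma (real N / 2)) * u powr (real N / 2 - 1)) \<partial>lborel)"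
proof -
 define l where "l = N - 1"
 have N1: "N = 1 + l" using N by (simp add: l_def)
 have G: "0 < Gamma (real N / 2)" using N by (intro Gamma_real_pos) simp
 have hs: "(\<lambda>y. h (sqn y)) \<in> borel_fun N 1"
  by (rule mcomp[OF measurable_sqn[where n=N and m=1] h]) simp
 have g: "(\<integral>\<^sup>+T. egauss T * ennreal (\<bar>det T\<bar> ^ l) \<partial>lmat 1 1) = ennreal (Gamma (real N / 2))"
 proof -
  have "(\<integral>\<^sup>+T. egauss T * ennreal (\<bar>det T\<bar> ^ l) \<partial>lmat 1 1) =
   (\<integral>\<^sup>+T. (\<lambda>u. ennreal (exp (- u))) (sqn (T @\<^sub>r 0\<^sub>m l 1)) * ennreal (\<bar>det T\<bar> ^ l) \<partial>lmat 1 1)"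
   by (rule nn_integral_cong) (simp add: sqn_append_rows[of _ 1 1 _ l])
  also have "... = (\<integral>\<^sup>+u. ennreal (exp (- u)) * ennreal (u powr (real (1 + l) / 2 - 1)) * indicator {0..} u \<partial>lborel)"
   by (rule radial_raw) measurable
  also have "... = ennreal (Gamma (real N / 2))"
   using nn_integral_Gamma[of "real N / 2"] N by (simp add: N1 ennreal_mult[symmetric])
  finally show ?thesis .
 qed
 have "ennreal (Gamma (real N / 2)) * (\<integral>\<^sup>+y. h (sqn y) \<partial>lmat N 1) =
   ennreal (sqrt pi ^ N) * (\<integral>\<^sup>+u. h u * ennreal (u powr (real N / 2 - 1)) * indicator {0..} u \<partial>lborel)"
  using polar_raw[of "\<lambda>y. h (sqn y)" 1 l] hs g radial_raw[OF h, of l] by (simp add: N1 sqn_orth)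
 then have "(\<integral>\<^sup>+y. h (sqn y) \<partial>lmat N 1) = ennreal (1 / Gamma (real N / 2)) *
   (ennreal (sqrt pi ^ N) * (\<integral>\<^sup>+u. h u * ennreal (u powr (real N / 2 - 1)) * indicator {0..} u \<partial>lborel))"
  by (rule nn_integral_eq_imp_inverse) (rule G)
 also have "... = ennreal (sqrt pi ^ N / Gamma (real N / 2)) * (\<integral>\<^sup>+u. h u * ennreal (u powr (real N / 2 - 1)) * indicator {0..} u \<partial>lborel)"
  using G by (simp add: mult.assoc[symmetric] ennreal_mult[symmetric])
 also have "... = (\<integral>\<^sup>+u. ennreal (sqrt pi ^ N / Gamma (real N / 2)) * (h u * ennreal (u powr (real N / 2 - 1)) * indicator {0..} u) \<partial>lborel)"
  by (rule nn_integral_cmult[symmetric]) (use h in measurable)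
 also have "... = (\<integral>\<^sup>+u. h u * ennreal (indicator {0..} u * (sqrt pi ^ N / Gamma (real N / 2)) * u powr (real N / 2 - 1)) \<partial>lborel)"
  by (rule nn_integral_cong, rule ennreal_weight) (use G in auto)
 finally show ?thesis .
qed

text \<open>Stated for measures because complex-valued integrals are next transported along
  \<open>sqn\<close>.\<close>

lemma distr_sqn:
 assumes N: "0 < N"
 shows "distr (lmat N 1) borel sqn =
  density lborel (\<lambda>u. ennreal (indicator {0..} u * (sqrt pi ^ N / Gamma (real N / 2)) * u powr (real N / 2 - 1)))"
proof (rule measure_eqI)
 fix A assume "A \<in> sets (distr (lmat N 1) borel sqn)"
 then have A: "A \<in> sets borel" by simp
 have ms: "sqn \<in> lmat N 1 \<rightarrow>\<^sub>M borel" using measurable_sqn[of "\<lambda>y. y" "borel_mat N 1" N 1] by simp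
 have "emeasure (distr (lmat N 1) borel sqn) A = (\<integral>\<^sup>+u. indicator A u \<partial>distr (lmat N 1) borel sqn)"
  using A by simp
 also have "... = (\<integral>\<^sup>+y. indicator A (sqn y) \<partial>lmat N 1)"
  by (rule nn_integral_distr[OF ms]) (use A in simp)
 also have "... = (\<integral>\<^sup>+u. indicator A u * ennreal (indicator {0..} u * (sqrt pi ^ N / Gamma (real N / 2)) * u powr (real N / 2 - 1)) \<partial>lborel)"
  by (rule radial_nn[OF _ N]) (use A in simp)
 also have "... = emeasure (density lborel (\<lambda>u. ennreal (indicator {0..} u * (sqrt pi ^ N / Gamma (real N / 2)) * u powr (real N / 2 - 1)))) A"
  by (subst emeasure_density) (use A in "auto simp: mult.commute")
 finally show "emeasure (distr (lmat N 1) borel sqn) A =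
  emeasure (density lborel (\<lambda>u. ennreal (indicator {0..} u * (sqrt pi ^ N / Gamma (real N / 2)) * u powr (real N / 2 - 1)))) A" .
qed simp

text \<open>On the negative axis the principal branch is \<open>Ln x = ln (- x) + i pi\<close>, so
  on the real line the function is given by three measurable cases.\<close>

lemma measurable_of_real_powr [measurable]: "(\<lambda>x::real. complex_of_real x powr s) \<in> borel_measurable borel"
proof -
 have "(\<lambda>x::real. if x = 0 then 0 else if 0 < x then exp (s * of_real (ln x)) else exp (s * (of_real (ln (- x)) + \<i> * pi)))
   \<in> borel_measurable borel" by measurable
 also have "(\<lambda>x::real. if x = 0 then 0 else if 0 < x then exp (s * of_real (ln x)) else exp (s * (of_real (ln (- x)) + \<i> * pi))) =
  (\<lambda>x::real. complex_of_real x powr s)"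
 proof (rule ext)
  fix x :: real
  have "Ln (complex_of_real x) = of_real (ln (- x)) + \<i> * pi" if "x < 0"
   using that Ln_minus[of "complex_of_real (- x)"] Ln_of_real[of "- x"] by simp
  then show "(if x = 0 then 0 else if 0 < x then exp (s * of_real (ln x)) else exp (s * (of_real (ln (- x)) + \<i> * pi))) =
   complex_of_real x powr s" by (auto simp: powr_def Ln_of_real)
 qed
 finally show ?thesis .
qed

section \<open>Gaussian moments of complex powers of \<open>mat_abs\<close>\<close>

definition gpow :: "complex => real mat => complex" where
 "gpow s y = of_real (exp (- sqn y)) * of_real (mat_abs y) powr s"

lemma measurable_mat_abs_cpowr: "(\<lambda>y. complex_of_real (mat_abs y) powr s) \<in> borel_fun n m"
 by (rule mcomp[OF measurable_mat_abs_id measurable_of_real_powr])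

lemma measurable_gpow: "gpow s \<in> borel_fun n m"
 unfolding gpow_def
 by (intro borel_measurable_times measurable_mat_abs_cpowr
   mcomp[OF measurable_exp_sqn_real, of complex_of_real]) measurable

lemma norm_gpow:
 assumes "y \<in> carrier_mat n m"
 shows "norm (gpow s y) = exp (- sqn y) * mat_abs y powr Re s"
  and "gpow (of_real (Re s)) y = of_real (norm (gpow s y))"
proof -
 show *: "norm (gpow s y) = exp (- sqn y) * mat_abs y powr Re s" for s
  using mat_abs_nonneg[OF assms] by (simp add: gpow_def norm_mult norm_powr_real_powr)
 show "gpow (of_real (Re s)) y = of_real (norm (gpow s y))"
  unfolding * using mat_abs_nonneg[OF assms] by (simp add: gpow_def powr_of_real)
qed

lemma Gamma_bochner:
 assumes z: "0 < Re z"
 shows "has_bochner_integral lborel (\<lambda>u. indicator {0<..} u *\<^sub>R (complex_of_real u powr (z - 1) / of_real (exp u))) (Gamma z)"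
proof -
 let ?f = "\<lambda>u. complex_of_real u powr (z - 1) / of_real (exp u)"
 have m: "(\<lambda>u. indicator {0<..} u *\<^sub>R ?f u) \<in> borel_measurable lborel" by measurable
 have i: "set_integrable lebesgue {0<..} ?f" by (rule absolutely_integrable_Gamma_integral'[OF z])
 then have "integrable lebesgue (\<lambda>u. indicator {0<..} u *\<^sub>R ?f u)" by (simp add: set_integrable_def)
 then have int: "integrable lborel (\<lambda>u. indicator {0<..} u *\<^sub>R ?f u)"
  using m by (simp add: integrable_completion)
 have "(LINT u:{0<..}|lebesgue. ?f u) = Gamma z"
  using set_lebesgue_integral_eq_integral(2)[OF i] Gamma_integral_complex'[OF z] by (simp add: integral_unique)
 then have "(LINT u|lborel. indicator {0<..} u *\<^sub>R ?f u) = Gamma z"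
  using m by (simp add: set_lebesgue_integral_def integral_completion)
 with int show ?thesis by (simp add: has_bochner_integral_iff)
qed

text \<open>For one column \<open>mat_abs y\<close> is the Euclidean norm, so in the squared radius
  \<open>u\<close> the integrand is \<open>exp (- u) u^(s/2 + N/2 - 1)\<close>, a Gamma
  integral.\<close>

lemma gpow_column:
 assumes N: "0 < N" and s: "- real N < Re s"
 shows "has_bochner_integral (lmat N 1) (gpow s) (of_real (sqrt pi ^ N) * Gamma ((of_nat N + s) / 2) / of_real (Gamma (real N / 2)))"
proof -
 define H where "H u = of_real (exp (- u)) * complex_of_real (sqrt u) powr s" for u :: real
 define C where "C = sqrt pi ^ N / Gamma (real N / 2)"
 have C: "0 < C" unfolding C_def using N by (auto intro!: divide_pos_pos Gamma_real_pos)
 have mH: "H \<in> borel_measurable borel"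
  unfolding H_def by (intro borel_measurable_times mcomp[OF _ measurable_of_real_powr]) measurable
 have ms: "sqn \<in> lmat N 1 \<rightarrow>\<^sub>M borel" using measurable_sqn[of "\<lambda>y. y" "borel_mat N 1" N 1] by simp
 let ?g = "\<lambda>u. indicator {0..} u * C * u powr (real N / 2 - 1)"
 let ?z = "(of_nat N + s) / 2"
 have z: "0 < Re ?z" using s by simp
 have "has_bochner_integral lborel (\<lambda>u. of_real C * (indicator {0<..} u *\<^sub>R (complex_of_real u powr (?z - 1) / of_real (exp u)))) (of_real C * Gamma ?z)"
  by (rule has_bochner_integral_mult_right[OF Gamma_bochner[OF z]])
 also have "(\<lambda>u. of_real C * (indicator {0<..} u *\<^sub>R (complex_of_real u powr (?z - 1) / of_real (exp u)))) = (\<lambda>u. ?g u *\<^sub>R H u)"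
 proof (rule ext)
  fix u :: real
  show "of_real C * (indicator {0<..} u *\<^sub>R (complex_of_real u powr (?z - 1) / of_real (exp u))) = ?g u *\<^sub>R H u"
  proof (cases "0 < u")
   case True
   have "complex_of_real (sqrt u) powr s = complex_of_real u powr (s / 2)"
    using True by (simp add: powr_def Ln_of_real ln_sqrt)
   moreover have "complex_of_real (u powr (real N / 2 - 1)) = complex_of_real u powr (of_real (real N / 2 - 1))"
    using True by (simp add: powr_of_real del: of_real_diff of_real_divide)
   moreover have "complex_of_real u powr (?z - 1) = complex_of_real u powr (of_real (real N / 2 - 1)) * complex_of_real u powr (s / 2)"
    using True by (simp add: powr_add[symmetric] add_divide_distrib algebra_simps)
   ultimately show ?thesis using True
    by (simp add: H_def exp_minus scaleR_conv_of_real field_simps del: of_real_diff)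
  next
   case False
   then show ?thesis by (cases "u = 0") (auto simp: H_def)
  qed
 qed
 finally have "has_bochner_integral lborel (\<lambda>u. ?g u *\<^sub>R H u) (of_real C * Gamma ?z)" .
 then have "has_bochner_integral (density lborel ?g) H (of_real C * Gamma ?z)"
  by (intro has_bochner_integral_density) (use mH C in "auto intro!: AE_I2")
 then have d: "has_bochner_integral (distr (lmat N 1) borel sqn) H (of_real C * Gamma ?z)"
  unfolding distr_sqn[OF N] C_def .
 have "has_bochner_integral (lmat N 1) (\<lambda>y. H (sqn y)) (of_real C * Gamma ?z)"
  using d mH ms by (simp add: has_bochner_integral_iff integrable_distr_eq integral_distr)
 also have "?this \<longleftrightarrow> has_bochner_integral (lmat N 1) (gpow s) (of_real C * Gamma ?z)"
 proof (rule has_bochner_integral_cong)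
  fix y assume "y \<in> space (lmat N 1)"
  then have y: "y \<in> carrier_mat N 1" by simp
  have c: "y\<^sup>T * y \<in> carrier_mat 1 1" using y by auto
  have "det (y\<^sup>T * y) = sqn y"
   unfolding det_single[OF c] sqn_gram[OF y] by (simp add: One_nat_def)
  then show "H (sqn y) = gpow s y" by (simp add: H_def gpow_def mat_abs_def)
 qed auto
 finally show ?thesis by (simp add: C_def)
qed

lemma has_bochner_integral_pair_mult:
 fixes u :: "'a => complex" and v :: "'b => complex"
 assumes "pair_sigma_finite M1 M2" and u: "has_bochner_integral M1 u a" and v: "has_bochner_integral M2 v b"
 shows "has_bochner_integral (M1 \<Otimes>\<^sub>M M2) (\<lambda>(x, y). u x * v y) (a * b)"
proof -
 interpret pair_sigma_finite M1 M2 by fact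
 have iu: "integrable M1 u" "integral\<^sup>L M1 u = a" and iv: "integrable M2 v" "integral\<^sup>L M2 v = b"
  using u v by (auto simp: has_bochner_integral_iff)
 have mu: "u \<in> borel_measurable M1" and mv: "v \<in> borel_measurable M2" using iu iv by auto
 have i: "integrable (M1 \<Otimes>\<^sub>M M2) (\<lambda>(x, y). u x * v y)"
 proof (rule Fubini_integrable)
  show "(\<lambda>(x, y). u x * v y) \<in> borel_measurable (M1 \<Otimes>\<^sub>M M2)"
   unfolding case_prod_unfold
   by (intro borel_measurable_times mcomp[OF measurable_fst mu] mcomp[OF measurable_snd mv])
  show "integrable M1 (\<lambda>x. \<integral>y. norm (case (x, y) of (x, y) => u x * v y) \<partial>M2)"
   using iu iv by (simp add: norm_mult)
  show "AE x in M1. integrable M2 (\<lambda>y. case (x, y) of (x, y) => u x * v y)"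
   using iv by (intro AE_I2) simp
 qed
 moreover have "integral\<^sup>L (M1 \<Otimes>\<^sub>M M2) (\<lambda>(x, y). u x * v y) = a * b"
  using integral_fst'[OF i] iu iv by simp
 ultimately show ?thesis by (simp add: has_bochner_integral_iff)
qed

lemma measurable_fibre_map:
 assumes "g \<in> orth_group (r + p)"
 shows "(\<lambda>(b1, b2). g * (b1 @\<^sub>r b2)) \<in> lmat r q \<Otimes>\<^sub>M lmat p q \<rightarrow>\<^sub>M borel_mat (r + p) q"
 unfolding case_prod_unfold measurable_lmat_pair
 by (intro measurable_mat_times[where k="r + p"] measurable_append_rows measurable_fst measurable_snd)
  (use orth_groupD(1)[OF assms] in auto)

lemma distr_lmat_fibre:
 assumes g: "g \<in> orth_group (r + p)"
 shows "distr (lmat r q \<Otimes>\<^sub>M lmat p q) (borel_mat (r + p) q) (\<lambda>(b1, b2). g * (b1 @\<^sub>r b2)) = lmat (r + p) q"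
proof -
 have gm: "(\<lambda>y. g * y) \<in> borel_mat (r + p) q \<rightarrow>\<^sub>M borel_mat (r + p) q"
  by (rule measurable_mat_mult_left[OF measurable_id_borel_mat(2) orth_groupD(1)[OF g]])
 have ap: "(\<lambda>(a, b). a @\<^sub>r b) \<in> lmat r q \<Otimes>\<^sub>M lmat p q \<rightarrow>\<^sub>M borel_mat (r + p) q"
  using measurable_append_rows_pair by simp
 have "lmat (r + p) q = distr (distr (lmat r q \<Otimes>\<^sub>M lmat p q) (borel_mat (r + p) q) (\<lambda>(a, b). a @\<^sub>r b)) (borel_mat (r + p) q) (\<lambda>y. g * y)"
  unfolding lmat_rows distr_lmat_orth[OF g] ..
 also have "... = distr (lmat r q \<Otimes>\<^sub>M lmat p q) (borel_mat (r + p) q) ((\<lambda>y. g * y) \<circ> (\<lambda>(a, b). a @\<^sub>r b))"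
  by (rule distr_distr[OF gm ap])
 also have "(\<lambda>y. g * y) \<circ> (\<lambda>(a, b). a @\<^sub>r b) = (\<lambda>(b1, b2). g * (b1 @\<^sub>r b2))" by auto
 finally show ?thesis ..
qed

lemma measurable_append_cols_pair:
 "(\<lambda>(a, b). a @\<^sub>c b) \<in> lmat n k \<Otimes>\<^sub>M lmat n l \<rightarrow>\<^sub>M borel_mat n (k + l)"
 unfolding case_prod_unfold measurable_lmat_pair by (rule measurable_append_cols[OF measurable_fst measurable_snd])

lemma lmat_cols:
 "distr (lmat n k \<Otimes>\<^sub>M lmat n l) (borel_mat n (k + l)) (\<lambda>(a, b). a @\<^sub>c b) = lmat n (k + l)"
proof (rule measure_eqI)
 fix A assume "A \<in> sets (distr (lmat n k \<Otimes>\<^sub>M lmat n l) (borel_mat n (k + l)) (\<lambda>(a, b). a @\<^sub>c b))"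
 then have A: "A \<in> sets (borel_mat n (k + l))" by simp
 then have iA: "indicator A \<in> borel_fun n (k + l)" by simp
 have "emeasure (distr (lmat n k \<Otimes>\<^sub>M lmat n l) (borel_mat n (k + l)) (\<lambda>(a, b). a @\<^sub>c b)) A =
   (\<integral>\<^sup>+y. indicator A y \<partial>distr (lmat n k \<Otimes>\<^sub>M lmat n l) (borel_mat n (k + l)) (\<lambda>(a, b). a @\<^sub>c b))"
  using A by simp
 also have "... = (\<integral>\<^sup>+z. indicator A ((\<lambda>(a, b). a @\<^sub>c b) z) \<partial>(lmat n k \<Otimes>\<^sub>M lmat n l))"
  by (rule nn_integral_distr[OF measurable_append_cols_pair]) (use iA in simp)
 also have "... = (\<integral>\<^sup>+a. \<integral>\<^sup>+b. indicator A (a @\<^sub>c b) \<partial>lmat n l \<partial>lmat n k)"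
  using lmat.nn_integral_fst[OF mcomp[OF measurable_append_cols_pair iA]] by simp
 also have "... = (\<integral>\<^sup>+y. indicator A y \<partial>lmat n (k + l))"
  by (rule nn_integral_lmat_cols(1)[OF iA, symmetric])
 finally show "emeasure (distr (lmat n k \<Otimes>\<^sub>M lmat n l) (borel_mat n (k + l)) (\<lambda>(a, b). a @\<^sub>c b)) A = emeasure (lmat n (k + l)) A"
  using A by simp
qed simp

text \<open>In coordinates adapted to \<open>a\<close> the new columns split off: \<open>b1\<close>,
  along the span of \<open>a\<close>, enters only the Gaussian, while \<open>b2\<close> carries the
  power.\<close>

lemma gpow_append_cols:
 assumes g: "g \<in> orth_group (r + p)" and T: "T \<in> carrier_mat r r" and a: "a = g * (T @\<^sub>r 0\<^sub>m p r)"
  and b: "b1 \<in> carrier_mat r q" "b2 \<in> carrier_mat p q"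
 shows "gpow s (a @\<^sub>c (g * (b1 @\<^sub>r b2))) = gpow s a * (of_real (exp (- sqn b1)) * gpow s b2)"
proof -
 have ac: "a \<in> carrier_mat (r + p) r" and bc: "b1 @\<^sub>r b2 \<in> carrier_mat (r + p) q"
  and gc: "g * (b1 @\<^sub>r b2) \<in> carrier_mat (r + p) q"
  using a T b orth_groupD(1)[OF g] by auto
 have ma: "mat_abs a = \<bar>det T\<bar>"
  unfolding a using mat_abs_orth[OF g, of "T @\<^sub>r 0\<^sub>m p r" r] mat_abs_append_zero[OF T] mat_abs_square[OF T] T by auto
 have "mat_abs (a @\<^sub>c (g * (b1 @\<^sub>r b2))) = mat_abs a * mat_abs b2"
  using mat_abs_append_cols[OF g T b] a ma by simp
 moreover have "sqn (a @\<^sub>c (g * (b1 @\<^sub>r b2))) = sqn a + (sqn b1 + sqn b2)"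
  unfolding sqn_append_cols[OF ac gc] sqn_orth[OF g bc] sqn_append_rows[OF b] ..
 moreover have "complex_of_real (mat_abs a * mat_abs b2) powr s = complex_of_real (mat_abs a) powr s * complex_of_real (mat_abs b2) powr s"
  using mat_abs_nonneg[OF ac] mat_abs_nonneg[OF b(2)] by (simp add: powr_times_real)
 moreover have "exp (- (sqn a + (sqn b1 + sqn b2))) = exp (- sqn a) * (exp (- sqn b1) * exp (- sqn b2))"
  by (simp add: exp_add[symmetric])
 ultimately show ?thesis by (simp only: gpow_def of_real_mult ac_simps)
qed

lemma exp_sqn_bochner:
 "has_bochner_integral (lmat n m) (\<lambda>y. complex_of_real (exp (- sqn y))) (of_real (sqrt pi ^ (n * m)))"
proof -
 have "has_bochner_integral (lmat n m) (\<lambda>y. exp (- sqn y)) (sqrt pi ^ (n * m))"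
  by (rule has_bochner_integral_nn_integral) (auto simp: nn_integral_gauss)
 then show ?thesis by (rule has_bochner_integral_of_real)
qed

text \<open>The factor for \<open>j\<close> comes from the column with \<open>j\<close>
  predecessors: the Gamma quotient from its component orthogonal to them, in dimension
  \<open>n - j\<close>, and \<open>pi^(n/2)\<close> from all its entries. The product is
  \<open>pi^(n m/2) Gamma_m ((n + s)/2) / Gamma_m (n/2)\<close>, a quotient of Siegel Gamma
  functions.\<close>

definition gint :: "nat => nat => complex => complex" where
 "gint n m s = (\<Prod>j<m. of_real (sqrt pi ^ n) * Gamma ((of_nat n - of_nat j + s) / 2) / of_real (Gamma ((real n - real j) / 2)))"

lemma gpow_fibre:
 assumes p: "0 < p" and s: "- real p < Re s" and a: "a \<in> carrier_mat (r + p) r" "mat_abs a \<noteq> 0"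
 shows "has_bochner_integral (lmat (r + p) 1) (\<lambda>b. gpow s (a @\<^sub>c b))
  (gpow s a * (of_real (sqrt pi ^ (r + p)) * Gamma ((of_nat p + s) / 2) / of_real (Gamma (real p / 2))))"
proof -
 obtain g T where gT: "g \<in> orth_group (r + p)" "T \<in> carrier_mat r r" "det T \<noteq> 0" "a = g * (T @\<^sub>r 0\<^sub>m p r)"
  using QR_nonsingular[OF a] by blast
 let ?K = "of_real (sqrt pi ^ p) * Gamma ((of_nat p + s) / 2) / of_real (Gamma (real p / 2))"
 have "has_bochner_integral (lmat r 1 \<Otimes>\<^sub>M lmat p 1) (\<lambda>(b1, b2). complex_of_real (exp (- sqn b1)) * gpow s b2)
   (of_real (sqrt pi ^ (r * 1)) * ?K)"
  by (rule has_bochner_integral_pair_mult[OF _ exp_sqn_bochner gpow_column[OF p s]]) (rule lmat_pair.pair_sigma_finite_axioms)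
 then have "has_bochner_integral (lmat r 1 \<Otimes>\<^sub>M lmat p 1) (\<lambda>z. gpow s a * (case z of (b1, b2) => complex_of_real (exp (- sqn b1)) * gpow s b2))
   (gpow s a * (of_real (sqrt pi ^ (r * 1)) * ?K))"
  by (rule has_bochner_integral_mult_right)
 also have "?this \<longleftrightarrow> has_bochner_integral (lmat r 1 \<Otimes>\<^sub>M lmat p 1) (\<lambda>z. gpow s (a @\<^sub>c ((\<lambda>(b1, b2). g * (b1 @\<^sub>r b2)) z)))
   (gpow s a * (of_real (sqrt pi ^ (r * 1)) * ?K))"
  by (rule has_bochner_integral_cong) (auto simp: space_pair_measure gpow_append_cols[OF gT(1,2,4)])
 finally have *: "has_bochner_integral (lmat r 1 \<Otimes>\<^sub>M lmat p 1) (\<lambda>z. gpow s (a @\<^sub>c ((\<lambda>(b1, b2). g * (b1 @\<^sub>r b2)) z)))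
   (gpow s a * (of_real (sqrt pi ^ (r * 1)) * ?K))" .
 have "(\<lambda>b. gpow s (a @\<^sub>c b)) \<in> borel_fun (r + p) 1"
  by (rule mcomp[OF measurable_append_cols[where n="r + p" and ?m1.0=r and ?m2.0=1] measurable_gpow]) (use a in auto)
 then have "has_bochner_integral (distr (lmat r 1 \<Otimes>\<^sub>M lmat p 1) (borel_mat (r + p) 1) (\<lambda>(b1, b2). g * (b1 @\<^sub>r b2))) (\<lambda>b. gpow s (a @\<^sub>c b))
   (gpow s a * (of_real (sqrt pi ^ (r * 1)) * ?K))"
  by (rule has_bochner_integral_distr[OF _ measurable_fibre_map[OF gT(1)] *])
 then show ?thesis unfolding distr_lmat_fibre[OF gT(1)] by (simp add: power_add mult.assoc)
qed

text \<open>Induction on columns: over \<open>a\<close> of full rank the fibre integral is a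
  multiple of \<open>gpow s a\<close>, and the factor depends on \<open>s\<close> and the dimensions
  alone.\<close>

theorem gpow_integral:
 assumes "m \<le> n" "real m - 1 - real n < Re s"
 shows "has_bochner_integral (lmat n m) (gpow s) (gint n m s)"
 using assms
proof (induction m arbitrary: s)
 case 0
 have one: "gpow s y = 1" if "y \<in> carrier_mat n 0" for y
 proof -
  have "y = 0\<^sub>m n 0" using that by (intro eq_matI) auto
  moreover have "mat_abs (0\<^sub>m n 0) = 1" by (simp add: mat_abs_def)
  ultimately show ?thesis by (simp add: gpow_def)
 qed
 have "has_bochner_integral (lmat n 0) (\<lambda>y. complex_of_real (exp (- sqn y))) (of_real (sqrt pi ^ (n * 0)))"
  by (rule exp_sqn_bochner)
 also have "?this \<longleftrightarrow> has_bochner_integral (lmat n 0) (gpow s) (gint n 0 s)"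
  by (rule has_bochner_integral_cong) (auto simp: one gint_def sqn_def)
 finally show ?case .
next
 case (Suc m)
 define p where "p = n - m"
 have n: "n = m + p" and p: "0 < p" using Suc.prems(1) by (auto simp: p_def)
 have sp: "- real p < Re s" using Suc.prems(2) n by simp
 define kap where "kap s = of_real (sqrt pi ^ n) * Gamma ((of_nat p + s) / 2) / of_real (Gamma (real p / 2))" for s :: complex
 have IH: "has_bochner_integral (lmat n m) (gpow s) (gint n m s)"
  if "- real p < Re s" for s using Suc.IH[of s] Suc.prems(1) that n by simp
 have fib: "has_bochner_integral (lmat n 1) (\<lambda>b. gpow s (a @\<^sub>c b)) (gpow s a * kap s)"
  if "- real p < Re s" "a \<in> carrier_mat n m" "mat_abs a \<noteq> 0" for s a
  using gpow_fibre[OF p that(1), of a m] that(2,3) unfolding n kap_def by simp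
 have AEn: "AE a in lmat n m. mat_abs a \<noteq> 0" by (rule AE_nonsingular) (use Suc.prems in simp)
 let ?f = "\<lambda>(a, b). gpow s (a @\<^sub>c b)"
 have mf: "?f \<in> borel_measurable (lmat n m \<Otimes>\<^sub>M lmat n 1)"
  using mcomp[OF measurable_append_cols_pair measurable_gpow[of s]] by (simp add: case_prod_unfold)
 \<comment> \<open>The norm of the integrand is the integrand for the exponent \<open>Re s\<close>,
   so the same fibre formula proves absolute integrability.\<close>
 have fibn: "(\<integral>b. norm (gpow s (a @\<^sub>c b)) \<partial>lmat n 1) = norm (gpow s a) * Re (kap (of_real (Re s)))"
  if a: "a \<in> carrier_mat n m" "mat_abs a \<noteq> 0" for a
 proof -
  have "has_bochner_integral (lmat n 1) (\<lambda>b. gpow (of_real (Re s)) (a @\<^sub>c b)) (gpow (of_real (Re s)) a * kap (of_real (Re s)))"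
   by (rule fib[OF _ a]) (use sp in simp)
  also have "?this \<longleftrightarrow> has_bochner_integral (lmat n 1) (\<lambda>b. complex_of_real (norm (gpow s (a @\<^sub>c b)))) (of_real (norm (gpow s a)) * kap (of_real (Re s)))"
  proof (rule has_bochner_integral_cong)
   show "gpow (of_real (Re s)) (a @\<^sub>c b) = of_real (norm (gpow s (a @\<^sub>c b)))" if "b \<in> space (lmat n 1)" for b
    using norm_gpow(2)[OF carrier_append_cols[OF a(1), of b 1]] that by simp
  qed (simp_all add: norm_gpow(2)[OF a(1)])
  finally have "has_bochner_integral (lmat n 1) (\<lambda>b. complex_of_real (norm (gpow s (a @\<^sub>c b)))) (of_real (norm (gpow s a)) * kap (of_real (Re s)))" .
  then have "has_bochner_integral (lmat n 1) (\<lambda>b. Re (complex_of_real (norm (gpow s (a @\<^sub>c b))))) (Re (of_real (norm (gpow s a)) * kap (of_real (Re s))))"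
   by (rule has_bochner_integral_Re)
  then show ?thesis by (simp add: has_bochner_integral_iff)
 qed
 have int: "integrable (lmat n m \<Otimes>\<^sub>M lmat n 1) ?f"
 proof (rule lmat_pair.Fubini_integrable[OF mf])
  have "integrable (lmat n m) (\<lambda>a. norm (gpow s a) * Re (kap (of_real (Re s))))"
   using IH[OF sp] by (auto simp: has_bochner_integral_iff)
  moreover have "(\<lambda>a. \<integral>b. norm (?f (a, b)) \<partial>lmat n 1) \<in> borel_measurable (lmat n m)"
   by (rule lmat.borel_measurable_lebesgue_integral) (use mf in measurable)
  moreover have "AE a in lmat n m. (\<integral>b. norm (?f (a, b)) \<partial>lmat n 1) = norm (gpow s a) * Re (kap (of_real (Re s)))"
   by (rule AE_mp[OF AEn], rule AE_I2) (simp add: fibn)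
  ultimately show "integrable (lmat n m) (\<lambda>a. \<integral>b. norm (?f (a, b)) \<partial>lmat n 1)"
   using integrable_cong_AE[of "\<lambda>a. \<integral>b. norm (?f (a, b)) \<partial>lmat n 1" "lmat n m"
     "\<lambda>a. norm (gpow s a) * Re (kap (of_real (Re s)))"] borel_measurable_integrable by blast
  show "AE a in lmat n m. integrable (lmat n 1) (\<lambda>b. ?f (a, b))"
   by (rule AE_mp[OF AEn], rule AE_I2) (use fib[OF sp] in "auto simp: has_bochner_integral_iff")
 qed
 have "(\<integral>a. \<integral>b. ?f (a, b) \<partial>lmat n 1 \<partial>lmat n m) = (\<integral>a. gpow s a * kap s \<partial>lmat n m)"
 proof (rule integral_cong_AE)
  show "(\<lambda>a. \<integral>b. ?f (a, b) \<partial>lmat n 1) \<in> borel_measurable (lmat n m)"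
   by (rule lmat.borel_measurable_lebesgue_integral) (use mf in measurable)
  show "(\<lambda>a. gpow s a * kap s) \<in> borel_measurable (lmat n m)"
   using measurable_gpow by simp
  show "AE a in lmat n m. (\<integral>b. ?f (a, b) \<partial>lmat n 1) = gpow s a * kap s"
   by (rule AE_mp[OF AEn], rule AE_I2) (use fib[OF sp] in "auto simp: has_bochner_integral_iff")
 qed
 also have "... = gint n m s * kap s" using IH[OF sp] by (simp add: has_bochner_integral_iff)
 also have "... = gint n (Suc m) s"
  using n by (simp add: gint_def kap_def)
 also have "... = gint n (m + 1) s" by (simp add: Suc_eq_plus1)
 finally have val: "integral\<^sup>L (lmat n m \<Otimes>\<^sub>M lmat n 1) ?f = gint n (m + 1) s"
  using lmat_pair.integral_fst'[OF int] by simp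
 have "has_bochner_integral (distr (lmat n m \<Otimes>\<^sub>M lmat n 1) (borel_mat n (m + 1)) (\<lambda>(a, b). a @\<^sub>c b)) (gpow s) (gint n (m + 1) s)"
  by (rule has_bochner_integral_distr[OF measurable_gpow measurable_append_cols_pair])
   (use int val in "simp add: has_bochner_integral_iff case_prod_unfold")
 then show ?case unfolding lmat_cols by (simp add: Suc_eq_plus1)
qed

text \<open>The value of \<open>gint\<close> at a real exponent as a real number, for use with
  nonnegative integrals.\<close>

definition Kr :: "nat => nat => real => real" where
 "Kr n m s = (\<Prod>j<m. sqrt pi ^ n * Gamma ((real n - real j + s) / 2) / Gamma ((real n - real j) / 2))"

lemma gint_of_real: "gint n m (of_real s) = of_real (Kr n m s)"
 unfolding gint_def Kr_def of_real_prod
 by (intro prod.cong refl) (simp add: Gamma_complex_of_real[symmetric] del: Gamma_complex_of_real)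

lemma Kr_pos:
 assumes "m \<le> n" "real m - 1 - real n < s"
 shows "0 < Kr n m s"
 unfolding Kr_def
proof (rule prod_pos)
 fix j assume "j \<in> {..<m}"
 then have "j < n" "0 < real n - real j + s" using assms by auto
 then show "0 < sqrt pi ^ n * Gamma ((real n - real j + s) / 2) / Gamma ((real n - real j) / 2)"
  by (intro divide_pos_pos mult_pos_pos Gamma_real_pos) auto
qed

lemma nn_gauss_powr:
 assumes "m \<le> n" "real m - 1 - real n < s"
 shows "(\<integral>\<^sup>+y. egauss y * epow y s \<partial>lmat n m) = ennreal (Kr n m s)"
proof -
 have "has_bochner_integral (lmat n m) (gpow (of_real s)) (gint n m (of_real s))"
  by (rule gpow_integral) (use assms in auto)
 then have "has_bochner_integral (lmat n m) (\<lambda>y. Re (gpow (of_real s) y)) (Re (gint n m (of_real s)))"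
  by (rule has_bochner_integral_Re)
 moreover have "gint n m (of_real s) = of_real (Kr n m s)" by (rule gint_of_real)
 moreover have "Re (gpow (of_real s) y) = exp (- sqn y) * mat_abs y powr s" if "y \<in> carrier_mat n m" for y
  using norm_gpow[OF that, of "of_real s"] by simp
 ultimately have *: "has_bochner_integral (lmat n m) (\<lambda>y. exp (- sqn y) * mat_abs y powr s) (Kr n m s)"
  by (subst (asm) has_bochner_integral_cong[OF refl _ refl]) auto
 have "(\<integral>\<^sup>+y. egauss y * epow y s \<partial>lmat n m) = (\<integral>\<^sup>+y. ennreal (exp (- sqn y) * mat_abs y powr s) \<partial>lmat n m)"
  by (intro nn_integral_cong) (simp add: ennreal_mult)
 also have "... = ennreal (Kr n m s)"
  using * by (subst nn_integral_eq_integral) (auto simp: has_bochner_integral_iff)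
 finally show ?thesis .
qed

text \<open>The Gaussian constant of \<open>polar_raw\<close> is now known, and the determinant
  power becomes an \<open>epow\<close>; the two differ only for singular \<open>T\<close> when
  \<open>l = 0\<close>.\<close>

lemma polar:
 assumes F: "F \<in> borel_fun (m + l) m"
  and inv: "\<And>g y. g \<in> orth_group (m + l) ==> y \<in> carrier_mat (m + l) m ==> F (g * y) = F y"
 shows "ennreal (Kr m m (real l)) * (\<integral>\<^sup>+y. F y \<partial>lmat (m + l) m) =
  ennreal (sqrt pi ^ ((m + l) * m)) * (\<integral>\<^sup>+T. F (T @\<^sub>r 0\<^sub>m l m) * epow T (real l) \<partial>lmat m m)"
proof -
 have e: "AE T in lmat m m. ennreal (\<bar>det T\<bar> ^ l) = epow T (real l)"
  by (rule AE_mp[OF AE_det_nonzero], rule AE_I2) (auto simp: mat_abs_square powr_realpow)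
 have "(\<integral>\<^sup>+T. egauss T * ennreal (\<bar>det T\<bar> ^ l) \<partial>lmat m m) = ennreal (Kr m m (real l))"
  using nn_gauss_powr[of m m "real l"]
  by (subst nn_integral_cong_AE[OF AE_mp[OF e]]) (auto intro!: AE_I2)
 moreover have "(\<integral>\<^sup>+T. F (T @\<^sub>r 0\<^sub>m l m) * ennreal (\<bar>det T\<bar> ^ l) \<partial>lmat m m) =
   (\<integral>\<^sup>+T. F (T @\<^sub>r 0\<^sub>m l m) * epow T (real l) \<partial>lmat m m)"
  by (rule nn_integral_cong_AE, rule AE_mp[OF e], rule AE_I2) simp
 ultimately show ?thesis using polar_raw[OF F inv] by simp
qed

section \<open>Averages over the orthogonal group\<close>

lemma sigma_finite_stf: "r \<le> n ==> sigma_finite_measure (stf n r)"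
 using stfD(1) prob_space_imp_sigma_finite by blast

lemma pair_sigma_finite_stf: "pair_sigma_finite (lmat k l) (stf n n)"
 using sigma_finite_stf[of n n] sigma_finite_lmat by (simp add: pair_sigma_finite_def)

lemma emeasure_stf_space: "emeasure (stf n n) (space (stf n n)) = 1"
 using prob_space.emeasure_space_1[OF haarD(1)] .

lemma nn_integral_stf_const [simp]: "(\<integral>\<^sup>+h. c \<partial>stf n n) = c"
 by (simp add: emeasure_stf_space)

lemma measurable_fst_stf: "fst \<in> stf n n \<Otimes>\<^sub>M N \<rightarrow>\<^sub>M borel_mat n n"
 by (rule mcomp[OF measurable_fst, of "\<lambda>x. x", simplified]) (use measurable_stf[of n n "\<lambda>x. x"] in simp)

lemma measurable_snd_stf: "snd \<in> N \<Otimes>\<^sub>M stf n n \<rightarrow>\<^sub>M borel_mat n n"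
 by (rule mcomp[OF measurable_snd, of "\<lambda>x. x", simplified]) (use measurable_stf[of n n "\<lambda>x. x"] in simp)

lemma measurable_to_lmat: "measurable N (lmat n m) = measurable N (borel_mat n m)"
 by (rule measurable_cong_sets) auto

lemma measurable_lmat_stf:
 "measurable (lmat n m \<Otimes>\<^sub>M stf k l) N = measurable (borel_mat n m \<Otimes>\<^sub>M stf k l) N"
 by (rule measurable_cong_sets) (auto intro!: sets_pair_measure_cong)

lemma measurable_fst_lmat: "fst \<in> lmat n m \<Otimes>\<^sub>M N \<rightarrow>\<^sub>M borel_mat n m"
 using measurable_fst[of "lmat n m" N] unfolding measurable_to_lmat .

lemma measurable_snd_lmat: "snd \<in> N \<Otimes>\<^sub>M lmat n m \<rightarrow>\<^sub>M borel_mat n m"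
 using measurable_snd[of N "lmat n m"] unfolding measurable_to_lmat .

definition havg :: "nat => (real mat => ennreal) => real mat => ennreal" where
 "havg n F y = (\<integral>\<^sup>+h. F (h * y) \<partial>stf n n)"

lemma measurable_havg_pair:
 assumes F: "F \<in> borel_fun n m"
 shows "(\<lambda>(y, h). F (h * y)) \<in> borel_measurable (borel_mat n m \<Otimes>\<^sub>M stf n n)"
 unfolding case_prod_unfold
 by (rule mcomp[OF measurable_mat_times[OF measurable_snd_stf measurable_fst] F])

lemma measurable_havg:
 assumes F: "F \<in> borel_fun n m"
 shows "havg n F \<in> borel_fun n m"
proof -
 interpret H: sigma_finite_measure "stf n n" by (rule sigma_finite_stf) simp
 have "(\<lambda>y. \<integral>\<^sup>+h. (\<lambda>(y, h). F (h * y)) (y, h) \<partial>stf n n) \<in> borel_fun n m"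
  by (rule H.borel_measurable_nn_integral_fst[OF measurable_havg_pair[OF F]])
 then show ?thesis by (simp add: havg_def[abs_def])
qed

lemma havg_orth:
 assumes F: "F \<in> borel_fun n m" and g: "g \<in> orth_group n" and y: "y \<in> carrier_mat n m"
 shows "havg n F (g * y) = havg n F y"
proof -
 have Fy: "(\<lambda>h. F (h * y)) \<in> borel_fun n n"
  by (rule measurable_mat_mult_right[OF F y])
 have "havg n F (g * y) = (\<integral>\<^sup>+h. F ((h * g) * y) \<partial>stf n n)"
  unfolding havg_def
  by (rule nn_integral_cong) (use orth_groupD(1) g y in "auto simp: haarD assoc_mult_mat[of _ n n _ n _ m]")
 also have "... = havg n F y"
  unfolding havg_def by (rule nn_integral_haar_right[OF g Fy])
 finally show ?thesis .
qed

text \<open>Lebesgue measure and \<open>W\<close> are both rotation invariant, so after exchanging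
  the integrals every rotation gives the same inner integral.\<close>

lemma nn_integral_havg:
 assumes F: "F \<in> borel_fun n m" and W: "W \<in> borel_fun n m"
  and inv: "\<And>g y. g \<in> orth_group n ==> y \<in> carrier_mat n m ==> W (g * y) = W y"
 shows "(\<integral>\<^sup>+y. havg n F y * W y \<partial>lmat n m) = (\<integral>\<^sup>+y. F y * W y \<partial>lmat n m)"
proof -
 interpret P: pair_sigma_finite "lmat n m" "stf n n" by (rule pair_sigma_finite_stf)
 have FW: "(\<lambda>y. F y * W y) \<in> borel_fun n m"
  by (intro times_ennreal F W)
 have mp: "(\<lambda>(y, h). F (h * y) * W (h * y)) \<in> borel_measurable (lmat n m \<Otimes>\<^sub>M stf n n)"
  using measurable_havg_pair[OF FW] by (simp add: case_prod_unfold measurable_lmat_stf)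
 have "(\<integral>\<^sup>+y. havg n F y * W y \<partial>lmat n m) = (\<integral>\<^sup>+y. \<integral>\<^sup>+h. F (h * y) * W (h * y) \<partial>stf n n \<partial>lmat n m)"
 proof (rule lmat_cong)
  fix y :: "real mat" assume y: "y \<in> carrier_mat n m"
  have "havg n F y * W y = (\<integral>\<^sup>+h. F (h * y) * W y \<partial>stf n n)"
   unfolding havg_def
   by (rule nn_integral_multc[symmetric], rule measurable_stf[OF order_refl measurable_mat_mult_right[OF F y]])
  also have "... = (\<integral>\<^sup>+h. F (h * y) * W (h * y) \<partial>stf n n)"
   by (rule nn_integral_cong) (simp add: haarD inv[OF _ y])
  finally show "havg n F y * W y = (\<integral>\<^sup>+h. F (h * y) * W (h * y) \<partial>stf n n)" .
 qed
 also have "... = (\<integral>\<^sup>+h. \<integral>\<^sup>+y. F (h * y) * W (h * y) \<partial>lmat n m \<partial>stf n n)"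
  by (rule P.Fubini'[OF mp, symmetric])
 also have "... = (\<integral>\<^sup>+h. \<integral>\<^sup>+y. F y * W y \<partial>lmat n m \<partial>stf n n)"
  by (rule nn_integral_cong) (simp add: haarD nn_integral_lmat_orth[OF _ FW])
 finally show ?thesis unfolding nn_integral_stf_const .
qed

lemma orth_diag:
 assumes "g \<in> orth_group k" "h \<in> orth_group l"
 shows "four_block_mat g (0\<^sub>m k l) (0\<^sub>m l k) h \<in> orth_group (k + l)"
proof -
 note g = orth_groupD[OF assms(1)] and h = orth_groupD[OF assms(2)]
 have "(four_block_mat g (0\<^sub>m k l) (0\<^sub>m l k) h)\<^sup>T * four_block_mat g (0\<^sub>m k l) (0\<^sub>m l k) h = 1\<^sub>m (k + l)"
  by (subst transpose_four_block_mat[of _ k k _ l _ l], use g h in auto,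
    subst mult_four_block_mat[of _ k k _ l _ l _ _ k _ l], use g h in auto)
 then show ?thesis using g h by (simp add: orth_group_def)
qed

lemma diag_mult_append_rows:
 fixes g :: "real mat"
 assumes "g \<in> carrier_mat k k" "h \<in> carrier_mat l l" "a \<in> carrier_mat k m" "b \<in> carrier_mat l m"
 shows "four_block_mat g (0\<^sub>m k l) (0\<^sub>m l k) h * (a @\<^sub>r b) = (g * a) @\<^sub>r (h * b)"
 by (subst four_block_mult_append_rows[of _ k k _ l _ l _ _ m]) (use assms in auto)

lemma mat_abs_powr_orth:
 "g \<in> orth_group n ==> y \<in> carrier_mat n m ==> epow (g * y) s = epow y s"
 by (simp add: mat_abs_orth)

lemma Kr_zero: "m \<le> l ==> Kr l m 0 = sqrt pi ^ (l * m)"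
proof -
 assume "m \<le> l"
 then have "Kr l m 0 = (\<Prod>j<m. sqrt pi ^ l)"
  unfolding Kr_def
 proof (intro prod.cong refl)
  fix j assume "j \<in> {..<m}"
  then have "0 < Gamma ((real l - real j) / 2)" using \<open>m \<le> l\<close> by (intro Gamma_real_pos) auto
  then show "sqrt pi ^ l * Gamma ((real l - real j + 0) / 2) / Gamma ((real l - real j) / 2) = sqrt pi ^ l" by simp
 qed
 then show ?thesis by (simp add: power_mult)
qed

text \<open>Factor by factor, \<open>n + (l - n) = l\<close> and \<open>m + (l - m) = l\<close> give
  the same numerator \<open>Gamma ((l - j)/2)\<close>, and \<open>Gamma ((n - j)/2)\<close> cancels
  on the left.\<close>

lemma Kr_ratio:
 assumes "m \<le> l" "l \<le> n"
 shows "Kr n m (real l - real n) * Kr m m (real (n - m)) = sqrt pi ^ (n * m) * Kr m m (real (l - m))"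
proof -
 have "sqrt pi ^ (n * m) = (\<Prod>j<m. sqrt pi ^ n)" by (simp add: power_mult)
 then show ?thesis
  unfolding Kr_def prod.distrib[symmetric]
 proof (simp only: prod.distrib[symmetric], intro prod.cong refl)
  fix j assume "j \<in> {..<m}"
  then have "0 < Gamma ((real n - real j) / 2)" using assms by (intro Gamma_real_pos) auto
  then show "sqrt pi ^ n * Gamma ((real n - real j + (real l - real n)) / 2) / Gamma ((real n - real j) / 2) *
    (sqrt pi ^ m * Gamma ((real m - real j + real (n - m)) / 2) / Gamma ((real m - real j) / 2)) =
    sqrt pi ^ n * (sqrt pi ^ m * Gamma ((real m - real j + real (l - m)) / 2) / Gamma ((real m - real j) / 2))"
   using assms by (simp add: of_nat_diff)
 qed
qed

text \<open>Both sides reduce to one integral \<open>X\<close> over square matrices, by polar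
  decomposition of \<open>l\<close> by \<open>m\<close> and of \<open>n\<close> by \<open>m\<close>
  matrices; the exponents match since \<open>(l - n) + (n - m) = l - m\<close>. This is why the two
  formulas for a Riesz potential agree when both apply.\<close>

lemma haar_polar:
 assumes ml: "m \<le> l" and ln: "l \<le> n" and F: "F \<in> borel_fun n m"
 shows "ennreal (Kr n m (real l - real n)) * (\<integral>\<^sup>+\<omega>. havg n F (\<omega> @\<^sub>r 0\<^sub>m (n - l) m) \<partial>lmat l m) =
  ennreal (Kr l m 0) * (\<integral>\<^sup>+y. F y * epow y (real l - real n) \<partial>lmat n m)"
proof -
 define q where "q = l - m"
 define r where "r = n - l"
 have l: "l = m + q" and n: "n = m + (q + r)" and n': "n = l + r" using ml ln by (auto simp: q_def r_def)
 let ?w = "\<lambda>y. epow y (real l - real n)"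
 define X where "X = (\<integral>\<^sup>+T. havg n F (T @\<^sub>r 0\<^sub>m (q + r) m) * epow T (real q) \<partial>lmat m m)"
 let ?L = "\<integral>\<^sup>+\<omega>. havg n F (\<omega> @\<^sub>r 0\<^sub>m r m) \<partial>lmat l m"
 let ?R = "\<integral>\<^sup>+y. F y * ?w y \<partial>lmat n m"
 have mh: "havg n F \<in> borel_fun n m" by (rule measurable_havg[OF F])
 have mG: "(\<lambda>\<omega>. havg n F (\<omega> @\<^sub>r 0\<^sub>m r m)) \<in> borel_fun (m + q) m"
  by (rule measurable_pad) (use mh n in "simp add: add.assoc")
 have A: "ennreal (Kr m m (real q)) * ?L = ennreal (sqrt pi ^ (l * m)) * X"
 proof -
  have "ennreal (Kr m m (real q)) * (\<integral>\<^sup>+\<omega>. havg n F (\<omega> @\<^sub>r 0\<^sub>m r m) \<partial>lmat (m + q) m) =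
   ennreal (sqrt pi ^ ((m + q) * m)) * (\<integral>\<^sup>+T. havg n F ((T @\<^sub>r 0\<^sub>m q m) @\<^sub>r 0\<^sub>m r m) * epow T (real q) \<partial>lmat m m)"
  proof (rule polar[OF mG])
   fix g and y :: "real mat" assume g: "g \<in> orth_group (m + q)" and y: "y \<in> carrier_mat (m + q) m"
   \<comment> \<open>A rotation of the upper \<open>l\<close> rows extends by the identity to a
     rotation of all \<open>n\<close> rows, under which the average is invariant.\<close>
   let ?g = "four_block_mat g (0\<^sub>m (m + q) r) (0\<^sub>m r (m + q)) (1\<^sub>m r)"
   have g': "?g \<in> orth_group n" using orth_diag[OF g one_orth_group[of r]] n by (simp add: add.assoc)
   have "(g * y) @\<^sub>r 0\<^sub>m r m = ?g * (y @\<^sub>r 0\<^sub>m r m)"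
    using diag_mult_append_rows[of g "m + q" "1\<^sub>m r" r y m "0\<^sub>m r m"] orth_groupD(1)[OF g] y by simp
   moreover have "y @\<^sub>r 0\<^sub>m r m \<in> carrier_mat n m"
    using carrier_append_rows[OF y zero_carrier_mat[of r m]] n by (simp add: add.assoc)
   ultimately show "havg n F ((g * y) @\<^sub>r 0\<^sub>m r m) = havg n F (y @\<^sub>r 0\<^sub>m r m)"
    using havg_orth[OF F g'] by simp
  qed
  also have "(\<integral>\<^sup>+T. havg n F ((T @\<^sub>r 0\<^sub>m q m) @\<^sub>r 0\<^sub>m r m) * epow T (real q) \<partial>lmat m m) = X"
   unfolding X_def
  proof (rule lmat_cong)
   fix T :: "real mat" assume T: "T \<in> carrier_mat m m"
   have "(T @\<^sub>r 0\<^sub>m q m) @\<^sub>r 0\<^sub>m r m = T @\<^sub>r (0\<^sub>m q m @\<^sub>r 0\<^sub>m r m)"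
    by (rule append_rows_assoc[OF T]) auto
   also have "0\<^sub>m q m @\<^sub>r 0\<^sub>m r m = 0\<^sub>m (q + r) m" by (simp add: append_rows_def)
   finally show "havg n F ((T @\<^sub>r 0\<^sub>m q m) @\<^sub>r 0\<^sub>m r m) * epow T (real q) =
     havg n F (T @\<^sub>r 0\<^sub>m (q + r) m) * epow T (real q)" by simp
  qed
  finally show ?thesis unfolding l .
 qed
 have B: "ennreal (Kr m m (real (q + r))) * ?R = ennreal (sqrt pi ^ (n * m)) * X"
 proof -
  have mW: "?w \<in> borel_fun n m" by (rule measurable_mat_abs_powr)
  have "?R = (\<integral>\<^sup>+y. havg n F y * ?w y \<partial>lmat n m)"
   by (rule nn_integral_havg[OF F mW mat_abs_powr_orth, symmetric])
  then have "ennreal (Kr m m (real (q + r))) * ?R = ennreal (Kr m m (real (q + r))) * (\<integral>\<^sup>+y. havg n F y * ?w y \<partial>lmat (m + (q + r)) m)"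
   by (simp add: n)
  also have "... = ennreal (sqrt pi ^ ((m + (q + r)) * m)) *
   (\<integral>\<^sup>+T. (havg n F (T @\<^sub>r 0\<^sub>m (q + r) m) * ?w (T @\<^sub>r 0\<^sub>m (q + r) m)) * epow T (real (q + r)) \<partial>lmat m m)"
  proof (rule polar)
   show "(\<lambda>y. havg n F y * ?w y) \<in> borel_fun (m + (q + r)) m"
    using mh mW unfolding n[symmetric] by (intro times_ennreal)
   show "havg n F (g * y) * ?w (g * y) = havg n F y * ?w y"
    if "g \<in> orth_group (m + (q + r))" "y \<in> carrier_mat (m + (q + r)) m" for g y
    using that havg_orth[OF F, of g y] mat_abs_orth[of g n y m] unfolding n[symmetric] by simp
  qed
  also have "(\<integral>\<^sup>+T. (havg n F (T @\<^sub>r 0\<^sub>m (q + r) m) * ?w (T @\<^sub>r 0\<^sub>m (q + r) m)) * epow T (real (q + r)) \<partial>lmat m m) = X"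
   unfolding X_def
  proof (rule nn_integral_cong_AE, rule AE_mp[OF AE_nonsingular[of m m]], simp, rule AE_I2, rule impI)
   fix T assume "T \<in> space (lmat m m)" and T0: "mat_abs T \<noteq> 0"
   then have T: "T \<in> carrier_mat m m" by simp
   have "mat_abs T powr (real l - real n) * mat_abs T powr real (q + r) = mat_abs T powr real q"
    using T0 l n by (simp add: powr_add[symmetric])
   then show "(havg n F (T @\<^sub>r 0\<^sub>m (q + r) m) * ?w (T @\<^sub>r 0\<^sub>m (q + r) m)) * epow T (real (q + r)) =
    havg n F (T @\<^sub>r 0\<^sub>m (q + r) m) * epow T (real q)"
    by (simp add: mat_abs_append_zero[OF T] mult.assoc ennreal_mult[symmetric])
  qed
  finally show ?thesis unfolding n[symmetric] .
 qed
 have pos: "0 < Kr m m (real q)" "0 < Kr m m (real (q + r))" by (auto intro!: Kr_pos)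
 have posn: "0 < Kr n m (real l - real n)" by (rule Kr_pos) (use ml ln in auto)
 have ratio: "Kr n m (real l - real n) * Kr m m (real (q + r)) = sqrt pi ^ (n * m) * Kr m m (real q)"
  using Kr_ratio[OF ml ln] l n by simp
 have "?L = ennreal (1 / Kr m m (real q)) * (ennreal (sqrt pi ^ (l * m)) * X)"
  by (rule nn_integral_eq_imp_inverse[OF A pos(1)])
 then have "ennreal (Kr n m (real l - real n)) * ?L = ennreal (Kr n m (real l - real n) * (1 / Kr m m (real q)) * sqrt pi ^ (l * m)) * X"
  using posn pos by (simp add: ennreal_mult[symmetric] mult.assoc[symmetric])
 also have "Kr n m (real l - real n) * (1 / Kr m m (real q)) = 1 / Kr m m (real (q + r)) * sqrt pi ^ (n * m)"
  using ratio pos by (simp add: field_simps)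
 also have "ennreal (1 / Kr m m (real (q + r)) * sqrt pi ^ (n * m) * sqrt pi ^ (l * m)) * X =
   ennreal (sqrt pi ^ (l * m)) * (ennreal (1 / Kr m m (real (q + r))) * (ennreal (sqrt pi ^ (n * m)) * X))"
  using pos by (simp add: ennreal_mult[symmetric] mult.assoc[symmetric] ac_simps)
 also have "ennreal (1 / Kr m m (real (q + r))) * (ennreal (sqrt pi ^ (n * m)) * X) = ?R"
  by (rule nn_integral_eq_imp_inverse[OF B pos(2), symmetric])
 finally show ?thesis using Kr_zero[OF ml] by (simp add: r_def)
qed

section \<open>The last rows of a rotated matrix\<close>

definition low_frame :: "nat => nat => real mat" where
 "low_frame k q = 0\<^sub>m k q @\<^sub>r 1\<^sub>m q"

lemma low_frame_carrier [simp]: "low_frame k q \<in> carrier_mat (k + q) q"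
 unfolding low_frame_def by auto

lemma low_frame_stiefel: "low_frame k q \<in> stiefel (k + q) q"
 unfolding stiefel_def low_frame_def using gram_append_rows[of "0\<^sub>m k q" k q "1\<^sub>m q" q] by auto

lemma low_frame_mult:
 assumes "a \<in> carrier_mat k m" "b \<in> carrier_mat q m"
 shows "(low_frame k q)\<^sup>T * (a @\<^sub>r b) = b"
 unfolding low_frame_def
 by (subst transpose_append_rows[of _ k q _ q], simp, simp, subst append_cols_mult_append_rows[of _ q k _ q _ m]) (use assms in auto)

text \<open>With \<xi> = \<open>g * low_frame k q\<close> this is \<open>\<xi>' y\<close>, the
  parameter of the plane through \<open>y\<close> with normal frame \<xi>.\<close>

definition bot :: "nat => nat => real mat => real mat => real mat" where
 "bot k q g y = (low_frame k q)\<^sup>T * (g\<^sup>T * y)"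

lemma bot_carrier:
 assumes "g \<in> carrier_mat (k + q) (k + q)" "y \<in> carrier_mat (k + q) m"
 shows "bot k q g y \<in> carrier_mat q m"
 unfolding bot_def using assms by (intro mult_carrier_mat[of _ q "k + q"]) auto

lemma measurable_bot:
 assumes "f \<in> M \<rightarrow>\<^sub>M borel_mat (k + q) (k + q)" "f' \<in> M \<rightarrow>\<^sub>M borel_mat (k + q) m"
 shows "(\<lambda>x. bot k q (f x) (f' x)) \<in> M \<rightarrow>\<^sub>M borel_mat q m"
 unfolding bot_def
 by (intro measurable_mat_times[where k="k + q"] measurable_mat_transpose assms measurable_const) simp

lemma mat_abs_bot_decomp:
 assumes h: "h \<in> orth_group (k + q)" and T: "T \<in> carrier_mat m m" and g: "g \<in> carrier_mat (k + q) (k + q)"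
  and I: "I0 \<in> carrier_mat (k + q) m"
 shows "mat_abs (bot k q (h * g) (h * (I0 * T))) = mat_abs (bot k q g I0) * \<bar>det T\<bar>"
proof -
 note hc = orth_groupD(1)[OF h]
 have IT: "I0 * T \<in> carrier_mat (k + q) m" using I T by auto
 have "(h * g)\<^sup>T * (h * (I0 * T)) = g\<^sup>T * (h\<^sup>T * (h * (I0 * T)))"
  using transpose_mult[OF hc g] hc g IT by (simp add: assoc_mult_mat[of _ "k + q" "k + q" _ "k + q" _ m])
 also have "... = g\<^sup>T * (I0 * T)" using orth_cancel(1)[OF h IT] by simp
 also have "... = g\<^sup>T * I0 * T" by (rule assoc_mult_mat[symmetric, of _ "k + q" "k + q" _ m _ m]) (use g I T in auto)
 finally have "bot k q (h * g) (h * (I0 * T)) = (low_frame k q)\<^sup>T * (g\<^sup>T * I0 * T)" by (simp add: bot_def)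
 also have "... = bot k q g I0 * T"
  unfolding bot_def by (rule assoc_mult_mat[symmetric, of _ q "k + q" _ m _ m]) (use g I T in auto)
 finally show ?thesis using mat_abs_mult_right[OF bot_carrier[OF g I] T] by simp
qed

lemma base_frame_mult:
 assumes "T \<in> carrier_mat m m"
 shows "base_frame (m + l) m * T = T @\<^sub>r 0\<^sub>m l m"
 unfolding base_frame_def using append_rows_mult[of T m m "1\<^sub>m m" m "0\<^sub>m l m" l] assms by simp

lemma base_frame_carrier: "base_frame (m + l) m \<in> carrier_mat (m + l) m"
 unfolding base_frame_def by auto

context
 fixes k q m :: nat
 assumes mq: "m \<le> q"
begin

abbreviation (input) "nn \<equiv> k + q"

lemma frame_carrier: "base_frame nn m \<in> carrier_mat nn m"
 using base_frame_carrier[of m "nn - m"] mq by simp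

lemma nonsingular_decomp:
 assumes "y \<in> carrier_mat nn m" "mat_abs y \<noteq> 0"
 shows "\<exists>h T. h \<in> orth_group nn \<and> T \<in> carrier_mat m m \<and> y = h * (base_frame nn m * T) \<and> mat_abs y = \<bar>det T\<bar>"
proof -
 define l where "l = nn - m"
 have n: "nn = m + l" using mq by (simp add: l_def)
 obtain h T where "h \<in> orth_group (m + l)" "T \<in> carrier_mat m m" "y = h * (T @\<^sub>r 0\<^sub>m l m)" "mat_abs y = \<bar>det T\<bar>"
  using QR_nonsingular[of y m l] assms unfolding n by blast
 then show ?thesis unfolding n by (intro exI[of _ h] exI[of _ T]) (simp add: base_frame_mult)
qed

text \<open>Write \<open>y = h I T\<close> with \<open>I\<close> the base frame. Left invariance of
  Haar measure absorbs \<open>h\<close>, and right multiplication by \<open>T\<close> pulls out a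
  power of \<open>\<bar>det T\<bar> = mat_abs y\<close>.\<close>

lemma nn_bot_average:
 assumes y: "y \<in> carrier_mat nn m" "mat_abs y \<noteq> 0"
 shows "(\<integral>\<^sup>+g. epow (bot k q g y) s \<partial>stf nn nn) =
  epow y s * (\<integral>\<^sup>+g. epow (bot k q g (base_frame nn m)) s \<partial>stf nn nn)"
proof -
 obtain h T where hT: "h \<in> orth_group nn" "T \<in> carrier_mat m m" "y = h * (base_frame nn m * T)" "mat_abs y = \<bar>det T\<bar>"
  using nonsingular_decomp[OF y] by blast
 have mb: "(\<lambda>g. epow (bot k q g z) s) \<in> borel_fun nn nn" if "z \<in> carrier_mat nn m" for z
  by (rule mcomp[OF measurable_bot[where m=m] measurable_mat_abs_powr]) (use that in auto)
 have "(\<integral>\<^sup>+g. epow (bot k q g y) s \<partial>stf nn nn) = (\<integral>\<^sup>+g. epow (bot k q (h * g) y) s \<partial>stf nn nn)"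
  by (rule nn_integral_haar_left[OF hT(1) mb[OF y(1)], symmetric])
 also have "... = (\<integral>\<^sup>+g. epow y s * epow (bot k q g (base_frame nn m)) s \<partial>stf nn nn)"
 proof (rule nn_integral_cong)
  fix g assume "g \<in> space (stf nn nn)"
  then have g: "g \<in> carrier_mat nn nn" using orth_groupD(1) by (simp add: haarD)
  have "mat_abs (bot k q (h * g) y) = mat_abs (bot k q g (base_frame nn m)) * mat_abs y"
   unfolding hT(4) unfolding hT(3) by (rule mat_abs_bot_decomp[OF hT(1,2) g frame_carrier])
  then show "epow (bot k q (h * g) y) s =
    epow y s * epow (bot k q g (base_frame nn m)) s"
   using mat_abs_nonneg[OF y(1)] mat_abs_nonneg[OF bot_carrier[OF g frame_carrier]]
   by (simp add: powr_mult ennreal_mult mult.commute)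
 qed
 also have "... = epow y s * (\<integral>\<^sup>+g. epow (bot k q g (base_frame nn m)) s \<partial>stf nn nn)"
  by (rule nn_integral_cmult, rule measurable_stf[OF order_refl mb[OF frame_carrier]])
 finally show ?thesis .
qed

end

lemma measurable_haar_mult:
 assumes g: "g \<in> orth_group n"
 shows "(\<lambda>h. g * h) \<in> stf n n \<rightarrow>\<^sub>M stf n n"
 by (rule measurable_orth_action[OF stfD(2) g]) simp

lemma distr_haar_left:
 assumes g: "g \<in> orth_group n"
 shows "distr (stf n n) (stf n n) (\<lambda>h. g * h) = stf n n"
 using invariant_probD(4)[OF invariant_prob_stf g, of n] by simp

context
 fixes k q m :: nat
 assumes mq: "m \<le> q"
begin

definition bmean :: "complex => complex" where
 "bmean s = (\<integral>g. of_real (mat_abs (bot k q g (base_frame (k + q) m))) powr s \<partial>stf (k + q) (k + q))"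

lemma bot_average:
 assumes y: "y \<in> carrier_mat (k + q) m" "mat_abs y \<noteq> 0"
 shows "(\<integral>g. of_real (mat_abs (bot k q g y)) powr s \<partial>stf (k + q) (k + q)) = of_real (mat_abs y) powr s * bmean s"
proof -
 let ?n = "k + q"
 obtain h T where hT: "h \<in> orth_group ?n" "T \<in> carrier_mat m m" "y = h * (base_frame ?n m * T)" "mat_abs y = \<bar>det T\<bar>"
  using nonsingular_decomp[OF mq y] by blast
 note fc = frame_carrier[OF mq, of k]
 have mb: "(\<lambda>g. complex_of_real (mat_abs (bot k q g y)) powr s) \<in> borel_fun ?n ?n"
  by (rule mcomp[OF measurable_bot[where m=m] measurable_mat_abs_cpowr]) (use y in auto)
 have "(\<integral>g. of_real (mat_abs (bot k q g y)) powr s \<partial>stf ?n ?n) = (\<integral>g. of_real (mat_abs (bot k q g y)) powr s \<partial>distr (stf ?n ?n) (stf ?n ?n) (\<lambda>g. h * g))"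
  by (simp add: distr_haar_left[OF hT(1)])
 also have "... = (\<integral>g. of_real (mat_abs (bot k q (h * g) y)) powr s \<partial>stf ?n ?n)"
  by (rule integral_distr[OF measurable_haar_mult[OF hT(1)]]) (rule measurable_stf[OF order_refl mb])
 also have "... = (\<integral>g. of_real (mat_abs y) powr s * of_real (mat_abs (bot k q g (base_frame ?n m))) powr s \<partial>stf ?n ?n)"
 proof (rule Bochner_Integration.integral_cong[OF refl])
  fix g assume "g \<in> space (stf ?n ?n)"
  then have g: "g \<in> carrier_mat ?n ?n" using orth_groupD(1) by (simp add: haarD)
  have "mat_abs (bot k q (h * g) y) = mat_abs (bot k q g (base_frame ?n m)) * mat_abs y"
   unfolding hT(4) unfolding hT(3) by (rule mat_abs_bot_decomp[OF hT(1,2) g fc])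
  then show "complex_of_real (mat_abs (bot k q (h * g) y)) powr s =
    of_real (mat_abs y) powr s * of_real (mat_abs (bot k q g (base_frame ?n m))) powr s"
   using mat_abs_nonneg[OF y(1)] mat_abs_nonneg[OF bot_carrier[OF g fc]]
   by (simp add: powr_times_real mult.commute)
 qed
 also have "... = of_real (mat_abs y) powr s * bmean s" unfolding bmean_def by simp
 finally show ?thesis .
qed

abbreviation (input) "P1 \<equiv> stf (k + q) (k + q) \<Otimes>\<^sub>M (lmat q m \<Otimes>\<^sub>M lmat k m)"

abbreviation (input) "rotpair \<equiv> (\<lambda>(g, b, a). (g * (a @\<^sub>r b), g))"

lemma measurable_rot: "(\<lambda>(g, b, a). g * (a @\<^sub>r b)) \<in> P1 \<rightarrow>\<^sub>M borel_mat (k + q) m"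
 unfolding case_prod_unfold
 by (intro measurable_mat_times[OF measurable_fst_stf] measurable_append_rows
   mcomp[OF measurable_snd measurable_fst_lmat] mcomp[OF measurable_snd measurable_snd_lmat])

lemma measurable_rotpair: "rotpair \<in> P1 \<rightarrow>\<^sub>M lmat (k + q) m \<Otimes>\<^sub>M stf (k + q) (k + q)"
proof -
 have "(\<lambda>x. (case x of (g, b, a) => g * (a @\<^sub>r b), fst x)) \<in> P1 \<rightarrow>\<^sub>M lmat (k + q) m \<Otimes>\<^sub>M stf (k + q) (k + q)"
  by (intro measurable_Pair measurable_fst) (unfold measurable_to_lmat, rule measurable_rot)
 then show ?thesis by (simp add: case_prod_unfold)
qed

lemma sigma_finite_P1_snd: "sigma_finite_measure (lmat q m \<Otimes>\<^sub>M lmat k m)"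
 by (rule lmat_pair.sigma_finite_measure_axioms)

lemma nn_integral_P1:
 assumes F: "F \<in> borel_measurable P1"
 shows "(\<integral>\<^sup>+z. F z \<partial>P1) = (\<integral>\<^sup>+g. \<integral>\<^sup>+b. \<integral>\<^sup>+a. F (g, b, a) \<partial>lmat k m \<partial>lmat q m \<partial>stf (k + q) (k + q))"
proof -
 have "(\<integral>\<^sup>+z. F z \<partial>P1) = (\<integral>\<^sup>+g. \<integral>\<^sup>+w. F (g, w) \<partial>(lmat q m \<Otimes>\<^sub>M lmat k m) \<partial>stf (k + q) (k + q))"
  by (rule sigma_finite_measure.nn_integral_fst[OF sigma_finite_P1_snd F, symmetric])
 also have "... = (\<integral>\<^sup>+g. \<integral>\<^sup>+b. \<integral>\<^sup>+a. F (g, b, a) \<partial>lmat k m \<partial>lmat q m \<partial>stf (k + q) (k + q))"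
 proof (rule nn_integral_cong)
  fix g assume "g \<in> space (stf (k + q) (k + q))"
  then have "(\<lambda>w. F (g, w)) \<in> borel_measurable (lmat q m \<Otimes>\<^sub>M lmat k m)"
   using measurable_Pair2[OF F] by simp
  from lmat.nn_integral_fst[OF this]
  show "(\<integral>\<^sup>+w. F (g, w) \<partial>(lmat q m \<Otimes>\<^sub>M lmat k m)) = (\<integral>\<^sup>+b. \<integral>\<^sup>+a. F (g, b, a) \<partial>lmat k m \<partial>lmat q m)" by simp
 qed
 finally show ?thesis .
qed

text \<open>For fixed \<open>g\<close> the map \<open>(b, a) -> g (a; b)\<close> preserves Lebesgue
  measure. Keeping \<open>g\<close> as a second component allows \<open>b\<close> to be recovered as
  \<open>bot k q g y\<close>.\<close>

lemma distr_rotpair: "distr P1 (lmat (k + q) m \<Otimes>\<^sub>M stf (k + q) (k + q)) rotpair = lmat (k + q) m \<Otimes>\<^sub>M stf (k + q) (k + q)"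
proof (rule measure_eqI)
 let ?n = "k + q"
 let ?N = "lmat ?n m \<Otimes>\<^sub>M stf ?n ?n"
 interpret P: pair_sigma_finite "lmat ?n m" "stf ?n ?n" by (rule pair_sigma_finite_stf)
 fix A assume "A \<in> sets (distr P1 ?N rotpair)"
 then have A: "A \<in> sets ?N" by simp
 then have iA: "(indicator A :: _ => ennreal) \<in> borel_measurable ?N" by simp
 have "emeasure (distr P1 ?N rotpair) A = (\<integral>\<^sup>+z. indicator A z \<partial>distr P1 ?N rotpair)" using A by simp
 also have "... = (\<integral>\<^sup>+z. indicator A (rotpair z) \<partial>P1)"
  by (rule nn_integral_distr[OF measurable_rotpair]) (use iA in simp)
 also have "... = (\<integral>\<^sup>+g. \<integral>\<^sup>+b. \<integral>\<^sup>+a. indicator A (g * (a @\<^sub>r b), g) \<partial>lmat k m \<partial>lmat q m \<partial>stf ?n ?n)"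
  using nn_integral_P1[OF mcomp[OF measurable_rotpair iA]] by simp
 also have "... = (\<integral>\<^sup>+g. \<integral>\<^sup>+y. indicator A (y, g) \<partial>lmat ?n m \<partial>stf ?n ?n)"
 proof (rule nn_integral_cong)
  fix g assume gs: "g \<in> space (stf ?n ?n)"
  then have g: "g \<in> orth_group ?n" by (simp add: haarD)
  have m: "(\<lambda>y. indicator A (y, g) :: ennreal) \<in> borel_fun ?n m"
   using mcomp[OF measurable_Pair2'[OF gs] iA] by simp
  have "(\<integral>\<^sup>+b. \<integral>\<^sup>+a. indicator A (g * (a @\<^sub>r b), g) \<partial>lmat k m \<partial>lmat q m) = (\<integral>\<^sup>+y. indicator A (g * y, g) \<partial>lmat ?n m)"
   by (rule nn_integral_lmat_rows(2)[symmetric], rule measurable_mat_mult_left[OF m orth_groupD(1)[OF g]])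
  also have "... = (\<integral>\<^sup>+y. indicator A (y, g) \<partial>lmat ?n m)" by (rule nn_integral_lmat_orth[OF g m])
  finally show "(\<integral>\<^sup>+b. \<integral>\<^sup>+a. indicator A (g * (a @\<^sub>r b), g) \<partial>lmat k m \<partial>lmat q m) = (\<integral>\<^sup>+y. indicator A (y, g) \<partial>lmat ?n m)" .
 qed
 also have "... = (\<integral>\<^sup>+z. indicator A z \<partial>?N)" by (rule P.nn_integral_snd) (use iA in simp)
 finally show "emeasure (distr P1 ?N rotpair) A = emeasure ?N A" using A by simp
qed simp

text \<open>A Gaussian integral over pairs \<open>(y, g)\<close> is computed twice: integrating over
  \<open>g\<close> first gives this constant times a positive number, and in the coordinates
  \<open>(g, b, a)\<close> it is a product of finite Gaussian moments.\<close>

lemma nn_bot_const_finite: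
 assumes s: "real m - 1 - real q < s"
 shows "(\<integral>\<^sup>+g. epow (bot k q g (base_frame (k + q) m)) s \<partial>stf (k + q) (k + q)) < \<infinity>"
  (is "?K < \<infinity>")
proof -
 let ?n = "k + q"
 interpret P: pair_sigma_finite "lmat ?n m" "stf ?n ?n" by (rule pair_sigma_finite_stf)
 let ?N = "lmat ?n m \<Otimes>\<^sub>M stf ?n ?n"
 let ?H = "\<lambda>(y, g). egauss y * epow (bot k q g y) s"
 have gk: "(\<integral>\<^sup>+y. egauss y * epow y s \<partial>lmat ?n m) = ennreal (Kr ?n m s)"
  by (rule nn_gauss_powr) (use mq s in auto)
 have mb: "(\<lambda>g. epow (bot k q g y) s) \<in> borel_measurable (stf ?n ?n)" if "y \<in> carrier_mat ?n m" for y
  by (rule measurable_stf[OF order_refl], rule mcomp[OF measurable_bot[where m=m] measurable_mat_abs_powr]) (use that in auto)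
 have mH: "?H \<in> borel_measurable ?N"
  unfolding case_prod_unfold
  by (intro times_ennreal mcomp[OF measurable_fst_lmat measurable_exp_sqn]
    mcomp[OF measurable_bot[OF measurable_snd_stf measurable_fst_lmat] measurable_mat_abs_powr])
 have "(\<integral>\<^sup>+z. ?H z \<partial>?N) = (\<integral>\<^sup>+y. \<integral>\<^sup>+g. ?H (y, g) \<partial>stf ?n ?n \<partial>lmat ?n m)"
  by (rule P.M2.nn_integral_fst[OF mH, symmetric])
 also have "... = (\<integral>\<^sup>+y. egauss y * epow y s * ?K \<partial>lmat ?n m)"
 proof (rule nn_integral_cong_AE, rule AE_mp[OF AE_nonsingular[of m ?n]], use mq in simp, rule AE_I2, rule impI)
  fix y assume "y \<in> space (lmat ?n m)" and y0: "mat_abs y \<noteq> 0"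
  then have y: "y \<in> carrier_mat ?n m" by simp
  show "(\<integral>\<^sup>+g. ?H (y, g) \<partial>stf ?n ?n) = egauss y * epow y s * ?K"
   using nn_integral_cmult[OF mb[OF y], of "egauss y"] nn_bot_average[OF mq y y0, of s]
   by (simp add: mult.assoc)
 qed
 also have "... = ennreal (Kr ?n m s) * ?K"
  unfolding gk[symmetric]
  by (rule nn_integral_multc) (simp, intro times_ennreal measurable_exp_sqn measurable_mat_abs_powr)
 finally have 1: "(\<integral>\<^sup>+z. ?H z \<partial>?N) = ennreal (Kr ?n m s) * ?K" .
 have "(\<integral>\<^sup>+z. ?H z \<partial>?N) = (\<integral>\<^sup>+z. ?H (rotpair z) \<partial>P1)"
  by (subst distr_rotpair[symmetric], rule nn_integral_distr[OF measurable_rotpair]) (use mH in simp)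
 also have "... = (\<integral>\<^sup>+g. \<integral>\<^sup>+b. \<integral>\<^sup>+a. ?H (g * (a @\<^sub>r b), g) \<partial>lmat k m \<partial>lmat q m \<partial>stf ?n ?n)"
  using nn_integral_P1[OF mcomp[OF measurable_rotpair mH]] by simp
 also have "... = (\<integral>\<^sup>+g. \<integral>\<^sup>+b. \<integral>\<^sup>+a. egauss b * epow b s * egauss a \<partial>lmat k m \<partial>lmat q m \<partial>stf ?n ?n)"
 proof (intro nn_integral_cong)
  fix g b a assume "g \<in> space (stf ?n ?n)" "b \<in> space (lmat q m)" "a \<in> space (lmat k m)"
  then have g: "g \<in> orth_group ?n" and a: "a \<in> carrier_mat k m" and b: "b \<in> carrier_mat q m" by (auto simp: haarD)
  have ab: "a @\<^sub>r b \<in> carrier_mat ?n m" using a b by auto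
  have "bot k q g (g * (a @\<^sub>r b)) = b"
   unfolding bot_def using orth_cancel(1)[OF g ab] low_frame_mult[OF a b] by simp
  moreover have "sqn (g * (a @\<^sub>r b)) = sqn b + sqn a"
   using sqn_orth[OF g ab] sqn_append_rows[OF a b] by simp
  ultimately show "?H (g * (a @\<^sub>r b), g) = egauss b * epow b s * egauss a"
   by (simp add: exp_add exp_diff exp_minus field_simps ennreal_mult[symmetric])
 qed
 also have "... = (\<integral>\<^sup>+b. egauss b * epow b s * ennreal (sqrt pi ^ (k * m)) \<partial>lmat q m)"
  unfolding nn_integral_stf_const
  by (intro nn_integral_cong, subst nn_integral_cmult) (simp_all add: nn_integral_gauss)
 also have "... = ennreal (Kr q m s) * ennreal (sqrt pi ^ (k * m))"
  unfolding nn_gauss_powr[OF mq s, symmetric]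
  by (rule nn_integral_multc) (simp, intro times_ennreal measurable_exp_sqn measurable_mat_abs_powr)
 finally have "ennreal (Kr ?n m s) * ?K < \<infinity>" unfolding 1 by (simp add: ennreal_mult_less_top)
 moreover have "0 < Kr ?n m s" by (rule Kr_pos) (use mq s in auto)
 ultimately show ?thesis by (auto simp: ennreal_mult_less_top)
qed

text \<open>In the coordinates \<open>(y, g)\<close> the power of \<open>b\<close> becomes a power
  of \<open>bot k q g y\<close>, whose average over \<open>g\<close> is \<open>bmean s\<close> times
  the power of \<open>y\<close>. Finiteness of the average for \<open>Re s\<close> gives absolute
  integrability.\<close>

lemma semyanistyi_kernel:
 assumes \<phi>: "\<phi> \<in> borel_fun (k + q) m"
  and s: "real m - 1 - real q < Re s"
  and int: "integrable (lmat (k + q) m) (\<lambda>y. \<phi> y * of_real (mat_abs y) powr s)"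
 shows "integrable P1 (\<lambda>(g, b, a). \<phi> (g * (a @\<^sub>r b)) * of_real (mat_abs b) powr s)"
  and "integral\<^sup>L P1 (\<lambda>(g, b, a). \<phi> (g * (a @\<^sub>r b)) * of_real (mat_abs b) powr s) =
   bmean s * (\<integral>y. \<phi> y * of_real (mat_abs y) powr s \<partial>lmat (k + q) m)"
proof -
 let ?n = "k + q"
 interpret P: pair_sigma_finite "lmat ?n m" "stf ?n ?n" by (rule pair_sigma_finite_stf)
 let ?N = "lmat ?n m \<Otimes>\<^sub>M stf ?n ?n"
 let ?H = "\<lambda>(y, g). \<phi> y * of_real (mat_abs (bot k q g y)) powr s"
 let ?K = "\<integral>\<^sup>+g. epow (bot k q g (base_frame ?n m)) (Re s) \<partial>stf ?n ?n"
 have mH: "?H \<in> borel_measurable ?N"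
  unfolding case_prod_unfold
  by (intro borel_measurable_times mcomp[OF measurable_fst_lmat \<phi>]
    mcomp[OF measurable_bot[OF measurable_snd_stf measurable_fst_lmat] measurable_mat_abs_cpowr])
 have AEn: "AE y in lmat ?n m. mat_abs y \<noteq> 0" by (rule AE_nonsingular) (use mq in simp)
 have intH: "integrable ?N ?H"
  unfolding integrable_iff_bounded
 proof (intro conjI mH)
  have mb: "(\<lambda>g. epow (bot k q g y) (Re s)) \<in> borel_measurable (stf ?n ?n)" if "y \<in> carrier_mat ?n m" for y
   by (rule measurable_stf[OF order_refl], rule mcomp[OF measurable_bot[where m=m] measurable_mat_abs_powr]) (use that in auto)
  have "(\<integral>\<^sup>+z. ennreal (norm (?H z)) \<partial>?N) = (\<integral>\<^sup>+y. \<integral>\<^sup>+g. ennreal (norm (?H (y, g))) \<partial>stf ?n ?n \<partial>lmat ?n m)"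
   by (rule P.M2.nn_integral_fst[symmetric]) (use mH in measurable)
  also have "... = (\<integral>\<^sup>+y. ennreal (norm (\<phi> y * of_real (mat_abs y) powr s)) * ?K \<partial>lmat ?n m)"
  proof (rule nn_integral_cong_AE, rule AE_mp[OF AEn], rule AE_I2, rule impI)
   fix y assume "y \<in> space (lmat ?n m)" and y0: "mat_abs y \<noteq> 0"
   then have y: "y \<in> carrier_mat ?n m" by simp
   have "(\<integral>\<^sup>+g. ennreal (norm (?H (y, g))) \<partial>stf ?n ?n) = (\<integral>\<^sup>+g. ennreal (norm (\<phi> y)) * epow (bot k q g y) (Re s) \<partial>stf ?n ?n)"
   proof (rule nn_integral_cong)
    fix g assume "g \<in> space (stf ?n ?n)"
    then have "g \<in> carrier_mat ?n ?n" using orth_groupD(1) by (simp add: haarD)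
    from mat_abs_nonneg[OF bot_carrier[OF this y]]
    show "ennreal (norm (?H (y, g))) = ennreal (norm (\<phi> y)) * epow (bot k q g y) (Re s)"
     by (simp add: norm_mult norm_powr_real_powr ennreal_mult)
   qed
   also have "... = ennreal (norm (\<phi> y)) * (epow y (Re s) * ?K)"
    using nn_integral_cmult[OF mb[OF y], of "ennreal (norm (\<phi> y))"] nn_bot_average[OF mq y y0, of "Re s"] by simp
   also have "... = ennreal (norm (\<phi> y * of_real (mat_abs y) powr s)) * ?K"
    using mat_abs_nonneg[OF y] by (simp add: norm_mult norm_powr_real_powr ennreal_mult mult.assoc)
   finally show "(\<integral>\<^sup>+g. ennreal (norm (?H (y, g))) \<partial>stf ?n ?n) = ennreal (norm (\<phi> y * of_real (mat_abs y) powr s)) * ?K" .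
  qed
  also have "... = (\<integral>\<^sup>+y. ennreal (norm (\<phi> y * of_real (mat_abs y) powr s)) \<partial>lmat ?n m) * ?K"
   by (rule nn_integral_multc) (use int in measurable)
  also have "... < \<infinity>"
   using int nn_bot_const_finite[OF s] by (simp add: integrable_iff_bounded ennreal_mult_less_top)
  finally show "(\<integral>\<^sup>+z. ennreal (norm (?H z)) \<partial>?N) < \<infinity>" .
 qed
 have eq: "?H (rotpair z) = (case z of (g, b, a) => \<phi> (g * (a @\<^sub>r b)) * of_real (mat_abs b) powr s)"
  if "z \<in> space P1" for z
 proof -
  obtain g b a where z: "z = (g, b, a)" by (cases z) auto
  have g: "g \<in> orth_group ?n" and a: "a \<in> carrier_mat k m" and b: "b \<in> carrier_mat q m"
   using that by (auto simp: z space_pair_measure haarD)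
  have ab: "a @\<^sub>r b \<in> carrier_mat ?n m" using a b by auto
  have "bot k q g (g * (a @\<^sub>r b)) = b"
   unfolding bot_def using orth_cancel(1)[OF g ab] low_frame_mult[OF a b] by simp
  then show ?thesis by (simp add: z)
 qed
 have "integrable P1 (\<lambda>z. ?H (rotpair z)) \<longleftrightarrow> integrable (distr P1 ?N rotpair) ?H"
  by (rule integrable_distr_eq[OF measurable_rotpair mH, symmetric])
 then have "integrable P1 (\<lambda>z. ?H (rotpair z))" unfolding distr_rotpair using intH by simp
 then show "integrable P1 (\<lambda>(g, b, a). \<phi> (g * (a @\<^sub>r b)) * of_real (mat_abs b) powr s)"
  using Bochner_Integration.integrable_cong[OF refl eq, of P1] by simp
 have "integral\<^sup>L P1 (\<lambda>(g, b, a). \<phi> (g * (a @\<^sub>r b)) * of_real (mat_abs b) powr s) = integral\<^sup>L P1 (\<lambda>z. ?H (rotpair z))"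
  by (rule Bochner_Integration.integral_cong[OF refl eq[symmetric]])
 also have "... = integral\<^sup>L (distr P1 ?N rotpair) ?H"
  by (rule integral_distr[OF measurable_rotpair mH, symmetric])
 also have "... = integral\<^sup>L ?N ?H" unfolding distr_rotpair ..
 also have "... = (\<integral>y. \<integral>g. ?H (y, g) \<partial>stf ?n ?n \<partial>lmat ?n m)" by (rule P.integral_fst'[OF intH, symmetric])
 also have "... = (\<integral>y. bmean s * (\<phi> y * of_real (mat_abs y) powr s) \<partial>lmat ?n m)"
 proof (rule integral_cong_AE)
  show "(\<lambda>y. \<integral>g. ?H (y, g) \<partial>stf ?n ?n) \<in> borel_measurable (lmat ?n m)"
   by (rule P.M2.borel_measurable_lebesgue_integral) (use mH in simp)
  show "(\<lambda>y. bmean s * (\<phi> y * of_real (mat_abs y) powr s)) \<in> borel_measurable (lmat ?n m)"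
   using int by measurable
  show "AE y in lmat ?n m. (\<integral>g. ?H (y, g) \<partial>stf ?n ?n) = bmean s * (\<phi> y * of_real (mat_abs y) powr s)"
   by (rule AE_mp[OF AEn], rule AE_I2) (simp add: bot_average)
 qed
 finally show "integral\<^sup>L P1 (\<lambda>(g, b, a). \<phi> (g * (a @\<^sub>r b)) * of_real (mat_abs b) powr s) =
   bmean s * (\<integral>y. \<phi> y * of_real (mat_abs y) powr s \<partial>lmat ?n m)" by simp
qed

text \<open>The preceding identity with a Gaussian \<phi>, for which both sides are
  explicit.\<close>

lemma bmean_eq:
 assumes s: "real m - 1 - real q < Re s"
 shows "bmean s * gint (k + q) m s = of_real (sqrt pi ^ (k * m)) * gint q m s"
proof -
 let ?n = "k + q"
 interpret H: prob_space "stf ?n ?n" by (rule haarD)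
 let ?e = "\<lambda>y. complex_of_real (exp (- sqn y))"
 have me: "?e \<in> borel_fun ?n m" by (intro mcomp[OF measurable_exp_sqn_real]) measurable
 have g: "has_bochner_integral (lmat ?n m) (\<lambda>y. ?e y * of_real (mat_abs y) powr s) (gint ?n m s)"
  using gpow_integral[of m ?n s] mq s unfolding gpow_def[abs_def] by simp
 then have i: "integrable (lmat ?n m) (\<lambda>y. ?e y * of_real (mat_abs y) powr s)"
  by (simp add: has_bochner_integral_iff)
 have "bmean s * gint ?n m s = integral\<^sup>L P1 (\<lambda>(g, b, a). ?e (g * (a @\<^sub>r b)) * of_real (mat_abs b) powr s)"
  using semyanistyi_kernel(2)[OF me s i] g by (simp add: has_bochner_integral_iff)
 also have "... = integral\<^sup>L P1 (\<lambda>(g, w). 1 * (case w of (b, a) => gpow s b * ?e a))"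
 proof (rule Bochner_Integration.integral_cong[OF refl])
  fix z assume "z \<in> space P1"
  then obtain g b a where z: "z = (g, b, a)" and g: "g \<in> orth_group ?n" and a: "a \<in> carrier_mat k m" and b: "b \<in> carrier_mat q m"
   by (auto simp: space_pair_measure haarD)
  have ab: "a @\<^sub>r b \<in> carrier_mat ?n m" using a b by auto
  have "exp (- sqn (g * (a @\<^sub>r b))) = exp (- sqn b) * exp (- sqn a)"
   using sqn_orth[OF g ab] sqn_append_rows[OF a b] by (simp add: exp_add[symmetric])
  then show "(case z of (g, b, a) => ?e (g * (a @\<^sub>r b)) * of_real (mat_abs b) powr s) = (case z of (g, w) => 1 * (case w of (b, a) => gpow s b * ?e a))"
   by (simp add: z gpow_def)
 qed
 also have "... = 1 * (gint q m s * of_real (sqrt pi ^ (k * m)))"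
 proof -
  have 1: "has_bochner_integral (stf ?n ?n) (\<lambda>g. 1 :: complex) 1"
   using H.prob_space by (simp add: has_bochner_integral_iff)
  have 2: "has_bochner_integral (lmat q m \<Otimes>\<^sub>M lmat k m) (\<lambda>(b, a). gpow s b * ?e a) (gint q m s * of_real (sqrt pi ^ (k * m)))"
   by (rule has_bochner_integral_pair_mult[OF lmat_pair.pair_sigma_finite_axioms gpow_integral[OF mq s] exp_sqn_bochner])
  have psf: "pair_sigma_finite (stf ?n ?n) (lmat q m \<Otimes>\<^sub>M lmat k m)"
   using sigma_finite_stf[of ?n ?n] sigma_finite_P1_snd by (simp add: pair_sigma_finite_def)
  show ?thesis
   using has_bochner_integral_pair_mult[OF psf 1 2] by (simp add: has_bochner_integral_iff)
 qed
 finally show ?thesis by (simp add: mult.commute)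
qed

end

section \<open>The measures \<open>\<gamma> (\<omega>; 0)\<close> underlying
  \<open>riesz_int\<close>\<close>

definition rank_measure :: "nat => nat => nat => real mat measure" where
 "rank_measure n m l = distr (lmat l m \<Otimes>\<^sub>M stf n n) (borel_mat n m) (\<lambda>(\<omega>, g). g * (\<omega> @\<^sub>r 0\<^sub>m (n - l) m))"

lemma sets_rank_measure [simp]: "sets (rank_measure n m l) = sets (borel_mat n m)"
 by (simp add: rank_measure_def)

lemma measurable_rank_map:
 assumes "l \<le> n"
 shows "(\<lambda>(\<omega>, g). g * (\<omega> @\<^sub>r 0\<^sub>m (n - l) m)) \<in> lmat l m \<Otimes>\<^sub>M stf n n \<rightarrow>\<^sub>M borel_mat n m"
proof -
 have "(\<lambda>x. fst x @\<^sub>r 0\<^sub>m (n - l) m) \<in> lmat l m \<Otimes>\<^sub>M stf n n \<rightarrow>\<^sub>M borel_mat (l + (n - l)) m"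
  by (intro measurable_append_rows measurable_fst_lmat measurable_const) simp
 then have "(\<lambda>x. snd x * (fst x @\<^sub>r 0\<^sub>m (n - l) m)) \<in> lmat l m \<Otimes>\<^sub>M stf n n \<rightarrow>\<^sub>M borel_mat n m"
  using assms by (intro measurable_mat_times[OF measurable_snd_stf]) simp
 then show ?thesis by (simp add: case_prod_unfold)
qed

lemma nn_integral_rank_measure:
 assumes "l \<le> n" and F: "F \<in> borel_fun n m"
 shows "(\<integral>\<^sup>+y. F y \<partial>rank_measure n m l) = (\<integral>\<^sup>+\<omega>. havg n F (\<omega> @\<^sub>r 0\<^sub>m (n - l) m) \<partial>lmat l m)"
proof -
 interpret P: pair_sigma_finite "lmat l m" "stf n n" by (rule pair_sigma_finite_stf)
 have "(\<integral>\<^sup>+y. F y \<partial>rank_measure n m l) = (\<integral>\<^sup>+z. F ((\<lambda>(\<omega>, g). g * (\<omega> @\<^sub>r 0\<^sub>m (n - l) m)) z) \<partial>(lmat l m \<Otimes>\<^sub>M stf n n))"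
  unfolding rank_measure_def by (rule nn_integral_distr[OF measurable_rank_map[OF assms(1)]]) (use F in simp)
 also have "... = (\<integral>\<^sup>+\<omega>. \<integral>\<^sup>+g. F (g * (\<omega> @\<^sub>r 0\<^sub>m (n - l) m)) \<partial>stf n n \<partial>lmat l m)"
  using P.M2.nn_integral_fst[OF mcomp[OF measurable_rank_map[OF assms(1)] F]] by simp
 finally show ?thesis by (simp add: havg_def)
qed

lemma measurable_mat_abs_weight_real: "(\<lambda>y. c * mat_abs y powr s) \<in> borel_fun n m"
 by (rule mcomp[OF measurable_mat_abs_id, of "\<lambda>x. c * x powr s"]) measurable

lemma measurable_mat_abs_weight: "(\<lambda>y. ennreal (c * mat_abs y powr s)) \<in> borel_fun n m"
 by (rule mcomp[OF measurable_mat_abs_weight_real measurable_ennreal])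

lemma ennreal_weight2:
 assumes "0 \<le> C" "0 \<le> P"
 shows "ennreal C * (x * ennreal P) = ennreal (C * P) * x"
 using assms by (simp add: ennreal_mult ac_simps)

text \<open>This is \<open>haar_polar\<close> for indicators. In the complementary range
  \<open>l < m\<close> the measure lives on rank-deficient matrices and is handled without a
  density.\<close>

lemma rank_measure_density:
 assumes "m \<le> l" "l \<le> n"
 shows "rank_measure n m l = density (lmat n m) (\<lambda>y. ennreal (Kr l m 0 / Kr n m (real l - real n) * mat_abs y powr (real l - real n)))"
proof (rule measure_eqI)
 fix A assume "A \<in> sets (rank_measure n m l)"
 then have A: "A \<in> sets (borel_mat n m)" by simp
 then have iA: "(indicator A :: _ => ennreal) \<in> borel_fun n m" by simp
 let ?s = "real l - real n"
 have pos: "0 < Kr n m ?s" "0 \<le> Kr l m 0" by (rule Kr_pos, use assms in auto, rule less_imp_le, rule Kr_pos, use assms in auto)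
 have "ennreal (Kr n m ?s) * (\<integral>\<^sup>+\<omega>. havg n (indicator A) (\<omega> @\<^sub>r 0\<^sub>m (n - l) m) \<partial>lmat l m) =
  ennreal (Kr l m 0) * (\<integral>\<^sup>+y. indicator A y * epow y ?s \<partial>lmat n m)"
  by (rule haar_polar[OF assms iA])
 from nn_integral_eq_imp_inverse[OF this pos(1)]
 have "emeasure (rank_measure n m l) A = ennreal (1 / Kr n m ?s) * (ennreal (Kr l m 0) * (\<integral>\<^sup>+y. indicator A y * epow y ?s \<partial>lmat n m))"
  using nn_integral_rank_measure[OF assms(2) iA] A by simp
 also have "... = ennreal (Kr l m 0 / Kr n m ?s) * (\<integral>\<^sup>+y. indicator A y * epow y ?s \<partial>lmat n m)"
  using pos by (simp add: mult.assoc[symmetric] ennreal_mult[symmetric])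
 also have "... = (\<integral>\<^sup>+y. ennreal (Kr l m 0 / Kr n m ?s) * (indicator A y * epow y ?s) \<partial>lmat n m)"
  by (rule nn_integral_cmult[symmetric]) (simp, intro times_ennreal iA measurable_mat_abs_powr)
 also have "... = (\<integral>\<^sup>+y. ennreal (Kr l m 0 / Kr n m ?s * mat_abs y powr ?s) * indicator A y \<partial>lmat n m)"
  by (rule nn_integral_cong, rule ennreal_weight2) (use pos in auto)
 also have "... = emeasure (density (lmat n m) (\<lambda>y. ennreal (Kr l m 0 / Kr n m ?s * mat_abs y powr ?s))) A"
  by (rule emeasure_density[symmetric]) (simp only: measurable_lmat, rule measurable_mat_abs_weight, simp add: A)
 finally show "emeasure (rank_measure n m l) A = emeasure (density (lmat n m) (\<lambda>y. ennreal (Kr l m 0 / Kr n m ?s * mat_abs y powr ?s))) A" .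
qed simp

section \<open>Finiteness almost everywhere\<close>

definition icols :: "nat => nat => real mat => real mat" where
 "icols n m y = mat n m (\<lambda>ij. y $$ ij)"

definition lcol :: "nat => nat => real mat => real mat" where
 "lcol n m y = mat n 1 (\<lambda>(i, j). y $$ (i, m))"

lemma icols_carrier [simp]: "icols n m y \<in> carrier_mat n m"
 by (simp add: icols_def)

lemma lcol_carrier [simp]: "lcol n m y \<in> carrier_mat n 1"
 by (simp add: lcol_def)

lemma icols_lcol_append [simp]:
 assumes "a \<in> carrier_mat n m" "v \<in> carrier_mat n 1"
 shows "icols n m (a @\<^sub>c v) = a" "lcol n m (a @\<^sub>c v) = v"
 by (rule eq_matI, use assms in "auto simp: icols_def lcol_def index_append_cols[of _ n m _ 1]")+

lemma measurable_icols: "icols n m \<in> borel_mat n (m + 1) \<rightarrow>\<^sub>M borel_mat n m"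
 by (rule measurable_borel_matI2[where h="\<lambda>i j y. y $$ (i, j)"])
  (auto simp: icols_def intro!: measurable_borel_mat_entry)

lemma measurable_lcol: "lcol n m \<in> borel_mat n (m + 1) \<rightarrow>\<^sub>M borel_mat n 1"
 by (rule measurable_borel_matI2[where h="\<lambda>i j y. y $$ (i, m)"])
  (auto simp: lcol_def intro!: measurable_borel_mat_entry)

lemma sqn_add_split:
 assumes "y \<in> carrier_mat n (m + 1)" "z \<in> carrier_mat n (m + 1)"
 shows "sqn (z + y) = sqn (icols n m z + icols n m y) + sqn (lcol n m z + lcol n m y)"
proof -
 have "z + y = (icols n m z + icols n m y) @\<^sub>c (lcol n m z + lcol n m y)"
  by (rule eq_matI) (use assms in "auto simp: icols_def lcol_def append_cols_def less_Suc_eq Suc_eq_plus1[symmetric]")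
 then show ?thesis using sqn_append_cols[of "icols n m z + icols n m y" n m "lcol n m z + lcol n m y" 1] by simp
qed

section \<open>Determinants \<open>det (y' y + D)\<close> with a partial identity
  \<open>D\<close>\<close>

definition dS :: "nat => nat set => real mat" where
 "dS m S = mat m m (\<lambda>(i, j). if i = j \<and> i \<in> S then 1 else 0)"

lemma dS_carrier [simp]: "dS m S \<in> carrier_mat m m"
 by (simp add: dS_def)

lemma dS_gram: "(dS m S)\<^sup>T * dS m S = dS m S"
proof (rule eq_matI)
 fix i j assume "i < dim_row (dS m S)" "j < dim_col (dS m S)"
 then have ij: "i < m" "j < m" by (auto simp: dS_def)
 have "((dS m S)\<^sup>T * dS m S) $$ (i, j) = (\<Sum>a = 0..<m. (if a = i \<and> a \<in> S then 1 else 0) * (if a = j \<and> a \<in> S then 1 else 0))"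
  using ij by (simp add: scalar_prod_def dS_def)
 also have "... = (\<Sum>a = 0..<m. if a = i then (if i = j \<and> i \<in> S then 1 else 0) else 0)"
  by (intro sum.cong) auto
 also have "... = dS m S $$ (i, j)" using ij by (simp add: dS_def)
 finally show "((dS m S)\<^sup>T * dS m S) $$ (i, j) = dS m S $$ (i, j)" .
qed (auto simp: dS_def)

text \<open>Equal to \<open>det (y' y + dS m S)\<close>: the set \<open>S\<close> interpolates
  between the square of \<open>mat_abs y\<close> for \<open>S\<close> empty and
  \<open>det (I + y' y)\<close> for \<open>S\<close> full. Written as a Gram determinant of a
  stacked matrix it is visibly nonnegative.\<close>

definition DS :: "nat => nat => nat set => real mat => real" where
 "DS n m S y = det ((y @\<^sub>r dS m S)\<^sup>T * (y @\<^sub>r dS m S))"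

lemma DS_eq: "y \<in> carrier_mat n m ==> DS n m S y = det (y\<^sup>T * y + dS m S)"
 unfolding DS_def by (subst gram_append_rows[of _ n m _ m]) (auto simp: dS_gram)

lemma DS_nonneg: "y \<in> carrier_mat n m ==> 0 \<le> DS n m S y"
 unfolding DS_def using det_gram_nonneg[of "y @\<^sub>r dS m S" "n + m" m] by auto

lemma DS_eq_mat_abs: "y \<in> carrier_mat n m ==> DS n m S y = (mat_abs (y @\<^sub>r dS m S))\<^sup>2"
 using DS_nonneg[of y n m S] by (simp add: mat_abs_def DS_def)

lemma measurable_DS: "DS n m S \<in> borel_fun n m"
 unfolding DS_def
 by (intro measurable_mat_det[where n=m] measurable_mat_times[where k="n + m"] measurable_mat_transpose
   measurable_append_rows measurable_const) auto

text \<open>Removing \<open>m\<close> from \<open>S\<close> lowers one diagonal entry by 1, and a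
  determinant is affine in each entry; the coefficient is the leading minor of size
  \<open>m\<close>, which is the \<open>DS\<close> of the first \<open>m\<close> columns.\<close>

lemma DS_step:
 assumes y: "y \<in> carrier_mat n (m + 1)" and S: "m \<in> S"
 shows "DS n (m + 1) S y = DS n (m + 1) (S - {m}) y + DS n m S (icols n m y)"
proof -
 define A where "A = y\<^sup>T * y + dS (m + 1) S"
 define B where "B = y\<^sup>T * y + dS (m + 1) (S - {m})"
 have A: "A \<in> carrier_mat (m + 1) (m + 1)" and B: "B \<in> carrier_mat (m + 1) (m + 1)" using y by (auto simp: A_def B_def)
 have yy: "y\<^sup>T * y \<in> carrier_mat (m + 1) (m + 1)" using y by auto
 have idx: "(y\<^sup>T * y + dS (m + 1) R) $$ (i, j) = (y\<^sup>T * y) $$ (i, j) + dS (m + 1) R $$ (i, j)"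
  if "i < m + 1" "j < m + 1" for i j R
  by (rule index_add_mat(1)) (use that carrier_matD[OF dS_carrier[of "m + 1" R]] in simp_all)
 have dSi: "dS (m + 1) R $$ (i, j) = (if i = j \<and> i \<in> R then 1 else 0)" if "i < m + 1" "j < m + 1" for i j R
  using that by (simp add: dS_def)
 have ent: "A $$ (i, j) = B $$ (i, j)" if "i < m + 1" "j < m + 1" "(i, j) \<noteq> (m, m)" for i j
  unfolding A_def B_def idx[OF that(1,2)] dSi[OF that(1,2)] using that(3) by auto
 have diag: "A $$ (m, m) = B $$ (m, m) + 1"
 proof -
  have "A $$ (m, m) = (y\<^sup>T * y) $$ (m, m) + dS (m + 1) S $$ (m, m)" unfolding A_def B_def by (rule idx) simp_all
  moreover have "B $$ (m, m) = (y\<^sup>T * y) $$ (m, m) + dS (m + 1) (S - {m}) $$ (m, m)" unfolding A_def B_def by (rule idx) simp_all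
  moreover have "dS (m + 1) S $$ (m, m) = 1" by (simp add: dSi S)
  moreover have "dS (m + 1) (S - {m}) $$ (m, m) = 0" by (simp add: dSi)
  ultimately show ?thesis by linarith
 qed
 have del: "mat_delete A i m = mat_delete B i m" if "i < m + 1" for i
  by (rule eq_matI) (use carrier_matD[OF A] carrier_matD[OF B] that in "auto simp: mat_delete_def intro!: ent")
 have cof: "cofactor A i m = cofactor B i m" if "i < m + 1" for i
  using del[OF that] by (simp add: cofactor_def)
 have "det A = (\<Sum>i<m + 1. A $$ (i, m) * cofactor A i m)"
  by (rule laplace_expansion_column[OF A]) simp
 also have "... = (\<Sum>i<m + 1. B $$ (i, m) * cofactor B i m + (if i = m then cofactor A m m else 0))"
  by (intro sum.cong refl) (use ent cof diag in "auto simp: algebra_simps")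
 also have "... = (\<Sum>i<m + 1. B $$ (i, m) * cofactor B i m) + cofactor A m m"
  by (simp add: sum.distrib)
 also have "(\<Sum>i<m + 1. B $$ (i, m) * cofactor B i m) = det B"
  by (rule laplace_expansion_column[OF B, symmetric]) simp
 also have "cofactor A m m = det (mat_delete A m m)" by (simp add: cofactor_def)
 also have "mat_delete A m m = (icols n m y)\<^sup>T * icols n m y + dS m S"
 proof (rule eq_matI)
  fix i j assume "i < dim_row ((icols n m y)\<^sup>T * icols n m y + dS m S)" "j < dim_col ((icols n m y)\<^sup>T * icols n m y + dS m S)"
  then have ij: "i < m" "j < m" by (auto simp: dS_def)
  have "mat_delete A m m $$ (i, j) = A $$ (i, j)"
   using ij carrier_matD[OF A] by (simp add: mat_delete_def)
  also have "... = ((icols n m y)\<^sup>T * icols n m y + dS m S) $$ (i, j)"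
   using ij y yy by (simp add: A_def dS_def icols_def scalar_prod_def)
  finally show "mat_delete A m m $$ (i, j) = ((icols n m y)\<^sup>T * icols n m y + dS m S) $$ (i, j)" .
 qed (use carrier_matD[OF A] in "auto simp: mat_delete_def dS_def icols_def")
 finally show ?thesis by (simp add: A_def B_def DS_eq[OF y] DS_eq[of "icols n m y" n m])
qed

text \<open>Induction over columns with \<open>DS_step\<close>, whose other summand is nonnegative;
  the empty determinant is 1.\<close>

lemma DS_ge_1:
 assumes "y \<in> carrier_mat n m" "{..<m} \<subseteq> S"
 shows "1 \<le> DS n m S y"
 using assms
proof (induction m arbitrary: y)
 case 0
 have "(y @\<^sub>r dS 0 S)\<^sup>T * (y @\<^sub>r dS 0 S) \<in> carrier_mat 0 0"
  using carrier_append_rows[OF 0(1) dS_carrier[of 0 S]] by simp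
 then show ?case by (simp add: DS_def)
next
 case (Suc m)
 have y: "y \<in> carrier_mat n (m + 1)" using Suc.prems(1) by (simp add: Suc_eq_plus1)
 have S: "{..<m} \<subseteq> S" using Suc.prems(2) by auto
 have "1 \<le> DS n m S (icols n m y)" by (rule Suc.IH[OF icols_carrier S])
 moreover have "0 \<le> DS n (m + 1) (S - {m}) y" by (rule DS_nonneg[OF y])
 ultimately show ?case using DS_step[OF y, of S] Suc.prems(2) by (simp add: Suc_eq_plus1 subset_eq)
qed

lemma dS_full: "{..<m} \<subseteq> S ==> dS m S = 1\<^sub>m m"
 by (rule eq_matI) (auto simp: dS_def)

lemma dS_empty: "S \<inter> {..<m} = {} ==> dS m S = 0\<^sub>m m m"
 by (rule eq_matI) (auto simp: dS_def)

definition pmat :: "nat => (nat => nat) => real mat" where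
 "pmat m \<pi> = mat m m (\<lambda>(i, j). if i = \<pi> j then 1 else 0)"

lemma pmat_carrier [simp]: "pmat m \<pi> \<in> carrier_mat m m"
 by (simp add: pmat_def)

lemma mult_pmat:
 assumes "y \<in> carrier_mat n m" "i < n" "j < m" "\<pi> j < m"
 shows "(y * pmat m \<pi>) $$ (i, j) = y $$ (i, \<pi> j)"
proof -
 have "(y * pmat m \<pi>) $$ (i, j) = (\<Sum>a = 0..<m. y $$ (i, a) * (if a = \<pi> j then 1 else 0))"
  using assms by (simp add: scalar_prod_def pmat_def)
 also have "... = (\<Sum>a = 0..<m. if a = \<pi> j then y $$ (i, \<pi> j) else 0)" by (intro sum.cong) auto
 also have "... = y $$ (i, \<pi> j)" using assms by simp
 finally show ?thesis .
qed

lemma pmat_orth: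
 assumes "\<And>j. j < m ==> \<pi> j < m" "\<And>j. j < m ==> \<pi> (\<pi> j) = j"
 shows "pmat m \<pi> \<in> orth_group m"
proof -
 have "(pmat m \<pi>)\<^sup>T * pmat m \<pi> = 1\<^sub>m m"
 proof (rule eq_matI)
  fix i j assume "i < dim_row (1\<^sub>m m :: real mat)" "j < dim_col (1\<^sub>m m :: real mat)"
  then have ij: "i < m" "j < m" by auto
  have "((pmat m \<pi>)\<^sup>T * pmat m \<pi>) $$ (i, j) = (pmat m \<pi>)\<^sup>T $$ (i, \<pi> j)"
   by (rule mult_pmat) (use ij assms in auto)
  also have "... = 1\<^sub>m m $$ (i, j)" using ij assms(1)[of j] assms(2)[of i] assms(2)[of j]
   by (auto simp: pmat_def)
  finally show "((pmat m \<pi>)\<^sup>T * pmat m \<pi>) $$ (i, j) = 1\<^sub>m m $$ (i, j)" .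
 qed (auto simp: pmat_def)
 then show ?thesis by (simp add: orth_group_def)
qed

lemma sqn_mult_orth:
 assumes "y \<in> carrier_mat n m" "g \<in> orth_group m"
 shows "sqn (y * g) = sqn y"
proof -
 note g = orth_groupD[OF assms(2)]
 have "sqn (y * g) = sqn ((y * g)\<^sup>T)" by (simp add: sqn_transpose)
 also have "(y * g)\<^sup>T = g\<^sup>T * y\<^sup>T" by (rule transpose_mult[OF assms(1) g(1)])
 also have "sqn ... = sqn (y\<^sup>T)" by (rule sqn_orth[OF g(6), of _ n]) (use assms in auto)
 finally show ?thesis by (simp add: sqn_transpose)
qed

text \<open>Permuting the columns of \<open>y\<close> permutes the diagonal units. For an involution
  \<pi> the direction of the permutation is immaterial.\<close>

lemma DS_pmat:
 assumes y: "y \<in> carrier_mat n m" and \<pi>: "\<And>j. j < m ==> \<pi> j < m" "\<And>j. j < m ==> \<pi> (\<pi> j) = j"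
 shows "DS n m S (y * pmat m \<pi>) = DS n m (\<pi> ` (S \<inter> {..<m})) y"
proof -
 let ?P = "pmat m \<pi>" and ?S = "\<pi> ` (S \<inter> {..<m})"
 have P: "?P \<in> orth_group m" by (rule pmat_orth[OF \<pi>])
 note Pc = orth_groupD(1)[OF P]
 have inS: "\<pi> j \<in> S \<longleftrightarrow> j \<in> ?S" if "j < m" for j
 proof
  assume "\<pi> j \<in> S"
  then have "\<pi> (\<pi> j) \<in> ?S" using \<pi>(1)[OF that] by blast
  then show "j \<in> ?S" using \<pi>(2)[OF that] by simp
 next
  assume "j \<in> ?S"
  then obtain a where "a \<in> S" "a < m" "j = \<pi> a" by auto
  then show "\<pi> j \<in> S" using \<pi>(2) by simp
 qed
 have d: "dS m S = ?P\<^sup>T * (dS m ?S * ?P)"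
 proof (rule eq_matI)
  fix i j assume "i < dim_row (?P\<^sup>T * (dS m ?S * ?P))" "j < dim_col (?P\<^sup>T * (dS m ?S * ?P))"
  then have ij: "i < m" "j < m" by (auto simp: pmat_def)
  have "?P\<^sup>T * (dS m ?S * ?P) = (?P\<^sup>T * dS m ?S) * ?P"
   by (rule assoc_mult_mat[symmetric, of _ m m _ m _ m]) (auto simp: pmat_def)
  then have "(?P\<^sup>T * (dS m ?S * ?P)) $$ (i, j) = (?P\<^sup>T * dS m ?S) $$ (i, \<pi> j)"
   using mult_pmat[of "?P\<^sup>T * dS m ?S" m m i j \<pi>] ij \<pi> mult_carrier_mat[of "?P\<^sup>T" m m "dS m ?S" m] by (simp add: pmat_def)
  also have "?P\<^sup>T * dS m ?S = (dS m ?S * ?P)\<^sup>T"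
  proof -
   have "(dS m ?S)\<^sup>T = dS m ?S" by (rule eq_matI) (auto simp: dS_def)
   then show ?thesis using transpose_mult[OF dS_carrier[of m ?S] Pc] by simp
  qed
  also have "(dS m ?S * ?P)\<^sup>T $$ (i, \<pi> j) = (dS m ?S * ?P) $$ (\<pi> j, i)"
   using mult_carrier_mat[OF dS_carrier[of m ?S] Pc] ij(1) \<pi>(1)[OF ij(2)]
   by (simp only: index_transpose_mat(1) carrier_matD)
  also have "... = dS m ?S $$ (\<pi> j, \<pi> i)"
   by (rule mult_pmat[where \<pi>=\<pi>, OF dS_carrier \<pi>(1)[OF ij(2)] ij(1) \<pi>(1)[OF ij(1)]])
  also have "... = dS m S $$ (i, j)"
  proof -
   have "\<pi> j = \<pi> i \<longleftrightarrow> i = j" using \<pi>(2)[OF ij(1)] \<pi>(2)[OF ij(2)] by metis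
   moreover have "\<pi> j \<in> ?S \<longleftrightarrow> j \<in> S" using inS[OF \<pi>(1)[OF ij(2)]] \<pi>(2)[OF ij(2)] by simp
   ultimately show ?thesis using ij \<pi>(1)[OF ij(1)] \<pi>(1)[OF ij(2)] by (auto simp: dS_def)
  qed
  finally show "dS m S $$ (i, j) = (?P\<^sup>T * (dS m ?S * ?P)) $$ (i, j)" ..
 qed (auto simp: dS_def pmat_def)
 have c1: "y @\<^sub>r dS m ?S \<in> carrier_mat (n + m) m" using y by auto
 have c2: "(y @\<^sub>r dS m ?S) * ?P \<in> carrier_mat (n + m) m" using c1 Pc by (rule mult_carrier_mat)
 let ?B = "four_block_mat (1\<^sub>m n) (0\<^sub>m n m) (0\<^sub>m m n) (?P\<^sup>T)"
 have B: "?B \<in> orth_group (n + m)" by (rule orth_diag[OF one_orth_group orth_groupD(6)[OF P]])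
 have "y * ?P @\<^sub>r dS m S = ?B * (y * ?P @\<^sub>r dS m ?S * ?P)"
  by (subst diag_mult_append_rows[of _ n _ m _ m]) (use y Pc d mult_carrier_mat[OF dS_carrier Pc] mult_carrier_mat[OF y Pc] in auto)
 also have "y * ?P @\<^sub>r dS m ?S * ?P = (y @\<^sub>r dS m ?S) * ?P"
  by (rule append_rows_mult[symmetric, OF Pc y dS_carrier])
 finally have "mat_abs (y * ?P @\<^sub>r dS m S) = mat_abs ((y @\<^sub>r dS m ?S) * ?P)"
  using mat_abs_orth[OF B c2] by simp
 also have "... = mat_abs (y @\<^sub>r dS m ?S)"
  using mat_abs_mult_right[OF c1 Pc] orth_groupD(4)[OF P] by simp
 finally show ?thesis
  using DS_eq_mat_abs[of "y * ?P" n m S] DS_eq_mat_abs[OF y, of ?S] mult_carrier_mat[OF y Pc] by simp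
qed

lemma powr_sum_le:
 fixes a b e :: real
 assumes "0 \<le> a" "0 \<le> b" "0 \<le> e"
 shows "(a + b) powr e \<le> 2 powr e * (a powr e + b powr e)"
proof -
 have "(a + b) powr e \<le> (2 * max a b) powr e" by (rule powr_mono2) (use assms in auto)
 also have "... = 2 powr e * (max a b) powr e" using assms by (simp add: powr_mult)
 also have "(max a b) powr e \<le> a powr e + b powr e" by (simp add: max_def)
 finally show ?thesis by simp
qed

lemma measurable_gauss_shift:
 assumes "z \<in> carrier_mat n m"
 shows "(\<lambda>y. egauss (z + y)) \<in> borel_fun n m"
 by (rule mcomp[OF measurable_mat_add[where n=n and m=m] measurable_exp_sqn]) (use assms in auto)

text \<open>Common properties of the power kernel and the rank measures, for all column numbers up
  to \<open>mm\<close> because the bounds are proved by removing columns. \<open>lam\<close> is the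
  degree of homogeneity, and \<open>real n - lam\<close> is the exponent cancelling a density
  \<open>|y|^(lam - n)\<close>. The constants in \<open>frozen\<close> and \<open>drop\<close> are
  uniform in the centre of the Gaussian, since the convolution later integrates over that
  centre.\<close>

locale riesz_family =
 fixes n mm :: nat and lam :: real and ka :: "nat => real mat measure"
 assumes sets_ka [simp]: "\<And>m. sets (ka m) = sets (borel_mat n m)"
  and lam_le: "lam \<le> real n"
  and right: "\<And>m T F. m \<le> mm ==> T \<in> carrier_mat m m ==> det T \<noteq> 0 ==> F \<in> borel_fun n m ==>
   ennreal (\<bar>det T\<bar> powr lam) * (\<integral>\<^sup>+y. F (y * T) \<partial>ka m) = (\<integral>\<^sup>+y. F y \<partial>ka m)"
  and gauss_fin: "\<And>m. m \<le> mm ==> (\<integral>\<^sup>+y. egauss y \<partial>ka m) < \<infinity>"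
  and frozen: "\<And>m. m \<le> mm ==> \<exists>C<\<infinity>. \<forall>z\<in>carrier_mat n m.
   (\<integral>\<^sup>+y. egauss (z + y) * epow y (real n - lam) \<partial>ka m) \<le> C"
  and drop: "\<And>m. m + 1 \<le> mm ==> \<exists>C<\<infinity>. \<forall>v\<in>carrier_mat n 1. \<forall>G\<in>borel_fun n m.
   (\<integral>\<^sup>+y. egauss (v + lcol n m y) * G (icols n m y) \<partial>ka (m + 1)) \<le> C * (\<integral>\<^sup>+y. G y \<partial>ka m)"
begin

lemma measurable_ka [simp]: "measurable (ka m) N = measurable (borel_mat n m) N"
 by (rule measurable_cong_sets) auto

lemma space_ka [simp]: "space (ka m) = carrier_mat n m"
 using sets_eq_imp_space_eq[OF sets_ka[of m]] by simp

text \<open>Balls have finite mass because the Gaussian is bounded below on them.\<close>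

lemma sigma_finite_ka:
 assumes "m \<le> mm"
 shows "sigma_finite_measure (ka m)"
proof
 define A where "A i = {y \<in> carrier_mat n m. sqn y \<le> real i}" for i :: nat
 have A: "A i \<in> sets (borel_mat n m)" for i
 proof -
  have "sqn -` {..real i} \<inter> space (borel_mat n m) \<in> sets (borel_mat n m)"
   by (rule measurable_sets[OF measurable_sqn[where n=n and m=m]]) auto
  moreover have "sqn -` {..real i} \<inter> space (borel_mat n m) = A i" by (auto simp: A_def)
  ultimately show ?thesis by simp
 qed
 have fin: "emeasure (ka m) (A i) < \<infinity>" for i
 proof -
  have "emeasure (ka m) (A i) = (\<integral>\<^sup>+y. indicator (A i) y \<partial>ka m)" using A by simp
  also have "... \<le> (\<integral>\<^sup>+y. ennreal (exp (real i)) * egauss y \<partial>ka m)"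
  proof (rule nn_integral_mono)
   fix y assume "y \<in> space (ka m)"
   show "indicator (A i) y \<le> ennreal (exp (real i)) * egauss y"
    by (auto simp: A_def indicator_def ennreal_mult[symmetric] exp_add[symmetric] simp flip: ennreal_1)
  qed
  also have "... = ennreal (exp (real i)) * (\<integral>\<^sup>+y. egauss y \<partial>ka m)"
   by (rule nn_integral_cmult) simp
  also have "... < \<infinity>" using gauss_fin[OF assms] by (simp add: ennreal_mult_less_top)
  finally show ?thesis .
 qed
 show "\<exists>X. countable X \<and> X \<subseteq> sets (ka m) \<and> \<Union> X = space (ka m) \<and> (\<forall>a\<in>X. emeasure (ka m) a \<noteq> \<infinity>)"
 proof (intro exI[of _ "range A"] conjI)
  show "\<Union> (range A) = space (ka m)"
   using real_arch_simple by (auto simp: A_def)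
 qed (use A fin in "auto simp: less_top")
qed

text \<open>Induction on the number of diagonal units. A unit in the last column is split off by
  \<open>DS_step\<close>: one term has one unit less, the other depends on the earlier columns only,
  and there the last column is integrated out by \<open>drop\<close>. Without units the bound is
  \<open>frozen\<close>.\<close>

lemma DS_bound:
 assumes "m \<le> mm"
 shows "\<exists>C<\<infinity>. \<forall>z\<in>carrier_mat n m.
  (\<integral>\<^sup>+y. egauss (z + y) * ennreal (DS n m S y powr ((real n - lam) / 2)) \<partial>ka m) \<le> C"
 using assms
proof (induction "card (S \<inter> {..<m})" arbitrary: m S rule: less_induct)
 case less
 let ?e = "(real n - lam) / 2"
 have e0: "0 \<le> ?e" using lam_le by simp
 have mD: "(\<lambda>y. ennreal (DS n m S y powr ?e)) \<in> borel_fun n m" for m S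
  by (rule mcomp[OF measurable_DS, where g="\<lambda>x. ennreal (x powr ?e)"]) measurable
 show ?case
 proof (cases "S \<inter> {..<m} = {}")
  case True
  have "DS n m S y powr ?e = mat_abs y powr (real n - lam)" if "y \<in> carrier_mat n m" for y
  proof -
   have "DS n m S y = mat_abs y powr 2"
    using DS_eq_mat_abs[OF that, of S] mat_abs_append_zero[OF that, of m] dS_empty[OF True] mat_abs_nonneg[OF that]
    by (simp add: powr_numeral)
   then have "DS n m S y powr ?e = mat_abs y powr (2 * ?e)" by (simp only: powr_powr)
   also have "2 * ?e = real n - lam" by (simp add: field_simps)
   finally show ?thesis .
  qed
  then have "(\<integral>\<^sup>+y. egauss (z + y) * ennreal (DS n m S y powr ?e) \<partial>ka m) =
   (\<integral>\<^sup>+y. egauss (z + y) * epow y (real n - lam) \<partial>ka m)" for z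
   by (intro nn_integral_cong) simp
  then show ?thesis using frozen[OF less.prems] by simp
 next
  case False
  then obtain i where i: "i \<in> S" "i < m" by auto
  define r where "r = m - 1"
  have m: "m = r + 1" and r: "r < m" using i by (auto simp: r_def)
  \<comment> \<open>A transposition moves the chosen unit to the last column; by
    \<open>right\<close> it preserves the measure, as its determinant has absolute value 1.\<close>
  define \<pi> where "\<pi> = Transposition.transpose i r"
  have \<pi>: "\<pi> j < m" if "j < m" for j using that i r by (auto simp: \<pi>_def Transposition.transpose_def)
  have \<pi>\<pi>: "\<pi> (\<pi> j) = j" for j by (simp add: \<pi>_def)
  define R where "R = \<pi> ` (S \<inter> {..<m})"
  have rS: "r \<in> R" using i by (auto simp: R_def \<pi>_def intro!: image_eqI[of _ _ i])
  have subS: "R \<subseteq> {..<m}" using \<pi> by (auto simp: R_def)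
  have cardS: "card (R \<inter> {..<m}) = card (S \<inter> {..<m})"
  proof -
   have "inj_on \<pi> (S \<inter> {..<m})" using \<pi>\<pi> by (intro inj_onI) metis
   then show ?thesis unfolding Int_absorb2[OF subS] unfolding R_def by (rule card_image)
  qed
  have P: "pmat m \<pi> \<in> orth_group m" by (rule pmat_orth) (use \<pi> \<pi>\<pi> in auto)
  note Pc = orth_groupD(1)[OF P]
  have lt1: "card ((R - {r}) \<inter> {..<m}) < card (S \<inter> {..<m})"
   unfolding cardS[symmetric] by (rule psubset_card_mono) (use rS r in auto)
  have lt2: "card (R \<inter> {..<r}) < card (S \<inter> {..<m})"
   unfolding cardS[symmetric] by (rule psubset_card_mono) (use rS r in auto)
  obtain C1 where C1: "C1 < \<infinity>" "\<And>z. z \<in> carrier_mat n m ==>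
   (\<integral>\<^sup>+y. egauss (z + y) * ennreal (DS n m (R - {r}) y powr ?e) \<partial>ka m) \<le> C1"
   using less.hyps[OF lt1 less.prems] by blast
  have r': "r \<le> mm" using less.prems m by simp
  obtain C2 where C2: "C2 < \<infinity>" "\<And>z. z \<in> carrier_mat n r ==>
   (\<integral>\<^sup>+y. egauss (z + y) * ennreal (DS n r R y powr ?e) \<partial>ka r) \<le> C2"
   using less.hyps[OF lt2 r'] by blast
  obtain C3 where C3: "C3 < \<infinity>" "\<And>v G. v \<in> carrier_mat n 1 ==> G \<in> borel_fun n r ==>
   (\<integral>\<^sup>+y. egauss (v + lcol n r y) * G (icols n r y) \<partial>ka (r + 1)) \<le> C3 * (\<integral>\<^sup>+y. G y \<partial>ka r)"
   using drop[of r] less.prems m by auto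
  let ?C = "ennreal (2 powr ?e) * (C1 + C3 * C2)"
  have main: "(\<integral>\<^sup>+y. egauss (z + y) * ennreal (DS n m R y powr ?e) \<partial>ka m) \<le> ?C"
   if z: "z \<in> carrier_mat n m" for z
  proof -
   have z': "z \<in> carrier_mat n (r + 1)" using z m by simp
   let ?a = "\<lambda>y. egauss (z + y) * ennreal (DS n m (R - {r}) y powr ?e)"
   let ?G = "\<lambda>y. egauss (icols n r z + y) * ennreal (DS n r R y powr ?e)"
   let ?b = "\<lambda>y. egauss (lcol n r z + lcol n r y) * ?G (icols n r y)"
   have mG: "?G \<in> borel_fun n r"
    by (intro times_ennreal measurable_gauss_shift mD) simp
   have ma: "?a \<in> borel_fun n m"
    by (intro times_ennreal measurable_gauss_shift mD z)
   have mb: "?b \<in> borel_fun n m"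
    unfolding m by (rule times_ennreal[OF mcomp[OF measurable_lcol
     measurable_gauss_shift[OF lcol_carrier]] mcomp[OF measurable_icols mG]])
   have "(\<integral>\<^sup>+y. egauss (z + y) * ennreal (DS n m R y powr ?e) \<partial>ka m) \<le>
    (\<integral>\<^sup>+y. ennreal (2 powr ?e) * (?a y + ?b y) \<partial>ka m)"
   proof (rule nn_integral_mono)
    fix y assume "y \<in> space (ka m)"
    then have y: "y \<in> carrier_mat n m" by simp
    then have y': "y \<in> carrier_mat n (r + 1)" using m by simp
    let ?d1 = "DS n m (R - {r}) y" and ?d2 = "DS n r R (icols n r y)"
    have "DS n m R y = ?d1 + ?d2" using DS_step[OF y' rS] m by simp
    then have "DS n m R y powr ?e \<le> 2 powr ?e * (?d1 powr ?e + ?d2 powr ?e)"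
     using powr_sum_le[OF DS_nonneg[OF y, of "R - {r}"] DS_nonneg[OF icols_carrier, of n r R y] e0] by simp
    then have "egauss (z + y) * ennreal (DS n m R y powr ?e) \<le>
     egauss (z + y) * ennreal (2 powr ?e * (?d1 powr ?e + ?d2 powr ?e))"
     by (intro mult_left_mono ennreal_leI) auto
    also have "... = ennreal (2 powr ?e) * (?a y + ?b y)"
    proof -
     have "exp (- sqn (z + y)) = exp (- sqn (lcol n r z + lcol n r y)) * exp (- sqn (icols n r z + icols n r y))"
      using sqn_add_split[OF y' z'] by (simp add: exp_add[symmetric])
     then show ?thesis
      by (simp add: ennreal_mult[symmetric] ennreal_plus[symmetric] algebra_simps del: ennreal_plus)
    qed
    finally show "egauss (z + y) * ennreal (DS n m R y powr ?e) \<le> ennreal (2 powr ?e) * (?a y + ?b y)" .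
   qed
   also have "... = ennreal (2 powr ?e) * ((\<integral>\<^sup>+y. ?a y \<partial>ka m) + (\<integral>\<^sup>+y. ?b y \<partial>ka m))"
    using ma mb by (simp add: nn_integral_cmult nn_integral_add)
   also have "(\<integral>\<^sup>+y. ?b y \<partial>ka m) \<le> C3 * (\<integral>\<^sup>+y. ?G y \<partial>ka r)"
    unfolding m by (rule C3(2)[OF lcol_carrier mG])
   also have "(\<integral>\<^sup>+y. ?G y \<partial>ka r) \<le> C2" by (rule C2(2)) simp
   also have "(\<integral>\<^sup>+y. ?a y \<partial>ka m) \<le> C1" by (rule C1(2)[OF z])
   finally show ?thesis by (simp add: add_mono mult_left_mono)
  qed
  show ?thesis
  proof (intro exI[of _ ?C] conjI ballI)
   show "?C < \<infinity>" using C1(1) C2(1) C3(1) by (simp add: ennreal_mult_less_top)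
   fix z :: "real mat" assume z: "z \<in> carrier_mat n m"
   let ?F = "\<lambda>y. egauss (z + y) * ennreal (DS n m S y powr ?e)"
   have mF: "?F \<in> borel_fun n m"
    by (intro times_ennreal measurable_gauss_shift mD z)
   have "(\<integral>\<^sup>+y. ?F y \<partial>ka m) = (\<integral>\<^sup>+y. ?F (y * pmat m \<pi>) \<partial>ka m)"
    using right[OF less.prems Pc orth_groupD(5)[OF P] mF] orth_groupD(4)[OF P] by simp
   also have "... = (\<integral>\<^sup>+y. egauss (z * pmat m \<pi> + y) * ennreal (DS n m R y powr ?e) \<partial>ka m)"
   proof (rule nn_integral_cong)
    fix y assume "y \<in> space (ka m)"
    then have y: "y \<in> carrier_mat n m" by simp
    have PP: "pmat m \<pi> * pmat m \<pi> = 1\<^sub>m m"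
    proof (rule eq_matI)
     fix a b assume "a < dim_row (1\<^sub>m m :: real mat)" "b < dim_col (1\<^sub>m m :: real mat)"
     then have ab: "a < m" "b < m" by auto
     show "(pmat m \<pi> * pmat m \<pi>) $$ (a, b) = 1\<^sub>m m $$ (a, b)"
      using mult_pmat[OF pmat_carrier ab, of \<pi> \<pi>] \<pi>[OF ab(2)] ab \<pi>\<pi> by (simp add: pmat_def)
    qed (auto simp: pmat_def)
    have "z * pmat m \<pi> * pmat m \<pi> = z"
     using assoc_mult_mat[OF z Pc Pc] PP z by simp
    then have "z + y * pmat m \<pi> = (z * pmat m \<pi> + y) * pmat m \<pi>"
     using add_mult_distrib_mat[OF mult_carrier_mat[OF z Pc] y Pc] by simp
    then have "sqn (z + y * pmat m \<pi>) = sqn (z * pmat m \<pi> + y)"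
     using sqn_mult_orth[OF _ P, of "z * pmat m \<pi> + y" n] y by simp
    moreover have "DS n m S (y * pmat m \<pi>) = DS n m R y"
     unfolding R_def by (rule DS_pmat[OF y]) (use \<pi> \<pi>\<pi> in auto)
    ultimately show "?F (y * pmat m \<pi>) = egauss (z * pmat m \<pi> + y) * ennreal (DS n m R y powr ?e)"
     by simp
   qed
   also have "... \<le> ?C" by (rule main) (use z Pc in auto)
   finally show "(\<integral>\<^sup>+y. ?F y \<partial>ka m) \<le> ?C" .
  qed
 qed
qed

text \<open>The weight is itself a Gaussian integral: with \<open>Y = (y; I)\<close>, integrating
  \<open>exp (- sqn (Y z)) (mat_abs z)^(b - m)\<close> over square \<open>z\<close> gives a multiple
  of \<open>(mat_abs Y)^(- b)\<close>. Integrating over \<open>y\<close> first, homogeneity produces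
  \<open>(mat_abs z)^(- lam)\<close>, and the remaining Gaussian moment of order
  \<open>b - m - lam\<close> is finite because \<open>b > lam + m - 1\<close>.\<close>

lemma weight_integrable:
 assumes m: "m \<le> mm" and b: "lam + real m - 1 < b" and lam0: "0 \<le> lam"
 shows "(\<integral>\<^sup>+y. epow (y @\<^sub>r 1\<^sub>m m) (- b) \<partial>ka m) < \<infinity>"
proof -
 interpret K: sigma_finite_measure "ka m" by (rule sigma_finite_ka[OF m])
 interpret P: pair_sigma_finite "ka m" "lmat m m" ..
 let ?G = "\<integral>\<^sup>+y. egauss y \<partial>ka m"
 let ?c = "Kr m m (b - real m)"
 have c: "0 < ?c" by (rule Kr_pos) (use b lam0 in auto)
 let ?H = "\<lambda>(y, z). egauss z * egauss (y * z) * epow z (b - real m)"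
 have eqm: "measurable (ka m \<Otimes>\<^sub>M lmat m m) N = measurable (borel_mat n m \<Otimes>\<^sub>M borel_mat m m) N" for N
  by (rule measurable_cong_sets) (auto intro!: sets_pair_measure_cong)
 have mH: "?H \<in> borel_measurable (ka m \<Otimes>\<^sub>M lmat m m)"
  unfolding case_prod_unfold eqm
  by (intro times_ennreal mcomp[OF measurable_snd measurable_exp_sqn]
    mcomp[OF measurable_mat_times[OF measurable_fst measurable_snd] measurable_exp_sqn]
    mcomp[OF measurable_snd measurable_mat_abs_powr])
 have inner: "(\<integral>\<^sup>+z. ?H (y, z) \<partial>lmat m m) = ennreal ?c * epow (y @\<^sub>r 1\<^sub>m m) (- b)"
  if y: "y \<in> carrier_mat n m" for y
 proof -
  let ?Y = "y @\<^sub>r 1\<^sub>m m"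
  have Y: "?Y \<in> carrier_mat (n + m) m" using y by auto
  have "mat_abs ?Y \<noteq> 0"
   using DS_ge_1[OF y, of "{..<m}"] DS_eq_mat_abs[OF y, of "{..<m}"] dS_full[of m "{..<m}"] by auto
  then obtain g T where gT: "g \<in> orth_group (m + n)" "T \<in> carrier_mat m m" "det T \<noteq> 0" "?Y = g * (T @\<^sub>r 0\<^sub>m n m)" "mat_abs ?Y = \<bar>det T\<bar>"
   using QR_nonsingular[of ?Y m n] Y by (auto simp: add.commute)
  let ?k = "\<lambda>z. egauss z * epow z (b - real m)"
  have mk: "?k \<in> borel_fun m m"
   by (intro times_ennreal measurable_exp_sqn measurable_mat_abs_powr)
  have mkT: "(\<lambda>z. ?k (T * z)) \<in> borel_fun m m"
   by (rule measurable_mat_mult_left[OF mk gT(2)])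
  have "ennreal ?c = (\<integral>\<^sup>+z. ?k z \<partial>lmat m m)"
   by (rule nn_gauss_powr[symmetric]) (use b lam0 in auto)
  also have "... = ennreal (\<bar>det T\<bar> ^ m) * (\<integral>\<^sup>+z. ?k (T * z) \<partial>lmat m m)"
   by (rule nn_integral_lmat_mult_left[OF gT(2,3) mk, symmetric])
  also have "(\<integral>\<^sup>+z. ?k (T * z) \<partial>lmat m m) = (\<integral>\<^sup>+z. ennreal (\<bar>det T\<bar> powr (b - real m)) * ?H (y, z) \<partial>lmat m m)"
  proof (rule lmat_cong)
   fix z :: "real mat" assume z: "z \<in> carrier_mat m m"
   have Tz: "T * z \<in> carrier_mat m m" using gT(2) z by auto
   have yz: "y * z \<in> carrier_mat n m" using y z by auto
   have "sqn (y * z) + sqn z = sqn (?Y * z)"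
    using append_rows_mult[OF z y one_carrier_mat[of m]] sqn_append_rows[OF yz z] z by simp
   also have "?Y * z = g * ((T @\<^sub>r 0\<^sub>m n m) * z)"
    unfolding gT(4) by (rule assoc_mult_mat[of _ "m + n" "m + n" _ m _ m]) (use orth_groupD(1)[OF gT(1)] gT(2) z in auto)
   also have "(T @\<^sub>r 0\<^sub>m n m) * z = (T * z) @\<^sub>r 0\<^sub>m n m"
    using append_rows_mult[OF z gT(2) zero_carrier_mat[of n m]] z by simp
   also have "sqn (g * ((T * z) @\<^sub>r 0\<^sub>m n m)) = sqn (T * z)"
    using sqn_orth[OF gT(1), of "(T * z) @\<^sub>r 0\<^sub>m n m" m] carrier_append_rows[OF Tz zero_carrier_mat[of n m]]
     sqn_append_rows[OF Tz zero_carrier_mat[of n m]] by simp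
   finally have "exp (- sqn (T * z)) = exp (- sqn z) * exp (- sqn (y * z))" by (simp add: exp_add[symmetric])
   moreover have "mat_abs (T * z) powr (b - real m) = \<bar>det T\<bar> powr (b - real m) * mat_abs z powr (b - real m)"
    using mat_abs_mult_right[OF gT(2) z] mat_abs_square[OF gT(2)] mat_abs_square[OF z] by (simp add: powr_mult)
   ultimately show "?k (T * z) = ennreal (\<bar>det T\<bar> powr (b - real m)) * ?H (y, z)"
    by (simp add: ennreal_mult ac_simps)
  qed
  also have "... = ennreal (\<bar>det T\<bar> powr (b - real m)) * (\<integral>\<^sup>+z. ?H (y, z) \<partial>lmat m m)"
   by (rule nn_integral_cmult) (use measurable_Pair2[OF mH, of y] y in simp)
  also have "ennreal (\<bar>det T\<bar> ^ m) * ... = ennreal (\<bar>det T\<bar> powr b) * (\<integral>\<^sup>+z. ?H (y, z) \<partial>lmat m m)"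
  proof -
   have "\<bar>det T\<bar> ^ m * \<bar>det T\<bar> powr (b - real m) = \<bar>det T\<bar> powr b"
    using gT(3) by (simp add: powr_realpow[symmetric] powr_add[symmetric])
   then show ?thesis by (simp add: mult.assoc[symmetric] ennreal_mult[symmetric])
  qed
  finally have "ennreal (\<bar>det T\<bar> powr b) * (\<integral>\<^sup>+z. ?H (y, z) \<partial>lmat m m) = ennreal ?c" ..
  then have "(\<integral>\<^sup>+z. ?H (y, z) \<partial>lmat m m) = ennreal (1 / \<bar>det T\<bar> powr b) * ennreal ?c"
   by (rule nn_integral_eq_imp_inverse) (use gT(3) in simp)
  then show ?thesis by (simp add: gT(5) powr_minus_divide mult.commute)
 qed
 have inner2: "(\<integral>\<^sup>+y. ?H (y, z) \<partial>ka m) = ?G * (egauss z * epow z (b - real m - lam))"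
  if z: "z \<in> carrier_mat m m" "det z \<noteq> 0" for z
 proof -
  have me: "(\<lambda>y. egauss (y * z)) \<in> borel_fun n m"
   by (rule measurable_mat_mult_right[OF measurable_exp_sqn z(1)])
  have "ennreal (\<bar>det z\<bar> powr lam) * (\<integral>\<^sup>+y. egauss (y * z) \<partial>ka m) = ?G"
   by (rule right[OF m z measurable_exp_sqn])
  from nn_integral_eq_imp_inverse[OF this]
  have g: "(\<integral>\<^sup>+y. egauss (y * z) \<partial>ka m) = ennreal (1 / \<bar>det z\<bar> powr lam) * ?G" using z(2) by simp
  have "(\<integral>\<^sup>+y. ?H (y, z) \<partial>ka m) = (\<integral>\<^sup>+y. egauss z * epow z (b - real m) * egauss (y * z) \<partial>ka m)"
   by (rule nn_integral_cong) (simp add: ac_simps)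
  also have "... = egauss z * epow z (b - real m) * (ennreal (1 / \<bar>det z\<bar> powr lam) * ?G)"
   by (subst nn_integral_cmult) (use me g in simp_all)
  also have "... = ?G * (egauss z * (epow z (b - real m) * ennreal (1 / \<bar>det z\<bar> powr lam)))"
   by (simp only: ac_simps)
  also have "epow z (b - real m) * ennreal (1 / \<bar>det z\<bar> powr lam) = epow z (b - real m - lam)"
   using z(2) by (simp add: ennreal_mult[symmetric] mat_abs_square[OF z(1)] powr_diff)
  finally show ?thesis .
 qed
 have "ennreal ?c * (\<integral>\<^sup>+y. epow (y @\<^sub>r 1\<^sub>m m) (- b) \<partial>ka m) =
   (\<integral>\<^sup>+y. ennreal ?c * epow (y @\<^sub>r 1\<^sub>m m) (- b) \<partial>ka m)"
  by (rule nn_integral_cmult[symmetric], unfold measurable_ka)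
   (rule mcomp[OF measurable_append_rows[where ?n1.0=n and ?n2.0=m and m=m] measurable_mat_abs_powr], auto)
 also have "... = (\<integral>\<^sup>+y. \<integral>\<^sup>+z. ?H (y, z) \<partial>lmat m m \<partial>ka m)"
  by (rule nn_integral_cong) (use inner in simp)
 also have "... = (\<integral>\<^sup>+z. \<integral>\<^sup>+y. ?H (y, z) \<partial>ka m \<partial>lmat m m)"
  using P.Fubini'[of "\<lambda>y z. ?H (y, z)"] mH by simp
 also have "... = (\<integral>\<^sup>+z. ?G * (egauss z * epow z (b - real m - lam)) \<partial>lmat m m)"
  by (rule nn_integral_cong_AE, rule AE_mp[OF AE_det_nonzero], rule AE_I2, rule impI, rule inner2) simp_all
 also have "... = ?G * ennreal (Kr m m (b - real m - lam))"
  using nn_gauss_powr[of m m "b - real m - lam"] b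
  by (subst nn_integral_cmult) (simp_all, intro times_ennreal measurable_exp_sqn measurable_mat_abs_powr)
 also have "... < \<infinity>" using gauss_fin[OF m] by (simp add: ennreal_mult_less_top)
 finally show ?thesis using c by (auto simp: ennreal_mult_less_top)
qed

end

context riesz_family
begin

lemma measurable_shift_pair:
 assumes "F \<in> borel_fun n m"
 shows "(\<lambda>z. F (snd z - fst z)) \<in> borel_measurable (ka m \<Otimes>\<^sub>M lmat n m)"
proof -
 have eqm: "measurable (ka m \<Otimes>\<^sub>M lmat n m) N = measurable (borel_mat n m \<Otimes>\<^sub>M borel_mat n m) N" for N
  by (rule measurable_cong_sets) (auto intro!: sets_pair_measure_cong)
 show ?thesis unfolding eqm
  by (rule mcomp[OF measurable_mat_minus[OF measurable_snd measurable_fst] assms])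
qed

text \<open>Integrating in \<open>x\<close> against a Gaussian and substituting
  \<open>u = x - y\<close> leaves \<open>A u\<close> times a Gaussian average of the weight, which
  \<open>DS_bound\<close> bounds uniformly in \<open>u\<close>. The Gaussian is positive and can be
  removed pointwise afterwards.\<close>

lemma convolution_AE_finite:
 assumes m: "m \<le> mm" and A: "A \<in> borel_fun n m" and fin: "(\<integral>\<^sup>+x. A x \<partial>lmat n m) < \<infinity>"
 shows "AE x in lmat n m. (\<integral>\<^sup>+y. A (x - y) * epow (y @\<^sub>r 1\<^sub>m m) (real n - lam) \<partial>ka m) < \<infinity>"
proof -
 interpret K: sigma_finite_measure "ka m" by (rule sigma_finite_ka[OF m])
 interpret P: pair_sigma_finite "ka m" "lmat n m" ..
 define g where "g y = epow (y @\<^sub>r 1\<^sub>m m) (real n - lam)" for y :: "real mat"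
 have mg: "g \<in> borel_fun n m" unfolding g_def
  by (rule mcomp[OF measurable_append_rows[where ?n1.0=n and ?n2.0=m and m=m] measurable_mat_abs_powr]) auto
 have g_eq: "g y = ennreal (DS n m {..<m} y powr ((real n - lam) / 2))" if y: "y \<in> carrier_mat n m" for y
 proof -
  have "DS n m {..<m} y = mat_abs (y @\<^sub>r 1\<^sub>m m) powr 2"
   using DS_eq_mat_abs[OF y, of "{..<m}"] dS_full[of m "{..<m}"] mat_abs_nonneg[of "y @\<^sub>r 1\<^sub>m m" "n + m" m] y
   by (simp add: powr_numeral)
  then have "DS n m {..<m} y powr ((real n - lam) / 2) = mat_abs (y @\<^sub>r 1\<^sub>m m) powr (2 * ((real n - lam) / 2))"
   by (simp only: powr_powr)
  also have "2 * ((real n - lam) / 2) = real n - lam" by simp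
  finally show ?thesis by (simp only: g_def)
 qed
 have mA: "(\<lambda>z. A (snd z - fst z)) \<in> borel_measurable (ka m \<Otimes>\<^sub>M lmat n m)" by (rule measurable_shift_pair[OF A])
 have eqm: "measurable (ka m \<Otimes>\<^sub>M lmat n m) N = measurable (borel_mat n m \<Otimes>\<^sub>M borel_mat n m) N" for N
  by (rule measurable_cong_sets) (auto intro!: sets_pair_measure_cong)
 have mF: "(\<lambda>z. g (fst z) * (egauss (snd z) * A (snd z - fst z))) \<in> borel_measurable (ka m \<Otimes>\<^sub>M lmat n m)"
  by (intro times_ennreal mA)
   (unfold eqm, rule mcomp[OF measurable_fst mg], rule mcomp[OF measurable_snd measurable_exp_sqn])
 have mF2: "(\<lambda>z. g (fst z) * (egauss (snd z + fst z) * A (snd z))) \<in> borel_measurable (ka m \<Otimes>\<^sub>M lmat n m)"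
  unfolding eqm
  by (intro times_ennreal mcomp[OF measurable_fst mg] mcomp[OF measurable_snd A]
    mcomp[OF measurable_mat_add[OF measurable_snd measurable_fst] measurable_exp_sqn])
 obtain C where C: "C < \<infinity>" "\<And>z. z \<in> carrier_mat n m ==>
  (\<integral>\<^sup>+y. egauss (z + y) * ennreal (DS n m {..<m} y powr ((real n - lam) / 2)) \<partial>ka m) \<le> C"
  using DS_bound[OF m, of "{..<m}"] by blast
 let ?H = "\<lambda>x. \<integral>\<^sup>+y. A (x - y) * g y \<partial>ka m"
 have mH: "(\<lambda>x. \<integral>\<^sup>+y. g y * (egauss x * A (x - y)) \<partial>ka m) \<in> borel_measurable (lmat n m)"
  using K.borel_measurable_nn_integral_fst[OF measurable_pair_swap[OF mF]] by (simp add: case_prod_unfold)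
 have "(\<integral>\<^sup>+x. \<integral>\<^sup>+y. g y * (egauss x * A (x - y)) \<partial>ka m \<partial>lmat n m) =
  (\<integral>\<^sup>+y. \<integral>\<^sup>+x. g y * (egauss x * A (x - y)) \<partial>lmat n m \<partial>ka m)"
  using P.Fubini'[of "\<lambda>y x. g y * (egauss x * A (x - y))"] mF by (simp add: case_prod_unfold)
 also have "... = (\<integral>\<^sup>+y. \<integral>\<^sup>+u. g y * (egauss (u + y) * A u) \<partial>lmat n m \<partial>ka m)"
 proof (rule nn_integral_cong)
  fix y assume "y \<in> space (ka m)"
  then have y: "y \<in> carrier_mat n m" by simp
  have "(\<lambda>x. g y * (egauss x * A (x - y))) \<in> borel_measurable (lmat n m)"
   using measurable_Pair2[OF mF, of y] y by simp
  then have "(\<integral>\<^sup>+x. g y * (egauss x * A (x - y)) \<partial>lmat n m) =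
   (\<integral>\<^sup>+u. g y * (egauss (y + u) * A ((y + u) - y)) \<partial>lmat n m)"
   by (intro nn_integral_lmat_translate[symmetric, OF _ y]) simp
  also have "... = (\<integral>\<^sup>+u. g y * (egauss (u + y) * A u) \<partial>lmat n m)"
  proof (rule lmat_cong)
   fix u :: "real mat" assume u: "u \<in> carrier_mat n m"
   have "y + u = u + y" using y u by (simp add: comm_add_mat)
   moreover have "(u + y) - y = u" by (rule eq_matI) (use y u in auto)
   ultimately show "g y * (egauss (y + u) * A ((y + u) - y)) = g y * (egauss (u + y) * A u)" by simp
  qed
  finally show "(\<integral>\<^sup>+x. g y * (egauss x * A (x - y)) \<partial>lmat n m) =
   (\<integral>\<^sup>+u. g y * (egauss (u + y) * A u) \<partial>lmat n m)" .
 qed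
 also have "... = (\<integral>\<^sup>+u. \<integral>\<^sup>+y. g y * (egauss (u + y) * A u) \<partial>ka m \<partial>lmat n m)"
  using P.Fubini'[of "\<lambda>y u. g y * (egauss (u + y) * A u)"] mF2 by (simp add: case_prod_unfold)
 also have "... \<le> (\<integral>\<^sup>+u. C * A u \<partial>lmat n m)"
 proof (rule lmat_mono)
  fix u :: "real mat" assume u: "u \<in> carrier_mat n m"
  have "(\<integral>\<^sup>+y. g y * (egauss (u + y) * A u) \<partial>ka m) =
   (\<integral>\<^sup>+y. (egauss (u + y) * ennreal (DS n m {..<m} y powr ((real n - lam) / 2))) * A u \<partial>ka m)"
   by (rule nn_integral_cong) (simp add: g_eq ac_simps)
  also have "... = (\<integral>\<^sup>+y. egauss (u + y) * ennreal (DS n m {..<m} y powr ((real n - lam) / 2)) \<partial>ka m) * A u"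
  proof (rule nn_integral_multc)
   show "(\<lambda>y. egauss (u + y) * ennreal (DS n m {..<m} y powr ((real n - lam) / 2))) \<in> borel_measurable (ka m)"
    unfolding measurable_ka
    by (rule times_ennreal[OF measurable_gauss_shift[OF u]],
      rule mcomp[OF measurable_DS, where g="\<lambda>x. ennreal (x powr ((real n - lam) / 2))"]) measurable
  qed
  also have "... \<le> C * A u" by (rule mult_right_mono[OF C(2)[OF u]]) simp
  finally show "(\<integral>\<^sup>+y. g y * (egauss (u + y) * A u) \<partial>ka m) \<le> C * A u" .
 qed
 also have "... = C * (\<integral>\<^sup>+u. A u \<partial>lmat n m)" by (rule nn_integral_cmult) (use A in simp)
 also have "... < \<infinity>" using C(1) fin by (simp add: ennreal_mult_less_top)
 finally have "(\<integral>\<^sup>+x. \<integral>\<^sup>+y. g y * (egauss x * A (x - y)) \<partial>ka m \<partial>lmat n m) \<noteq> \<infinity>" by simp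
 from nn_integral_PInf_AE[OF mH this]
 have ae: "AE x in lmat n m. (\<integral>\<^sup>+y. g y * (egauss x * A (x - y)) \<partial>ka m) \<noteq> \<infinity>" .
 show ?thesis
 proof (rule AE_mp[OF ae], rule AE_I2, rule impI)
  fix x assume x: "x \<in> space (lmat n m)" and fx: "(\<integral>\<^sup>+y. g y * (egauss x * A (x - y)) \<partial>ka m) \<noteq> \<infinity>"
  have mx: "(\<lambda>y. A (x - y) * g y) \<in> borel_measurable (ka m)"
   by (rule times_ennreal) (use measurable_Pair1[OF mA, of x] x mg in simp_all)
  have "(\<integral>\<^sup>+y. g y * (egauss x * A (x - y)) \<partial>ka m) = (\<integral>\<^sup>+y. egauss x * (A (x - y) * g y) \<partial>ka m)"
   by (rule nn_integral_cong) (simp only: ac_simps)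
  also have "... = egauss x * ?H x" by (rule nn_integral_cmult[OF mx])
  finally have "egauss x * ?H x < \<infinity>" using fx by (simp add: less_top)
  then have "?H x < \<infinity>" by (auto simp: ennreal_mult_less_top ennreal_eq_0_iff not_le)
  then show "(\<integral>\<^sup>+y. A (x - y) * epow (y @\<^sub>r 1\<^sub>m m) (real n - lam) \<partial>ka m) < \<infinity>"
   by (simp add: g_def)
 qed
qed

text \<open>For \<open>p > 1\<close> put \<open>w = g^(-1/(p - 1))\<close>: if \<open>a > w\<close>
  then \<open>a^(p - 1) g >= 1\<close>, hence \<open>a <= a^p g\<close>; otherwise
  \<open>a <= w\<close>. The first term is treated by \<open>convolution_AE_finite\<close>, as
  \<open>a^p\<close> is integrable, the second by \<open>weight_integrable\<close>.\<close>

lemma AE_convolution_finite: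
 assumes m: "m \<le> mm" "1 \<le> m" and lam0: "0 \<le> lam" and a: "a \<in> borel_fun n m" "\<And>x. 0 \<le> a x"
  and p: "1 \<le> p" "p * (lam + real m - 1) < real n"
  and fin: "(\<integral>\<^sup>+x. ennreal (a x powr p) \<partial>lmat n m) < \<infinity>"
 shows "AE x in lmat n m. (\<integral>\<^sup>+y. ennreal (a (x - y)) \<partial>ka m) < \<infinity>"
proof -
 let ?e = "real n - lam"
 let ?g = "\<lambda>y. mat_abs (y @\<^sub>r 1\<^sub>m m) powr ?e"
 let ?b = "?e / (p - 1)"
 let ?w = "\<lambda>y. if p = 1 then 0 else mat_abs (y @\<^sub>r 1\<^sub>m m) powr (- ?b)"
 have mA: "(\<lambda>x. ennreal (a x powr p)) \<in> borel_fun n m"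
  by (rule mcomp[OF a(1), where g="\<lambda>t. ennreal (t powr p)"]) measurable
 have mw: "(\<lambda>y. epow (y @\<^sub>r 1\<^sub>m m) s) \<in> borel_fun n m" for s
  by (rule mcomp[OF measurable_append_rows[where ?n1.0=n and ?n2.0=m and m=m] measurable_mat_abs_powr]) auto
 have W: "(\<integral>\<^sup>+y. ennreal (?w y) \<partial>ka m) < \<infinity>"
 proof (cases "p = 1")
  case False
  \<comment> \<open>The hypothesis on \<open>p\<close> bounds the left side by
    \<open>n - lam - (m - 1)\<close>, which is at most \<open>?e\<close>; division by
    \<open>p - 1\<close> gives the exponent condition of \<open>weight_integrable\<close>.\<close>
  have "(p - 1) * (lam + real m - 1) < ?e"
   using p m by (simp add: algebra_simps)
  then have "lam + real m - 1 < ?b" using False p by (simp add: pos_less_divide_eq mult.commute)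
  then show ?thesis using weight_integrable[OF m(1) _ lam0] False by simp
 qed simp
 have pt: "ennreal (a (x - y)) \<le> ennreal (a (x - y) powr p) * ennreal (?g y) + ennreal (?w y)"
  if y: "y \<in> carrier_mat n m" for x y
 proof -
  let ?a = "a (x - y)"
  have "1 \<le> (mat_abs (y @\<^sub>r 1\<^sub>m m))\<^sup>2"
   using DS_ge_1[OF y, of "{..<m}"] DS_eq_mat_abs[OF y, of "{..<m}"] dS_full[of m "{..<m}"] by simp
  then have D: "1 \<le> mat_abs (y @\<^sub>r 1\<^sub>m m)"
   using mat_abs_nonneg[of "y @\<^sub>r 1\<^sub>m m" "n + m" m] y by (simp add: power2_nonneg_ge_1_iff)
  \<comment> \<open>For \<open>p = 1\<close> this alone gives \<open>a <= a g\<close>, with second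
    term 0.\<close>
  have g1: "1 \<le> ?g y" using D lam_le by (simp add: ge_one_powr_ge_zero)
  have "?a \<le> ?a powr p * ?g y + ?w y"
  proof (cases "p = 1")
   case True
   then show ?thesis using mult_left_mono[OF g1 a(2)[of "x - y"]] a(2)[of "x - y"] by simp
  next
   case False
   then have p1: "0 < p - 1" using p by simp
   show ?thesis
   proof (cases "?a \<le> ?w y")
    case True
    then show ?thesis using a(2)[of "x - y"] by (simp add: add_increasing)
   next
    case False
    have w: "?w y = mat_abs (y @\<^sub>r 1\<^sub>m m) powr (- ?b)" using p1 by simp
    have pos: "0 < ?a" using False w powr_ge_zero[of "mat_abs (y @\<^sub>r 1\<^sub>m m)" "- ?b"] by linarith
    have "?w y powr (p - 1) \<le> ?a powr (p - 1)"
     by (rule powr_mono2) (use False p1 in auto)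
    moreover have "?w y powr (p - 1) = mat_abs (y @\<^sub>r 1\<^sub>m m) powr (- ?e)"
     unfolding w powr_powr using p1 by simp
    ultimately have "mat_abs (y @\<^sub>r 1\<^sub>m m) powr (- ?e) * ?g y \<le> ?a powr (p - 1) * ?g y"
     by (intro mult_right_mono) auto
    then have "1 \<le> ?a powr (p - 1) * ?g y" using D by (simp add: powr_add[symmetric])
    then have "?a \<le> ?a * (?a powr (p - 1) * ?g y)" using mult_left_mono[of 1 _ ?a] pos by simp
    also have "... = ?a powr p * ?g y" using pos by (simp add: powr_diff)
    finally show ?thesis using w by (simp add: add_increasing2)
   qed
  qed
  then have "ennreal ?a \<le> ennreal (?a powr p * ?g y + ?w y)" by (rule ennreal_leI)
  then show ?thesis by (simp add: ennreal_mult ennreal_plus)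
 qed
 show ?thesis
 proof (rule AE_mp[OF convolution_AE_finite[OF m(1) mA fin]], rule AE_I2, rule impI)
  fix x assume x: "x \<in> space (lmat n m)"
   and fx: "(\<integral>\<^sup>+y. ennreal (a (x - y) powr p) * ennreal (?g y) \<partial>ka m) < \<infinity>"
  have mx: "(\<lambda>y. ennreal (a (x - y) powr p)) \<in> borel_fun n m"
   using measurable_Pair1[OF measurable_shift_pair[OF mA], of x] x by simp
  have "(\<integral>\<^sup>+y. ennreal (a (x - y)) \<partial>ka m) \<le> (\<integral>\<^sup>+y. ennreal (a (x - y) powr p) * ennreal (?g y) + ennreal (?w y) \<partial>ka m)"
   by (rule nn_integral_mono, rule pt) simp
  also have "... = (\<integral>\<^sup>+y. ennreal (a (x - y) powr p) * ennreal (?g y) \<partial>ka m) + (\<integral>\<^sup>+y. ennreal (?w y) \<partial>ka m)"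
  proof (rule nn_integral_add)
   show "(\<lambda>y. ennreal (a (x - y) powr p) * ennreal (?g y)) \<in> borel_measurable (ka m)"
    unfolding measurable_ka by (rule times_ennreal[OF mx mw])
   show "(\<lambda>y. ennreal (?w y)) \<in> borel_measurable (ka m)"
    using mw[of "- ?b"] by (cases "p = 1") simp_all
  qed
  also have "... < \<infinity>" using fx W by simp
  finally show "(\<integral>\<^sup>+y. ennreal (a (x - y)) \<partial>ka m) < \<infinity>" .
 qed
qed

text \<open>Fubini and translation invariance in \<open>x\<close>. Since \<open>ka m\<close> may be
  singular, a single translate of a null set can carry positive mass, but for almost every
  \<open>x\<close> it does not.\<close>

lemma AE_convolution_null:
 assumes m: "m \<le> mm" and N: "N \<in> null_sets (lmat n m)"
 shows "AE x in lmat n m. AE y in ka m. x - y \<notin> N"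
proof -
 interpret K: sigma_finite_measure "ka m" by (rule sigma_finite_ka[OF m])
 interpret P: pair_sigma_finite "ka m" "lmat n m" ..
 have N': "N \<in> sets (borel_mat n m)" using N by auto
 then have iN: "(indicator N :: _ => ennreal) \<in> borel_fun n m" by simp
 have mN: "(\<lambda>z. indicator N (snd z - fst z) :: ennreal) \<in> borel_measurable (ka m \<Otimes>\<^sub>M lmat n m)"
  by (rule measurable_shift_pair[OF iN])
 have mH: "(\<lambda>x. \<integral>\<^sup>+y. indicator N (x - y) \<partial>ka m) \<in> borel_measurable (lmat n m)"
  using K.borel_measurable_nn_integral_fst[OF measurable_pair_swap[OF mN]] by (simp add: case_prod_unfold)
 have "(\<integral>\<^sup>+x. \<integral>\<^sup>+y. indicator N (x - y) \<partial>ka m \<partial>lmat n m) = (\<integral>\<^sup>+y. \<integral>\<^sup>+x. indicator N (x - y) \<partial>lmat n m \<partial>ka m)"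
  using P.Fubini'[of "\<lambda>y x. indicator N (x - y)"] mN by (simp add: case_prod_unfold)
 also have "... = (\<integral>\<^sup>+y. 0 \<partial>ka m)"
 proof (rule nn_integral_cong)
  fix y assume "y \<in> space (ka m)"
  then have y: "y \<in> carrier_mat n m" by simp
  have "(\<lambda>x. indicator N (x - y) :: ennreal) \<in> borel_measurable (lmat n m)"
   using measurable_Pair2[OF mN, of y] y by simp
  then have "(\<integral>\<^sup>+x. indicator N (x - y) \<partial>lmat n m) = (\<integral>\<^sup>+u. indicator N ((y + u) - y) \<partial>lmat n m)"
   by (intro nn_integral_lmat_translate[symmetric, OF _ y]) simp
  also have "... = (\<integral>\<^sup>+u. indicator N u \<partial>lmat n m)"
  proof (rule lmat_cong)
   fix u :: "real mat" assume u: "u \<in> carrier_mat n m"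
   have "(y + u) - y = u" by (rule eq_matI) (use y u in auto)
   then show "indicator N ((y + u) - y) = (indicator N u :: ennreal)" by simp
  qed
  also have "... = 0" using N N' by auto
  finally show "(\<integral>\<^sup>+x. indicator N (x - y) \<partial>lmat n m) = 0" .
 qed
 finally have "(\<integral>\<^sup>+x. \<integral>\<^sup>+y. indicator N (x - y) \<partial>ka m \<partial>lmat n m) = 0" by simp
 then have ae: "AE x in lmat n m. (\<integral>\<^sup>+y. indicator N (x - y) \<partial>ka m) = 0"
  by (simp add: nn_integral_0_iff_AE[OF mH])
 show ?thesis
 proof (rule AE_mp[OF ae], rule AE_I2, rule impI)
  fix x assume x: "x \<in> space (lmat n m)" and 0: "(\<integral>\<^sup>+y. indicator N (x - y) \<partial>ka m) = 0"
  have "(\<lambda>y. indicator N (x - y) :: ennreal) \<in> borel_measurable (ka m)"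
   using measurable_Pair1[OF mN, of x] x by simp
  from 0[unfolded nn_integral_0_iff_AE[OF this]] show "AE y in ka m. x - y \<notin> N"
   by (auto simp: indicator_def)
 qed
qed

end

section \<open>Verification of the bounds for the power kernel and the rank measures\<close>

lemma mat_abs_zero_wide:
 assumes y: "y \<in> carrier_mat l m" and "l < m"
 shows "mat_abs y = 0"
 using wide_kernel[OF assms] det_gram_0_iff[OF y] by (simp add: mat_abs_def)

text \<open>For \<open>s \<le> 0\<close> the singular weight is dominated by \<open>1\<close> away from the unit ball, and there the
 Gaussian factor is bounded below, which makes the bound uniform in the centre \<open>v\<close>.\<close>

lemma column_weight_bound:
 assumes mn: "m + 1 \<le> n" and s: "s \<le> 0" "real m - real n < s"
 shows "\<exists>C<\<infinity>. \<forall>v\<in>carrier_mat n 1. \<forall>a\<in>carrier_mat n m. mat_abs a \<noteq> 0 \<longrightarrow>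
  (\<integral>\<^sup>+b. egauss (v + b) * epow (a @\<^sub>c b) s \<partial>lmat n 1) \<le> C * epow a s"
proof -
 define p where "p = n - m"
 have n: "n = m + p" and p1: "1 \<le> p" using mn by (auto simp: p_def)
 \<comment> \<open>The first term accounts for \<open>sqn b >= 1\<close>, the second for the unit
   ball; both come from the \<open>p\<close> coordinates orthogonal to the columns of
   \<open>a\<close>.\<close>
 let ?c2 = "ennreal (sqrt pi ^ p) + ennreal (exp 1) * ennreal (Kr p 1 s)"
 let ?C = "ennreal (sqrt pi ^ m) * ?c2"
 have pt: "egauss (w + b) * epow b s \<le>
   egauss (w + b) + ennreal (exp 1) * (egauss b * epow b s)"
  if w: "w \<in> carrier_mat p 1" and b: "b \<in> carrier_mat p 1" for w b :: "real mat"
 proof -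
  have c: "b\<^sup>T * b \<in> carrier_mat 1 1" using b by auto
  have "det (b\<^sup>T * b) = sqn b" unfolding det_single[OF c] sqn_gram[OF b] by (simp add: One_nat_def)
  then have abs: "mat_abs b = sqrt (sqn b)" by (simp add: mat_abs_def)
  have sq: "0 \<le> sqn b" using det_gram_nonneg[OF b] \<open>det (b\<^sup>T * b) = sqn b\<close> by simp
  have sw: "0 \<le> sqn (w + b)" by (simp add: sqn_def sum_nonneg)
  have "exp (- sqn (w + b)) * mat_abs b powr s \<le> exp (- sqn (w + b)) + exp 1 * (exp (- sqn b) * mat_abs b powr s)"
  proof (cases "1 \<le> sqn b")
   case True
   then have "mat_abs b powr s \<le> mat_abs b powr 0" unfolding abs by (intro powr_mono s) simp
   also have "... \<le> 1" by (simp add: powr_def)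
   finally have "exp (- sqn (w + b)) * mat_abs b powr s \<le> exp (- sqn (w + b)) * 1" by (intro mult_left_mono) auto
   then show ?thesis by (simp add: add_increasing2)
  next
   case False
   \<comment> \<open>Inside the unit ball the shifted Gaussian is at most 1, hence at most
     \<open>exp (1 - sqn b)\<close>, a multiple of the centred one.\<close>
   have "- sqn (w + b) \<le> 1 - sqn b" using False sw by linarith
   then have "exp (- sqn (w + b)) \<le> exp (1 - sqn b)" by simp
   then have "exp (- sqn (w + b)) * mat_abs b powr s \<le> exp (1 - sqn b) * mat_abs b powr s"
    by (intro mult_right_mono) auto
   also have "exp (1 - sqn b) = exp 1 * exp (- sqn b)" by (simp add: exp_add[symmetric])
   finally show ?thesis by (simp add: add_increasing mult.assoc)
  qed
  then have "ennreal (exp (- sqn (w + b)) * mat_abs b powr s) \<le> ennreal (exp (- sqn (w + b)) + exp 1 * (exp (- sqn b) * mat_abs b powr s))"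
   by (rule ennreal_leI)
  then show ?thesis by (simp add: ennreal_mult ennreal_plus)
 qed
 have inner: "(\<integral>\<^sup>+b. egauss (w + b) * epow b s \<partial>lmat p 1) \<le> ?c2"
  if w: "w \<in> carrier_mat p 1" for w
 proof -
  have mg: "(\<lambda>b. egauss (w + b)) \<in> borel_measurable (lmat p 1)"
   using measurable_gauss_shift[OF w] by simp
  have mk: "(\<lambda>b. egauss b * epow b s) \<in> borel_measurable (lmat p 1)"
   by (simp, intro times_ennreal measurable_exp_sqn measurable_mat_abs_powr)
  have "(\<integral>\<^sup>+b. egauss (w + b) * epow b s \<partial>lmat p 1) \<le>
   (\<integral>\<^sup>+b. egauss (w + b) + ennreal (exp 1) * (egauss b * epow b s) \<partial>lmat p 1)"
   by (rule nn_integral_mono, rule pt[OF w]) simp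
  also have "... = (\<integral>\<^sup>+b. egauss (w + b) \<partial>lmat p 1) +
   ennreal (exp 1) * (\<integral>\<^sup>+b. egauss b * epow b s \<partial>lmat p 1)"
   using mg mk by (subst nn_integral_add) (auto simp del: measurable_lmat intro!: times_ennreal simp: nn_integral_cmult)
  also have "(\<integral>\<^sup>+b. egauss (w + b) \<partial>lmat p 1) = ennreal (sqrt pi ^ p)"
   using nn_integral_lmat_translate[OF measurable_exp_sqn w] nn_integral_gauss[of p 1] by simp
  also have "(\<integral>\<^sup>+b. egauss b * epow b s \<partial>lmat p 1) = ennreal (Kr p 1 s)"
   by (rule nn_gauss_powr) (use p1 s n in auto)
  finally show ?thesis .
 qed
 show ?thesis
 proof (intro exI[of _ ?C] conjI ballI impI)
  show "?C < \<infinity>" by (simp add: ennreal_mult_less_top)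
  fix v a :: "real mat" assume v: "v \<in> carrier_mat n 1" and a: "a \<in> carrier_mat n m" and a0: "mat_abs a \<noteq> 0"
  obtain g T where gT: "g \<in> orth_group (m + p)" "T \<in> carrier_mat m m" "det T \<noteq> 0" "a = g * (T @\<^sub>r 0\<^sub>m p m)" "mat_abs a = \<bar>det T\<bar>"
   using QR_nonsingular[of a m p] a a0 n by auto
  note g = orth_groupD[OF gT(1)]
  let ?F = "\<lambda>y. egauss (v + lcol n m y) * epow y s"
  have mF: "?F \<in> borel_fun n (m + 1)"
   by (rule times_ennreal[OF mcomp[OF measurable_lcol measurable_gauss_shift[OF v]] measurable_mat_abs_powr])
  \<comment> \<open>The centre is split in the coordinates adapted to \<open>a\<close>; only the
    part \<open>v2\<close> meets the singular weight.\<close>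
  obtain v1 v2 where v12: "v1 \<in> carrier_mat m 1" "v2 \<in> carrier_mat p 1" "g\<^sup>T * v = v1 @\<^sub>r v2"
  proof -
   have "g\<^sup>T * v \<in> carrier_mat (m + p) 1" using g(1) v n by auto
   from split_rows[OF this] show ?thesis using that by metis
  qed
  have gv: "g * (v1 @\<^sub>r v2) = v" using orth_cancel(2)[OF gT(1), of v 1] v v12(3) n by simp
  have "(\<integral>\<^sup>+b. egauss (v + b) * epow (a @\<^sub>c b) s \<partial>lmat n 1) = (\<integral>\<^sup>+b. ?F (a @\<^sub>c b) \<partial>lmat (m + p) 1)"
   unfolding n[symmetric] by (rule nn_integral_cong) (use a in simp)
  also have "... = (\<integral>\<^sup>+b1. \<integral>\<^sup>+b2. ?F (a @\<^sub>c (g * (b1 @\<^sub>r b2))) \<partial>lmat p 1 \<partial>lmat m 1)"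
   by (rule nn_integral_lmat_fibre[OF gT(1)]) (use a mF n in auto)
  also have "... \<le> (\<integral>\<^sup>+b1. epow a s * ?c2 * egauss (v1 + b1) \<partial>lmat m 1)"
  proof (rule lmat_mono)
   fix b1 :: "real mat" assume b1: "b1 \<in> carrier_mat m 1"
   have mi: "(\<lambda>b2. egauss (v2 + b2) * epow b2 s) \<in> borel_measurable (lmat p 1)"
    by (simp, rule times_ennreal[OF measurable_gauss_shift[OF v12(2)] measurable_mat_abs_powr])
   have "(\<integral>\<^sup>+b2. ?F (a @\<^sub>c (g * (b1 @\<^sub>r b2))) \<partial>lmat p 1) =
    (\<integral>\<^sup>+b2. epow a s * egauss (v1 + b1) * (egauss (v2 + b2) * epow b2 s) \<partial>lmat p 1)"
   proof (rule lmat_cong)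
    fix b2 :: "real mat" assume b2: "b2 \<in> carrier_mat p 1"
    have b12: "b1 @\<^sub>r b2 \<in> carrier_mat (m + p) 1" using b1 b2 by auto
    have gb: "g * (b1 @\<^sub>r b2) \<in> carrier_mat n 1" using mult_carrier_mat[OF g(1) b12] n by simp
    have vc: "v1 @\<^sub>r v2 \<in> carrier_mat (m + p) 1" using v12 by auto
    have "v + g * (b1 @\<^sub>r b2) = g * ((v1 @\<^sub>r v2) + (b1 @\<^sub>r b2))"
     using mult_add_distrib_mat[OF g(1) vc b12] gv by simp
    also have "(v1 @\<^sub>r v2) + (b1 @\<^sub>r b2) = (v1 + b1) @\<^sub>r (v2 + b2)"
     by (rule eq_matI) (use v12 b1 b2 in "auto simp: append_rows_def")
    also have "sqn (g * ((v1 + b1) @\<^sub>r (v2 + b2))) = sqn (v1 + b1) + sqn (v2 + b2)"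
     using sqn_orth[OF gT(1), of "(v1 + b1) @\<^sub>r (v2 + b2)" 1] sqn_append_rows[of "v1 + b1" m 1 "v2 + b2" p] b1 b2
      carrier_append_rows[of "v1 + b1" m 1 "v2 + b2" p] by simp
    finally have e: "exp (- sqn (v + g * (b1 @\<^sub>r b2))) = exp (- sqn (v1 + b1)) * exp (- sqn (v2 + b2))"
     by (simp add: exp_add[symmetric])
    have "mat_abs (a @\<^sub>c (g * (b1 @\<^sub>r b2))) = mat_abs a * mat_abs b2"
     using mat_abs_append_cols[OF gT(1,2) b1 b2] gT(4,5) by simp
    then have "mat_abs (a @\<^sub>c (g * (b1 @\<^sub>r b2))) powr s = mat_abs a powr s * mat_abs b2 powr s"
     by (simp add: powr_mult)
    with e show "?F (a @\<^sub>c (g * (b1 @\<^sub>r b2))) = epow a s * egauss (v1 + b1) *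
     (egauss (v2 + b2) * epow b2 s)"
     using icols_lcol_append(2)[OF a gb] by (simp add: ennreal_mult ac_simps)
   qed
   also have "... = epow a s * egauss (v1 + b1) *
    (\<integral>\<^sup>+b2. egauss (v2 + b2) * epow b2 s \<partial>lmat p 1)"
    by (rule nn_integral_cmult[OF mi])
   also have "... \<le> epow a s * egauss (v1 + b1) * ?c2"
    by (rule mult_left_mono[OF inner[OF v12(2)]]) simp
   also have "... = epow a s * ?c2 * egauss (v1 + b1)" by (simp only: ac_simps)
   finally show "(\<integral>\<^sup>+b2. ?F (a @\<^sub>c (g * (b1 @\<^sub>r b2))) \<partial>lmat p 1) \<le> epow a s * ?c2 * egauss (v1 + b1)" .
  qed
  also have "... = epow a s * ?c2 * (\<integral>\<^sup>+b1. egauss (v1 + b1) \<partial>lmat m 1)"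
   by (rule nn_integral_cmult) (use measurable_gauss_shift[OF v12(1)] in simp)
  also have "(\<integral>\<^sup>+b1. egauss (v1 + b1) \<partial>lmat m 1) = ennreal (sqrt pi ^ m)"
   using nn_integral_lmat_translate[OF measurable_exp_sqn v12(1)] nn_integral_gauss[of m 1] by simp
  also have "epow a s * ?c2 * ennreal (sqrt pi ^ m) = ?C * epow a s" by (simp only: ac_simps)
  finally show "(\<integral>\<^sup>+b. egauss (v + b) * epow (a @\<^sub>c b) s \<partial>lmat n 1) \<le> ?C * epow a s" .
 qed
qed

text \<open>The number of columns is the last argument, so that \<open>kernel_measure n s\<close> is
  a family of the kind required by \<open>riesz_family\<close>.\<close>

definition kernel_measure :: "nat => real => nat => real mat measure" where
 "kernel_measure n s m = density (lmat n m) (\<lambda>y. epow y s)"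

lemma sets_kernel_measure [simp]: "sets (kernel_measure n s m) = sets (borel_mat n m)"
 by (simp add: kernel_measure_def)

lemma measurable_lmat_powr: "(\<lambda>y. epow y s) \<in> borel_measurable (lmat n m)"
 by (simp add: measurable_mat_abs_powr)

lemma nn_integral_kernel_measure:
 assumes "F \<in> borel_fun n m"
 shows "(\<integral>\<^sup>+y. F y \<partial>kernel_measure n s m) = (\<integral>\<^sup>+y. epow y s * F y \<partial>lmat n m)"
 unfolding kernel_measure_def by (rule nn_integral_density[OF measurable_lmat_powr]) (use assms in simp)

lemma measurable_drop_integrand:
 assumes "v \<in> carrier_mat n 1" "G \<in> borel_fun n m"
 shows "(\<lambda>y. egauss (v + lcol n m y) * G (icols n m y)) \<in> borel_fun n (m + 1)"
 by (rule times_ennreal[OF mcomp[OF measurable_lcol measurable_gauss_shift[OF assms(1)]]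
    mcomp[OF measurable_icols assms(2)]])

text \<open>The two powers cancel where \<open>mat_abs y\<close> is nonzero and give 0 elsewhere, so
  at most a translated Gaussian remains.\<close>

lemma kernel_frozen:
 assumes z: "z \<in> carrier_mat n m"
 shows "(\<integral>\<^sup>+y. epow y (- t) * (egauss (z + y) * epow y t) \<partial>lmat n m)
  \<le> ennreal (sqrt pi ^ (n * m))"
proof -
 have "(\<integral>\<^sup>+y. epow y (- t) * (egauss (z + y) * epow y t) \<partial>lmat n m) \<le>
  (\<integral>\<^sup>+y. egauss (z + y) \<partial>lmat n m)"
 proof (rule nn_integral_mono)
  fix y :: "real mat"
  have "mat_abs y powr - t * mat_abs y powr t \<le> 1" by (simp add: powr_def exp_add[symmetric])
  then have "exp (- sqn (z + y)) * (mat_abs y powr - t * mat_abs y powr t) \<le> exp (- sqn (z + y)) * 1"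
   by (intro mult_left_mono) auto
  then have "mat_abs y powr - t * (exp (- sqn (z + y)) * mat_abs y powr t) \<le> exp (- sqn (z + y))"
   by (simp only: ac_simps mult_1_right)
  then show "epow y (- t) * (egauss (z + y) * epow y t) \<le> egauss (z + y)"
   by (simp add: ennreal_mult[symmetric] ennreal_leI)
 qed
 also have "... = ennreal (sqrt pi ^ (n * m))"
  using nn_integral_lmat_translate[OF measurable_exp_sqn z] nn_integral_gauss[of n m] by simp
 finally show ?thesis .
qed

text \<open>The bound \<open>real mm - 1 < lam\<close> gives the kernel finite Gaussian integrals
  despite its singularity, and \<open>lam <= n\<close> makes its exponent nonpositive, as required
  for integrating out a column.\<close>

lemma riesz_family_kernel:
 assumes mm: "mm \<le> n" and lam: "real mm - 1 < lam" "lam \<le> real n"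
 shows "riesz_family n mm lam (kernel_measure n (lam - real n))"
proof
 let ?s = "lam - real n"
 show "lam \<le> real n" by (rule lam)
 show "sets (kernel_measure n ?s m) = sets (borel_mat n m)" for m by simp
 show "ennreal (\<bar>det T\<bar> powr lam) * (\<integral>\<^sup>+y. F (y * T) \<partial>kernel_measure n ?s m) = (\<integral>\<^sup>+y. F y \<partial>kernel_measure n ?s m)"
  if m: "m \<le> mm" and T: "T \<in> carrier_mat m m" "det T \<noteq> 0" and F: "F \<in> borel_fun n m" for m T F
 proof -
  let ?K = "\<lambda>y. epow y ?s * F y"
  have mK: "?K \<in> borel_fun n m" by (rule times_ennreal[OF measurable_mat_abs_powr F])
  have FT: "(\<lambda>y. F (y * T)) \<in> borel_fun n m" by (rule measurable_mat_mult_right[OF F T(1)])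
  have d: "\<bar>det T\<bar> ^ n * \<bar>det T\<bar> powr ?s = \<bar>det T\<bar> powr lam"
   using T(2) by (simp add: powr_realpow[symmetric] powr_add[symmetric])
  have "(\<integral>\<^sup>+y. F y \<partial>kernel_measure n ?s m) = (\<integral>\<^sup>+y. ?K y \<partial>lmat n m)" by (rule nn_integral_kernel_measure[OF F])
  also have "... = ennreal (\<bar>det T\<bar> ^ n) * (\<integral>\<^sup>+y. ?K (y * T) \<partial>lmat n m)"
   by (rule nn_integral_lmat_mult_right[OF T mK, symmetric])
  also have "(\<integral>\<^sup>+y. ?K (y * T) \<partial>lmat n m) = (\<integral>\<^sup>+y. ennreal (\<bar>det T\<bar> powr ?s) * (epow y ?s * F (y * T)) \<partial>lmat n m)"
  proof (rule lmat_cong)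
   fix y :: "real mat" assume y: "y \<in> carrier_mat n m"
   have "mat_abs (y * T) powr ?s = \<bar>det T\<bar> powr ?s * mat_abs y powr ?s"
    using mat_abs_mult_right[OF y T(1)] by (simp add: powr_mult mult.commute)
   then show "?K (y * T) = ennreal (\<bar>det T\<bar> powr ?s) * (epow y ?s * F (y * T))"
    by (simp add: ennreal_mult mult.assoc)
  qed
  also have "... = ennreal (\<bar>det T\<bar> powr ?s) * (\<integral>\<^sup>+y. epow y ?s * F (y * T) \<partial>lmat n m)"
   by (rule nn_integral_cmult) (simp, rule times_ennreal[OF measurable_mat_abs_powr FT])
  also have "(\<integral>\<^sup>+y. epow y ?s * F (y * T) \<partial>lmat n m) = (\<integral>\<^sup>+y. F (y * T) \<partial>kernel_measure n ?s m)"
   by (rule nn_integral_kernel_measure[OF FT, symmetric])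
  finally show ?thesis using d by (simp add: mult.assoc[symmetric] ennreal_mult[symmetric])
 qed
 show "(\<integral>\<^sup>+y. egauss y \<partial>kernel_measure n ?s m) < \<infinity>" if m: "m \<le> mm" for m
 proof -
  have "(\<integral>\<^sup>+y. egauss y \<partial>kernel_measure n ?s m) = (\<integral>\<^sup>+y. egauss y * epow y ?s \<partial>lmat n m)"
   unfolding nn_integral_kernel_measure[OF measurable_exp_sqn] by (simp only: mult.commute)
  also have "... = ennreal (Kr n m ?s)" by (rule nn_gauss_powr) (use m mm lam in auto)
  finally show ?thesis by simp
 qed
 show "\<exists>C<\<infinity>. \<forall>z\<in>carrier_mat n m.
   (\<integral>\<^sup>+y. egauss (z + y) * epow y (real n - lam) \<partial>kernel_measure n ?s m) \<le> C" for m
 proof (intro exI[of _ "ennreal (sqrt pi ^ (n * m))"] conjI ballI)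
  fix z :: "real mat" assume z: "z \<in> carrier_mat n m"
  have "(\<lambda>y. egauss (z + y) * epow y (real n - lam)) \<in> borel_fun n m"
   by (rule times_ennreal[OF measurable_gauss_shift[OF z] measurable_mat_abs_powr])
  from nn_integral_kernel_measure[OF this, of ?s]
  show "(\<integral>\<^sup>+y. egauss (z + y) * epow y (real n - lam) \<partial>kernel_measure n ?s m) \<le> ennreal (sqrt pi ^ (n * m))"
   using kernel_frozen[OF z, of "real n - lam"] by simp
 qed simp
 show "\<exists>C<\<infinity>. \<forall>v\<in>carrier_mat n 1. \<forall>G\<in>borel_fun n m.
   (\<integral>\<^sup>+y. egauss (v + lcol n m y) * G (icols n m y) \<partial>kernel_measure n ?s (m + 1)) \<le> C * (\<integral>\<^sup>+y. G y \<partial>kernel_measure n ?s m)"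
  if m: "m + 1 \<le> mm" for m
 proof -
  have "\<exists>C<\<infinity>. \<forall>v\<in>carrier_mat n 1. \<forall>a\<in>carrier_mat n m. mat_abs a \<noteq> 0 \<longrightarrow>
   (\<integral>\<^sup>+b. egauss (v + b) * epow (a @\<^sub>c b) ?s \<partial>lmat n 1) \<le> C * epow a ?s"
   by (rule column_weight_bound) (use m mm lam in auto)
  then obtain C where C: "C < \<infinity>" "\<And>v a. v \<in> carrier_mat n 1 ==> a \<in> carrier_mat n m ==> mat_abs a \<noteq> 0 ==>
   (\<integral>\<^sup>+b. egauss (v + b) * epow (a @\<^sub>c b) ?s \<partial>lmat n 1) \<le> C * epow a ?s"
   by blast
  show ?thesis
  proof (intro exI[of _ C] conjI ballI C(1))
   fix v :: "real mat" and G :: "real mat => ennreal"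
   assume v: "v \<in> carrier_mat n 1" and G: "G \<in> borel_fun n m"
   let ?F = "\<lambda>y. egauss (v + lcol n m y) * G (icols n m y)"
   have mF: "?F \<in> borel_fun n (m + 1)" by (rule measurable_drop_integrand[OF v G])
   have mK: "(\<lambda>y. epow y ?s * ?F y) \<in> borel_fun n (m + 1)"
    by (rule times_ennreal[OF measurable_mat_abs_powr mF])
   have "(\<integral>\<^sup>+y. ?F y \<partial>kernel_measure n ?s (m + 1)) = (\<integral>\<^sup>+a. \<integral>\<^sup>+b. epow (a @\<^sub>c b) ?s * ?F (a @\<^sub>c b) \<partial>lmat n 1 \<partial>lmat n m)"
    unfolding nn_integral_kernel_measure[OF mF] by (rule nn_integral_lmat_cols(1)[OF mK])
   also have "... \<le> (\<integral>\<^sup>+a. C * (epow a ?s * G a) \<partial>lmat n m)"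
   proof (rule nn_integral_mono_AE, rule AE_mp[OF AE_nonsingular], goal_cases)
    case 2
    show ?case
    proof (rule AE_I2, rule impI)
     fix a assume "a \<in> space (lmat n m)" and a0: "mat_abs a \<noteq> 0"
     then have a: "a \<in> carrier_mat n m" by simp
     have mb: "(\<lambda>b. egauss (v + b) * epow (a @\<^sub>c b) ?s) \<in> borel_measurable (lmat n 1)"
     proof -
      have "(\<lambda>b. a @\<^sub>c b) \<in> borel_mat n 1 \<rightarrow>\<^sub>M borel_mat n (m + 1)"
       by (rule measurable_append_cols) (use a in auto)
      then show ?thesis unfolding measurable_lmat
       by (rule times_ennreal[OF measurable_gauss_shift[OF v] mcomp[OF _ measurable_mat_abs_powr]])
     qed
     have "(\<integral>\<^sup>+b. epow (a @\<^sub>c b) ?s * ?F (a @\<^sub>c b) \<partial>lmat n 1) =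
      (\<integral>\<^sup>+b. G a * (egauss (v + b) * epow (a @\<^sub>c b) ?s) \<partial>lmat n 1)"
      by (rule nn_integral_cong) (use a in "simp add: ac_simps")
     also have "... = G a * (\<integral>\<^sup>+b. egauss (v + b) * epow (a @\<^sub>c b) ?s \<partial>lmat n 1)"
      by (rule nn_integral_cmult[OF mb])
     also have "... \<le> G a * (C * epow a ?s)" by (rule mult_left_mono[OF C(2)[OF v a a0]]) simp
     also have "... = C * (epow a ?s * G a)" by (simp only: ac_simps)
     finally show "(\<integral>\<^sup>+b. epow (a @\<^sub>c b) ?s * ?F (a @\<^sub>c b) \<partial>lmat n 1) \<le> C * (epow a ?s * G a)" .
    qed
   qed (use m mm in simp)
   also have "... = C * (\<integral>\<^sup>+a. epow a ?s * G a \<partial>lmat n m)"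
    by (rule nn_integral_cmult) (simp, rule times_ennreal[OF measurable_mat_abs_powr G])
   also have "(\<integral>\<^sup>+a. epow a ?s * G a \<partial>lmat n m) = (\<integral>\<^sup>+y. G y \<partial>kernel_measure n ?s m)"
    by (rule nn_integral_kernel_measure[OF G, symmetric])
   finally show "(\<integral>\<^sup>+y. ?F y \<partial>kernel_measure n ?s (m + 1)) \<le> C * (\<integral>\<^sup>+y. G y \<partial>kernel_measure n ?s m)" .
  qed
 qed
qed

lemma rank_point:
 assumes "l \<le> n" "w \<in> carrier_mat l m"
 shows "w @\<^sub>r 0\<^sub>m (n - l) m \<in> carrier_mat n m"
 using carrier_append_rows[OF assms(2) zero_carrier_mat[of "n - l" m]] assms(1) by simp

lemma measurable_rank_point:
 assumes "l \<le> n"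
 shows "(\<lambda>w. w @\<^sub>r 0\<^sub>m (n - l) m) \<in> borel_mat l m \<rightarrow>\<^sub>M borel_mat n m"
 using measurable_append_rows[of "\<lambda>w. w" "borel_mat l m" l m "\<lambda>w. 0\<^sub>m (n - l) m" "n - l"] assms by simp

lemma space_stfD: "h \<in> space (stf n n) ==> h \<in> orth_group n"
 using haarD(2)[of n] by (simp add: stiefel_square)

text \<open>For \<open>m > l\<close> the weight in \<open>frozen\<close> is zero on matrices of rank
  at most \<open>l\<close>; for \<open>m\<close> at most \<open>l\<close> the density is used. In
  \<open>drop\<close> the last column of the \<open>l\<close>-row matrix is integrated first, and
  the component of the rotated centre outside the first \<open>l\<close> coordinates only decreases
  the Gaussian.\<close>

lemma riesz_family_rank:
 assumes ln: "l \<le> n"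
 shows "riesz_family n mm (real l) (\<lambda>m. rank_measure n m l)"
proof
 show "real l \<le> real n" using ln by simp
 show "sets (rank_measure n m l) = sets (borel_mat n m)" for m by simp
 show "ennreal (\<bar>det T\<bar> powr real l) * (\<integral>\<^sup>+y. F (y * T) \<partial>rank_measure n m l) = (\<integral>\<^sup>+y. F y \<partial>rank_measure n m l)"
  if T: "T \<in> carrier_mat m m" "det T \<noteq> 0" and F: "F \<in> borel_fun n m" for m T F
 proof -
  have FT: "(\<lambda>y. F (y * T)) \<in> borel_fun n m" by (rule measurable_mat_mult_right[OF F T(1)])
  have mH: "(\<lambda>w. havg n F (w @\<^sub>r 0\<^sub>m (n - l) m)) \<in> borel_fun l m"
   by (rule mcomp[OF measurable_rank_point[OF ln] measurable_havg[OF F]])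
  have "(\<integral>\<^sup>+y. F (y * T) \<partial>rank_measure n m l) = (\<integral>\<^sup>+w. havg n F ((w * T) @\<^sub>r 0\<^sub>m (n - l) m) \<partial>lmat l m)"
   unfolding nn_integral_rank_measure[OF ln FT]
  proof (rule lmat_cong)
   fix w :: "real mat" assume w: "w \<in> carrier_mat l m"
   show "havg n (\<lambda>y. F (y * T)) (w @\<^sub>r 0\<^sub>m (n - l) m) = havg n F ((w * T) @\<^sub>r 0\<^sub>m (n - l) m)"
    unfolding havg_def
   proof (rule nn_integral_cong)
    fix h assume "h \<in> space (stf n n)"
    then have h: "h \<in> carrier_mat n n" by (rule orth_groupD(1)[OF space_stfD])
    have "h * (w @\<^sub>r 0\<^sub>m (n - l) m) * T = h * ((w @\<^sub>r 0\<^sub>m (n - l) m) * T)"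
     by (rule assoc_mult_mat[OF h rank_point[OF ln w] T(1)])
    also have "(w @\<^sub>r 0\<^sub>m (n - l) m) * T = (w * T) @\<^sub>r 0\<^sub>m (n - l) m"
     using append_rows_mult[OF T(1) w zero_carrier_mat[of "n - l" m]] T(1) by simp
    finally show "F (h * (w @\<^sub>r 0\<^sub>m (n - l) m) * T) = F (h * ((w * T) @\<^sub>r 0\<^sub>m (n - l) m))" by simp
   qed
  qed
  then have "ennreal (\<bar>det T\<bar> ^ l) * (\<integral>\<^sup>+y. F (y * T) \<partial>rank_measure n m l) = (\<integral>\<^sup>+y. F y \<partial>rank_measure n m l)"
   using nn_integral_lmat_mult_right[OF T mH] nn_integral_rank_measure[OF ln F] by simp
  then show ?thesis using T(2) by (simp add: powr_realpow)
 qed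
 show "(\<integral>\<^sup>+y. egauss y \<partial>rank_measure n m l) < \<infinity>" for m
 proof -
  have "(\<integral>\<^sup>+y. egauss y \<partial>rank_measure n m l) = (\<integral>\<^sup>+w. egauss w \<partial>lmat l m)"
   unfolding nn_integral_rank_measure[OF ln measurable_exp_sqn]
  proof (rule lmat_cong)
   fix w :: "real mat" assume w: "w \<in> carrier_mat l m"
   have "havg n (\<lambda>y. egauss y) (w @\<^sub>r 0\<^sub>m (n - l) m) = (\<integral>\<^sup>+h. egauss w \<partial>stf n n)"
    unfolding havg_def
   proof (rule nn_integral_cong)
    fix h assume "h \<in> space (stf n n)"
    then show "egauss (h * (w @\<^sub>r 0\<^sub>m (n - l) m)) = egauss w"
     using sqn_orth[OF space_stfD rank_point[OF ln w]] sqn_append_rows[OF w zero_carrier_mat[of "n - l" m]] by simp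
   qed
   then show "havg n (\<lambda>y. egauss y) (w @\<^sub>r 0\<^sub>m (n - l) m) = egauss w"
    by (simp only: nn_integral_stf_const)
  qed
  then show ?thesis by (simp add: nn_integral_gauss)
 qed
 show "\<exists>C<\<infinity>. \<forall>z\<in>carrier_mat n m.
   (\<integral>\<^sup>+y. egauss (z + y) * epow y (real n - real l) \<partial>rank_measure n m l) \<le> C" for m
 proof (cases "m \<le> l")
  case True
  let ?s = "real l - real n"
  let ?c = "Kr l m 0 / Kr n m ?s"
  have c: "0 \<le> ?c"
   by (rule divide_nonneg_nonneg; rule less_imp_le, rule Kr_pos) (use True ln in auto)
  show ?thesis
  proof (intro exI[of _ "ennreal ?c * ennreal (sqrt pi ^ (n * m))"] conjI ballI)
   show "ennreal ?c * ennreal (sqrt pi ^ (n * m)) < \<infinity>" by (simp add: ennreal_mult_less_top)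
   fix z :: "real mat" assume z: "z \<in> carrier_mat n m"
   let ?F = "\<lambda>y. egauss (z + y) * epow y (real n - real l)"
   have mF: "?F \<in> borel_fun n m"
    by (rule times_ennreal[OF measurable_gauss_shift[OF z] measurable_mat_abs_powr])
   have mw: "(\<lambda>y. ennreal (?c * mat_abs y powr ?s)) \<in> borel_measurable (lmat n m)"
    unfolding measurable_lmat by (rule measurable_mat_abs_weight)
   have "(\<integral>\<^sup>+y. ?F y \<partial>rank_measure n m l) = (\<integral>\<^sup>+y. ennreal (?c * mat_abs y powr ?s) * ?F y \<partial>lmat n m)"
    unfolding rank_measure_density[OF True ln]
    by (rule nn_integral_density[OF mw]) (use mF in simp)
   also have "... = (\<integral>\<^sup>+y. ennreal ?c * (epow y ?s * ?F y) \<partial>lmat n m)"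
    by (rule nn_integral_cong) (use c in "simp only: ennreal_mult powr_ge_zero mult.assoc")
   also have "... = ennreal ?c * (\<integral>\<^sup>+y. epow y ?s * ?F y \<partial>lmat n m)"
    by (rule nn_integral_cmult) (unfold measurable_lmat, rule times_ennreal[OF measurable_mat_abs_powr mF])
   also have "... \<le> ennreal ?c * ennreal (sqrt pi ^ (n * m))"
    using kernel_frozen[OF z, of "real n - real l"] by (intro mult_left_mono) simp_all
   finally show "(\<integral>\<^sup>+y. ?F y \<partial>rank_measure n m l) \<le> ennreal ?c * ennreal (sqrt pi ^ (n * m))" .
  qed
 next
  case False
  show ?thesis
  proof (intro exI[of _ 0] conjI ballI)
   fix z :: "real mat" assume z: "z \<in> carrier_mat n m"
   let ?F = "\<lambda>y. egauss (z + y) * epow y (real n - real l)"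
   have mF: "?F \<in> borel_fun n m"
    by (rule times_ennreal[OF measurable_gauss_shift[OF z] measurable_mat_abs_powr])
   have "(\<integral>\<^sup>+y. ?F y \<partial>rank_measure n m l) = (\<integral>\<^sup>+w. 0 \<partial>lmat l m)"
    unfolding nn_integral_rank_measure[OF ln mF]
   proof (rule lmat_cong)
    fix w :: "real mat" assume w: "w \<in> carrier_mat l m"
    have "havg n ?F (w @\<^sub>r 0\<^sub>m (n - l) m) = (\<integral>\<^sup>+h. 0 \<partial>stf n n)"
     unfolding havg_def
    proof (rule nn_integral_cong)
     fix h assume "h \<in> space (stf n n)"
     then have "mat_abs (h * (w @\<^sub>r 0\<^sub>m (n - l) m)) = 0"
      using mat_abs_orth[OF space_stfD rank_point[OF ln w]] mat_abs_append_zero[OF w, of "n - l"] mat_abs_zero_wide[OF w] False by simp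
     then show "?F (h * (w @\<^sub>r 0\<^sub>m (n - l) m)) = 0" by simp
    qed
    then show "havg n ?F (w @\<^sub>r 0\<^sub>m (n - l) m) = 0" by simp
   qed
   then show "(\<integral>\<^sup>+y. ?F y \<partial>rank_measure n m l) \<le> 0" by simp
  qed simp
 qed
 show "\<exists>C<\<infinity>. \<forall>v\<in>carrier_mat n 1. \<forall>G\<in>borel_fun n m.
   (\<integral>\<^sup>+y. egauss (v + lcol n m y) * G (icols n m y) \<partial>rank_measure n (m + 1) l) \<le> C * (\<integral>\<^sup>+y. G y \<partial>rank_measure n m l)" for m
 proof (intro exI[of _ "ennreal (sqrt pi ^ l)"] conjI ballI)
  fix v :: "real mat" and G :: "real mat => ennreal"
  assume v: "v \<in> carrier_mat n 1" and G: "G \<in> borel_fun n m"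
  interpret P: pair_sigma_finite "lmat l 1" "stf n n" by (rule pair_sigma_finite_stf)
  let ?F = "\<lambda>y. egauss (v + lcol n m y) * G (icols n m y)"
  let ?z = "\<lambda>w m. w @\<^sub>r 0\<^sub>m (n - l) m"
  have mF: "?F \<in> borel_fun n (m + 1)" by (rule measurable_drop_integrand[OF v G])
  have mH: "(\<lambda>w. havg n ?F (?z w (m + 1))) \<in> borel_fun l (m + 1)"
   by (rule mcomp[OF measurable_rank_point[OF ln] measurable_havg[OF mF]])
  have inner: "(\<integral>\<^sup>+w. egauss (v + h * ?z w 1) \<partial>lmat l 1) \<le> ennreal (sqrt pi ^ l)"
   if h: "h \<in> orth_group n" for h
  proof -
   note hD = orth_groupD[OF h]
   have "h\<^sup>T * v \<in> carrier_mat (l + (n - l)) 1" using hD(1) v ln by simp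
   then obtain v1 v2 where v12: "v1 \<in> carrier_mat l 1" "v2 \<in> carrier_mat (n - l) 1" "h\<^sup>T * v = v1 @\<^sub>r v2"
    by (rule split_rows)
   have "(\<integral>\<^sup>+w. egauss (v + h * ?z w 1) \<partial>lmat l 1) \<le> (\<integral>\<^sup>+w. egauss (v1 + w) \<partial>lmat l 1)"
   proof (rule lmat_mono)
    fix w :: "real mat" assume w: "w \<in> carrier_mat l 1"
    have vc: "v1 @\<^sub>r v2 \<in> carrier_mat n 1" using carrier_append_rows[OF v12(1,2)] ln by simp
    have s: "v1 + w \<in> carrier_mat l 1" using w by simp
    have "v + h * ?z w 1 = h * ((v1 @\<^sub>r v2) + ?z w 1)"
     using mult_add_distrib_mat[OF hD(1) vc rank_point[OF ln w]] orth_cancel(2)[OF h v] v12(3) by simp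
    also have "(v1 @\<^sub>r v2) + ?z w 1 = (v1 + w) @\<^sub>r v2"
     by (rule eq_matI) (use v12 w in "auto simp: append_rows_def")
    also have "sqn (h * ((v1 + w) @\<^sub>r v2)) = sqn (v1 + w) + sqn v2"
     using sqn_orth[OF h, of "(v1 + w) @\<^sub>r v2" 1] sqn_append_rows[OF s v12(2)] carrier_append_rows[OF s v12(2)] ln by simp
    finally have "sqn (v + h * ?z w 1) = sqn (v1 + w) + sqn v2" .
    moreover have "0 \<le> sqn v2" by (simp add: sqn_def sum_nonneg)
    ultimately show "egauss (v + h * ?z w 1) \<le> egauss (v1 + w)" by (intro ennreal_leI) simp
   qed
   also have "... = ennreal (sqrt pi ^ l)"
    using nn_integral_lmat_translate[OF measurable_exp_sqn v12(1)] nn_integral_gauss[of l 1] by simp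
   finally show ?thesis .
  qed
  have "(\<integral>\<^sup>+y. ?F y \<partial>rank_measure n (m + 1) l) = (\<integral>\<^sup>+a. \<integral>\<^sup>+w. havg n ?F (?z (a @\<^sub>c w) (m + 1)) \<partial>lmat l 1 \<partial>lmat l m)"
   unfolding nn_integral_rank_measure[OF ln mF] by (rule nn_integral_lmat_cols(1)[OF mH])
  also have "... \<le> (\<integral>\<^sup>+a. ennreal (sqrt pi ^ l) * havg n G (?z a m) \<partial>lmat l m)"
  proof (rule lmat_mono)
   fix a :: "real mat" assume a: "a \<in> carrier_mat l m"
   let ?K = "\<lambda>w h. egauss (v + h * ?z w 1) * G (h * ?z a m)"
   have me: "(\<lambda>(w, h). egauss (v + h * ?z w 1)) \<in> borel_measurable (lmat l 1 \<Otimes>\<^sub>M stf n n)"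
    using mcomp[OF measurable_rank_map[OF ln, of 1] measurable_gauss_shift[OF v]] by (simp add: case_prod_unfold)
   have mGh: "(\<lambda>h. G (h * ?z a m)) \<in> borel_measurable (stf n n)"
    by (rule measurable_stf[OF order_refl], rule mcomp[OF measurable_mat_times[where k=n] G])
     (use rank_point[OF ln a] in auto)
   have mK: "(\<lambda>(w, h). ?K w h) \<in> borel_measurable (lmat l 1 \<Otimes>\<^sub>M stf n n)"
    using times_ennreal[OF me mcomp[OF measurable_snd mGh]] by (simp add: case_prod_unfold)
   have "(\<integral>\<^sup>+w. havg n ?F (?z (a @\<^sub>c w) (m + 1)) \<partial>lmat l 1) = (\<integral>\<^sup>+w. \<integral>\<^sup>+h. ?K w h \<partial>stf n n \<partial>lmat l 1)"
    unfolding havg_def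
   proof (intro nn_integral_cong)
    fix w h assume "w \<in> space (lmat l 1)" "h \<in> space (stf n n)"
    then have w: "w \<in> carrier_mat l 1" and h: "h \<in> carrier_mat n n" using orth_groupD(1)[OF space_stfD] by auto
    have "?z (a @\<^sub>c w) (m + 1) = ?z a m @\<^sub>c ?z w 1"
     by (rule eq_matI) (use a w in "auto simp: append_rows_def append_cols_def")
    then have "h * ?z (a @\<^sub>c w) (m + 1) = (h * ?z a m) @\<^sub>c (h * ?z w 1)"
     using mult_append_cols[OF h rank_point[OF ln a] rank_point[OF ln w]] by simp
    then show "?F (h * ?z (a @\<^sub>c w) (m + 1)) = ?K w h"
     using icols_lcol_append[OF mult_carrier_mat[OF h rank_point[OF ln a]] mult_carrier_mat[OF h rank_point[OF ln w]]] by simp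
   qed
   also have "... = (\<integral>\<^sup>+h. \<integral>\<^sup>+w. ?K w h \<partial>lmat l 1 \<partial>stf n n)"
    by (rule P.Fubini'[OF mK, symmetric])
   also have "... \<le> (\<integral>\<^sup>+h. ennreal (sqrt pi ^ l) * G (h * ?z a m) \<partial>stf n n)"
   proof (rule nn_integral_mono)
    fix h assume h: "h \<in> space (stf n n)"
    have mh: "(\<lambda>w. egauss (v + h * ?z w 1)) \<in> borel_measurable (lmat l 1)"
     using measurable_Pair1[OF me h] by simp
    have "(\<integral>\<^sup>+w. ?K w h \<partial>lmat l 1) = (\<integral>\<^sup>+w. egauss (v + h * ?z w 1) \<partial>lmat l 1) * G (h * ?z a m)"
     by (rule nn_integral_multc[OF mh])
    also have "... \<le> ennreal (sqrt pi ^ l) * G (h * ?z a m)"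
     by (rule mult_right_mono[OF inner[OF space_stfD[OF h]]]) simp
    finally show "(\<integral>\<^sup>+w. ?K w h \<partial>lmat l 1) \<le> ennreal (sqrt pi ^ l) * G (h * ?z a m)" .
   qed
   also have "... = ennreal (sqrt pi ^ l) * havg n G (?z a m)"
    unfolding havg_def by (rule nn_integral_cmult[OF mGh])
   finally show "(\<integral>\<^sup>+w. havg n ?F (?z (a @\<^sub>c w) (m + 1)) \<partial>lmat l 1) \<le> ennreal (sqrt pi ^ l) * havg n G (?z a m)" .
  qed
  also have "... = ennreal (sqrt pi ^ l) * (\<integral>\<^sup>+a. havg n G (?z a m) \<partial>lmat l m)"
   by (rule nn_integral_cmult) (unfold measurable_lmat, rule mcomp[OF measurable_rank_point[OF ln] measurable_havg[OF G]])
  also have "(\<integral>\<^sup>+a. havg n G (?z a m) \<partial>lmat l m) = (\<integral>\<^sup>+y. G y \<partial>rank_measure n m l)"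
   by (rule nn_integral_rank_measure[OF ln G, symmetric])
  finally show "(\<integral>\<^sup>+y. ?F y \<partial>rank_measure n (m + 1) l) \<le> ennreal (sqrt pi ^ l) * (\<integral>\<^sup>+y. G y \<partial>rank_measure n m l)" .
 qed simp
qed

section \<open>Integrals over completed measures\<close>

text \<open>Equality almost everywhere with a Borel \<open>G\<close> already makes \<open>F\<close>
  measurable for the completion. This admits integrands built from \<open>rotation_to\<close>, whose
  own measurability is unknown.\<close>

lemma integral_completion_AE:
 fixes F G :: "'a => complex"
 assumes G: "G \<in> borel_measurable M" and ae: "AE x in M. F x = G x"
 shows "integral\<^sup>L (completion M) F = integral\<^sup>L M G"
proof -
 have Gc: "G \<in> borel_measurable (completion M)" by (rule measurable_completion[OF G])
 have aec: "AE x in completion M. F x = G x" by (rule AE_completion[OF ae])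
 have Fc: "F \<in> borel_measurable (completion M)"
 proof (rule measurableI)
  fix S :: "complex set" assume S: "S \<in> sets borel"
  show "F -` S \<inter> space (completion M) \<in> sets (completion M)"
  proof (rule completion.in_sets_AE[OF _ measurable_sets[OF Gc S]])
   show "AE x in completion M. x \<in> G -` S \<inter> space (completion M) \<longleftrightarrow> x \<in> F -` S \<inter> space (completion M)"
    by (rule AE_mp[OF aec], rule AE_I2) simp
  qed simp
 qed simp
 have "integral\<^sup>L (completion M) F = integral\<^sup>L (completion M) G" by (rule integral_cong_AE[OF Fc Gc aec])
 also have "... = integral\<^sup>L M G" by (rule integral_completion[OF G])
 finally show ?thesis .
qed

lemma riesz_kernel_eq:
 assumes h: "h \<in> borel_fun N m" and ae: "AE y in lmat N m. \<phi> (u - y) = h y"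
 shows "riesz_kernel N m \<beta> \<phi> u =
  1 / riesz_gamma N m \<beta> * (\<integral>y. h y * of_real (mat_abs y) powr (\<beta> - of_nat N) \<partial>lmat N m)"
proof -
 have "(\<integral>y. \<phi> (u - y) * of_real (mat_abs y) powr (\<beta> - of_nat N) \<partial>completion (lmat N m)) =
  (\<integral>y. h y * of_real (mat_abs y) powr (\<beta> - of_nat N) \<partial>lmat N m)"
 proof (rule integral_completion_AE)
  show "(\<lambda>y. h y * of_real (mat_abs y) powr (\<beta> - of_nat N)) \<in> borel_measurable (lmat N m)"
   unfolding measurable_lmat by (rule borel_measurable_times[OF h measurable_mat_abs_cpowr])
 qed (rule AE_mp[OF ae], rule AE_I2, simp)
 then show ?thesis by (simp add: riesz_kernel_def lebesgue_mat_eq)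
qed

definition riesz_int_const :: "nat => nat => nat => complex" where
 "riesz_int_const n m j = of_real (2 powr - (real j * real m) * pi powr - (real j * real m / 2)) *
   Gamma_mat m ((of_nat n - of_nat j) / 2) / Gamma_mat m (of_nat n / 2)"

text \<open>Equality almost everywhere for the image measure is pulled back to pairs
  \<open>(w, g)\<close> and split into almost all \<open>g\<close> for almost all \<open>w\<close>,
  matching the two nested completed integrals.\<close>

lemma riesz_int_eq:
 assumes l: "l \<le> N" and h: "h \<in> borel_fun N m"
  and ae: "AE y in rank_measure N m l. \<phi> (u - y) = h y" and int: "integrable (rank_measure N m l) h"
 shows "riesz_int N m l \<phi> u = riesz_int_const N m l * (\<integral>y. h y \<partial>rank_measure N m l)"
proof -
 let ?z = "\<lambda>w g. g * (w @\<^sub>r 0\<^sub>m (N - l) m)"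
 interpret P: pair_sigma_finite "lmat l m" "stf N N" by (rule pair_sigma_finite_stf)
 have mz: "(\<lambda>(w, g). ?z w g) \<in> lmat l m \<Otimes>\<^sub>M stf N N \<rightarrow>\<^sub>M borel_mat N m" by (rule measurable_rank_map[OF l])
 have mh: "(\<lambda>(w, g). h (?z w g)) \<in> borel_measurable (lmat l m \<Otimes>\<^sub>M stf N N)"
  using mcomp[OF mz h] by (simp add: case_prod_unfold)
 have "AE p in lmat l m \<Otimes>\<^sub>M stf N N. \<phi> (u - (case p of (w, g) => ?z w g)) = h (case p of (w, g) => ?z w g)"
  by (rule AE_distrD[OF mz ae[unfolded rank_measure_def]])
 from P.AE_pair[OF this]
 have ae2: "AE w in lmat l m. AE g in stf N N. \<phi> (u - ?z w g) = h (?z w g)" by simp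
 have inner: "AE w in lmat l m. (\<integral>g. \<phi> (u - ?z w g) \<partial>completion (stf N N)) = (\<integral>g. h (?z w g) \<partial>stf N N)"
 proof (rule AE_mp[OF ae2], rule AE_I2, rule impI)
  fix w assume w: "w \<in> space (lmat l m)" and "AE g in stf N N. \<phi> (u - ?z w g) = h (?z w g)"
  then show "(\<integral>g. \<phi> (u - ?z w g) \<partial>completion (stf N N)) = (\<integral>g. h (?z w g) \<partial>stf N N)"
   by (intro integral_completion_AE) (use measurable_Pair2[OF mh w] in simp)
 qed
 have "(\<integral>w. (\<integral>g. \<phi> (u - ?z w g) \<partial>completion (stf N N)) \<partial>completion (lmat l m)) = (\<integral>w. (\<integral>g. h (?z w g) \<partial>stf N N) \<partial>lmat l m)"
  by (rule integral_completion_AE[OF P.M2.borel_measurable_lebesgue_integral[OF mh] inner])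
 also have "... = integral\<^sup>L (lmat l m \<Otimes>\<^sub>M stf N N) (\<lambda>(w, g). h (?z w g))"
  using P.integral_fst'[of "\<lambda>(w, g). h (?z w g)"] int integrable_distr_eq[OF mz h]
  by (simp add: rank_measure_def case_prod_unfold)
 also have "... = (\<integral>y. h y \<partial>rank_measure N m l)"
  unfolding rank_measure_def by (subst integral_distr[OF mz h]) (simp add: case_prod_unfold)
 finally show ?thesis by (simp add: riesz_int_def riesz_int_const_def lebesgue_mat_eq haar_orth_eq)
qed

section \<open>Plane integrals\<close>

text \<open>The Gaussian weight in the direction orthogonal to the plane turns the integral over the plane
 determined by \<open>\<xi>\<close> into an integral over the whole space, so that its measurability in \<open>\<xi>\<close> is
 evident although \<^const>\<open>rotation_to\<close> need not be measurable.\<close>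

definition plane :: "nat => nat => nat => real mat => real mat measure" where
 "plane k q m \<xi> = distr (density (lmat (k + q) m) (\<lambda>z. ennreal (exp (- sqn (\<xi>\<^sup>T * z)) / sqrt pi ^ (q * m))))
   (borel_mat (k + q) m) (\<lambda>z. z - \<xi> * (\<xi>\<^sup>T * z))"

lemma measurable_plane_map:
 assumes "\<xi> \<in> carrier_mat (k + q) q"
 shows "(\<lambda>z. z - \<xi> * (\<xi>\<^sup>T * z)) \<in> borel_mat (k + q) m \<rightarrow>\<^sub>M borel_mat (k + q) m"
  "(\<lambda>z. exp (- sqn (\<xi>\<^sup>T * z)) / sqrt pi ^ (q * m)) \<in> borel_fun (k + q) m"
proof -
 have t: "(\<lambda>z. \<xi>\<^sup>T * z) \<in> borel_mat (k + q) m \<rightarrow>\<^sub>M borel_mat q m"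
  by (rule measurable_mat_times[where k="k + q"]) (use assms in auto)
 show "(\<lambda>z. z - \<xi> * (\<xi>\<^sup>T * z)) \<in> borel_mat (k + q) m \<rightarrow>\<^sub>M borel_mat (k + q) m"
  by (rule measurable_mat_minus[OF measurable_ident_sets[OF refl] measurable_mat_times[OF measurable_const t]]) (use assms in auto)
 show "(\<lambda>z. exp (- sqn (\<xi>\<^sup>T * z)) / sqrt pi ^ (q * m)) \<in> borel_fun (k + q) m"
  by (intro borel_measurable_divide mcomp[OF _ borel_measurable_exp] borel_measurable_uminus
    measurable_sqn[OF t] measurable_const mcomp[OF _ borel_measurable_uminus]) simp_all
qed

lemma sets_plane [simp]: "sets (plane k q m \<xi>) = sets (borel_mat (k + q) m)"
 by (simp add: plane_def)

lemma nn_integral_plane: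
 assumes "\<xi> \<in> carrier_mat (k + q) q" and G: "G \<in> borel_fun (k + q) m"
 shows "(\<integral>\<^sup>+y. G y \<partial>plane k q m \<xi>) =
  (\<integral>\<^sup>+z. ennreal (exp (- sqn (\<xi>\<^sup>T * z)) / sqrt pi ^ (q * m)) * G (z - \<xi> * (\<xi>\<^sup>T * z)) \<partial>lmat (k + q) m)"
 unfolding plane_def
 by (subst nn_integral_distr, use measurable_plane_map(1)[OF assms(1)] G in simp_all,
   rule nn_integral_density, use mcomp[OF measurable_plane_map(2)[OF assms(1)] measurable_ennreal]
    mcomp[OF measurable_plane_map(1)[OF assms(1)] G] in simp_all)

lemma integral_plane:
 fixes G :: "real mat => complex"
 assumes "\<xi> \<in> carrier_mat (k + q) q" and G: "G \<in> borel_fun (k + q) m"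
 shows "(\<integral>y. G y \<partial>plane k q m \<xi>) =
  (\<integral>z. (exp (- sqn (\<xi>\<^sup>T * z)) / sqrt pi ^ (q * m)) *\<^sub>R G (z - \<xi> * (\<xi>\<^sup>T * z)) \<partial>lmat (k + q) m)"
 unfolding plane_def
 by (subst integral_distr, use measurable_plane_map(1)[OF assms(1)] G in simp_all,
   rule integral_density, use measurable_plane_map(2)[OF assms(1)]
    mcomp[OF measurable_plane_map(1)[OF assms(1)] G] in simp_all)

lemma rot_split:
 assumes g: "g \<in> orth_group (k + q)" and w: "w \<in> carrier_mat k m" and t: "t \<in> carrier_mat q m"
 shows "g * (w @\<^sub>r t) \<in> carrier_mat (k + q) m" "(g * low_frame k q)\<^sup>T * (g * (w @\<^sub>r t)) = t"
  "(g * low_frame k q) * t = g * (0\<^sub>m k m @\<^sub>r t)"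
  "g * (w @\<^sub>r t) - (g * low_frame k q) * t = g * (w @\<^sub>r 0\<^sub>m q m)"
  "(g * low_frame k q) * t + g * (w @\<^sub>r 0\<^sub>m q m) = g * (w @\<^sub>r t)"
proof -
 note gc = orth_groupD(1)[OF g]
 have E: "low_frame k q \<in> carrier_mat (k + q) q" by simp
 have wt: "w @\<^sub>r t \<in> carrier_mat (k + q) m" and 0: "0\<^sub>m k m @\<^sub>r t \<in> carrier_mat (k + q) m" "w @\<^sub>r 0\<^sub>m q m \<in> carrier_mat (k + q) m"
  using w t by auto
 show "g * (w @\<^sub>r t) \<in> carrier_mat (k + q) m" by (rule mult_carrier_mat[OF gc wt])
 have "(g * low_frame k q)\<^sup>T * (g * (w @\<^sub>r t)) = (low_frame k q)\<^sup>T * (g\<^sup>T * (g * (w @\<^sub>r t)))"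
  unfolding transpose_mult[OF gc E]
  by (rule assoc_mult_mat[of _ q "k + q" _ "k + q" _ m]) (use gc wt E in auto)
 then show "(g * low_frame k q)\<^sup>T * (g * (w @\<^sub>r t)) = t"
  using orth_cancel(1)[OF g wt] low_frame_mult[OF w t] by simp
 have "low_frame k q * t = 0\<^sub>m k m @\<^sub>r t"
  unfolding low_frame_def using append_rows_mult[OF t zero_carrier_mat[of k q] one_carrier_mat[of q]] t by simp
 then show *: "(g * low_frame k q) * t = g * (0\<^sub>m k m @\<^sub>r t)"
  using assoc_mult_mat[OF gc E t] by simp
 have "(w @\<^sub>r t) - (0\<^sub>m k m @\<^sub>r t) = w @\<^sub>r 0\<^sub>m q m" "(0\<^sub>m k m @\<^sub>r t) + (w @\<^sub>r 0\<^sub>m q m) = w @\<^sub>r t"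
  by (rule eq_matI, use w t in "auto simp: append_rows_def")+
 then show "g * (w @\<^sub>r t) - (g * low_frame k q) * t = g * (w @\<^sub>r 0\<^sub>m q m)"
  "(g * low_frame k q) * t + g * (w @\<^sub>r 0\<^sub>m q m) = g * (w @\<^sub>r t)"
  unfolding * using mult_minus_distrib_mat[OF gc wt 0(1)] mult_add_distrib_mat[OF gc 0] by simp_all
qed

lemma measurable_rot_rows:
 assumes "g \<in> carrier_mat (k + q) (k + q)" "t \<in> carrier_mat q m"
 shows "(\<lambda>w. g * (w @\<^sub>r t)) \<in> borel_mat k m \<rightarrow>\<^sub>M borel_mat (k + q) m"
 by (rule measurable_mat_times[where k="k + q"], use assms(1) in simp,
   rule measurable_append_rows) (use assms(2) in auto)

text \<open>In the coordinates \<open>z = g (w; t)\<close> one has \<open>\<xi>' z = t\<close> and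
  \<open>z - \<xi> \<xi>' z = g (w; 0)\<close>, and the normalized Gaussian in \<open>t\<close>
  integrates to 1.\<close>

lemma plane_orth:
 assumes g: "g \<in> orth_group (k + q)"
 shows "plane k q m (g * low_frame k q) = distr (lmat k m) (borel_mat (k + q) m) (\<lambda>w. g * (w @\<^sub>r 0\<^sub>m q m))"
proof (rule measure_eqI)
 let ?x = "g * low_frame k q"
 note gc = orth_groupD(1)[OF g]
 have x: "?x \<in> carrier_mat (k + q) q" using gc by auto
 fix A assume "A \<in> sets (plane k q m ?x)"
 then have A: "A \<in> sets (borel_mat (k + q) m)" by simp
 then have iA: "(indicator A :: _ => ennreal) \<in> borel_fun (k + q) m" by simp
 let ?H = "\<lambda>z. ennreal (exp (- sqn (?x\<^sup>T * z)) / sqrt pi ^ (q * m)) * indicator A (z - ?x * (?x\<^sup>T * z))"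
 have mH: "?H \<in> borel_fun (k + q) m"
  by (rule times_ennreal[OF mcomp[OF measurable_plane_map(2)[OF x] measurable_ennreal]
    mcomp[OF measurable_plane_map(1)[OF x] iA]])
 have z0: "(\<lambda>w. g * (w @\<^sub>r 0\<^sub>m q m)) \<in> borel_mat k m \<rightarrow>\<^sub>M borel_mat (k + q) m" by (rule measurable_rot_rows[OF gc]) simp
 have "emeasure (plane k q m ?x) A = (\<integral>\<^sup>+y. indicator A y \<partial>plane k q m ?x)" using A by simp
 also have "... = (\<integral>\<^sup>+z. ?H z \<partial>lmat (k + q) m)" by (rule nn_integral_plane[OF x iA])
 also have "... = (\<integral>\<^sup>+z. ?H (g * z) \<partial>lmat (k + q) m)" by (rule nn_integral_lmat_orth[OF g mH, symmetric])
 also have "... = (\<integral>\<^sup>+w. \<integral>\<^sup>+t. ?H (g * (w @\<^sub>r t)) \<partial>lmat q m \<partial>lmat k m)"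
  by (rule nn_integral_lmat_rows(1), rule measurable_mat_mult_left[OF mH gc])
 also have "... = (\<integral>\<^sup>+w. \<integral>\<^sup>+t. (ennreal (1 / sqrt pi ^ (q * m)) * egauss t) * indicator A (g * (w @\<^sub>r 0\<^sub>m q m)) \<partial>lmat q m \<partial>lmat k m)"
  by (intro nn_integral_cong) (use rot_split(2,4)[OF g] in "simp add: ennreal_mult[symmetric]")
 also have "... = (\<integral>\<^sup>+w. (ennreal (1 / sqrt pi ^ (q * m)) * ennreal (sqrt pi ^ (q * m))) * indicator A (g * (w @\<^sub>r 0\<^sub>m q m)) \<partial>lmat k m)"
  by (rule nn_integral_cong, subst nn_integral_multc)
   (use measurable_exp_sqn in "simp_all add: nn_integral_cmult nn_integral_gauss")
 also have "... = (\<integral>\<^sup>+w. indicator A (g * (w @\<^sub>r 0\<^sub>m q m)) \<partial>lmat k m)"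
  by (simp add: ennreal_mult[symmetric])
 also have "... = (\<integral>\<^sup>+y. indicator A y \<partial>distr (lmat k m) (borel_mat (k + q) m) (\<lambda>w. g * (w @\<^sub>r 0\<^sub>m q m)))"
  by (rule nn_integral_distr[symmetric]) (use z0 iA in simp_all)
 also have "... = emeasure (distr (lmat k m) (borel_mat (k + q) m) (\<lambda>w. g * (w @\<^sub>r 0\<^sub>m q m))) A" using A by simp
 finally show "emeasure (plane k q m ?x) A = emeasure (distr (lmat k m) (borel_mat (k + q) m) (\<lambda>w. g * (w @\<^sub>r 0\<^sub>m q m))) A" .
qed simp

text \<open>For a frame \<xi> this is the integral of \<open>G\<close> over the plane of all
  \<open>y\<close> with \<open>\<xi>' y = t\<close>, expressed through \<xi> itself instead of a
  chosen rotation.\<close>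

definition pint :: "nat => nat => nat => (real mat => complex) => real mat => real mat => complex" where
 "pint k q m G \<xi> t = (\<integral>y. G (\<xi> * t + y) \<partial>plane k q m \<xi>)"

definition nn_pint :: "nat => nat => nat => (real mat => ennreal) => real mat => real mat => ennreal" where
 "nn_pint k q m G \<xi> t = (\<integral>\<^sup>+y. G (\<xi> * t + y) \<partial>plane k q m \<xi>)"

lemma measurable_shift_plane:
 assumes "\<xi> \<in> carrier_mat (k + q) q" "t \<in> carrier_mat q m" and G: "G \<in> borel_mat (k + q) m \<rightarrow>\<^sub>M N"
 shows "(\<lambda>y. G (\<xi> * t + y)) \<in> borel_mat (k + q) m \<rightarrow>\<^sub>M N"
 by (rule mcomp[OF measurable_mat_add[where n="k + q" and m=m] G]) (use mult_carrier_mat[OF assms(1,2)] in auto)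

lemma pint_orth:
 assumes g: "g \<in> orth_group (k + q)" and t: "t \<in> carrier_mat q m"
 shows "G \<in> borel_fun (k + q) m ==> pint k q m G (g * low_frame k q) t = (\<integral>w. G (g * (w @\<^sub>r t)) \<partial>lmat k m)"
  "G' \<in> borel_fun (k + q) m ==> nn_pint k q m G' (g * low_frame k q) t = (\<integral>\<^sup>+w. G' (g * (w @\<^sub>r t)) \<partial>lmat k m)"
proof -
 note gc = orth_groupD(1)[OF g]
 have x: "g * low_frame k q \<in> carrier_mat (k + q) q" using gc by auto
 have z0: "(\<lambda>w. g * (w @\<^sub>r 0\<^sub>m q m)) \<in> lmat k m \<rightarrow>\<^sub>M borel_mat (k + q) m" using measurable_rot_rows[OF gc] by simp
 show "pint k q m G (g * low_frame k q) t = (\<integral>w. G (g * (w @\<^sub>r t)) \<partial>lmat k m)" if "G \<in> borel_fun (k + q) m"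
  unfolding pint_def plane_orth[OF g] integral_distr[OF z0 measurable_shift_plane[OF x t that]]
  by (rule Bochner_Integration.integral_cong) (use rot_split(5)[OF g _ t] in simp_all)
 show "nn_pint k q m G' (g * low_frame k q) t = (\<integral>\<^sup>+w. G' (g * (w @\<^sub>r t)) \<partial>lmat k m)" if "G' \<in> borel_fun (k + q) m"
  unfolding nn_pint_def plane_orth[OF g]
  by (subst nn_integral_distr[OF z0]) (use measurable_shift_plane[OF x t that] rot_split(5)[OF g _ t] in "simp_all cong: nn_integral_cong_simp")
qed

lemma measurable_plane_integrand:
 fixes q k m :: nat
 defines "M \<equiv> (borel_mat (k + q) q \<Otimes>\<^sub>M borel_mat q m) \<Otimes>\<^sub>M lmat (k + q) m"
 shows "(\<lambda>((\<xi>, t), z). exp (- sqn (\<xi>\<^sup>T * z)) / sqrt pi ^ (q * m)) \<in> borel_measurable M"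
  "G \<in> borel_mat (k + q) m \<rightarrow>\<^sub>M N ==> (\<lambda>((\<xi>, t), z). G (\<xi> * t + (z - \<xi> * (\<xi>\<^sup>T * z)))) \<in> M \<rightarrow>\<^sub>M N"
proof -
 have x: "(\<lambda>p. fst (fst p)) \<in> M \<rightarrow>\<^sub>M borel_mat (k + q) q" unfolding M_def by measurable
 have t: "(\<lambda>p. snd (fst p)) \<in> M \<rightarrow>\<^sub>M borel_mat q m" unfolding M_def by measurable
 have z: "snd \<in> M \<rightarrow>\<^sub>M borel_mat (k + q) m" unfolding M_def by (rule measurable_snd_lmat)
 have xz: "(\<lambda>p. (fst (fst p))\<^sup>T * snd p) \<in> M \<rightarrow>\<^sub>M borel_mat q m"
  by (rule measurable_mat_times[OF measurable_mat_transpose[OF x] z])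
 show "(\<lambda>((\<xi>, t), z). exp (- sqn (\<xi>\<^sup>T * z)) / sqrt pi ^ (q * m)) \<in> borel_measurable M"
  unfolding case_prod_unfold
  by (intro borel_measurable_divide mcomp[OF _ borel_measurable_exp] borel_measurable_uminus measurable_const
    measurable_sqn[OF xz]) simp
 show "(\<lambda>((\<xi>, t), z). G (\<xi> * t + (z - \<xi> * (\<xi>\<^sup>T * z)))) \<in> M \<rightarrow>\<^sub>M N" if "G \<in> borel_mat (k + q) m \<rightarrow>\<^sub>M N"
  unfolding case_prod_unfold
  by (rule mcomp[OF measurable_mat_add[OF measurable_mat_times[OF x t] measurable_mat_minus[OF z measurable_mat_times[OF x xz]]] that])
qed

lemma measurable_pint:
 assumes "G \<in> borel_fun (k + q) m"
 shows "(\<lambda>(\<xi>, t). pint k q m G \<xi> t) \<in> borel_measurable (borel_mat (k + q) q \<Otimes>\<^sub>M borel_mat q m)" (is "_ \<in> borel_measurable ?B")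
proof -
 have "(\<lambda>(p, z). (case p of (\<xi>, t) => (exp (- sqn (\<xi>\<^sup>T * z)) / sqrt pi ^ (q * m)) *\<^sub>R G (\<xi> * t + (z - \<xi> * (\<xi>\<^sup>T * z)))))
   \<in> borel_measurable (?B \<Otimes>\<^sub>M lmat (k + q) m)"
  using borel_measurable_scaleR[OF measurable_plane_integrand(1) measurable_plane_integrand(2)[OF assms]]
  by (simp add: case_prod_unfold)
 from lmat.borel_measurable_lebesgue_integral[OF this]
 have "(\<lambda>p. \<integral>z. (case p of (\<xi>, t) => (exp (- sqn (\<xi>\<^sup>T * z)) / sqrt pi ^ (q * m)) *\<^sub>R G (\<xi> * t + (z - \<xi> * (\<xi>\<^sup>T * z)))) \<partial>lmat (k + q) m)
   \<in> borel_measurable ?B" by simp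
 then show ?thesis
 proof (rule measurable_cong[THEN iffD1, rotated])
  fix p assume "p \<in> space ?B"
  then have p: "fst p \<in> carrier_mat (k + q) q" "snd p \<in> carrier_mat q m" by (auto simp: space_pair_measure)
  show "(\<integral>z. (case p of (\<xi>, t) => (exp (- sqn (\<xi>\<^sup>T * z)) / sqrt pi ^ (q * m)) *\<^sub>R G (\<xi> * t + (z - \<xi> * (\<xi>\<^sup>T * z)))) \<partial>lmat (k + q) m)
   = (case p of (\<xi>, t) => pint k q m G \<xi> t)"
   by (simp add: case_prod_unfold pint_def integral_plane[OF p(1) measurable_shift_plane[OF p assms]])
 qed
qed

lemma measurable_nn_pint:
 assumes "G \<in> borel_fun (k + q) m"
 shows "(\<lambda>(\<xi>, t). nn_pint k q m G \<xi> t) \<in> borel_measurable (borel_mat (k + q) q \<Otimes>\<^sub>M borel_mat q m)" (is "_ \<in> borel_measurable ?B")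
proof -
 have "(\<lambda>p. ennreal (case fst p of (\<xi>, t) => exp (- sqn (\<xi>\<^sup>T * snd p)) / sqrt pi ^ (q * m)) *
   (case fst p of (\<xi>, t) => G (\<xi> * t + (snd p - \<xi> * (\<xi>\<^sup>T * snd p))))) \<in> borel_measurable (?B \<Otimes>\<^sub>M lmat (k + q) m)"
  using times_ennreal[OF mcomp[OF measurable_plane_integrand(1) measurable_ennreal] measurable_plane_integrand(2)[OF assms]]
  by (simp add: case_prod_unfold)
 from lmat.borel_measurable_nn_integral_fst[OF this]
 have "(\<lambda>p. \<integral>\<^sup>+z. ennreal (case p of (\<xi>, t) => exp (- sqn (\<xi>\<^sup>T * z)) / sqrt pi ^ (q * m)) *
   (case p of (\<xi>, t) => G (\<xi> * t + (z - \<xi> * (\<xi>\<^sup>T * z)))) \<partial>lmat (k + q) m) \<in> borel_measurable ?B" by simp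
 then show ?thesis
 proof (rule measurable_cong[THEN iffD1, rotated])
  fix p assume "p \<in> space ?B"
  then have p: "fst p \<in> carrier_mat (k + q) q" "snd p \<in> carrier_mat q m" by (auto simp: space_pair_measure)
  show "(\<integral>\<^sup>+z. ennreal (case p of (\<xi>, t) => exp (- sqn (\<xi>\<^sup>T * z)) / sqrt pi ^ (q * m)) *
   (case p of (\<xi>, t) => G (\<xi> * t + (z - \<xi> * (\<xi>\<^sup>T * z)))) \<partial>lmat (k + q) m) = (case p of (\<xi>, t) => nn_pint k q m G \<xi> t)"
   by (simp add: case_prod_unfold nn_pint_def nn_integral_plane[OF p(1) measurable_shift_plane[OF p assms]])
 qed
qed

text \<open>An orthogonal matrix carrying the standard frame to \<xi> exists by transitivity. If its
  determinant is - 1, it is composed with the reflection of the first coordinate, which fixes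
  \<open>low_frame\<close> because \<open>k\<close> is at least 1.\<close>

lemma rotation_to:
 assumes \<xi>: "\<xi> \<in> stiefel (k + q) q" and k: "1 \<le> k"
 shows "rotation_to (k + q) k \<xi> \<in> orth_group (k + q)" "rotation_to (k + q) k \<xi> * low_frame k q = \<xi>"
proof -
 let ?n = "k + q" and ?E = "low_frame k q"
 let ?D = "multrow_mat (k + q) 0 (- 1 :: real)"
 have D: "?D \<in> carrier_mat ?n ?n" by simp
 have mD: "?D * A = multrow 0 (- 1) A" if "A \<in> carrier_mat ?n c" for A c
  using multrow_mat[OF that, of 0 "- 1"] by simp
 have "?D\<^sup>T = ?D" by (rule eq_matI) auto
 then have "?D\<^sup>T * ?D = multrow 0 (- 1) ?D" using mD[OF D] by simp
 also have "... = 1\<^sub>m ?n" by (rule eq_matI) (use k in auto)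
 finally have Do: "?D \<in> orth_group ?n" by (simp add: orth_group_def)
 have "?D * ?E = multrow 0 (- 1) ?E" by (rule mD[OF low_frame_carrier])
 also have "... = ?E" by (rule eq_matI) (use k in "auto simp: low_frame_def append_rows_def")
 finally have DE: "?D * ?E = ?E" .
 obtain g where g: "g \<in> orth_group ?n" "\<xi> = g * ?E"
  using stiefel_transitive[OF low_frame_stiefel \<xi>] by auto
 have "\<exists>h \<in> special_orth_group ?n. h * ?E = \<xi>"
 proof (cases "det g = 1")
  case True
  then show ?thesis using g by (auto simp: special_orth_group_def)
 next
  case False
  then have "det g = - 1" using orth_groupD(4)[OF g(1)] by (simp add: abs_if split: if_splits)
  then have "det (g * ?D) = 1"
   using det_mult[OF orth_groupD(1)[OF g(1)] D] det_multrow_mat[of 0 ?n "- 1 :: real"] k by simp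
  moreover have "(g * ?D) * ?E = \<xi>"
   using assoc_mult_mat[OF orth_groupD(1)[OF g(1)] D low_frame_carrier] DE g(2) by simp
  ultimately show ?thesis using orth_group_mult[OF g(1) Do] by (auto simp: special_orth_group_def)
 qed
 then have "\<exists>h. h \<in> special_orth_group ?n \<and> h * (0\<^sub>m k (?n - k) @\<^sub>r 1\<^sub>m (?n - k)) = \<xi>" by (auto simp: low_frame_def)
 from someI_ex[OF this] show "rotation_to ?n k \<xi> \<in> orth_group ?n" "rotation_to ?n k \<xi> * ?E = \<xi>"
  unfolding rotation_to_def by (auto simp: special_orth_group_def low_frame_def)
qed

text \<open>With \<open>x = g (x1; x2)\<close> the point \<open>g (w; \<xi>' x - t)\<close> equals
  \<open>x - g (x1 - w; t)\<close>. Reflecting \<open>w\<close> about \<open>x1\<close> turns the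
  Radon transform at \<open>\<xi>' x - t\<close> into a plane integral of
  \<open>y -> f (x - y)\<close>, for which \<open>h\<close> is a Borel version.\<close>

lemma radon_eq:
 assumes \<xi>: "\<xi> \<in> stiefel (k + q) q" and k: "1 \<le> k" and x: "x \<in> carrier_mat (k + q) m" and t: "t \<in> carrier_mat q m"
  and h: "h \<in> borel_fun (k + q) m"
  and ae: "AE w in lmat k m. f (x - rotation_to (k + q) k \<xi> * (w @\<^sub>r t)) = h (rotation_to (k + q) k \<xi> * (w @\<^sub>r t))"
 shows "radon (k + q) m k f \<xi> (\<xi>\<^sup>T * x - t) = pint k q m h \<xi> t"
proof -
 define g where "g = rotation_to (k + q) k \<xi>"
 have g: "g \<in> orth_group (k + q)" and gE: "g * low_frame k q = \<xi>" using rotation_to[OF \<xi> k] by (auto simp: g_def)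
 note gc = orth_groupD(1)[OF g]
 have "g\<^sup>T * x \<in> carrier_mat (k + q) m" using gc x by auto
 then obtain x1 x2 where x12: "x1 \<in> carrier_mat k m" "x2 \<in> carrier_mat q m" "g\<^sup>T * x = x1 @\<^sub>r x2" by (rule split_rows)
 have gx: "x = g * (x1 @\<^sub>r x2)" using orth_cancel(2)[OF g x] x12(3) by simp
 have x2: "\<xi>\<^sup>T * x = x2" using rot_split(2)[OF g x12(1,2)] gE gx by simp
 have eq: "g * (w @\<^sub>r (\<xi>\<^sup>T * x - t)) = x - g * ((x1 - w) @\<^sub>r t)" if w: "w \<in> carrier_mat k m" for w
 proof -
  have c: "x1 @\<^sub>r x2 \<in> carrier_mat (k + q) m" "(x1 - w) @\<^sub>r t \<in> carrier_mat (k + q) m"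
   using x12 carrier_append_rows[OF minus_carrier_mat[OF w, of x1] t] by auto
  have "w @\<^sub>r (x2 - t) = (x1 @\<^sub>r x2) - ((x1 - w) @\<^sub>r t)"
   by (rule eq_matI) (use x12 w t in "auto simp: append_rows_def")
  then show ?thesis using mult_minus_distrib_mat[OF gc c] gx x2 by simp
 qed
 let ?h = "\<lambda>w. h (g * (w @\<^sub>r t))"
 have mr: "(\<lambda>w. x1 - w) \<in> lmat k m \<rightarrow>\<^sub>M borel_mat k m"
  unfolding measurable_lmat
  by (rule measurable_mat_minus[OF measurable_const measurable_ident_sets[OF refl]]) (use x12(1) in simp)
 have mh: "?h \<in> borel_fun k m" by (rule mcomp[OF measurable_rot_rows[OF gc t] h])
 have "AE w in distr (lmat k m) (borel_mat k m) (\<lambda>w. x1 - w). f (x - g * (w @\<^sub>r t)) = ?h w"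
  unfolding lmat_reflect[OF x12(1)] using ae by (simp only: g_def)
 from AE_distrD[OF mr this] have ae2: "AE w in lmat k m. f (x - g * ((x1 - w) @\<^sub>r t)) = ?h (x1 - w)" .
 have "radon (k + q) m k f \<xi> (\<xi>\<^sup>T * x - t) = (\<integral>w. f (g * (w @\<^sub>r (\<xi>\<^sup>T * x - t))) \<partial>completion (lmat k m))"
  by (simp add: radon_def g_def lebesgue_mat_eq)
 also have "... = (\<integral>w. ?h (x1 - w) \<partial>lmat k m)"
  by (rule integral_completion_AE[OF mcomp[OF mr mh]], rule AE_mp[OF ae2], rule AE_I2) (simp add: eq)
 also have "... = (\<integral>w. ?h w \<partial>distr (lmat k m) (borel_mat k m) (\<lambda>w. x1 - w))"
  by (rule integral_distr[OF mr mh, symmetric])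
 also have "... = pint k q m h \<xi> t" using pint_orth(1)[OF g t h] gE by (simp add: lmat_reflect[OF x12(1)])
 finally show ?thesis .
qed

section \<open>Passing between frames and the orthogonal group\<close>

lemma measurable_frame: "(\<lambda>g. g * low_frame k q) \<in> stf (k + q) (k + q) \<rightarrow>\<^sub>M stf (k + q) q"
proof (rule measurable_to_stiefel[OF stfD(2)])
 show "(\<lambda>g. g * low_frame k q) \<in> stf (k + q) (k + q) \<rightarrow>\<^sub>M borel_mat (k + q) q"
  by (rule measurable_stf[OF order_refl measurable_mat_times[where k="k + q"]]) auto
qed (auto simp: haarD intro: orth_mult_stiefel low_frame_stiefel)

text \<open>The inner integrals depend on \<open>g\<close> only through the frame
  \<open>g * low_frame k q\<close>, by way of \<open>nn_pint\<close>. Finiteness in the mean over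
  the group therefore gives finiteness for almost every frame, whichever rotation is chosen for
  it.\<close>

lemma AE_stiefel_finite:
 assumes k: "1 \<le> k" and T: "sigma_finite_measure T" "sets T = sets (borel_mat q m)" and F: "F \<in> borel_fun (k + q) m"
  and fin: "(\<integral>\<^sup>+g. \<integral>\<^sup>+t. \<integral>\<^sup>+w. F (g * (w @\<^sub>r t)) \<partial>lmat k m \<partial>T \<partial>stf (k + q) (k + q)) < \<infinity>"
 shows "AE \<xi> in stf (k + q) q. (\<integral>\<^sup>+t. \<integral>\<^sup>+w. F (rotation_to (k + q) k \<xi> * (w @\<^sub>r t)) \<partial>lmat k m \<partial>T) < \<infinity>"
proof -
 let ?n = "k + q" and ?E = "low_frame k q"
 have sp: "space T = carrier_mat q m" using sets_eq_imp_space_eq[OF T(2)] by simp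
 let ?P = "\<lambda>\<xi>. \<integral>\<^sup>+t. nn_pint k q m F \<xi> t \<partial>T"
 have "(\<lambda>(\<xi>, t). nn_pint k q m F \<xi> t) \<in> borel_measurable (borel_mat ?n q \<Otimes>\<^sub>M T)"
  using measurable_nn_pint[OF F] measurable_cong_sets[OF sets_pair_measure_cong[OF refl T(2)[symmetric]] refl] by blast
 then have mP: "?P \<in> borel_fun ?n q"
  using sigma_finite_measure.borel_measurable_nn_integral[OF T(1), of "\<lambda>\<xi> t. nn_pint k q m F \<xi> t"] by simp
 have Pg: "?P (g * ?E) = (\<integral>\<^sup>+t. \<integral>\<^sup>+w. F (g * (w @\<^sub>r t)) \<partial>lmat k m \<partial>T)" if "g \<in> orth_group ?n" for g
  by (rule nn_integral_cong) (use pint_orth(2)[OF that _ F] sp in simp)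
 note mE = measurable_frame[of k q]
 have "(\<integral>\<^sup>+\<xi>. ?P \<xi> \<partial>stf ?n q) = (\<integral>\<^sup>+\<xi>. ?P \<xi> \<partial>distr (stf ?n ?n) (stf ?n q) (\<lambda>g. g * ?E))"
  using distr_haar_frame[OF _ low_frame_stiefel, of q k] by simp
 also have "... = (\<integral>\<^sup>+g. ?P (g * ?E) \<partial>stf ?n ?n)"
  by (rule nn_integral_distr[OF mE]) (simp, rule measurable_stf[OF _ mP], simp)
 also have "... < \<infinity>" using fin Pg by (simp add: haarD cong: nn_integral_cong_simp)
 finally have "AE \<xi> in stf ?n q. ?P \<xi> \<noteq> \<infinity>"
  by (intro nn_integral_PInf_AE measurable_stf[OF _ mP]) simp_all
 then show ?thesis
 proof (rule AE_mp, intro AE_I2 impI)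
  fix \<xi> assume "\<xi> \<in> space (stf ?n q)" and fx: "?P \<xi> \<noteq> \<infinity>"
  then have \<xi>: "\<xi> \<in> stiefel ?n q" using stfD(3)[of q ?n] by simp
  show "(\<integral>\<^sup>+t. \<integral>\<^sup>+w. F (rotation_to ?n k \<xi> * (w @\<^sub>r t)) \<partial>lmat k m \<partial>T) < \<infinity>"
   using Pg[OF rotation_to(1)[OF \<xi> k]] rotation_to(2)[OF \<xi> k] fx by (simp add: less_top)
 qed
qed

text \<open>The measure on frames is the image of Haar measure, and at the frame of \<open>g\<close>
  the plane integral is taken over \<open>g (a; t)\<close> with \<open>t\<close> fixed.\<close>

lemma integral_stiefel_pint:
 assumes T: "sigma_finite_measure T" "sets T = sets (borel_mat q m)" and G: "G \<in> borel_fun (k + q) m"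
  and w: "w \<in> borel_fun q m"
  and ae: "AE \<xi> in stf (k + q) q. H \<xi> = C * (\<integral>t. pint k q m G \<xi> t * w t \<partial>T)"
 shows "(\<integral>\<xi>. H \<xi> \<partial>stiefel_measure (k + q) q) =
  C * (\<integral>g. \<integral>t. (\<integral>a. G (g * (a @\<^sub>r t)) \<partial>lmat k m) * w t \<partial>T \<partial>stf (k + q) (k + q))"
proof -
 let ?n = "k + q" and ?E = "low_frame k q"
 have sp: "space T = carrier_mat q m" using sets_eq_imp_space_eq[OF T(2)] by simp
 let ?P = "\<lambda>\<xi>. \<integral>t. pint k q m G \<xi> t * w t \<partial>T"
 have "(\<lambda>(\<xi>, t). pint k q m G \<xi> t * w t) \<in> borel_measurable (borel_mat ?n q \<Otimes>\<^sub>M borel_mat q m)"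
  using borel_measurable_times[OF measurable_pint[OF G] mcomp[OF measurable_snd w]] by (simp add: case_prod_unfold)
 then have "(\<lambda>(\<xi>, t). pint k q m G \<xi> t * w t) \<in> borel_measurable (borel_mat ?n q \<Otimes>\<^sub>M T)"
  using measurable_cong_sets[OF sets_pair_measure_cong[OF refl T(2)[symmetric]] refl] by blast
 then have mP: "?P \<in> borel_fun ?n q"
  by (rule sigma_finite_measure.borel_measurable_lebesgue_integral[OF T(1)])
 note mE = measurable_frame[of k q]
 have mPs: "?P \<in> borel_measurable (stf ?n q)" by (rule measurable_stf[OF _ mP]) simp
 have "(\<integral>\<xi>. H \<xi> \<partial>stiefel_measure ?n q) = (\<integral>\<xi>. C * ?P \<xi> \<partial>stf ?n q)"
  unfolding stiefel_measure_eq by (rule integral_completion_AE[OF borel_measurable_times[OF measurable_const mPs] ae]) simp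
 also have "... = C * (\<integral>\<xi>. ?P \<xi> \<partial>distr (stf ?n ?n) (stf ?n q) (\<lambda>g. g * ?E))"
  using distr_haar_frame[OF _ low_frame_stiefel, of q k] by simp
 also have "(\<integral>\<xi>. ?P \<xi> \<partial>distr (stf ?n ?n) (stf ?n q) (\<lambda>g. g * ?E)) = (\<integral>g. ?P (g * ?E) \<partial>stf ?n ?n)"
  by (rule integral_distr[OF mE mPs])
 also have "... = (\<integral>g. \<integral>t. (\<integral>a. G (g * (a @\<^sub>r t)) \<partial>lmat k m) * w t \<partial>T \<partial>stf ?n ?n)"
  by (intro Bochner_Integration.integral_cong refl) (use pint_orth(1)[OF _ _ G] sp haarD in simp)
 finally show ?thesis .
qed

section \<open>Constants\<close>

lemma sqrt_pi_power: "sqrt pi ^ a = pi powr (real a / 2)"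
proof -
 have "sqrt pi ^ a = sqrt pi powr real a" by (simp add: powr_realpow)
 also have "... = pi powr (1 / 2 * real a)" by (simp only: powr_half_sqrt[symmetric] powr_powr pi_ge_zero)
 finally show ?thesis by simp
qed

text \<open>The condition keeps each argument \<open>z - j/2\<close> with \<open>j < m\<close> in
  the right half plane, away from the poles, where \<open>Gamma\<close> has the value 0 by
  convention.\<close>

lemma Gamma_mat_nonzero:
 assumes "real m - 1 < 2 * Re z"
 shows "Gamma_mat m z \<noteq> 0"
proof -
 have "Gamma (z - of_nat j / 2) \<noteq> 0" if "j < m" for j
 proof -
  have "0 < Re (z - of_nat j / 2)" using assms that by simp
  moreover have "Re w \<le> 0" if "w \<in> \<int>\<^sub>\<le>\<^sub>0" for w :: complex using that by (auto elim!: nonpos_Ints_cases)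
  ultimately have "z - of_nat j / 2 \<notin> \<int>\<^sub>\<le>\<^sub>0" using not_le by blast
  then show ?thesis by (simp add: Gamma_eq_zero_iff)
 qed
 then show ?thesis by (simp add: Gamma_mat_def)
qed

text \<open>The shift by \<open>- n\<close> moves the numerator to \<open>\<beta>/2\<close>, and the
  powers of \<open>pi\<close> in front of the two \<open>Gamma_mat\<close> cancel.\<close>

lemma gint_Gamma_mat:
 "gint n m (\<beta> - of_nat n) = of_real (pi powr (real n * real m / 2)) * Gamma_mat m (\<beta> / 2) / Gamma_mat m (of_nat n / 2)"
proof -
 have g: "complex_of_real (Gamma ((real n - real j) / 2)) = Gamma (of_nat n / 2 - of_nat j / 2)" for j
  by (simp add: Gamma_complex_of_real[symmetric] diff_divide_distrib)
 have "gint n m (\<beta> - of_nat n) = (\<Prod>j<m. of_real (sqrt pi ^ n) * Gamma (\<beta> / 2 - of_nat j / 2) / Gamma (of_nat n / 2 - of_nat j / 2))"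
  unfolding gint_def g by (intro prod.cong refl) (simp add: diff_divide_distrib)
 also have "... = of_real (sqrt pi ^ (n * m)) * (\<Prod>j<m. Gamma (\<beta> / 2 - of_nat j / 2)) / (\<Prod>j<m. Gamma (of_nat n / 2 - of_nat j / 2))"
  by (simp add: prod.distrib prod_dividef power_mult)
 also have "... = of_real (pi powr (real n * real m / 2)) * Gamma_mat m (\<beta> / 2) / Gamma_mat m (of_nat n / 2)"
  by (simp add: Gamma_mat_def sqrt_pi_power del: of_real_power)
 finally show ?thesis .
qed

lemma two_powr_split: "2 powr ((\<alpha> + of_nat k) * of_nat m) = 2 powr (\<alpha> * of_nat m) * (2 :: complex) ^ (k * m)"
proof -
 have "(2 :: complex) powr of_nat (k * m) = 2 ^ (k * m)" by (subst powr_nat) simp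
 then show ?thesis by (simp add: distrib_right powr_add)
qed

text \<open>By \<open>bmean_eq\<close> the mean is \<open>X Z / (Y W)\<close>, the powers of
  \<open>pi\<close> cancelling. The factor \<open>V\<close> is common to both Riesz constants
  because \<open>(k + q) - (\<alpha> + k) = q - \<alpha>\<close>.\<close>

lemma kernel_const:
 assumes mq: "m \<le> q" and a: "real m - 1 < Re \<alpha>" "Re \<alpha> < real q - real m + 1"
 shows "bmean k q m (\<alpha> - of_nat q) / riesz_gamma q m \<alpha> = c_const (k + q) k m / riesz_gamma (k + q) m (\<alpha> + of_nat k)"
proof -
 let ?X = "Gamma_mat m (\<alpha> / 2)" and ?Y = "Gamma_mat m (of_nat q / 2)" and ?Z = "Gamma_mat m (of_nat (k + q) / 2)"
  and ?W = "Gamma_mat m ((\<alpha> + of_nat k) / 2)" and ?V = "Gamma_mat m ((of_nat q - \<alpha>) / 2)"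
 define P where "P j = complex_of_real (pi powr (real j * real m / 2))" for j
 have nz: "?X \<noteq> 0" "?Y \<noteq> 0" "?Z \<noteq> 0" "?W \<noteq> 0" "?V \<noteq> 0"
  by (rule Gamma_mat_nonzero, use mq a in simp)+
 have Pnz: "P j \<noteq> 0" for j by (simp add: P_def)
 have Padd: "P (k + q) = P k * P q"
  by (simp add: P_def powr_add[symmetric] of_real_mult[symmetric] add_divide_distrib distrib_right del: of_real_mult)
 have "bmean k q m (\<alpha> - of_nat q) * gint (k + q) m (\<alpha> - of_nat q) = of_real (sqrt pi ^ (k * m)) * gint q m (\<alpha> - of_nat q)"
  by (rule bmean_eq[OF mq]) (use a in simp)
 moreover have "gint (k + q) m (\<alpha> - of_nat q) = P (k + q) * ?W / ?Z"
  using gint_Gamma_mat[of "k + q" m "\<alpha> + of_nat k"] by (simp add: P_def)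
 moreover have "gint q m (\<alpha> - of_nat q) = P q * ?X / ?Y" by (simp add: gint_Gamma_mat P_def)
 moreover have "complex_of_real (sqrt pi ^ (k * m)) = P k" by (simp add: sqrt_pi_power P_def del: of_real_power)
 ultimately have "bmean k q m (\<alpha> - of_nat q) * (P (k + q) * ?W / ?Z) = P k * (P q * ?X / ?Y)" by simp
 then have b: "bmean k q m (\<alpha> - of_nat q) = ?X * ?Z / (?Y * ?W)"
  using nz Pnz[of k] Pnz[of q] unfolding Padd by (simp add: field_simps)
 have V: "Gamma_mat m ((of_nat (k + q) - (\<alpha> + of_nat k)) / 2) = ?V" by simp
 have c: "c_const (k + q) k m = 2 ^ (k * m) * P k * ?Z / ?Y" by (simp add: c_const_def P_def)
 have g1: "riesz_gamma q m \<alpha> = 2 powr (\<alpha> * of_nat m) * P q * ?X / ?V" by (simp add: riesz_gamma_def P_def)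
 have g2: "riesz_gamma (k + q) m (\<alpha> + of_nat k) = 2 powr (\<alpha> * of_nat m) * 2 ^ (k * m) * (P k * P q) * ?W / ?V"
  unfolding riesz_gamma_def V two_powr_split by (simp add: P_def[symmetric] Padd[symmetric] del: of_nat_add)
 show ?thesis unfolding b c g1 g2 using nz Pnz[of k] Pnz[of q] by (simp add: field_simps)
qed

text \<open>As \<open>(k + q) - (k + j) = q - j\<close> and \<open>(k + q) - k = q\<close>, the
  Gamma factors telescope, and the remaining powers of 2 and \<open>pi\<close> combine.\<close>

lemma rank_const:
 assumes "m \<le> q"
 shows "c_const (k + q) k m * riesz_int_const (k + q) m (k + j) = riesz_int_const q m j"
proof -
 have nz: "Gamma_mat m (of_nat (k + q) / 2) \<noteq> 0" by (rule Gamma_mat_nonzero) (use assms in simp)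
 have "2 ^ (k * m) * pi powr (real k * real m / 2) * (2 powr - (real (k + j) * real m) * pi powr - (real (k + j) * real m / 2)) =
  2 powr - (real j * real m) * pi powr - (real j * real m / 2)"
 proof -
  have "(2 :: real) ^ (k * m) = 2 powr (real k * real m)" by (simp add: powr_realpow[symmetric])
  then have "2 ^ (k * m) * pi powr (real k * real m / 2) * (2 powr - (real (k + j) * real m) * pi powr - (real (k + j) * real m / 2)) =
   (2 powr (real k * real m) * 2 powr - (real (k + j) * real m)) * (pi powr (real k * real m / 2) * pi powr - (real (k + j) * real m / 2))"
   by (simp only: ac_simps)
  also have "... = 2 powr - (real j * real m) * pi powr - (real j * real m / 2)"
   unfolding powr_add[symmetric] by (simp add: algebra_simps add_divide_distrib)
  finally show ?thesis .
 qed
 then have r: "complex_of_real (2 ^ (k * m) * pi powr (real k * real m / 2)) * of_real (2 powr - (real (k + j) * real m) * pi powr - (real (k + j) * real m / 2)) =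
  of_real (2 powr - (real j * real m) * pi powr - (real j * real m / 2))" by (simp only: of_real_mult[symmetric])
 have d: "complex_of_nat (k + q) - of_nat (k + j) = of_nat q - of_nat j" "complex_of_nat (k + q) - of_nat k = of_nat q" by simp_all
 show ?thesis
  unfolding c_const_def riesz_int_const_def d r[symmetric] using nz by (simp add: field_simps del: of_real_mult of_nat_add)
qed

text \<open>Up to a power of \<open>pi\<close> the density constant is
  \<open>Gamma_m (n/2) / Gamma_m (l/2)\<close>, which converts the normalization of
  \<open>riesz_int\<close> into that of the power kernel.\<close>

lemma kernel_rank_const:
 assumes ml: "m \<le> l" and ln: "l \<le> n"
 shows "riesz_int_const n m l * of_real (Kr l m 0 / Kr n m (real l - real n)) = 1 / riesz_gamma n m (of_nat l)"
proof -
 let ?W = "Gamma_mat m (of_nat l / 2)" and ?Z = "Gamma_mat m (of_nat n / 2)" and ?V = "Gamma_mat m ((of_nat n - of_nat l) / 2)"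
 have nz: "?W \<noteq> 0" "?Z \<noteq> 0" by (rule Gamma_mat_nonzero, use ml ln in simp)+
 have "gint n m (of_real (real l - real n)) = of_real (Kr n m (real l - real n))" by (rule gint_of_real)
 then have K: "of_real (Kr n m (real l - real n)) = of_real (pi powr (real n * real m / 2)) * ?W / ?Z"
  using gint_Gamma_mat[of n m "of_nat l"] by simp
 have two: "complex_of_real (2 powr - (real l * real m)) = 1 / (2 powr (of_nat l * of_nat m))"
  by (simp add: powr_minus_divide powr_of_real[symmetric])
 have p: "complex_of_real (pi powr - (real l * real m / 2)) * of_real (pi powr (real l * real m / 2)) = 1"
  by (simp add: of_real_mult[symmetric] powr_add[symmetric] del: of_real_mult)
 have L: "complex_of_real (Kr l m 0) = of_real (pi powr (real l * real m / 2))"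
  using Kr_zero[OF ml] by (simp add: sqrt_pi_power)
 show ?thesis
  unfolding riesz_int_const_def of_real_divide of_real_mult K L two riesz_gamma_def using nz p
  by (simp add: field_simps)
qed

section \<open>Averages over rotated planes\<close>

text \<open>The density is positive off the null set of singular matrices.\<close>

lemma AE_kernel_measure:
 assumes "m \<le> N" and "AE y in kernel_measure N s m. P y"
 shows "AE y in lmat N m. P y"
proof -
 have a: "AE y in lmat N m. 0 < epow y s \<longrightarrow> P y"
  using assms(2) unfolding kernel_measure_def by (subst (asm) AE_density[OF measurable_lmat_powr])
 show ?thesis
  by (rule AE_mp[OF a], rule AE_mp[OF AE_nonsingular[OF assms(1)]], rule AE_I2) simp
qed

text \<open>The nonnegative form of \<open>semyanistyi_kernel\<close>: the value is a finite
  constant times the integral over the large space. It supplies the almost-everywhere statements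
  before any complex integral is formed.\<close>

lemma nn_semyanistyi_finite:
 assumes mq: "m \<le> q" and s: "real m - 1 - real q < s" and F: "F \<in> borel_fun (k + q) m"
  and fin: "(\<integral>\<^sup>+y. F y \<partial>kernel_measure (k + q) s m) < \<infinity>"
 shows "(\<integral>\<^sup>+g. \<integral>\<^sup>+t. \<integral>\<^sup>+w. F (g * (w @\<^sub>r t)) \<partial>lmat k m \<partial>kernel_measure q s m \<partial>stf (k + q) (k + q)) < \<infinity>"
proof -
 let ?n = "k + q"
 let ?N = "lmat ?n m \<Otimes>\<^sub>M stf ?n ?n"
 let ?P = "stf ?n ?n \<Otimes>\<^sub>M (lmat q m \<Otimes>\<^sub>M lmat k m)"
 let ?r = "\<lambda>(g, b, a). (g * (a @\<^sub>r b), g)"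
 interpret P: pair_sigma_finite "lmat ?n m" "stf ?n ?n" by (rule pair_sigma_finite_stf)
 let ?H = "\<lambda>(y, g). F y * epow (bot k q g y) s"
 let ?K = "\<integral>\<^sup>+g. epow (bot k q g (base_frame ?n m)) s \<partial>stf ?n ?n"
 have mH: "?H \<in> borel_measurable ?N"
  unfolding case_prod_unfold
  by (intro times_ennreal mcomp[OF measurable_fst_lmat F]
    mcomp[OF measurable_bot[OF measurable_snd_stf measurable_fst_lmat] measurable_mat_abs_powr])
 have mr: "?r \<in> ?P \<rightarrow>\<^sub>M ?N" by (rule measurable_rotpair[OF mq])
 have "(\<integral>\<^sup>+g. \<integral>\<^sup>+t. \<integral>\<^sup>+w. F (g * (w @\<^sub>r t)) \<partial>lmat k m \<partial>kernel_measure q s m \<partial>stf ?n ?n) =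
  (\<integral>\<^sup>+g. \<integral>\<^sup>+b. \<integral>\<^sup>+a. ?H (?r (g, b, a)) \<partial>lmat k m \<partial>lmat q m \<partial>stf ?n ?n)"
 proof (rule nn_integral_cong)
  fix g assume "g \<in> space (stf ?n ?n)"
  then have g: "g \<in> orth_group ?n" by (rule space_stfD)
  note gc = orth_groupD(1)[OF g]
  have mF: "(\<lambda>(t, w). F (g * (w @\<^sub>r t))) \<in> borel_measurable (borel_mat q m \<Otimes>\<^sub>M lmat k m)"
   unfolding case_prod_unfold
   by (rule mcomp[OF measurable_mat_times[OF measurable_const measurable_append_rows[OF measurable_snd_lmat measurable_fst]] F])
    (use gc in simp)
  have "(\<integral>\<^sup>+t. \<integral>\<^sup>+w. F (g * (w @\<^sub>r t)) \<partial>lmat k m \<partial>kernel_measure q s m) =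
   (\<integral>\<^sup>+t. epow t s * (\<integral>\<^sup>+w. F (g * (w @\<^sub>r t)) \<partial>lmat k m) \<partial>lmat q m)"
   by (rule nn_integral_kernel_measure) (use lmat.borel_measurable_nn_integral_fst[OF mF] in simp)
  also have "... = (\<integral>\<^sup>+b. \<integral>\<^sup>+a. ?H (?r (g, b, a)) \<partial>lmat k m \<partial>lmat q m)"
  proof (rule lmat_cong)
   fix b :: "real mat" assume b: "b \<in> carrier_mat q m"
   have "(\<lambda>w. F (g * (w @\<^sub>r b))) \<in> borel_measurable (lmat k m)"
    using mcomp[OF measurable_rot_rows[OF gc b] F] by simp
   then have "epow b s * (\<integral>\<^sup>+w. F (g * (w @\<^sub>r b)) \<partial>lmat k m) = (\<integral>\<^sup>+w. epow b s * F (g * (w @\<^sub>r b)) \<partial>lmat k m)"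
    by (rule nn_integral_cmult[symmetric])
   also have "... = (\<integral>\<^sup>+a. ?H (?r (g, b, a)) \<partial>lmat k m)"
   proof (rule lmat_cong)
    fix a :: "real mat" assume a: "a \<in> carrier_mat k m"
    have "a @\<^sub>r b \<in> carrier_mat ?n m" using a b by auto
    then have "bot k q g (g * (a @\<^sub>r b)) = b"
     unfolding bot_def using orth_cancel(1)[OF g] low_frame_mult[OF a b] by simp
    then show "epow b s * F (g * (a @\<^sub>r b)) = ?H (?r (g, b, a))" by (simp add: mult.commute)
   qed
   finally show "epow b s * (\<integral>\<^sup>+w. F (g * (w @\<^sub>r b)) \<partial>lmat k m) = (\<integral>\<^sup>+a. ?H (?r (g, b, a)) \<partial>lmat k m)" .
  qed
  finally show "(\<integral>\<^sup>+t. \<integral>\<^sup>+w. F (g * (w @\<^sub>r t)) \<partial>lmat k m \<partial>kernel_measure q s m) = (\<integral>\<^sup>+b. \<integral>\<^sup>+a. ?H (?r (g, b, a)) \<partial>lmat k m \<partial>lmat q m)" .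
 qed
 also have "... = (\<integral>\<^sup>+z. ?H (?r z) \<partial>?P)"
  by (rule nn_integral_P1[OF mq mcomp[OF mr mH], symmetric])
 also have "... = (\<integral>\<^sup>+z. ?H z \<partial>distr ?P ?N ?r)" by (rule nn_integral_distr[symmetric, OF mr]) (use mH in simp)
 also have "... = (\<integral>\<^sup>+y. \<integral>\<^sup>+g. ?H (y, g) \<partial>stf ?n ?n \<partial>lmat ?n m)"
  unfolding distr_rotpair[OF mq] by (rule P.M2.nn_integral_fst[OF mH, symmetric])
 also have "... = (\<integral>\<^sup>+y. (epow y s * F y) * ?K \<partial>lmat ?n m)"
 proof (rule nn_integral_cong_AE, rule AE_mp[OF AE_nonsingular], goal_cases)
  case 2
  show ?case
  proof (rule AE_I2, rule impI)
   fix y assume "y \<in> space (lmat ?n m)" and y0: "mat_abs y \<noteq> 0"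
   then have y: "y \<in> carrier_mat ?n m" by simp
   have "(\<lambda>g. epow (bot k q g y) s) \<in> borel_measurable (stf ?n ?n)"
    by (rule measurable_stf[OF order_refl], rule mcomp[OF measurable_bot[where m=m] measurable_mat_abs_powr]) (use y in auto)
   then show "(\<integral>\<^sup>+g. ?H (y, g) \<partial>stf ?n ?n) = (epow y s * F y) * ?K"
    using nn_bot_average[OF mq y y0, of s] by (simp add: nn_integral_cmult ac_simps)
  qed
 qed (use mq in simp)
 also have "... = (\<integral>\<^sup>+y. epow y s * F y \<partial>lmat ?n m) * ?K"
  by (rule nn_integral_multc) (simp, rule times_ennreal[OF measurable_mat_abs_powr F])
 also have "... < \<infinity>"
  using fin nn_bot_const_finite[OF mq s] by (simp add: nn_integral_kernel_measure[OF F] ennreal_mult_less_top)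
 finally show ?thesis .
qed

text \<open>Inner integrability is available only for almost every \<open>g\<close>, so the iterated
  integrals are compared almost everywhere, with their measurability in \<open>g\<close> established
  separately.\<close>

lemma nested_integral:
 fixes h :: "real mat \<times> real mat \<times> real mat => complex"
 assumes T: "sigma_finite_measure T" and int: "integrable (stf n n \<Otimes>\<^sub>M (T \<Otimes>\<^sub>M lmat k m)) h"
 shows "(\<integral>g. \<integral>t. \<integral>a. h (g, t, a) \<partial>lmat k m \<partial>T \<partial>stf n n) = integral\<^sup>L (stf n n \<Otimes>\<^sub>M (T \<Otimes>\<^sub>M lmat k m)) h"
proof -
 interpret T: sigma_finite_measure T by (rule T)
 interpret Q: pair_sigma_finite T "lmat k m" ..
 interpret S: sigma_finite_measure "stf n n" by (rule sigma_finite_stf) simp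
 interpret P: pair_sigma_finite "stf n n" "T \<Otimes>\<^sub>M lmat k m"
  by (simp add: pair_sigma_finite_def S.sigma_finite_measure_axioms Q.sigma_finite_measure_axioms)
 have ae: "AE g in stf n n. integrable (T \<Otimes>\<^sub>M lmat k m) (\<lambda>y. h (g, y))" by (rule P.AE_integrable_fst'[OF int])
 have mh: "h \<in> borel_measurable (stf n n \<Otimes>\<^sub>M (T \<Otimes>\<^sub>M lmat k m))" using int by simp
 have m1: "(\<lambda>g. \<integral>z. h (g, z) \<partial>(T \<Otimes>\<^sub>M lmat k m)) \<in> borel_measurable (stf n n)"
  by (rule sigma_finite_measure.borel_measurable_lebesgue_integral[OF Q.sigma_finite_measure_axioms]) (use mh in simp)
 have "(\<lambda>p. h (fst (fst p), snd (fst p), snd p)) \<in> borel_measurable ((stf n n \<Otimes>\<^sub>M T) \<Otimes>\<^sub>M lmat k m)"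
  by (rule mcomp[OF _ mh]) measurable
 then have m2': "(\<lambda>(p, a). case p of (g, t) => h (g, t, a)) \<in> borel_measurable ((stf n n \<Otimes>\<^sub>M T) \<Otimes>\<^sub>M lmat k m)"
  by (simp add: case_prod_unfold)
 have "(\<lambda>(g, t). \<integral>a. h (g, t, a) \<partial>lmat k m) \<in> borel_measurable (stf n n \<Otimes>\<^sub>M T)"
  using lmat.borel_measurable_lebesgue_integral[OF m2'] by (simp add: case_prod_unfold)
 from T.borel_measurable_lebesgue_integral[OF this]
 have m2: "(\<lambda>g. \<integral>t. \<integral>a. h (g, t, a) \<partial>lmat k m \<partial>T) \<in> borel_measurable (stf n n)" .
 have "(\<integral>g. \<integral>t. \<integral>a. h (g, t, a) \<partial>lmat k m \<partial>T \<partial>stf n n) = (\<integral>g. \<integral>z. h (g, z) \<partial>(T \<Otimes>\<^sub>M lmat k m) \<partial>stf n n)"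
 proof (rule integral_cong_AE[OF m2 m1], rule AE_mp[OF ae], intro AE_I2 impI)
  fix g assume "integrable (T \<Otimes>\<^sub>M lmat k m) (\<lambda>y. h (g, y))"
  from Q.integral_fst'[OF this] show "(\<integral>t. \<integral>a. h (g, t, a) \<partial>lmat k m \<partial>T) = (\<integral>z. h (g, z) \<partial>(T \<Otimes>\<^sub>M lmat k m))" by simp
 qed
 also have "... = integral\<^sup>L (stf n n \<Otimes>\<^sub>M (T \<Otimes>\<^sub>M lmat k m)) h" by (rule P.integral_fst'[OF int])
 finally show ?thesis .
qed

lemma sigma_finite_rank_measure: "l \<le> n ==> sigma_finite_measure (rank_measure n m l)"
 using riesz_family.sigma_finite_ka[OF riesz_family_rank order_refl] by blast

text \<open>The rotation inside \<open>rank_measure q m j\<close> acts on the last \<open>q\<close>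
  rows and, extended block-diagonally, is absorbed by the average over the large group. What remains
  is the average of \<open>(w; z; 0)\<close> with \<open>k + j\<close> free rows.\<close>

lemma nn_rank_stack:
 assumes jq: "j \<le> q" and F: "F \<in> borel_fun (k + q) m"
 shows "(\<integral>\<^sup>+g. \<integral>\<^sup>+t. \<integral>\<^sup>+w. F (g * (w @\<^sub>r t)) \<partial>lmat k m \<partial>rank_measure q m j \<partial>stf (k + q) (k + q)) =
  (\<integral>\<^sup>+y. F y \<partial>rank_measure (k + q) m (k + j))"
proof -
 let ?n = "k + q"
 interpret T: sigma_finite_measure "rank_measure q m j" by (rule sigma_finite_rank_measure[OF jq])
 interpret S: sigma_finite_measure "stf ?n ?n" by (rule sigma_finite_stf) simp
 interpret P: pair_sigma_finite "rank_measure q m j" "stf ?n ?n" ..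
 interpret R: pair_sigma_finite "lmat k m" "stf ?n ?n" by (rule pair_sigma_finite_stf)
 define L where "L t = (\<integral>\<^sup>+w. havg ?n F (w @\<^sub>r t) \<partial>lmat k m)" for t
 have mA: "havg ?n F \<in> borel_fun ?n m" by (rule measurable_havg[OF F])
 have mL2: "(\<lambda>(t, w). havg ?n F (w @\<^sub>r t)) \<in> borel_measurable (borel_mat q m \<Otimes>\<^sub>M lmat k m)"
  unfolding case_prod_unfold
  by (rule mcomp[OF measurable_append_rows[OF measurable_snd_lmat measurable_fst] mA])
 have mL: "L \<in> borel_fun q m"
  using lmat.borel_measurable_nn_integral_fst[OF mL2] unfolding L_def[abs_def] by simp
 have cT: "measurable (A \<Otimes>\<^sub>M rank_measure q m j) N = measurable (A \<Otimes>\<^sub>M borel_mat q m) N"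
  "measurable (rank_measure q m j \<Otimes>\<^sub>M A) N = measurable (borel_mat q m \<Otimes>\<^sub>M A) N" for A :: "real mat measure" and N
  by (rule measurable_cong_sets[OF sets_pair_measure_cong[OF refl sets_rank_measure] refl],
    rule measurable_cong_sets[OF sets_pair_measure_cong[OF sets_rank_measure refl] refl])
 have mF3: "(\<lambda>(p, w). F (snd p * (w @\<^sub>r fst p))) \<in> borel_measurable ((borel_mat q m \<Otimes>\<^sub>M stf ?n ?n) \<Otimes>\<^sub>M lmat k m)"
  unfolding case_prod_unfold
  by (rule mcomp[OF measurable_mat_times[OF mcomp[OF measurable_fst measurable_snd_stf]
   measurable_append_rows[OF measurable_snd_lmat mcomp[OF measurable_fst measurable_fst]]] F])
 have mF2: "(\<lambda>(t, g). \<integral>\<^sup>+w. F (g * (w @\<^sub>r t)) \<partial>lmat k m) \<in> borel_measurable (rank_measure q m j \<Otimes>\<^sub>M stf ?n ?n)"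
  using lmat.borel_measurable_nn_integral_fst[OF mF3] unfolding cT by (simp add: case_prod_unfold)
 have "(\<integral>\<^sup>+g. \<integral>\<^sup>+t. \<integral>\<^sup>+w. F (g * (w @\<^sub>r t)) \<partial>lmat k m \<partial>rank_measure q m j \<partial>stf ?n ?n) =
  (\<integral>\<^sup>+t. \<integral>\<^sup>+g. \<integral>\<^sup>+w. F (g * (w @\<^sub>r t)) \<partial>lmat k m \<partial>stf ?n ?n \<partial>rank_measure q m j)"
  by (rule P.Fubini'[OF mF2])
 also have "... = (\<integral>\<^sup>+t. L t \<partial>rank_measure q m j)"
 proof (rule nn_integral_cong)
  fix t assume "t \<in> space (rank_measure q m j)"
  then have t: "t \<in> carrier_mat q m" by (simp add: rank_measure_def)
  have "(\<lambda>(w, g). F (g * (w @\<^sub>r t))) \<in> borel_measurable (lmat k m \<Otimes>\<^sub>M stf ?n ?n)"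
   unfolding case_prod_unfold
   by (rule mcomp[OF measurable_mat_times[OF measurable_snd_stf measurable_append_rows[OF measurable_fst_lmat measurable_const]] F])
    (use t in simp)
  from R.Fubini'[OF this] show "(\<integral>\<^sup>+g. \<integral>\<^sup>+w. F (g * (w @\<^sub>r t)) \<partial>lmat k m \<partial>stf ?n ?n) = L t"
   by (simp add: L_def havg_def)
 qed
 also have "... = (\<integral>\<^sup>+z. havg q L (z @\<^sub>r 0\<^sub>m (q - j) m) \<partial>lmat j m)" by (rule nn_integral_rank_measure[OF jq mL])
 also have "... = (\<integral>\<^sup>+z. L (z @\<^sub>r 0\<^sub>m (q - j) m) \<partial>lmat j m)"
 proof (rule nn_integral_cong)
  fix z assume "z \<in> space (lmat j m)"
  then have zc: "z @\<^sub>r 0\<^sub>m (q - j) m \<in> carrier_mat q m" using rank_point[OF jq] by simp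
  have "L (h * t) = L t" if h: "h \<in> orth_group q" and t: "t \<in> carrier_mat q m" for h t
   unfolding L_def
  proof (rule lmat_cong)
   fix w :: "real mat" assume w: "w \<in> carrier_mat k m"
   let ?D = "four_block_mat (1\<^sub>m k) (0\<^sub>m k q) (0\<^sub>m q k) h"
   have wt: "w @\<^sub>r t \<in> carrier_mat ?n m" using w t by auto
   have "?D * (w @\<^sub>r t) = w @\<^sub>r (h * t)"
    using diag_mult_append_rows[OF one_carrier_mat orth_groupD(1)[OF h] w t] w by simp
   then show "havg ?n F (w @\<^sub>r (h * t)) = havg ?n F (w @\<^sub>r t)"
    using havg_orth[OF F orth_diag[OF one_orth_group h] wt] by simp
  qed
  then have "havg q L (z @\<^sub>r 0\<^sub>m (q - j) m) = (\<integral>\<^sup>+h. L (z @\<^sub>r 0\<^sub>m (q - j) m) \<partial>stf q q)"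
   unfolding havg_def by (intro nn_integral_cong) (use zc space_stfD in blast)
  then show "havg q L (z @\<^sub>r 0\<^sub>m (q - j) m) = L (z @\<^sub>r 0\<^sub>m (q - j) m)" by (simp only: nn_integral_stf_const)
 qed
 also have "... = (\<integral>\<^sup>+z. \<integral>\<^sup>+w. havg ?n F ((w @\<^sub>r z) @\<^sub>r 0\<^sub>m (?n - (k + j)) m) \<partial>lmat k m \<partial>lmat j m)"
  unfolding L_def by (intro nn_integral_cong) (use jq in \<open>simp add: append_rows_assoc[of _ k m _ j _ "q - j"]\<close>)
 also have "... = (\<integral>\<^sup>+v. havg ?n F (v @\<^sub>r 0\<^sub>m (?n - (k + j)) m) \<partial>lmat (k + j) m)"
  by (rule nn_integral_lmat_rows(2)[symmetric], rule mcomp[OF measurable_rank_point mA]) (use jq in simp)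
 also have "... = (\<integral>\<^sup>+y. F y \<partial>rank_measure ?n m (k + j))"
  by (rule nn_integral_rank_measure[symmetric, OF _ F]) (use jq in simp)
 finally show ?thesis .
qed

text \<open>The nonnegative identity for indicators identifies an image measure, from which the
  complex integral follows.\<close>

lemma integral_rank_stack:
 fixes G :: "real mat => complex"
 assumes jq: "j \<le> q" and int: "integrable (rank_measure (k + q) m (k + j)) G"
 shows "(\<integral>g. \<integral>t. (\<integral>w. G (g * (w @\<^sub>r t)) \<partial>lmat k m) \<partial>rank_measure q m j \<partial>stf (k + q) (k + q)) =
  (\<integral>y. G y \<partial>rank_measure (k + q) m (k + j))"
proof -
 let ?n = "k + q" and ?T = "rank_measure q m j"
 let ?P = "stf ?n ?n \<Otimes>\<^sub>M (?T \<Otimes>\<^sub>M lmat k m)"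
 let ?r = "\<lambda>(g, t, w). g * (w @\<^sub>r t)"
 interpret T: sigma_finite_measure ?T by (rule sigma_finite_rank_measure[OF jq])
 interpret Q: pair_sigma_finite ?T "lmat k m" ..
 have mt: "fst \<in> ?T \<Otimes>\<^sub>M lmat k m \<rightarrow>\<^sub>M borel_mat q m"
  using measurable_fst[of ?T "lmat k m"] measurable_cong_sets[OF refl sets_rank_measure[of q m j]] by blast
 have mr: "?r \<in> ?P \<rightarrow>\<^sub>M borel_mat ?n m"
  unfolding case_prod_unfold
  by (rule measurable_mat_times[OF measurable_fst_stf measurable_append_rows[OF mcomp[OF measurable_snd measurable_snd_lmat]
   mcomp[OF measurable_snd mt]]])
 have d: "distr ?P (borel_mat ?n m) ?r = rank_measure ?n m (k + j)"
 proof (rule measure_eqI)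
  fix A assume "A \<in> sets (distr ?P (borel_mat ?n m) ?r)"
  then have A: "A \<in> sets (borel_mat ?n m)" by simp
  then have iA: "(indicator A :: _ => ennreal) \<in> borel_fun ?n m" by simp
  have mi: "(\<lambda>z. indicator A (?r z) :: ennreal) \<in> borel_measurable ?P" by (rule mcomp[OF mr iA])
  have "emeasure (distr ?P (borel_mat ?n m) ?r) A = (\<integral>\<^sup>+y. indicator A y \<partial>distr ?P (borel_mat ?n m) ?r)" using A by simp
  also have "... = (\<integral>\<^sup>+z. indicator A (?r z) \<partial>?P)" by (rule nn_integral_distr[OF mr]) (use iA in simp)
  also have "... = (\<integral>\<^sup>+g. \<integral>\<^sup>+z. indicator A (?r (g, z)) \<partial>(?T \<Otimes>\<^sub>M lmat k m) \<partial>stf ?n ?n)"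
   by (rule sigma_finite_measure.nn_integral_fst[OF Q.sigma_finite_measure_axioms mi, symmetric])
  also have "... = (\<integral>\<^sup>+g. \<integral>\<^sup>+t. \<integral>\<^sup>+w. indicator A (g * (w @\<^sub>r t)) \<partial>lmat k m \<partial>?T \<partial>stf ?n ?n)"
  proof (rule nn_integral_cong)
   fix g assume g: "g \<in> space (stf ?n ?n)"
   show "(\<integral>\<^sup>+z. indicator A (?r (g, z)) \<partial>(?T \<Otimes>\<^sub>M lmat k m)) = (\<integral>\<^sup>+t. \<integral>\<^sup>+w. indicator A (g * (w @\<^sub>r t)) \<partial>lmat k m \<partial>?T)"
    using lmat.nn_integral_fst[OF measurable_Pair2[OF mi g]] by simp
  qed
  also have "... = emeasure (rank_measure ?n m (k + j)) A" using nn_rank_stack[OF jq iA] A by simp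
  finally show "emeasure (distr ?P (borel_mat ?n m) ?r) A = emeasure (rank_measure ?n m (k + j)) A" .
 qed simp
 have mG: "G \<in> borel_fun ?n m"
  using borel_measurable_integrable[OF int] unfolding measurable_cong_sets[OF sets_rank_measure refl] .
 have "integrable ?P (\<lambda>z. G (?r z))" by (rule integrable_distr[OF mr]) (unfold d, rule int)
 from nested_integral[OF sigma_finite_rank_measure[OF jq] this]
 have "(\<integral>g. \<integral>t. (\<integral>w. G (g * (w @\<^sub>r t)) \<partial>lmat k m) \<partial>?T \<partial>stf ?n ?n) = integral\<^sup>L ?P (\<lambda>z. G (?r z))"
  by (simp only: prod.case)
 also have "... = (\<integral>y. G y \<partial>distr ?P (borel_mat ?n m) ?r)" by (rule integral_distr[OF mr mG, symmetric])
 finally show ?thesis by (simp only: d)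
qed

section \<open>The composition formula\<close>

text \<open>\<open>h\<close> is the Borel representative of \<open>f\<close> and \<open>N\<close>
  contains the points where they differ. One point \<open>x\<close> is fixed; convergence at
  \<open>x\<close> enters as a hypothesis of the individual lemmas.\<close>

locale good_point =
 fixes k q m :: nat and f h :: "real mat => complex" and N :: "real mat set" and x :: "real mat"
 assumes k: "1 \<le> k" and x: "x \<in> carrier_mat (k + q) m"
  and h: "h \<in> borel_fun (k + q) m" and N: "N \<in> sets (borel_mat (k + q) m)"
  and fh: "\<And>y. y \<in> carrier_mat (k + q) m ==> y \<notin> N ==> f y = h y"
begin

abbreviation (input) "hx \<equiv> \<lambda>y. h (x - y)"

text \<open>The value infinity where \<open>x - y\<close> lies in \<open>N\<close> lets a single
  finiteness statement give two things: integrability of \<open>h (x - y)\<close> over almost every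
  plane, and that almost every plane meets this set in a null set.\<close>

definition F :: "real mat => ennreal" where
 "F y = ennreal (norm (h (x - y))) + \<infinity> * indicator N (x - y)"

lemma measurable_reflect: "(\<lambda>y. x - y) \<in> borel_mat (k + q) m \<rightarrow>\<^sub>M borel_mat (k + q) m"
 by (rule measurable_mat_minus[OF measurable_const measurable_ident_sets[OF refl]]) (use x in simp)

lemma measurable_hx: "hx \<in> borel_fun (k + q) m"
 by (rule mcomp[OF measurable_reflect h])

lemma measurable_F: "F \<in> borel_fun (k + q) m"
 unfolding F_def[abs_def]
proof (intro borel_measurable_add times_ennreal measurable_const)
 show "(\<lambda>y. ennreal (norm (h (x - y)))) \<in> borel_fun (k + q) m" using measurable_hx by measurable
 show "(\<lambda>y. indicator N (x - y) :: ennreal) \<in> borel_fun (k + q) m"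
  by (rule mcomp[OF measurable_reflect]) (use N in simp)
qed simp

lemma nn_integral_F:
 assumes "AE y in M. x - y \<notin> N"
 shows "(\<integral>\<^sup>+y. F y \<partial>M) = (\<integral>\<^sup>+y. ennreal (norm (h (x - y))) \<partial>M)"
 by (rule nn_integral_cong_AE, rule AE_mp[OF assms], rule AE_I2) (simp add: F_def)

lemma AE_f: "AE y in M. x - y \<notin> N ==> space M = carrier_mat (k + q) m ==> AE y in M. f (x - y) = hx y"
 by (rule AE_mp, assumption, rule AE_I2) (simp add: fh minus_carrier_mat)

text \<open>Finiteness of the integral of \<open>F\<close> passes from the group to almost every
  frame and from there to almost every parallel plane. Where it is finite, \<open>f\<close> and
  \<open>h\<close> agree almost everywhere on the plane, so \<open>radon\<close> is given by
  \<open>pint\<close>.\<close>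

lemma AE_radon:
 assumes T: "sigma_finite_measure T" "sets T = sets (borel_mat q m)"
  and fin: "(\<integral>\<^sup>+g. \<integral>\<^sup>+t. \<integral>\<^sup>+w. F (g * (w @\<^sub>r t)) \<partial>lmat k m \<partial>T \<partial>stf (k + q) (k + q)) < \<infinity>"
 shows "AE \<xi> in stf (k + q) q. (AE t in T. radon (k + q) m k f \<xi> (\<xi>\<^sup>T * x - t) = pint k q m hx \<xi> t) \<and>
  integrable T (pint k q m hx \<xi>)"
proof (rule AE_mp[OF AE_stiefel_finite[OF k T measurable_F fin]], intro AE_I2 impI)
 let ?n = "k + q"
 fix \<xi> assume "\<xi> \<in> space (stf ?n q)"
  and fx: "(\<integral>\<^sup>+t. \<integral>\<^sup>+w. F (rotation_to ?n k \<xi> * (w @\<^sub>r t)) \<partial>lmat k m \<partial>T) < \<infinity>"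
 then have \<xi>: "\<xi> \<in> stiefel ?n q" using stfD(3)[of q ?n] by simp
 then have \<xi>c: "\<xi> \<in> carrier_mat ?n q" by (simp add: stiefel_def)
 have sp: "space T = carrier_mat q m" using sets_eq_imp_space_eq[OF T(2)] by simp
 have cT: "measurable T L = measurable (borel_mat q m) L" for L by (rule measurable_cong_sets[OF T(2) refl])
 define g where "g = rotation_to ?n k \<xi>"
 have g: "g \<in> orth_group ?n" and gE: "g * low_frame k q = \<xi>" using rotation_to[OF \<xi> k] by (auto simp: g_def)
 note gc = orth_groupD(1)[OF g]
 have mF: "(\<lambda>(t, w). F (g * (w @\<^sub>r t))) \<in> borel_measurable (borel_mat q m \<Otimes>\<^sub>M lmat k m)"
  unfolding case_prod_unfold
  by (rule mcomp[OF measurable_mat_times[OF measurable_const measurable_append_rows[OF measurable_snd_lmat measurable_fst]] measurable_F])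
   (use gc in simp)
 have mI: "(\<lambda>t. \<integral>\<^sup>+w. F (g * (w @\<^sub>r t)) \<partial>lmat k m) \<in> borel_measurable T"
  unfolding cT using lmat.borel_measurable_nn_integral_fst[OF mF] by simp
 have ae: "AE t in T. (\<integral>\<^sup>+w. F (g * (w @\<^sub>r t)) \<partial>lmat k m) \<noteq> \<infinity>"
  by (rule nn_integral_PInf_AE[OF mI]) (use fx in "simp add: g_def less_top")
 have "AE t in T. radon ?n m k f \<xi> (\<xi>\<^sup>T * x - t) = pint k q m hx \<xi> t"
 proof (rule AE_mp[OF ae], intro AE_I2 impI)
  fix t assume "t \<in> space T" and ft: "(\<integral>\<^sup>+w. F (g * (w @\<^sub>r t)) \<partial>lmat k m) \<noteq> \<infinity>"
  then have t: "t \<in> carrier_mat q m" using sp by simp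
  have "AE w in lmat k m. F (g * (w @\<^sub>r t)) \<noteq> \<infinity>"
   by (rule nn_integral_PInf_AE[OF _ ft]) (use mcomp[OF measurable_rot_rows[OF gc t] measurable_F] in simp)
  then have "AE w in lmat k m. f (x - g * (w @\<^sub>r t)) = hx (g * (w @\<^sub>r t))"
  proof (rule AE_mp, intro AE_I2 impI)
   fix w assume "w \<in> space (lmat k m)" and "F (g * (w @\<^sub>r t)) \<noteq> \<infinity>"
   then have "w \<in> carrier_mat k m" and nN: "x - g * (w @\<^sub>r t) \<notin> N"
    by (auto simp: F_def indicator_def ennreal_top_mult split: if_splits)
   then show "f (x - g * (w @\<^sub>r t)) = hx (g * (w @\<^sub>r t))"
    using fh[OF minus_carrier_mat nN] rot_split(1)[OF g _ t] by simp
  qed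
  then show "radon ?n m k f \<xi> (\<xi>\<^sup>T * x - t) = pint k q m hx \<xi> t"
   using radon_eq[OF \<xi> k x t measurable_hx] by (simp add: g_def)
 qed
 moreover have "integrable T (pint k q m hx \<xi>)"
  unfolding integrable_iff_bounded
 proof
  have "(\<lambda>t. (\<xi>, t)) \<in> borel_mat q m \<rightarrow>\<^sub>M borel_mat ?n q \<Otimes>\<^sub>M borel_mat q m" using \<xi>c by simp
  from mcomp[OF this measurable_pint[OF measurable_hx]]
  show "pint k q m hx \<xi> \<in> borel_measurable T" unfolding cT by simp
  have "(\<integral>\<^sup>+t. ennreal (norm (pint k q m hx \<xi> t)) \<partial>T) \<le> (\<integral>\<^sup>+t. \<integral>\<^sup>+w. F (g * (w @\<^sub>r t)) \<partial>lmat k m \<partial>T)"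
  proof (rule nn_integral_mono)
   fix t assume "t \<in> space T"
   then have t: "t \<in> carrier_mat q m" using sp by simp
   \<comment> \<open>On a slice that is not integrable the Bochner integral is 0 by default, so the
     bound holds there as well.\<close>
   have "ennreal (norm (pint k q m hx \<xi> t)) \<le> (\<integral>\<^sup>+w. ennreal (norm (hx (g * (w @\<^sub>r t)))) \<partial>lmat k m)"
    unfolding gE[symmetric] pint_orth(1)[OF g t measurable_hx]
    by (cases "integrable (lmat k m) (\<lambda>w. hx (g * (w @\<^sub>r t)))")
     (auto simp: not_integrable_integral_eq intro: integral_norm_bound_ennreal)
   also have "... \<le> (\<integral>\<^sup>+w. F (g * (w @\<^sub>r t)) \<partial>lmat k m)" by (intro nn_integral_mono) (simp add: F_def)
   finally show "ennreal (norm (pint k q m hx \<xi> t)) \<le> (\<integral>\<^sup>+w. F (g * (w @\<^sub>r t)) \<partial>lmat k m)" .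
  qed
  then show "(\<integral>\<^sup>+t. ennreal (norm (pint k q m hx \<xi> t)) \<partial>T) < \<infinity>" using fx by (simp add: g_def le_less_trans)
 qed
 ultimately show "(AE t in T. radon ?n m k f \<xi> (\<xi>\<^sup>T * x - t) = pint k q m hx \<xi> t) \<and> integrable T (pint k q m hx \<xi>)" by simp
qed

lemma measurable_pint_t: "\<xi> \<in> carrier_mat (k + q) q ==> pint k q m hx \<xi> \<in> borel_fun q m"
 using measurable_Pair2[OF measurable_pint[OF measurable_hx], of \<xi>] by simp

lemma stf_carrier: "\<xi> \<in> space (stf (k + q) q) ==> \<xi> \<in> carrier_mat (k + q) q"
 using stfD(3)[of q "k + q"] by (simp add: stiefel_def)

lemma semyanistyi_kernel_range:
 assumes m: "1 \<le> m" and mq: "m \<le> q" and a: "real m - 1 < Re \<alpha>" "Re \<alpha> < real q - real m + 1"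
  and null: "AE y in kernel_measure (k + q) (Re \<alpha> - real q) m. x - y \<notin> N"
  and fin: "(\<integral>\<^sup>+y. ennreal (norm (hx y)) \<partial>kernel_measure (k + q) (Re \<alpha> - real q) m) < \<infinity>"
 shows "semyanistyi (k + q) m k \<alpha> (radon (k + q) m k f) x = c_const (k + q) k m * riesz (k + q) m (\<alpha> + of_nat k) f x"
proof -
 let ?n = "k + q" and ?s = "\<alpha> - of_nat q"
 let ?T = "kernel_measure q (Re \<alpha> - real q) m" and ?L = "stf (k + q) (k + q) \<Otimes>\<^sub>M (lmat q m \<Otimes>\<^sub>M lmat k m)"
 let ?pw = "\<lambda>y. complex_of_real (mat_abs y) powr ?s"
 have s: "real m - 1 - real q < Re ?s" using a by simp
 have T: "sigma_finite_measure ?T"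
  by (rule riesz_family.sigma_finite_ka[OF riesz_family_kernel order_refl]) (use m mq a in auto)
 have TF: "(\<integral>\<^sup>+g. \<integral>\<^sup>+t. \<integral>\<^sup>+w. F (g * (w @\<^sub>r t)) \<partial>lmat k m \<partial>?T \<partial>stf ?n ?n) < \<infinity>"
  by (rule nn_semyanistyi_finite[OF mq _ measurable_F]) (use s fin nn_integral_F[OF null] in simp_all)
 \<comment> \<open>The exceptional integers begin at \<open>q - m + 1\<close>, beyond the upper
   bound on \<open>Re \<alpha>\<close>; the same bound shifted by \<open>k\<close> serves in the
   large space.\<close>
 have nat_out: "\<beta> \<notin> of_nat ` {l..}" if "Re \<beta> < real l" for \<beta> :: complex and l using that by auto
 have rq: "riesz q m \<alpha> \<phi> = riesz_kernel q m \<alpha> \<phi>" for \<phi>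
  by (rule ext) (use a mq nat_out[of \<alpha> "q - m + 1"] in "simp add: riesz_def of_nat_diff")
 have rn: "riesz ?n m (\<alpha> + of_nat k) \<phi> = riesz_kernel ?n m (\<alpha> + of_nat k) \<phi>" for \<phi>
  by (rule ext) (use a mq nat_out[of "\<alpha> + of_nat k" "?n - m + 1"] in "simp add: riesz_def of_nat_diff")
 have int: "integrable (lmat ?n m) (\<lambda>y. hx y * ?pw y)"
  unfolding integrable_iff_bounded
 proof
  show "(\<lambda>y. hx y * ?pw y) \<in> borel_measurable (lmat ?n m)"
   unfolding measurable_lmat by (rule borel_measurable_times[OF measurable_hx measurable_mat_abs_cpowr])
  have "(\<integral>\<^sup>+y. ennreal (norm (hx y * ?pw y)) \<partial>lmat ?n m) = (\<integral>\<^sup>+y. epow y (Re \<alpha> - real q) * ennreal (norm (hx y)) \<partial>lmat ?n m)"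
   by (rule nn_integral_cong) (use mat_abs_nonneg[of _ ?n m] in "simp add: norm_mult norm_powr_real_powr ennreal_mult mult.commute")
  also have "... < \<infinity>"
   using fin nn_integral_kernel_measure[of "\<lambda>y. ennreal (norm (hx y))" ?n m "Re \<alpha> - real q"] measurable_hx by simp
  finally show "(\<integral>\<^sup>+y. ennreal (norm (hx y * ?pw y)) \<partial>lmat ?n m) < \<infinity>" .
 qed
 have "semyanistyi ?n m k \<alpha> (radon ?n m k f) x = (\<integral>\<xi>. riesz_kernel q m \<alpha> (radon ?n m k f \<xi>) (\<xi>\<^sup>T * x) \<partial>stiefel_measure ?n q)"
  by (simp add: semyanistyi_def dual_radon_def rq)
 also have "... = 1 / riesz_gamma q m \<alpha> * (\<integral>g. \<integral>t. (\<integral>b. hx (g * (b @\<^sub>r t)) \<partial>lmat k m) * ?pw t \<partial>lmat q m \<partial>stf ?n ?n)"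
 proof (rule integral_stiefel_pint[OF sigma_finite_lmat sets_lmat measurable_hx measurable_mat_abs_cpowr])
  show "AE \<xi> in stf ?n q. riesz_kernel q m \<alpha> (radon ?n m k f \<xi>) (\<xi>\<^sup>T * x) = 1 / riesz_gamma q m \<alpha> * (\<integral>t. pint k q m hx \<xi> t * ?pw t \<partial>lmat q m)"
  proof (rule AE_mp[OF AE_radon[OF T _ TF]], goal_cases)
   case 2
   show ?case
   proof (intro AE_I2 impI)
    fix \<xi> assume \<xi>: "\<xi> \<in> space (stf ?n q)" and "(AE t in ?T. radon ?n m k f \<xi> (\<xi>\<^sup>T * x - t) = pint k q m hx \<xi> t) \<and> integrable ?T (pint k q m hx \<xi>)"
    then have "AE t in lmat q m. radon ?n m k f \<xi> (\<xi>\<^sup>T * x - t) = pint k q m hx \<xi> t" using AE_kernel_measure[OF mq] by blast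
    then show "riesz_kernel q m \<alpha> (radon ?n m k f \<xi>) (\<xi>\<^sup>T * x) = 1 / riesz_gamma q m \<alpha> * (\<integral>t. pint k q m hx \<xi> t * ?pw t \<partial>lmat q m)"
     by (rule riesz_kernel_eq[OF measurable_pint_t[OF stf_carrier[OF \<xi>]]])
   qed
  qed simp
 qed
 also have "(\<integral>g. \<integral>t. (\<integral>b. hx (g * (b @\<^sub>r t)) \<partial>lmat k m) * ?pw t \<partial>lmat q m \<partial>stf ?n ?n) =
  integral\<^sup>L ?L (\<lambda>(g, b, a). hx (g * (a @\<^sub>r b)) * ?pw b)"
  using nested_integral[OF sigma_finite_lmat semyanistyi_kernel(1)[OF mq measurable_hx s int]] by simp
 also have "... = bmean k q m ?s * (\<integral>y. hx y * ?pw y \<partial>lmat ?n m)"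
  by (rule semyanistyi_kernel(2)[OF mq measurable_hx s int])
 also have "1 / riesz_gamma q m \<alpha> * (bmean k q m ?s * (\<integral>y. hx y * ?pw y \<partial>lmat ?n m)) =
  bmean k q m ?s / riesz_gamma q m \<alpha> * (\<integral>y. hx y * ?pw y \<partial>lmat ?n m)" by simp
 also have "... = c_const ?n k m * (1 / riesz_gamma ?n m (\<alpha> + of_nat k) * (\<integral>y. hx y * ?pw y \<partial>lmat ?n m))"
  unfolding kernel_const[OF mq a] by simp
 also have "1 / riesz_gamma ?n m (\<alpha> + of_nat k) * (\<integral>y. hx y * ?pw y \<partial>lmat ?n m) = riesz ?n m (\<alpha> + of_nat k) f x"
  unfolding rn
 proof (subst riesz_kernel_eq[OF measurable_hx AE_f])
  show "AE y in lmat ?n m. x - y \<notin> N" by (rule AE_kernel_measure[OF _ null]) (use mq in simp)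
 qed simp_all
 finally show ?thesis .
qed

text \<open>A block without rows pads to the zero matrix, and both measures have total mass 1, so a
  constant is averaged. Order 0 thus becomes the case \<open>j = 0\<close> of the rank
  formula.\<close>

lemma riesz_int_zero:
 assumes u: "u \<in> carrier_mat q m" and mq: "m \<le> q"
 shows "riesz_int q m 0 \<phi> u = \<phi> u"
proof -
 interpret S: prob_space "stf q q" by (rule haarD)
 have "emeasure (lmat 0 m) (space (lmat 0 m)) = 1" using nn_integral_lmat_0[of "\<lambda>y. 1" 0 m] by simp
 then have "prob_space (lmat 0 m)" by (rule prob_spaceI)
 then interpret L: prob_space "lmat 0 m" .
 interpret S': prob_space "completion (stf q q)" by (rule S.prob_space_completion)
 interpret L': prob_space "completion (lmat 0 m)" by (rule L.prob_space_completion)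
 have "u - g * (w @\<^sub>r 0\<^sub>m q m) = u" if "g \<in> orth_group q" "w \<in> carrier_mat 0 m" for g w
 proof -
  have "w @\<^sub>r 0\<^sub>m q m = 0\<^sub>m q m" by (rule eq_matI) (use that(2) in "auto simp: append_rows_def")
  then have "g * (w @\<^sub>r 0\<^sub>m q m) = 0\<^sub>m q m" using orth_groupD(1)[OF that(1)] by simp
  then show ?thesis using u by (auto intro!: eq_matI)
 qed
 then have "(\<integral>w. (\<integral>g. \<phi> (u - g * (w @\<^sub>r 0\<^sub>m (q - 0) m)) \<partial>completion (stf q q)) \<partial>completion (lmat 0 m)) =
  (\<integral>w. (\<integral>g. \<phi> u \<partial>completion (stf q q)) \<partial>completion (lmat 0 m))"
  by (intro Bochner_Integration.integral_cong refl) (simp_all add: haarD)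
 also have "... = \<phi> u" using S'.prob_space L'.prob_space by simp
 finally have i: "(\<integral>w. (\<integral>g. \<phi> (u - g * (w @\<^sub>r 0\<^sub>m (q - 0) m)) \<partial>completion (stf q q)) \<partial>completion (lmat 0 m)) = \<phi> u" .
 have "Gamma_mat m (of_nat q / 2) \<noteq> 0" by (rule Gamma_mat_nonzero) (use mq in simp)
 then show ?thesis unfolding riesz_int_def lebesgue_mat_eq haar_orth_eq i by simp
qed

lemma riesz_of_nat:
 assumes "\<not> real m - 1 < real j" "j \<le> q - m" "m \<le> q" "u \<in> carrier_mat q m"
 shows "riesz q m (of_nat j) \<phi> u = riesz_int q m j \<phi> u"
proof (cases "j = 0")
 case True
 have "(0 :: complex) \<notin> of_nat ` {1..q - m}" by auto
 then show ?thesis using riesz_int_zero[OF assms(4,3)] assms(1) True by (simp add: riesz_def)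
next
 case False
 have "(THE i. (of_nat j :: complex) = of_nat i) = j" by (rule the_equality) auto
 moreover have "(of_nat j :: complex) \<in> of_nat ` {1..q - m}" using False assms(2) by auto
 ultimately show ?thesis using assms(1) by (simp add: riesz_def)
qed

lemma semyanistyi_rank_range:
 assumes mq: "m \<le> q" and j: "j < m" "j \<le> q - m"
  and null: "AE y in rank_measure (k + q) m (k + j). x - y \<notin> N"
  and fin: "(\<integral>\<^sup>+y. ennreal (norm (hx y)) \<partial>rank_measure (k + q) m (k + j)) < \<infinity>"
 shows "semyanistyi (k + q) m k (of_nat j) (radon (k + q) m k f) x = c_const (k + q) k m * riesz (k + q) m (of_nat j + of_nat k) f x"
proof -
 let ?n = "k + q" and ?l = "k + j"
 let ?T = "rank_measure q m j" and ?R = "rank_measure (k + q) m (k + j)"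
 have jq: "j \<le> q" and ln: "?l \<le> ?n" using j mq by auto
 have T: "sigma_finite_measure ?T" by (rule sigma_finite_rank_measure[OF jq])
 have TF: "(\<integral>\<^sup>+g. \<integral>\<^sup>+t. \<integral>\<^sup>+w. F (g * (w @\<^sub>r t)) \<partial>lmat k m \<partial>?T \<partial>stf ?n ?n) < \<infinity>"
  unfolding nn_rank_stack[OF jq measurable_F] nn_integral_F[OF null] by (rule fin)
 have cR: "measurable ?R L = measurable (borel_mat ?n m) L" for L by (rule measurable_cong_sets[OF sets_rank_measure refl])
 have spR: "space ?R = carrier_mat ?n m" by (simp add: rank_measure_def)
 have int: "integrable ?R hx"
  unfolding integrable_iff_bounded cR using measurable_hx fin by simp
 have aeR: "AE y in ?R. f (x - y) = hx y" by (rule AE_f[OF null spR])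
 have "semyanistyi ?n m k (of_nat j) (radon ?n m k f) x = (\<integral>\<xi>. riesz q m (of_nat j) (radon ?n m k f \<xi>) (\<xi>\<^sup>T * x) \<partial>stiefel_measure ?n q)"
  by (simp add: semyanistyi_def dual_radon_def)
 also have "... = riesz_int_const q m j * (\<integral>g. \<integral>t. (\<integral>b. hx (g * (b @\<^sub>r t)) \<partial>lmat k m) * 1 \<partial>?T \<partial>stf ?n ?n)"
 proof (rule integral_stiefel_pint[OF T sets_rank_measure measurable_hx measurable_const])
  show "AE \<xi> in stf ?n q. riesz q m (of_nat j) (radon ?n m k f \<xi>) (\<xi>\<^sup>T * x) = riesz_int_const q m j * (\<integral>t. pint k q m hx \<xi> t * 1 \<partial>?T)"
  proof (rule AE_mp[OF AE_radon[OF T sets_rank_measure TF]], intro AE_I2 impI)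
   fix \<xi> assume "\<xi> \<in> space (stf ?n q)" and *: "(AE t in ?T. radon ?n m k f \<xi> (\<xi>\<^sup>T * x - t) = pint k q m hx \<xi> t) \<and> integrable ?T (pint k q m hx \<xi>)"
   then have \<xi>: "\<xi> \<in> carrier_mat ?n q" by (intro stf_carrier)
   have "\<xi>\<^sup>T * x \<in> carrier_mat q m" using \<xi> x by auto
   then have "riesz q m (of_nat j) (radon ?n m k f \<xi>) (\<xi>\<^sup>T * x) = riesz_int q m j (radon ?n m k f \<xi>) (\<xi>\<^sup>T * x)"
    by (intro riesz_of_nat) (use j mq in auto)
   also have "... = riesz_int_const q m j * (\<integral>t. pint k q m hx \<xi> t \<partial>?T)"
    by (rule riesz_int_eq[OF jq measurable_pint_t[OF \<xi>]]) (use * in auto)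
   finally show "riesz q m (of_nat j) (radon ?n m k f \<xi>) (\<xi>\<^sup>T * x) = riesz_int_const q m j * (\<integral>t. pint k q m hx \<xi> t * 1 \<partial>?T)" by simp
  qed
 qed simp
 also have "... = riesz_int_const q m j * (\<integral>y. hx y \<partial>?R)"
  using integral_rank_stack[OF jq int] by simp
 also have "... = c_const ?n k m * (riesz_int_const ?n m ?l * (\<integral>y. hx y \<partial>?R))"
  using rank_const[OF mq, of k j] by simp
 also have "riesz_int_const ?n m ?l * (\<integral>y. hx y \<partial>?R) = riesz ?n m (of_nat ?l) f x"
 \<comment> \<open>Although \<open>j < m\<close>, the order \<open>k + j\<close> in the large space
   may fall into either range. For \<open>m\<close> at most \<open>k + j\<close> the definition of
   \<open>riesz\<close> selects the power kernel, and the density of the rank measure provides the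
   passage.\<close>
 proof (cases "m \<le> ?l")
  case False
  then have "riesz ?n m (of_nat ?l) f x = riesz_int ?n m ?l f x"
  proof -
   have "(THE i. (of_nat ?l :: complex) = of_nat i) = ?l" by (rule the_equality) (simp_all del: of_nat_add)
   moreover have "(of_nat ?l :: complex) \<in> of_nat ` {1..?n - m}" using k j mq by (intro imageI) auto
   moreover have "\<not> real m - 1 < Re (of_nat ?l)" using False by simp
   ultimately show ?thesis unfolding riesz_def by (simp del: of_nat_add)
  qed
  then show ?thesis using riesz_int_eq[OF ln measurable_hx aeR int] by simp
 next
  case True
  let ?s = "real ?l - real ?n"
  let ?K = "Kr ?l m 0 / Kr ?n m ?s"
  have K: "0 \<le> ?K" by (rule divide_nonneg_nonneg; rule less_imp_le, rule Kr_pos) (use True ln in auto)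
  have "(of_nat ?l :: complex) \<notin> of_nat ` {?n - m + 1..}"
  proof
   assume "(of_nat ?l :: complex) \<in> of_nat ` {?n - m + 1..}"
   then obtain i where i: "(of_nat ?l :: complex) = of_nat i" "?n - m + 1 \<le> i" by blast
   from i(1) have "?l = i" by (simp only: of_nat_eq_iff)
   with i(2) j mq show False by simp
  qed
  then have r: "riesz ?n m (of_nat ?l) f x = riesz_kernel ?n m (of_nat ?l) f x"
   using True unfolding riesz_def by (simp del: of_nat_add)
  have ae: "AE y in lmat ?n m. f (x - y) = hx y"
  proof -
   have w: "(\<lambda>y. ennreal (?K * mat_abs y powr ?s)) \<in> borel_measurable (lmat ?n m)"
    unfolding measurable_lmat by (rule measurable_mat_abs_weight)
   have Kp: "0 < ?K" by (rule divide_pos_pos; rule Kr_pos) (use True ln in auto)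
   have "AE y in lmat ?n m. 0 < ennreal (?K * mat_abs y powr ?s) \<longrightarrow> f (x - y) = hx y"
    using aeR unfolding rank_measure_density[OF True ln] by (subst (asm) AE_density[OF w])
   then have *: "AE y in lmat ?n m. mat_abs y \<noteq> 0 \<longrightarrow> f (x - y) = hx y"
    by (rule AE_mp, intro AE_I2 impI) (use Kp in "simp del: times_divide_eq_left")
   show ?thesis by (rule AE_mp[OF AE_nonsingular *]) (use mq in simp)
  qed
  have "(\<integral>y. hx y \<partial>?R) = (\<integral>y. (?K * mat_abs y powr ?s) *\<^sub>R hx y \<partial>lmat ?n m)"
   unfolding rank_measure_density[OF True ln]
   by (rule integral_density) (use K measurable_hx measurable_mat_abs_weight_real in "simp_all del: times_divide_eq_left")
  also have "... = (\<integral>y. of_real ?K * (hx y * of_real (mat_abs y) powr (of_nat ?l - of_nat ?n)) \<partial>lmat ?n m)"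
  proof (rule Bochner_Integration.integral_cong[OF refl])
   fix y assume "y \<in> space (lmat ?n m)"
   then have "0 \<le> mat_abs y" using mat_abs_nonneg[of y ?n m] by simp
   then have "complex_of_real (mat_abs y) powr (of_nat ?l - of_nat ?n) = of_real (mat_abs y powr ?s)"
    using powr_of_real[of "mat_abs y" ?s] by simp
   then show "(?K * mat_abs y powr ?s) *\<^sub>R hx y = of_real ?K * (hx y * of_real (mat_abs y) powr (of_nat ?l - of_nat ?n))"
    by (simp add: scaleR_conv_of_real)
  qed
  also have "... = of_real ?K * (\<integral>y. hx y * of_real (mat_abs y) powr (of_nat ?l - of_nat ?n) \<partial>lmat ?n m)"
   by (rule integral_mult_right_zero)
  finally have I: "(\<integral>y. hx y \<partial>?R) = of_real ?K * (\<integral>y. hx y * of_real (mat_abs y) powr (of_nat ?l - of_nat ?n) \<partial>lmat ?n m)" .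
  show ?thesis
   unfolding r riesz_kernel_eq[where u=x, OF measurable_hx ae] I kernel_rank_const[OF True ln, symmetric] by (simp only: ac_simps)
 qed
 finally show ?thesis by (simp add: add.commute)
qed

end

text \<open>Real and imaginary parts have Borel versions, and the set of disagreement is enlarged to
  a Borel null set.\<close>

lemma Lp_borel_representative:
 fixes f :: "'a => complex"
 assumes "f \<in> Lp_space p (completion M)"
 obtains h N where "h \<in> borel_measurable M" "N \<in> null_sets M" "\<And>y. y \<in> space M ==> y \<notin> N ==> f y = h y"
  "(\<integral>\<^sup>+x. ennreal (norm (h x) powr p) \<partial>M) < \<infinity>"
proof -
 have mf: "f \<in> borel_measurable (completion M)" and int: "integrable (completion M) (\<lambda>x. norm (f x) powr p)"
  using assms by (auto simp: Lp_space_def)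
 have mRI: "(\<lambda>x. Re (f x)) \<in> borel_measurable (completion M)" "(\<lambda>x. Im (f x)) \<in> borel_measurable (completion M)"
  by (rule mcomp[OF mf], measurable)+
 obtain a where a: "a \<in> borel_measurable M" "AE x in M. Re (f x) = a x" using completion_ex_borel_measurable_real[OF mRI(1)] by blast
 obtain b where b: "b \<in> borel_measurable M" "AE x in M. Im (f x) = b x" using completion_ex_borel_measurable_real[OF mRI(2)] by blast
 define h where "h x = Complex (a x) (b x)" for x
 have mh: "h \<in> borel_measurable M" unfolding h_def[abs_def] using a(1) b(1)
  by (simp add: borel_measurable_complex_iff)
 have ae: "AE x in M. f x = h x"
  by (rule AE_mp[OF a(2)], rule AE_mp[OF b(2)], rule AE_I2) (simp add: h_def complex_eq_iff)
 then obtain N where N: "{x \<in> space M. f x \<noteq> h x} \<subseteq> N" "emeasure M N = 0" "N \<in> sets M" by (rule AE_E)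
 have "(\<integral>\<^sup>+x. ennreal (norm (h x) powr p) \<partial>M) = (\<integral>\<^sup>+x. ennreal (norm (f x) powr p) \<partial>M)"
  by (rule nn_integral_cong_AE, rule AE_mp[OF ae], rule AE_I2) simp
 also have "... = (\<integral>\<^sup>+x. ennreal (norm (f x) powr p) \<partial>completion M)" by (rule nn_integral_completion[symmetric])
 also have "... < \<infinity>" using int by (simp add: integrable_iff_bounded)
 finally show ?thesis using that[OF mh _ _] N by (auto simp: null_sets_def)
qed

theorem theorem0p9:
  fixes n m k :: nat and \<alpha> :: complex and p :: real and f :: "real mat \<Rightarrow> complex"
  assumes "1 \<le> m" and "1 \<le> k" and "k \<le> n - m"
    and "\<alpha> \<in> W_set n m"
    and "f \<in> Lp_space p (lebesgue_mat n m)"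
    and "1 \<le> p" and "p < real n / (Re \<alpha> + real k + real m - 1)"
  shows "(AE x in lebesgue_mat n m.
            semyanistyi n m k \<alpha> (radon n m k f) x
              = c_const n k m * riesz n m (\<alpha> + of_nat k) f x) \<and>
         (\<alpha> = 0 \<longrightarrow>
           (AE x in lebesgue_mat n m.
              dual_radon n k (radon n m k f) x = c_const n k m * riesz n m (of_nat k) f x))"
proof -
 define q where "q = n - k"
 have n: "n = k + q" and mq: "m \<le> q" using assms(1-3) by (auto simp: q_def)
 obtain h N where hN: "h \<in> borel_measurable (lmat n m)" "N \<in> null_sets (lmat n m)"
  "\<And>y. y \<in> space (lmat n m) ==> y \<notin> N ==> f y = h y" "(\<integral>\<^sup>+x. ennreal (norm (h x) powr p) \<partial>lmat n m) < \<infinity>"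
  using Lp_borel_representative[of f p "lmat n m"] assms(5) unfolding lebesgue_mat_eq by metis
 have h: "h \<in> borel_fun n m" using hN(1) by simp
 have Ns: "N \<in> sets (borel_mat n m)" using hN(2) by auto
 have \<alpha>0: "0 \<le> Re \<alpha>" using assms(1,4) by (auto simp: W_set_def)
 \<comment> \<open>The real part of the order in the large space, which is the degree of homogeneity
   of the measures used there.\<close>
 define lam where "lam = Re \<alpha> + real k"
 have den: "0 < lam + real m - 1" using \<alpha>0 assms(1,2) by (simp add: lam_def)
 have pn: "p * (lam + real m - 1) < real n" using assms(7) den by (simp add: lam_def pos_less_divide_eq)
 have "1 * (lam + real m - 1) \<le> p * (lam + real m - 1)" using assms(6) den by (intro mult_right_mono) auto
 \<comment> \<open>As \<open>p\<close> is at least 1, the condition on \<open>p\<close> forces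
   \<open>lam < n - m + 1\<close>; this keeps the orders in both spaces below their exceptional
   integers.\<close>
 then have lamn: "lam + real m - 1 < real n" using pn by simp
 have good: "good_point k q m f h N x" if "x \<in> carrier_mat n m" for x
  by unfold_locales (use that assms(2) h Ns hN(3) n in auto)
 \<comment> \<open>For almost every \<open>x\<close> the convolution with \<open>h\<close> converges
   absolutely and the exceptional set is avoided; what follows is done at one such
   \<open>x\<close>.\<close>
 have conv: "AE x in lmat n m. (AE y in ka m. x - y \<notin> N) \<and> (\<integral>\<^sup>+y. ennreal (norm (h (x - y))) \<partial>ka m) < \<infinity>"
  if "riesz_family n m lam ka" for ka
 proof -
  have "AE x in lmat n m. (\<integral>\<^sup>+y. ennreal (norm (h (x - y))) \<partial>ka m) < \<infinity>"
   by (rule riesz_family.AE_convolution_finite[OF that order_refl assms(1) _ _ _ assms(6) pn, where a="\<lambda>x. norm (h x)"])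
    (use h hN(4) \<alpha>0 lam_def in auto)
  with riesz_family.AE_convolution_null[OF that order_refl hN(2)] show ?thesis by eventually_elim simp
 qed
 have main: "AE x in lmat n m. semyanistyi n m k \<alpha> (radon n m k f) x = c_const n k m * riesz n m (\<alpha> + of_nat k) f x"
 proof (cases "real m - 1 < Re \<alpha>")
  case True
  have a: "Re \<alpha> < real q - real m + 1" using lamn n by (simp add: lam_def)
  have fam: "riesz_family n m lam (kernel_measure n (lam - real n))"
   by (rule riesz_family_kernel) (use True mq n lamn assms(1) in "auto simp: lam_def")
  show ?thesis
  proof (rule AE_mp[OF conv[OF fam]], intro AE_I2 impI)
   fix x assume "x \<in> space (lmat n m)"
    and *: "(AE y in kernel_measure n (lam - real n) m. x - y \<notin> N) \<and> (\<integral>\<^sup>+y. ennreal (norm (h (x - y))) \<partial>kernel_measure n (lam - real n) m) < \<infinity>"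
   then have x: "x \<in> carrier_mat n m" by simp
   have e: "lam - real n = Re \<alpha> - real q" by (simp add: lam_def n)
   show "semyanistyi n m k \<alpha> (radon n m k f) x = c_const n k m * riesz n m (\<alpha> + of_nat k) f x"
    using good_point.semyanistyi_kernel_range[OF good[OF x] assms(1) mq True a] *[unfolded e] unfolding n by blast
  qed
 next
  case False
  then obtain j where j: "\<alpha> = of_nat j" "j \<le> m - 1" using assms(4) by (auto simp: W_set_def)
  \<comment> \<open>The bound \<open>j <= q - m\<close> is stronger than what
    \<open>W_set n m\<close> provides; it comes from \<open>lamn\<close>, that is
    \<open>j + k + m - 1 < k + q\<close>.\<close>
  have jm: "j < m" "j \<le> q - m" using j(2) assms(1) lamn n by (auto simp: lam_def j(1))
  have fam: "riesz_family n m lam (\<lambda>m. rank_measure n m (k + j))"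
   using riesz_family_rank[of "k + j" n m] jm n by (simp add: lam_def j(1) add.commute)
  show ?thesis
  proof (rule AE_mp[OF conv[OF fam]], intro AE_I2 impI)
   fix x assume "x \<in> space (lmat n m)"
    and *: "(AE y in rank_measure n m (k + j). x - y \<notin> N) \<and> (\<integral>\<^sup>+y. ennreal (norm (h (x - y))) \<partial>rank_measure n m (k + j)) < \<infinity>"
   then have x: "x \<in> carrier_mat n m" by simp
   then show "semyanistyi n m k \<alpha> (radon n m k f) x = c_const n k m * riesz n m (\<alpha> + of_nat k) f x"
    using good_point.semyanistyi_rank_range[OF good[OF x] mq jm] * unfolding n j(1) by simp
  qed
 qed
 \<comment> \<open>Order 0 lies in neither range of formulas in \<open>riesz\<close>, as
   \<open>m\<close> is at least 1, so the inner potential is the identity.\<close>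
 have "(0 :: complex) \<notin> of_nat ` {1..n - k - m}" "(0 :: complex) \<notin> of_nat ` {n - k - m + 1..}" by auto
 then have "semyanistyi n m k 0 (radon n m k f) = dual_radon n k (radon n m k f)"
  using assms(1) unfolding semyanistyi_def riesz_def by simp
 with main show ?thesis unfolding lebesgue_mat_eq by (auto intro: AE_completion)
qed

end
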